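(* Let $\theta>0$ and let $I_1,\dots,I_m$ be a finite number of fixed arcs of the unit circle, of the form $I_k=\left(\mathrm{e}^{2i\pi\alpha_k},\mathrm{e}^{2i\pi\beta_k}\right]$ with $0\le\alpha_k<1$ and $\alpha_k<\beta_k\le\alpha_k+1$. For $1\le k,l\le m$ put $c_{k,l}:=c(\alpha_k,\beta_k,\alpha_l,\beta_l)$ and $\widetilde c_{k,l}:=\widetilde c(\alpha_k,\beta_k,\alpha_l,\beta_l)$. Then, as $N\to\infty$: 1. For every $1\le k\le m$, $\mathrm{Var}(X_N^{I_k})\sim c_{k,k}\,\theta\log N$ and $\mathrm{Var}(\widetilde X_N^{I_k})\sim\widetilde c_{k,k}\,\theta\log N$. 2. $$\left(\frac{X_N^{I_1}-\mathbb{E}(X_N^{I_1})}{\sqrt{\mathrm{Var}(X_N^{I_1})}},\dots,\frac{X_N^{I_m}-\mathbb{E}(X_N^{I_m})}{\sqrt{\mathrm{Var}(X_N^{I_m})}}\right)\overset{d}{\longrightarrow}\mathcal N(0,D),$$ where $D=(D_{k,l})_{1\le k,l\le m}$ with $D_{k,l}=\dfrac{c_{k,l}}{\sqrt{c_{k,k}c_{l,l}}}$. 3. $$\left(\frac{\widetilde X_N^{I_1}-\mathbb{E}(\widetilde X_N^{I_1})}{\sqrt{\mathrm{Var}(\widetilde X_N^{I_1})}},\dots,\frac{\widetilde X_N^{I_m}-\mathbb{E}(\widetilde X_N^{I_m})}{\sqrt{\mathrm{Var}(\widetilde X_N^{I_m})}}\right)\overset{d}{\longrightarrow}\mathcal N(0,\widetilde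 D),$$ where $\widetilde D=(\widetilde D_{k,l})_{1\le k,l\le m}$ with $\widetilde D_{k,l}=\dfrac{\widetilde c_{k,l}}{\sqrt{\widetilde c_{k,k}\widetilde c_{l,l}}}$.
   Context: $\{x\}=x-\lfloor x\rfloor$ is the fractional part. For each $N\ge1$, $\sigma_N$ is a random permutation in the symmetric group $\mathfrak S_N$ following the Ewens measure of parameter $\theta>0$: $\mathbb P(\sigma_N=\sigma)=\dfrac{\theta^{K(\sigma)}}{\theta(\theta+1)\cdots(\theta+N-1)}$, where $K(\sigma)$ is the total number of cycles of $\sigma$ (fixed points included). $(z_j)_{j\ge1}$ is a sequence of i.i.d. random variables uniformly distributed on the unit circle, independent of $(\sigma_N)_{N\ge1}$. The $N\times N$ random matrices $M_N$ and $\widetilde M_N$ have entries $(M_N)_{i,j}=\mathbf{1}_{i=\sigma_N(j)}$ and $(\widetilde M_N)_{i,j}=z_i\mathbf{1}_{i=\sigma_N(j)}$. Their eigenvalues lie on the unit circle. For $0\le\alpha<1$ and $\alpha<\beta\le\alpha+1$, $I=\left(\mathrm{e}^{2i\pi\alpha},\mathrm{e}^{2i\pi\beta}\right]$ denotes the arc of the unit circle from $\mathrm{e}^{2i\pi\alpha}$ (excluded) to $\mathrm{e}^{2i\pi\beta}$ (included), i.e. $\{\mathrm{e}^{2i\pi x}:\alpha<x\le\beta\}$. $X_N^I$ and $\widetilde X_N^I$ are the numbers of eigenvalues, counted with multiplicity, of $M_N$ and $\widetilde M_N$ respectively lying in $I$. For real $s,t,u,v$, $$c(s,t,u,v):=\lim_{N\to\infty}\frac1N\sum_{j=1}^N(\{js\}-\{jt\})(\{ju\}-\{jv\}),$$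 $$\widetilde c(s,t,u,v):=\lim_{N\to\infty}\frac1{2N}\sum_{j=1}^N\big(h_j(t-u)+h_j(s-v)-h_j(s-u)-h_j(t-v)\big),$$ with $h_j(x):=\{jx\}(1-\{jx\})$; these limits exist and are finite. $\mathcal N(0,D)$ is the centred Gaussian law on $\mathbb R^m$ with covariance matrix $D$, and $\overset{d}{\longrightarrow}$ is convergence in distribution. *)

theory Defs
  imports
    "HOL-Probability.Probability"
    "HOL-Combinatorics.Orbits"
    "HOL-Library.Landau_Symbols"
    "Jordan_Normal_Form.Char_Poly"
begin

text \<open>
  Rows, columns and permuted points are numbered from 0, as in \<^theory>\<open>Jordan_Normal_Form.Matrix\<close>:
  the symmetric group on N letters is the set of \<open>p\<close> with \<open>p permutes {..<N}\<close>.
\<close>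

definition sym_group :: "nat \<Rightarrow> (nat \<Rightarrow> nat) set" where
  "sym_group N = {p. p permutes {..<N}}"

text \<open>
  \<open>orbit p x\<close> collects the iterates of \<open>p\<close> at \<open>x\<close>; for a permutation of a finite set this is the
  cycle through \<open>x\<close>, a fixed point having the singleton orbit.
\<close>

definition num_cycles :: "nat \<Rightarrow> (nat \<Rightarrow> nat) \<Rightarrow> nat" where
  "num_cycles N p = card (orbit p ` {..<N})"

definition ewens_measure :: "real \<Rightarrow> nat \<Rightarrow> (nat \<Rightarrow> nat) measure" where
  "ewens_measure \<theta> N =
     point_measure (sym_group N) (\<lambda>p. ennreal (\<theta> ^ num_cycles N p / pochhammer \<theta> N))"

definition uniform_circle :: "complex measure" where
  "uniform_circle = distr (uniform_measure lborel {0..1}) borel (\<lambda>x. cis (2 * pi * x))"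

definition perm_mat :: "nat \<Rightarrow> (nat \<Rightarrow> nat) \<Rightarrow> complex mat" where
  "perm_mat N p = Matrix.mat N N (\<lambda>(i, j). if i = p j then 1 else 0)"

definition twisted_perm_mat :: "nat \<Rightarrow> (nat \<Rightarrow> complex) \<Rightarrow> (nat \<Rightarrow> nat) \<Rightarrow> complex mat" where
  "twisted_perm_mat N w p = Matrix.mat N N (\<lambda>(i, j). if i = p j then w i else 0)"

definition circle_arc :: "real \<Rightarrow> real \<Rightarrow> complex set" where
  "circle_arc a b = (\<lambda>x. cis (2 * pi * x)) ` {a<..b}"

definition eigenvalue_count :: "complex mat \<Rightarrow> complex set \<Rightarrow> nat" where
  "eigenvalue_count A I = (\<Sum>x | x \<in> I \<and> eigenvalue A x. Polynomial.order x (char_poly A))"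

definition c_coeff :: "real \<Rightarrow> real \<Rightarrow> real \<Rightarrow> real \<Rightarrow> real" where
  "c_coeff s t u v =
     lim (\<lambda>N. 1 / real N *
       (\<Sum>j = 1..N. (frac (real j * s) - frac (real j * t)) * (frac (real j * u) - frac (real j * v))))"

definition h_fun :: "nat \<Rightarrow> real \<Rightarrow> real" where
  "h_fun j x = frac (real j * x) * (1 - frac (real j * x))"

definition c_tilde :: "real \<Rightarrow> real \<Rightarrow> real \<Rightarrow> real \<Rightarrow> real" where
  "c_tilde s t u v =
     lim (\<lambda>N. 1 / (2 * real N) *
       (\<Sum>j = 1..N. h_fun j (t - u) + h_fun j (s - v) - h_fun j (s - u) - h_fun j (t - v)))"

text \<open>
  The covariance matrix of a Gaussian law may be singular, so one-dimensional marginals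
  are allowed to be the point mass at 0.
\<close>

definition centred_gaussian :: "('m::finite \<Rightarrow> 'm \<Rightarrow> real) \<Rightarrow> (real ^ 'm) measure \<Rightarrow> bool" where
  "centred_gaussian D \<mu> \<longleftrightarrow>
     prob_space \<mu> \<and> sets \<mu> = sets borel \<and>
     (\<forall>t. distr \<mu> borel (\<lambda>x. t \<bullet> x) = return borel 0 \<or>
          (\<exists>s>0. distr \<mu> borel (\<lambda>x. t \<bullet> x) = density lborel (\<lambda>x. ennreal (normal_density 0 s x)))) \<and>
     (\<forall>k l. (LINT x|\<mu>. vec_nth x k * vec_nth x l) = D k l)"

definition converges_in_distribution ::
    "'a measure \<Rightarrow> (nat \<Rightarrow> 'a \<Rightarrow> 'b::topological_space) \<Rightarrow> 'b measure \<Rightarrow> bool" where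
  "converges_in_distribution M Y \<mu> \<longleftrightarrow>
     (\<forall>N. Y N \<in> borel_measurable M) \<and>
     (\<forall>f :: 'b \<Rightarrow> real. continuous_on UNIV f \<and> bounded (range f) \<longrightarrow>
        (\<lambda>N. LINT \<omega>|M. f (Y N \<omega>)) \<longlonglongrightarrow> (LINT x|\<mu>. f x))"

text \<open>
  A component of variance 0 is standardized to 0, as division by 0 yields 0; for the counts
  below this concerns the arcs that are the full circle (and, for small \<open>N\<close>, possibly others).
\<close>

definition standardize :: "'a measure \<Rightarrow> ('m::finite \<Rightarrow> 'a \<Rightarrow> real) \<Rightarrow> 'a \<Rightarrow> real ^ 'm" where
  "standardize M X \<omega> =
     (\<chi> k. (X k \<omega> - prob_space.expectation M (X k)) / sqrt (prob_space.variance M (X k)))"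

definition correlation :: "('m \<Rightarrow> 'm \<Rightarrow> real) \<Rightarrow> 'm \<Rightarrow> 'm \<Rightarrow> real" where
  "correlation C k l = C k l / sqrt (C k k * C l l)"

end

theory Submission imports Defs "HOL-Computational_Algebra.Formal_Power_Series" begin

text \<open>
  Removing the cycle of a given point turns an Ewens permutation into a smaller one, so the law of
  any sum over cycles satisfies a linear recursion over the size of that cycle. For summands of
  size \<open>\<eta>\<close>, comparing the centred characteristic function \<open>f n\<close> of such a sum with
  \<open>exp (- V n / 2)\<close>, where \<open>V n\<close> is the exact variance, makes all second-order terms of the
  recursion cancel; the error is of order \<open>\<eta>\<^sup>3\<close> times the mean number of cycles, hence
  \<open>\<eta>\<^sup>3 ln n\<close>, which vanishes for \<open>\<eta>\<close> of order \<open>1 / sqrt (ln n)\<close>.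

  The variance is a diagonal sum of \<open>\<theta> a\<^sub>j\<^sup>2 / j\<close> up to pair correlations, and these are of
  constant sign up to a bounded part, so that their total absolute sum follows from the case of
  the number of cycles and is bounded. The variance divided by \<open>\<theta> ln n\<close> thus tends to a
  logarithmic average, which converges with the Cesaro averages; these converge since fractional
  parts are almost periodic.

  The characteristic polynomial of a weighted permutation matrix is the product over the cycles
  \<open>C\<close> of \<open>x\<^bsup>|C|\<^esup> - W\<close> with \<open>W\<close> the product of the weights on \<open>C\<close>. Both eigenvalue counts are
  therefore sums over cycles, in the twisted case with independent uniform \<open>W\<close>. Tightness from second
  moments and approximation by trigonometric polynomials give weak convergence.
\<close>

section \<open>The recursion over the first cycle\<close>

text \<open>The comparison closes because the exact variance obeys a recursion of its own, so that
  the linear and the quadratic terms average to 0 at every step; an asymptotic value of the variance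
  would leave a defect each time. The remainder of one step is \<open>\<eta> ^ 3\<close> times a
  cubic moment of \<open>1 + Q m n\<close>. This moment is bounded in \<open>n\<close>:
  \<open>Q m n\<close> behaves like \<theta> ln (n / m) and has exponential moments under
  \<open>jump\<close>. The mean number of cycles \<open>Q 0 n\<close> solves the same recursion with
  source 1 and therefore absorbs the sum of the remainders.

  Several arcs reduce to one real variable, since a linear combination of the counts is again a sum
  over cycles; its coefficients change with the dimension, so the estimate has to be uniform in the
  summands. The sign of the pair correlations comes from the normalized weights \<open>B\<close>
  being log-convex for \<theta> \<le> 1 and log-concave for \<theta> \<ge> 1. Full circles carry an
  almost surely constant count and are the degenerate case; for any other arc two consecutive cycle
  lengths cannot both contribute little, which makes its diagonal coefficient positive.\<close>

lemma cube_le_exp_half: "x \<ge> 0 \<Longrightarrow> (1 + x) ^ 3 \<le> 96 * exp (x / 2)" for x :: real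
proof -
  assume x: "x \<ge> 0"
  \<comment> \<open>The third Taylor term gives \<open>y ^ 3 \<le> 6 * exp y\<close>. The constant
    96 is 8 * 6 * 2: the 8 undoes the halving, the 2 bounds \<open>exp (1/2)\<close>.\<close>
  define y where "y = (1 + x) / 2"
  have y: "y \<ge> 0" using x by (simp add: y_def)
  have "y ^ 3 / fact 3 \<le> exp y"
  proof -
    have "(\<Sum>k\<in>{3}. y ^ k / fact k) \<le> (\<Sum>k. y ^ k / fact k)"
      using y summable_exp_generic[of y] by (intro sum_le_suminf) (auto simp: field_simps scaleR_conv_of_real)
    then show ?thesis by (simp add: exp_def field_simps scaleR_conv_of_real)
  qed
  moreover have "exp y = exp (1/2) * exp (x / 2)" by (simp add: y_def exp_add[symmetric] add_divide_distrib)
  ultimately have "y ^ 3 \<le> 6 * (exp (1/2) * exp (x / 2))" by (simp add: fact_numeral)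
  also have "\<dots> \<le> 6 * (2 * exp (x / 2))" using exp_half_le2 by (intro mult_left_mono mult_right_mono) auto
  finally have "y ^ 3 \<le> 6 * (2 * exp (x / 2))" .
  moreover have "(1 + x) ^ 3 = 8 * y ^ 3" by (simp add: y_def power3_eq_cube)
  ultimately show ?thesis by simp
qed

text \<open>Taylor expansion of \<open>exp (- x)\<close> at \<open>y\<close> to first order.
  Factoring out the exponential at the smaller of the two points, which is at most 1, gives a
  remainder without any factor depending on the size of \<open>x\<close> and \<open>y\<close>; in
  the application these are half variances and grow like ln n.\<close>

lemma exp_neg_second_order:
  fixes x y :: real
  assumes "x \<ge> 0" "y \<ge> 0"
  shows "\<bar>exp (- x) - exp (- y) + (x - y) * exp (- y)\<bar> \<le> (x - y)\<^sup>2"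
proof (cases "x \<ge> y")
  case True
  define d where "d = x - y"
  have d: "d \<ge> 0" using True by (simp add: d_def)
  have "exp (- d) \<le> 1 / (1 + d)"
    using exp_ge_add_one_self[of d] d by (simp add: exp_minus field_simps)
  also have "\<dots> \<le> 1 - d + d\<^sup>2"
  proof -
    have "(1 - d + d\<^sup>2) * (1 + d) = 1 + d ^ 3" by (simp add: algebra_simps power2_eq_square power3_eq_cube)
    then show ?thesis using d by (simp add: field_simps)
  qed
  finally have up: "exp (- d) - 1 + d \<le> d\<^sup>2" by simp
  have lo: "exp (- d) - 1 + d \<ge> 0" using exp_ge_add_one_self[of "- d"] by simp
  have "exp (- x) - exp (- y) + (x - y) * exp (- y) = exp (- y) * (exp (- d) - 1 + d)"
    by (simp add: d_def exp_diff exp_minus field_simps)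
  moreover have "exp (- y) * (exp (- d) - 1 + d) \<le> 1 * d\<^sup>2"
    using up lo assms by (intro mult_mono) auto
  ultimately show ?thesis using lo by (simp add: d_def)
next
  case False
  define s where "s = y - x"
  have s: "s \<ge> 0" using False by (simp add: s_def)
  have "exp (- s) * (1 + s) \<le> 1"
    using exp_ge_add_one_self[of s] by (simp add: exp_minus field_simps)
  then have lo: "1 - exp (- s) * (1 + s) \<ge> 0" by simp
  have "(1 - s) * (1 + s) \<le> exp (- s) * (1 + s)"
    using exp_ge_add_one_self[of "- s"] s by (intro mult_right_mono) auto
  then have up: "1 - exp (- s) * (1 + s) \<le> s\<^sup>2" by (simp add: algebra_simps power2_eq_square)
  have "exp (- x) - exp (- y) + (x - y) * exp (- y) = exp (- x) * (1 - exp (- s) * (1 + s))"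
    by (simp add: s_def exp_diff exp_minus field_simps)
  moreover have "exp (- x) * (1 - exp (- s) * (1 + s)) \<le> 1 * s\<^sup>2"
    using up lo assms by (intro mult_mono) auto
  ultimately show ?thesis using lo by (simp add: s_def power2_commute)
qed

lemma cis_third_order: "cmod (cis y - (1 + \<i> * y - y\<^sup>2 / 2)) \<le> \<bar>y\<bar> ^ 3 / 6" for y :: real
proof -
  have "(\<Sum>k\<le>2. (\<i> * complex_of_real y) ^ k / fact k) = 1 + \<i> * y - y\<^sup>2 / 2"
    by (simp add: numeral_2_eq_2 power_mult_distrib)
  then show ?thesis
    using iexp_approx1[of y 2] by (simp add: cis_conv_exp eval_nat_numeral)
qed

section \<open>The law of the number of points left by the first cycle\<close>

locale ewens =
  fixes \<theta> :: real
  assumes theta_pos: "\<theta> > 0"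
begin

text \<open>\<open>n! B n\<close> is the total Ewens weight of the permutations of \<open>n\<close> points, \<open>q i\<close> the probability that
  point \<open>i\<close> opens a new cycle when it is inserted, and \<open>jump n m\<close> the probability that the cycle of
  a given point leaves \<open>m\<close> of the \<open>n\<close> points.\<close>

definition B :: "nat \<Rightarrow> real" where "B n = pochhammer \<theta> n / fact n"

definition q :: "nat \<Rightarrow> real" where "q i = \<theta> / (\<theta> + real i)"

definition Q :: "nat \<Rightarrow> nat \<Rightarrow> real" where "Q m n = (\<Sum>i=m..<n. q i)"

definition jump :: "nat \<Rightarrow> nat \<Rightarrow> real" where "jump n m = \<theta> * B m / (real n * B n)"

lemma B_pos: "B n > 0"
  using theta_pos by (simp add: B_def pochhammer_pos)

lemma B_0 [simp]: "B 0 = 1"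
  by (simp add: B_def)

lemma B_Suc: "B (Suc n) = B n * ((\<theta> + real n) / (real n + 1))"
  by (simp add: B_def pochhammer_Suc field_simps)

lemma q_pos: "q i > 0"
  using theta_pos by (simp add: q_def add_pos_nonneg)

lemma q_le_1: "q i \<le> 1"
  using theta_pos by (simp add: q_def field_simps)

lemma q_0 [simp]: "q 0 = 1"
  using theta_pos by (simp add: q_def)

lemma Q_nonneg: "Q m n \<ge> 0"
  unfolding Q_def by (intro sum_nonneg less_imp_le q_pos)

lemma Q_Suc: "m \<le> n \<Longrightarrow> Q m (Suc n) = Q m n + q n"
  by (simp add: Q_def)

lemma jump_nonneg: "jump n m \<ge> 0"
  unfolding jump_def using theta_pos B_pos by (simp add: less_imp_le)

lemma jump_Suc_self: "jump (Suc n) n = q n"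
  using theta_pos B_pos[of n] by (simp add: jump_def B_Suc q_def field_simps add_nonneg_eq_0_iff)

lemma jump_Suc: "n \<ge> 1 \<Longrightarrow> jump (Suc n) m = (1 - q n) * jump n m"
proof -
  assume "n \<ge> 1"
  then have n: "real n > 0" by simp
  have "1 - q n = real n / (\<theta> + real n)"
    using theta_pos n by (simp add: q_def field_simps)
  moreover have "real (Suc n) * B (Suc n) = B n * (\<theta> + real n)"
    by (simp add: B_Suc add.commute del: of_nat_Suc) (simp add: field_simps)
  ultimately show ?thesis
    using n unfolding jump_def by simp
qed

text \<open>The law \<open>jump (Suc n)\<close> is a mixture of the point mass at \<open>n\<close>,
  with weight \<open>q n\<close>, and of \<open>jump n\<close>. This identity turns averages over
  \<open>jump\<close> into inductions on \<open>n\<close>.\<close>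

lemma sum_jump_Suc:
  fixes g :: "nat \<Rightarrow> real"
  shows "(\<Sum>m<Suc n. jump (Suc n) m * g m) = q n * g n + (1 - q n) * (\<Sum>m<n. jump n m * g m)"
proof (cases "n = 0")
  case True
  then show ?thesis by (simp add: jump_Suc_self)
next
  case False
  have "(\<Sum>m<Suc n. jump (Suc n) m * g m) = (\<Sum>m<n. (1 - q n) * jump n m * g m) + q n * g n"
    unfolding lessThan_Suc using False
    by (subst sum.insert) (simp_all add: jump_Suc_self jump_Suc)
  then show ?thesis by (simp add: sum_distrib_left mult.assoc)
qed

lemma sum_jump: "n \<ge> 1 \<Longrightarrow> (\<Sum>m<n. jump n m) = 1"
proof (induction n)
  case (Suc n)
  have "(\<Sum>m<Suc n. jump (Suc n) m) = q n + (1 - q n) * (\<Sum>m<n. jump n m)"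
    using sum_jump_Suc[of n "\<lambda>_. 1"] by simp
  then show ?case using Suc by (cases "n = 0") auto
qed simp

text \<open>By the mixture identity the average of \<open>u\<close> over \<open>jump n\<close> grows
  by exactly \<open>q n * x n\<close> when \<open>n\<close> is increased. The recursion for
  \<open>u\<close> thus becomes an explicit sum, from which differences of values of
  \<open>u\<close> can be read off.\<close>

lemma jump_potential:
  fixes u x :: "nat \<Rightarrow> real"
  assumes "u 0 = 0" and u: "\<And>n. n \<ge> 1 \<Longrightarrow> u n = x n + (\<Sum>m<n. jump n m * u m)"
  shows "(\<Sum>m<n. jump n m * u m) = (\<Sum>i=1..<n. q i * x i)"
proof (induction n)
  case (Suc n)
  show ?case
  proof (cases "n = 0")
    case False
    have "(\<Sum>m<Suc n. jump (Suc n) m * u m) = q n * u n + (1 - q n) * (\<Sum>m<n. jump n m * u m)"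
      by (rule sum_jump_Suc)
    also have "u n = x n + (\<Sum>m<n. jump n m * u m)" using False by (intro u) auto
    finally show ?thesis using Suc False by (simp add: algebra_simps)
  qed (use assms in \<open>simp\<close>)
qed simp

lemma Q_recurrence: "n \<ge> 1 \<Longrightarrow> Q 0 n = 1 + (\<Sum>m<n. jump n m * Q 0 m)"
proof (induction n)
  case (Suc n)
  show ?case
  proof (cases "n = 0")
    case False
    then show ?thesis using Suc sum_jump_Suc[of n "Q 0"] by (simp add: Q_Suc algebra_simps)
  next
    case True
    then show ?thesis by (simp add: Q_def)
  qed
qed simp

text \<open>Each value of \<open>u\<close> is its source plus a partial sum of
  \<open>q i * x i\<close>; in the difference only the indices from \<open>m\<close> to
  \<open>n\<close> survive, and their \<open>q i\<close> add up to \<open>Q m n\<close>. The two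
  source terms account for the rest. The index 0 is separate because the recursion does not speak of
  \<open>u 0\<close>.\<close>

lemma potential_diff_bound:
  fixes u x :: "nat \<Rightarrow> real"
  assumes u0: "u 0 = 0" and u: "\<And>n. n \<ge> 1 \<Longrightarrow> u n = x n + (\<Sum>m<n. jump n m * u m)"
    and x: "\<And>n. n \<ge> 1 \<Longrightarrow> \<bar>x n\<bar> \<le> K" and K: "K \<ge> 0" and mn: "m < n"
  shows "\<bar>u n - u m\<bar> \<le> 2 * K * (1 + Q m n)"
proof -
  have un: "u n = x n + (\<Sum>i=1..<n. q i * x i)"
    using u[of n] jump_potential[OF u0 u, of n] mn by simp
  have bnd: "\<bar>\<Sum>i=l..<n. q i * x i\<bar> \<le> K * Q l n" if "l \<ge> 1" for l
  proof -
    have "\<bar>\<Sum>i=l..<n. q i * x i\<bar> \<le> (\<Sum>i=l..<n. \<bar>q i * x i\<bar>)" by (rule sum_abs)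
    also have "\<dots> \<le> (\<Sum>i=l..<n. K * q i)"
      using x q_pos that
      by (intro sum_mono) (auto simp: abs_mult mult.commute intro!: mult_mono simp: less_imp_le)
    finally show ?thesis by (simp add: Q_def sum_distrib_left)
  qed
  show ?thesis
  proof (cases "m = 0")
    case True
    \<comment> \<open>The explicit sum starts at 1, whereas \<open>Q 0 n\<close> also contains
      \<open>q 0\<close>.\<close>
    have "Q 0 n = q 0 + Q 1 n" using mn unfolding Q_def by (simp add: sum.atLeast_Suc_lessThan)
    then have "K * Q 1 n \<le> K * Q 0 n" using K by (intro mult_left_mono) auto
    then have "\<bar>u n - u m\<bar> \<le> K + K * Q m n"
      using bnd[of 1] x[of n] un True u0 mn by simp
    also have "\<dots> \<le> 2 * K * (1 + Q m n)" using K Q_nonneg[of m n] by (simp add: algebra_simps)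
    finally show ?thesis .
  next
    case False
    have um: "u m = x m + (\<Sum>i=1..<m. q i * x i)"
      using u[of m] jump_potential[OF u0 u, of m] False by simp
    have "(\<Sum>i=1..<n. q i * x i) = (\<Sum>i=1..<m. q i * x i) + (\<Sum>i=m..<n. q i * x i)"
      using False mn by (simp add: sum.atLeastLessThan_concat)
    then have "u n - u m = x n - x m + (\<Sum>i=m..<n. q i * x i)" using un um by simp
    then have "\<bar>u n - u m\<bar> \<le> 2 * K + K * Q m n"
      using bnd[of m] x[of n] x[of m] False mn by simp
    also have "\<dots> \<le> 2 * K * (1 + Q m n)" using K Q_nonneg[of m n] by (simp add: algebra_simps)
    finally show ?thesis .
  qed
qed

text \<open>The bound reproduces itself under the mixture identity:
  \<open>q * exp (q / 2) + 5 * (1 - q) * exp (q / 2)\<close> equals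
  \<open>5 * exp (q / 2) * (1 - 4/5 * q)\<close>, and the loss 4/5 exceeds the gain 1/2 in the
  exponent. The 5 is only a convenient value for which this holds.\<close>

lemma sum_jump_exp: "(\<Sum>m<n. jump n m * exp (Q m n / 2)) \<le> 5"
proof (induction n)
  case (Suc n)
  have "(\<Sum>m<Suc n. jump (Suc n) m * exp (Q m (Suc n) / 2))
      = q n * exp (q n / 2) + (1 - q n) * (\<Sum>m<n. jump n m * exp (Q m (Suc n) / 2))"
    using sum_jump_Suc[of n "\<lambda>m. exp (Q m (Suc n) / 2)"] by (simp add: Q_def)
  also have "(\<Sum>m<n. jump n m * exp (Q m (Suc n) / 2))
      = exp (q n / 2) * (\<Sum>m<n. jump n m * exp (Q m n / 2))"
    by (simp add: sum_distrib_left Q_Suc add_divide_distrib exp_add mult_ac)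
  also have "q n * exp (q n / 2) + (1 - q n) * (exp (q n / 2) * (\<Sum>m<n. jump n m * exp (Q m n / 2)))
      \<le> q n * exp (q n / 2) + (1 - q n) * (exp (q n / 2) * 5)"
    using Suc q_le_1[of n] by (intro add_left_mono mult_left_mono) auto
  also have "\<dots> = 5 * exp (q n / 2) * (1 - 4/5 * q n)" by (simp add: algebra_simps)
  also have "\<dots> \<le> 5 * exp (q n / 2) * exp (- (4/5 * q n))"
    using exp_ge_add_one_self[of "- (4/5 * q n)"] by (intro mult_left_mono) auto
  also have "\<dots> = 5 * exp (q n / 2 - 4/5 * q n)" by (simp add: mult_exp_exp)
  also have "\<dots> \<le> 5" using q_pos[of n] by simp
  finally show ?case .
qed simp

lemma sum_jump_cube: "(\<Sum>m<n. jump n m * (1 + Q m n) ^ 3) \<le> 480"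
proof -
  have "(\<Sum>m<n. jump n m * (1 + Q m n) ^ 3) \<le> (\<Sum>m<n. jump n m * (96 * exp (Q m n / 2)))"
    using jump_nonneg cube_le_exp_half Q_nonneg by (intro sum_mono mult_left_mono) auto
  also have "\<dots> = 96 * (\<Sum>m<n. jump n m * exp (Q m n / 2))" by (simp add: sum_distrib_left mult_ac)
  finally show ?thesis using sum_jump_exp[of n] by simp
qed

text \<open>A cycle of length \<open>j\<close> contributes a summand with mean \<open>a j\<close>, second moment \<open>r j\<close> and
  characteristic function \<open>\<phi> j\<close>; the sum has mean \<open>\<mu> n\<close>, variance \<open>V n\<close> and characteristic function
  \<open>f n\<close>.\<close>

context
  fixes a r :: "nat \<Rightarrow> real" and \<phi> :: "nat \<Rightarrow> complex" and \<eta> :: real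
    and \<mu> V :: "nat \<Rightarrow> real" and f :: "nat \<Rightarrow> complex"
  assumes eta: "0 \<le> \<eta>" "\<eta> \<le> 1"
    and a_bound: "\<And>j. \<bar>a j\<bar> \<le> \<eta>" and a_sq_le: "\<And>j. (a j)\<^sup>2 \<le> r j" and r_bound: "\<And>j. r j \<le> \<eta>\<^sup>2"
    and phi_bound: "\<And>j. cmod (\<phi> j) \<le> 1"
    and phi_taylor: "\<And>j. cmod (\<phi> j - (1 + \<i> * a j - r j / 2)) \<le> \<eta> ^ 3"
    and mu_0: "\<mu> 0 = 0"
    and mu_rec: "\<And>n. n \<ge> 1 \<Longrightarrow> \<mu> n = (\<Sum>m<n. jump n m * (a (n - m) + \<mu> m))"
    and V_0: "V 0 = 0"
    and V_rec: "\<And>n. n \<ge> 1 \<Longrightarrow> V n = (\<Sum>m<n. jump n m *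
          (r (n - m) + 2 * a (n - m) * (\<mu> m - \<mu> n) + (\<mu> m - \<mu> n)\<^sup>2 + V m))"
    and f_0: "f 0 = 1"
    and f_rec: "\<And>n. n \<ge> 1 \<Longrightarrow> f n = (\<Sum>m<n. jump n m * (\<phi> (n - m) * f m))"
begin

lemma mu_diff: "m < n \<Longrightarrow> \<bar>\<mu> m - \<mu> n\<bar> \<le> 2 * \<eta> * (1 + Q m n)"
proof -
  assume mn: "m < n"
  have "\<bar>\<mu> n - \<mu> m\<bar> \<le> 2 * \<eta> * (1 + Q m n)"
  proof (rule potential_diff_bound[where u = \<mu> and K = \<eta>, OF mu_0 _ _ eta(1) mn])
    fix n :: nat assume n: "n \<ge> 1"
    show "\<mu> n = (\<Sum>m<n. jump n m * a (n - m)) + (\<Sum>m<n. jump n m * \<mu> m)"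
      using mu_rec[OF n] by (simp add: algebra_simps sum.distrib)
    have "\<bar>\<Sum>m<n. jump n m * a (n - m)\<bar> \<le> (\<Sum>m<n. jump n m * \<eta>)"
      using a_bound jump_nonneg by (intro order.trans[OF sum_abs] sum_mono) (auto simp: abs_mult intro: mult_left_mono)
    then show "\<bar>\<Sum>m<n. jump n m * a (n - m)\<bar> \<le> \<eta>"
      using sum_jump[OF n] by (simp flip: sum_distrib_right)
  qed
  then show ?thesis by (simp add: abs_minus_commute)
qed

text \<open>The second moment of the summand of a cycle of length \<open>n - m\<close>, shifted by
  \<open>\<mu> m - \<mu> n\<close>: the quadratic increment of the centred sum, given that the first
  cycle leaves \<open>m\<close> points.\<close>

definition incr :: "nat \<Rightarrow> nat \<Rightarrow> real" where
  "incr n m = r (n - m) + 2 * a (n - m) * (\<mu> m - \<mu> n) + (\<mu> m - \<mu> n)\<^sup>2"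

lemma incr_nonneg: "incr n m \<ge> 0"
proof -
  have "0 \<le> (a (n - m) + (\<mu> m - \<mu> n))\<^sup>2" by simp
  also have "\<dots> \<le> incr n m" using a_sq_le[of "n - m"] by (simp add: incr_def power2_sum)
  finally show ?thesis .
qed

text \<open>The 9 is 1 + 4 + 4, from the second moment, the mixed term and the squared difference of
  means.\<close>

lemma incr_le: "m < n \<Longrightarrow> incr n m \<le> 9 * \<eta>\<^sup>2 * (1 + Q m n)\<^sup>2"
proof -
  assume mn: "m < n"
  define L where "L = 1 + Q m n"
  have L: "L \<ge> 1" using Q_nonneg by (simp add: L_def)
  have D: "\<bar>\<mu> m - \<mu> n\<bar> \<le> 2 * \<eta> * L" using mu_diff[OF mn] by (simp add: L_def)
  have "a (n - m) * (\<mu> m - \<mu> n) \<le> \<bar>a (n - m)\<bar> * \<bar>\<mu> m - \<mu> n\<bar>" by (simp add: flip: abs_mult)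
  also have "\<dots> \<le> \<eta> * (2 * \<eta> * L)" using D a_bound eta by (intro mult_mono) auto
  finally have 1: "2 * a (n - m) * (\<mu> m - \<mu> n) \<le> 4 * (\<eta>\<^sup>2 * L)" by (simp add: power2_eq_square mult_ac)
  have 2: "(\<mu> m - \<mu> n)\<^sup>2 \<le> (2 * \<eta> * L)\<^sup>2"
    using D by (metis abs_ge_zero power2_abs power_mono)
  have L2: "1 \<le> L\<^sup>2" "L \<le> L\<^sup>2" using L by (auto simp: power2_eq_square mult_ge1_I)
  have "\<eta>\<^sup>2 * 1 \<le> \<eta>\<^sup>2 * L\<^sup>2" "\<eta>\<^sup>2 * L \<le> \<eta>\<^sup>2 * L\<^sup>2" using L2 by (intro mult_left_mono; simp)+
  then show ?thesis
    using 1 2 r_bound[of "n - m"] unfolding incr_def L_def[symmetric] power_mult_distrib by (simp add: field_simps)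
qed

text \<open>\<open>V\<close> is again a potential, with the average of \<open>incr\<close> as its
  nonnegative source. This average is at most 9 * 480 = 4320 times \<open>\<eta>\<^sup>2\<close>,
  and \<open>potential_diff_bound\<close> doubles the constant.\<close>

lemma V_diff: "m < n \<Longrightarrow> \<bar>V m - V n\<bar> \<le> 8640 * \<eta>\<^sup>2 * (1 + Q m n)"
  and V_nonneg: "V n \<ge> 0"
proof -
  have V: "V n = (\<Sum>m<n. jump n m * incr n m) + (\<Sum>m<n. jump n m * V m)" if "n \<ge> 1" for n
    using V_rec[OF that] unfolding incr_def[symmetric] by (simp add: distrib_left sum.distrib)
  have nn: "(\<Sum>m<n. jump n m * incr n m) \<ge> 0" for n
    using jump_nonneg incr_nonneg by (intro sum_nonneg mult_nonneg_nonneg)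
  have "(\<Sum>m<n. jump n m * incr n m) \<le> 4320 * \<eta>\<^sup>2" for n
  proof -
    have "(\<Sum>m<n. jump n m * incr n m) \<le> (\<Sum>m<n. jump n m * (9 * \<eta>\<^sup>2 * (1 + Q m n) ^ 3))"
    proof (intro sum_mono mult_left_mono jump_nonneg)
      fix m assume "m \<in> {..<n}"
      then have "incr n m \<le> 9 * \<eta>\<^sup>2 * (1 + Q m n)\<^sup>2" using incr_le by simp
      also have "\<dots> \<le> 9 * \<eta>\<^sup>2 * (1 + Q m n) ^ 3"
        using Q_nonneg by (intro mult_left_mono power_increasing) auto
      finally show "incr n m \<le> 9 * \<eta>\<^sup>2 * (1 + Q m n) ^ 3" .
    qed
    also have "\<dots> = 9 * \<eta>\<^sup>2 * (\<Sum>m<n. jump n m * (1 + Q m n) ^ 3)"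
      by (simp add: sum_distrib_left mult_ac)
    also have "\<dots> \<le> 9 * \<eta>\<^sup>2 * 480" by (intro mult_left_mono sum_jump_cube) auto
    finally show ?thesis by simp
  qed
  then show "\<bar>V m - V n\<bar> \<le> 8640 * \<eta>\<^sup>2 * (1 + Q m n)" if mn: "m < n"
    using potential_diff_bound[OF V_0 V _ _ mn, of "4320 * \<eta>\<^sup>2"] nn by (simp add: abs_minus_commute)
  show "V n \<ge> 0"
  proof (induction n rule: less_induct)
    case (less n)
    then show ?case
      using V[of n] nn[of n] V_0 jump_nonneg
      by (cases "n = 0") (auto intro!: add_nonneg_nonneg sum_nonneg mult_nonneg_nonneg)
  qed
qed

text \<open>The term subtracted last is the part of order one and two; its average over
  \<open>jump n\<close> is 0. Three errors remain: the Taylor error \<open>R1\<close> of the shifted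
  characteristic function, with 11 = 1 + 6 + 2 + 1 + 1, the Taylor error \<open>R2\<close> of the
  Gaussian factor, with 18662400 the square of 4320, and the product \<open>R3\<close> of the two
  first-order deviations, with 21600 = 5 * 4320.\<close>

lemma step_error:
  assumes mn: "m < n"
  shows "cmod (\<phi> (n - m) * cis (\<mu> m - \<mu> n) * exp (- (V m / 2)) - exp (- (V n / 2))
      - exp (- (V n / 2)) * (\<i> * (a (n - m) + \<mu> m - \<mu> n) - (incr n m + V m - V n) / 2))
      \<le> 18700000 * \<eta> ^ 3 * (1 + Q m n) ^ 3"
proof -
  define L where "L = 1 + Q m n"
  define D where "D = \<mu> m - \<mu> n"
  define E where "E = V m - V n"
  define j where "j = n - m"
  define gm where "gm = exp (- (V m / 2))"
  define gn where "gn = exp (- (V n / 2))"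
  have L: "L \<ge> 1" using Q_nonneg by (simp add: L_def)
  have D: "\<bar>D\<bar> \<le> 2 * \<eta> * L" using mu_diff[OF mn] by (simp add: L_def D_def)
  have E: "\<bar>E\<bar> \<le> 8640 * \<eta>\<^sup>2 * L" using V_diff[OF mn] by (simp add: L_def E_def)
  have a: "\<bar>a j\<bar> \<le> \<eta>" and r: "\<bar>r j\<bar> \<le> \<eta>\<^sup>2"
    using a_bound[of j] r_bound[of j] a_sq_le[of j] zero_le_power2[of "a j"] by linarith+
  have e2: "\<eta>\<^sup>2 \<le> \<eta>" using eta power_decreasing[of 1 2 \<eta>] by simp
  have e3: "\<eta> ^ 3 \<le> \<eta>" using eta power_decreasing[of 1 3 \<eta>] by simp
  have e43: "\<eta> ^ 4 \<le> \<eta> ^ 3" using eta by (intro power_decreasing) auto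
  have L23: "L \<le> L ^ 3" "1 \<le> L ^ 3" "L\<^sup>2 \<le> L ^ 3"
    using power_increasing[of 1 3 L] power_increasing[of 0 3 L] power_increasing[of 2 3 L] L by simp_all
  have mono: "x * \<eta> ^ 3 * y \<le> x * \<eta> ^ 3 * L ^ 3" if "x \<ge> 0" "y \<le> L ^ 3" for x y
    using that eta by (intro mult_left_mono) auto
  define P1 where "P1 = 1 + \<i> * a j - r j / 2"
  define P2 where "P2 = 1 + \<i> * D - D\<^sup>2 / 2"
  have "cmod P1 \<le> 1 + \<bar>a j\<bar> + \<bar>r j\<bar> / 2"
    using norm_triangle_ineq4[of "1 + \<i> * a j" "r j / 2"] norm_triangle_ineq[of 1 "\<i> * a j"]
    by (simp add: P1_def norm_mult norm_divide)
  then have P1: "cmod P1 \<le> 3" using a r eta e2 by linarith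
  have "cmod (cis D - P2) \<le> \<bar>D\<bar> ^ 3 / 6" unfolding P2_def by (rule cis_third_order)
  also have "\<dots> \<le> (2 * \<eta> * L) ^ 3 / 6" using D by (intro divide_right_mono power_mono) auto
  also have "\<dots> = 8 / 6 * (\<eta> ^ 3 * L ^ 3)" by (simp add: power_mult_distrib)
  also have "\<dots> \<le> 2 * (\<eta> ^ 3 * L ^ 3)" using eta L by (intro mult_right_mono) auto
  also have "\<dots> = 2 * \<eta> ^ 3 * L ^ 3" by simp
  finally have c2: "cmod (cis D - P2) \<le> 2 * \<eta> ^ 3 * L ^ 3" .
  have c1: "cmod (\<phi> j - P1) \<le> \<eta> ^ 3 * L ^ 3"
  proof -
    have "1 * \<eta> ^ 3 * 1 \<le> 1 * \<eta> ^ 3 * L ^ 3" using L23(2) by (intro mono) simp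
    then show ?thesis using phi_taylor[of j] unfolding P1_def by linarith
  qed
  define S where "S = incr n m"
  have S: "S = r j + 2 * a j * D + D\<^sup>2" by (simp add: S_def incr_def j_def D_def)
  have b1: "cmod (complex_of_real (a j) * D\<^sup>2) \<le> 4 * \<eta> ^ 3 * L ^ 3"
  proof -
    have "\<bar>a j\<bar> * \<bar>D\<bar>\<^sup>2 \<le> \<eta> * (2 * \<eta> * L)\<^sup>2" using a D eta by (intro mult_mono power_mono) auto
    also have "\<dots> = 4 * \<eta> ^ 3 * L\<^sup>2" by (simp add: power2_eq_square power3_eq_cube)
    finally show ?thesis using mono[of 4 "L\<^sup>2"] L23 by (simp add: norm_mult norm_power)
  qed
  have b2: "cmod (complex_of_real (r j) * D) \<le> 2 * \<eta> ^ 3 * L ^ 3"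
  proof -
    have "\<bar>r j\<bar> * \<bar>D\<bar> \<le> \<eta>\<^sup>2 * (2 * \<eta> * L)" using r D eta by (intro mult_mono) auto
    also have "\<dots> = 2 * \<eta> ^ 3 * L" by (simp add: power2_eq_square power3_eq_cube)
    finally show ?thesis using mono[of 2 L] L23 by (simp add: norm_mult)
  qed
  have b3: "cmod (complex_of_real (r j) * D\<^sup>2) \<le> 4 * \<eta> ^ 3 * L ^ 3"
  proof -
    have "\<bar>r j\<bar> * \<bar>D\<bar>\<^sup>2 \<le> \<eta>\<^sup>2 * (2 * \<eta> * L)\<^sup>2" using r D eta by (intro mult_mono power_mono) auto
    also have "\<dots> = 4 * \<eta> ^ 4 * L\<^sup>2" by (simp add: power2_eq_square power4_eq_xxxx)
    also have "\<dots> \<le> 4 * \<eta> ^ 3 * L\<^sup>2" using e43 by (intro mult_right_mono) auto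
    finally show ?thesis using mono[of 4 "L\<^sup>2"] L23 by (simp add: norm_mult norm_power)
  qed
  \<comment> \<open>\<open>T\<close> keeps the terms of \<open>P1 * P2\<close> up to second order:
    the mixed product of the two linear terms turns the quadratic part into \<open>S\<close>. What
    is dropped is of order three and four.\<close>
  define T where "T = 1 + \<i> * (a j + D) - S / 2"
  define R1 where "R1 = \<phi> j * cis D - T"
  have "R1 = (\<phi> j - P1) * cis D + P1 * (cis D - P2) + (P1 * P2 - T)"
    by (simp add: R1_def algebra_simps)
  moreover have "P1 * P2 - T = - (\<i> * (complex_of_real (a j) * D\<^sup>2)) / 2 - \<i> * (complex_of_real (r j) * D) / 2
      + complex_of_real (r j) * D\<^sup>2 / 4"
    by (simp add: P1_def P2_def T_def S field_simps power2_eq_square)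
  ultimately have "R1 = (\<phi> j - P1) * cis D + P1 * (cis D - P2) +
     (- (\<i> * (complex_of_real (a j) * D\<^sup>2)) / 2 - \<i> * (complex_of_real (r j) * D) / 2
      + complex_of_real (r j) * D\<^sup>2 / 4)" by (simp only:)
  moreover have "cmod (- (\<i> * (complex_of_real (a j) * D\<^sup>2)) / 2 - \<i> * (complex_of_real (r j) * D) / 2)
      \<le> cmod (complex_of_real (a j) * D\<^sup>2) / 2 + cmod (complex_of_real (r j) * D) / 2"
    by (rule order.trans[OF norm_triangle_ineq4]) (simp add: norm_mult norm_divide norm_power)
  moreover have "cmod (x + y + (z + w)) \<le> cmod x + cmod y + (cmod z + cmod w)" for x y z w
    using norm_triangle_ineq[of "x + y" "z + w"] norm_triangle_ineq[of x y] norm_triangle_ineq[of z w] by linarith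
  ultimately have "cmod R1 \<le> cmod ((\<phi> j - P1) * cis D) + cmod (P1 * (cis D - P2))
      + (cmod (- (\<i> * (complex_of_real (a j) * D\<^sup>2)) / 2 - \<i> * (complex_of_real (r j) * D) / 2)
        + cmod (complex_of_real (r j) * D\<^sup>2 / 4))"
    by (simp only:)
  also have "\<dots> \<le> cmod (\<phi> j - P1) * 1 + cmod P1 * cmod (cis D - P2)
      + ((cmod (complex_of_real (a j) * D\<^sup>2) / 2 + cmod (complex_of_real (r j) * D) / 2)
        + cmod (complex_of_real (r j) * D\<^sup>2) / 4)"
    by (intro add_mono order.refl)
       (simp_all add: norm_mult norm_divide,
        rule order.trans[OF norm_triangle_ineq4], simp add: norm_mult norm_divide norm_power)
  also have "\<dots> \<le> \<eta> ^ 3 * L ^ 3 * 1 + 3 * (2 * \<eta> ^ 3 * L ^ 3)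
      + (4 * \<eta> ^ 3 * L ^ 3 / 2 + 2 * \<eta> ^ 3 * L ^ 3 / 2 + 4 * \<eta> ^ 3 * L ^ 3 / 4)"
    using c1 c2 P1 b1 b2 b3 eta L by (intro add_mono mult_mono divide_right_mono) auto
  finally have R1: "cmod R1 \<le> 11 * \<eta> ^ 3 * L ^ 3" by (simp add: mult_ac)
  have gn: "0 \<le> gn" "gn \<le> 1" using V_nonneg[of n] by (auto simp: gn_def)
  define R2 where "R2 = gm - gn + E / 2 * gn"
  have "\<bar>R2\<bar> \<le> (E / 2)\<^sup>2"
    using exp_neg_second_order[of "V m / 2" "V n / 2"] V_nonneg
    by (simp add: R2_def gm_def gn_def E_def diff_divide_distrib)
  also have "\<dots> \<le> (4320 * \<eta>\<^sup>2 * L)\<^sup>2" using E by (subst abs_le_square_iff[symmetric]) (use L in \<open>simp add: abs_mult\<close>)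
  also have "\<dots> = 18662400 * \<eta> ^ 4 * L\<^sup>2" by (simp add: power2_eq_square power4_eq_xxxx)
  also have "\<dots> \<le> 18662400 * \<eta> ^ 3 * L\<^sup>2" using e43 by (intro mult_right_mono) auto
  also have "\<dots> \<le> 18662400 * \<eta> ^ 3 * L ^ 3" using L23 by (intro mono) auto
  finally have R2: "\<bar>R2\<bar> \<le> 18662400 * \<eta> ^ 3 * L ^ 3" .
  have gmn: "\<bar>gm - gn\<bar> \<le> 4320 * \<eta>\<^sup>2 * L"
  proof -
    have lip: "\<bar>exp (- x) - exp (- y)\<bar> \<le> y - x" if "0 \<le> x" "x \<le> y" for x y :: real
    proof -
      have "exp (- x) - exp (- y) = exp (- x) * (1 - exp (- (y - x)))"
        by (simp add: right_diff_distrib mult_exp_exp)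
      moreover have "1 - exp (- (y - x)) \<le> y - x" using exp_ge_add_one_self[of "- (y - x)"] by linarith
      then have "exp (- x) * (1 - exp (- (y - x))) \<le> 1 * (y - x)"
        using that by (intro mult_mono) auto
      moreover have "0 \<le> exp (- x) * (1 - exp (- (y - x)))" using that by simp
      ultimately show ?thesis by (metis abs_of_nonneg mult_1)
    qed
    have "\<bar>gm - gn\<bar> \<le> \<bar>E\<bar> / 2"
    proof (cases "V m \<le> V n")
      case True
      then have "\<bar>gm - gn\<bar> \<le> V n / 2 - V m / 2"
        unfolding gm_def gn_def using V_nonneg by (intro lip) auto
      then show ?thesis using True by (simp add: E_def)
    next
      case False
      then have "\<bar>gn - gm\<bar> \<le> V m / 2 - V n / 2"
        unfolding gm_def gn_def using V_nonneg by (intro lip) auto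
      then show ?thesis using False by (simp add: E_def abs_minus_commute)
    qed
    then show ?thesis using E by simp
  qed
  have one: "cmod (\<phi> j * cis D - 1) \<le> 5 * \<eta> * L"
  proof -
    have e: "\<phi> j * cis D - 1 = (\<phi> j - P1) * cis D + (P1 - 1) * cis D + (cis D - 1)" by (simp add: algebra_simps)
    have "cmod (\<phi> j * cis D - 1) \<le> cmod ((\<phi> j - P1) * cis D) + cmod ((P1 - 1) * cis D) + cmod (cis D - 1)"
      unfolding e by (intro order.trans[OF norm_triangle_ineq] add_right_mono norm_triangle_ineq)
    also have "\<dots> = cmod (\<phi> j - P1) + cmod (P1 - 1) + cmod (cis D - 1)" by (simp add: norm_mult)
    also have "cmod (\<phi> j - P1) \<le> \<eta>" using phi_taylor[of j] e3 unfolding P1_def by simp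
    also have "cmod (P1 - 1) \<le> \<bar>a j\<bar> + \<bar>r j\<bar> / 2"
      using norm_triangle_ineq4[of "\<i> * a j" "r j / 2"] by (simp add: P1_def norm_mult norm_divide)
    also have "\<bar>a j\<bar> + \<bar>r j\<bar> / 2 \<le> 2 * \<eta>" using a r e2 eta by linarith
    also have "cmod (cis D - 1) \<le> \<bar>D\<bar>"
      using iexp_approx1[of D 0] by (simp add: cis_conv_exp)
    also have "\<dots> \<le> 2 * \<eta> * L" by (rule D)
    finally have "cmod (\<phi> j * cis D - 1) \<le> 3 * \<eta> + 2 * \<eta> * L" by simp
    also have "\<dots> \<le> 5 * \<eta> * L" using eta L mult_left_mono[of 1 L \<eta>] by (simp add: mult_ac)
    finally show ?thesis .
  qed
  have R3: "cmod ((\<phi> j * cis D - 1) * (complex_of_real (gm - gn))) \<le> 21600 * \<eta> ^ 3 * L ^ 3"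
  proof -
    have "cmod ((\<phi> j * cis D - 1) * complex_of_real (gm - gn)) \<le> (5 * \<eta> * L) * (4320 * \<eta>\<^sup>2 * L)"
      unfolding norm_mult norm_of_real using one gmn eta L by (intro mult_mono) auto
    also have "\<dots> = 21600 * \<eta> ^ 3 * L\<^sup>2" by (simp add: power2_eq_square power3_eq_cube)
    also have "\<dots> \<le> 21600 * \<eta> ^ 3 * L ^ 3" using L23 by (intro mono) auto
    finally show ?thesis .
  qed
  \<comment> \<open>An exact identity: writing \<open>\<phi> j * cis D\<close> as 1 plus a deviation
    and \<open>gm\<close> as \<open>gn\<close> plus a deviation separates the product of the
    deviations from the two Taylor remainders.\<close>
  have "\<phi> j * cis D * gm - gn - gn * (\<i> * (a j + D) - (S + E) / 2)
      = (\<phi> j * cis D - 1) * complex_of_real (gm - gn) + R2 + R1 * gn"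
    by (simp add: R1_def R2_def T_def field_simps)
  also have "cmod \<dots> \<le> cmod ((\<phi> j * cis D - 1) * complex_of_real (gm - gn)) + \<bar>R2\<bar> + cmod R1 * gn"
    using gn by (intro order.trans[OF norm_triangle_ineq] add_mono) (auto simp: norm_mult)
  also have "\<dots> \<le> 21600 * \<eta> ^ 3 * L ^ 3 + 18662400 * \<eta> ^ 3 * L ^ 3 + 11 * \<eta> ^ 3 * L ^ 3 * 1"
    using R1 R2 R3 gn eta L by (intro add_mono mult_mono) auto
  also have "\<dots> \<le> 18700000 * \<eta> ^ 3 * L ^ 3" using eta L by simp
  finally show ?thesis
    by (simp add: j_def D_def S_def E_def gm_def gn_def L_def algebra_simps)
qed

text \<open>Earlier errors are only averaged, as they are multiplied by factors of modulus at most
  1. The new error is at most 18700000 * 480 < \<open>10 ^ 10\<close> times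
  \<open>\<eta> ^ 3\<close>, and is absorbed by the source 1 in the recursion for
  \<open>Q 0\<close>.\<close>

lemma char_fun_estimate:
  "cmod (f n * cis (- \<mu> n) - exp (- (V n / 2))) \<le> 10 ^ 10 * \<eta> ^ 3 * Q 0 n"
proof (induction n rule: less_induct)
  case (less n)
  show ?case
  proof (cases "n = 0")
    case True
    then show ?thesis by (simp add: f_0 mu_0 V_0 Q_def)
  next
    case False
    then have n: "n \<ge> 1" by simp
    define g where "g k = exp (- (V k / 2))" for k
    define err where "err m = \<phi> (n - m) * cis (\<mu> m - \<mu> n) * g m - g n
      - g n * (\<i> * (a (n - m) + \<mu> m - \<mu> n) - (incr n m + V m - V n) / 2)" for m
    have shift: "(\<Sum>m<n. jump n m * (h m - c)) = (\<Sum>m<n. jump n m * h m) - c" for h c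
      using sum_jump[OF n] by (simp add: right_diff_distrib sum_subtractf flip: sum_distrib_right)
    \<comment> \<open>Since \<open>jump n\<close> has total mass 1, constants can be moved out of
      the average; \<open>z1\<close> and \<open>z2\<close> are then the recursions for the mean and
      the variance. This is the cancellation of the terms of order one and two.\<close>
    have z1: "(\<Sum>m<n. jump n m * (a (n - m) + \<mu> m - \<mu> n)) = 0"
      using mu_rec[OF n] by (subst shift) simp
    have z2: "(\<Sum>m<n. jump n m * (incr n m + V m - V n)) = 0"
      using V_rec[OF n] by (subst shift) (simp add: incr_def)
    have "f n * cis (- \<mu> n) - g n
        = (\<Sum>m<n. jump n m * (\<phi> (n - m) * f m * cis (- \<mu> n))) - (\<Sum>m<n. jump n m) * g n"
      using f_rec[OF n] sum_jump[OF n] by (simp add: sum_distrib_right sum_distrib_left mult_ac)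
    also have "\<dots> = (\<Sum>m<n. jump n m * (\<phi> (n - m) * cis (\<mu> m - \<mu> n) * (f m * cis (- \<mu> m) - g m)))
        + (\<Sum>m<n. jump n m * (\<phi> (n - m) * cis (\<mu> m - \<mu> n) * g m - g n))"
    proof -
      have c: "cis (- \<mu> n) = cis (\<mu> m - \<mu> n) * cis (- \<mu> m)" for m by (simp add: cis_mult)
      have "jump n m * (\<phi> (n - m) * f m * cis (- \<mu> n)) =
          jump n m * (\<phi> (n - m) * cis (\<mu> m - \<mu> n) * (f m * cis (- \<mu> m) - g m))
        + jump n m * (\<phi> (n - m) * cis (\<mu> m - \<mu> n) * g m - g n) + jump n m * g n" for m
        by (subst c[of m]) (simp add: algebra_simps)
      then show ?thesis by (simp add: sum.distrib flip: sum_distrib_right)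
    qed
    also have "(\<Sum>m<n. jump n m * (\<phi> (n - m) * cis (\<mu> m - \<mu> n) * g m - g n)) = (\<Sum>m<n. jump n m * err m)"
    proof -
      have "(\<Sum>m<n. jump n m * (\<phi> (n - m) * cis (\<mu> m - \<mu> n) * g m - g n)) =
        (\<Sum>m<n. jump n m * err m)
        + \<i> * g n * complex_of_real (\<Sum>m<n. jump n m * (a (n - m) + \<mu> m - \<mu> n))
        - g n / 2 * complex_of_real (\<Sum>m<n. jump n m * (incr n m + V m - V n))"
        unfolding of_real_sum sum_distrib_left sum.distrib[symmetric] sum_subtractf[symmetric]
        by (intro sum.cong refl) (simp add: err_def field_simps)
      then show ?thesis by (simp add: z1 z2)
    qed
    finally have "cmod (f n * cis (- \<mu> n) - g n) \<le>
      (\<Sum>m<n. cmod (jump n m * (\<phi> (n - m) * cis (\<mu> m - \<mu> n) * (f m * cis (- \<mu> m) - g m))))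
        + (\<Sum>m<n. cmod (jump n m * err m))"
      by (simp only:) (intro order.trans[OF norm_triangle_ineq] add_mono norm_sum)
    also have "\<dots> \<le> (\<Sum>m<n. jump n m * (10 ^ 10 * \<eta> ^ 3 * Q 0 m))
        + (\<Sum>m<n. jump n m * (18700000 * \<eta> ^ 3 * (1 + Q m n) ^ 3))"
    proof (intro add_mono sum_mono)
      fix m assume "m \<in> {..<n}"
      then have mn: "m < n" by simp
      have "cmod (\<phi> (n - m) * (f m * cis (- \<mu> m) - g m)) \<le> 1 * (10 ^ 10 * \<eta> ^ 3 * Q 0 m)"
        unfolding norm_mult using phi_bound less[OF mn] by (intro mult_mono) (auto simp: g_def)
      then show "cmod (jump n m * (\<phi> (n - m) * cis (\<mu> m - \<mu> n) * (f m * cis (- \<mu> m) - g m)))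
          \<le> jump n m * (10 ^ 10 * \<eta> ^ 3 * Q 0 m)"
        using jump_nonneg[of n m] by (auto simp: norm_mult intro!: mult_left_mono)
      have "cmod (err m) \<le> 18700000 * \<eta> ^ 3 * (1 + Q m n) ^ 3"
        using step_error[OF mn] by (simp add: err_def g_def)
      then show "cmod (jump n m * err m) \<le> jump n m * (18700000 * \<eta> ^ 3 * (1 + Q m n) ^ 3)"
        using jump_nonneg[of n m] by (auto simp: norm_mult intro!: mult_left_mono)
    qed
    also have "\<dots> = 10 ^ 10 * \<eta> ^ 3 * (\<Sum>m<n. jump n m * Q 0 m)
        + 18700000 * \<eta> ^ 3 * (\<Sum>m<n. jump n m * (1 + Q m n) ^ 3)"
      by (simp add: sum_distrib_left sum_distrib_right mult_ac)
    also have "\<dots> \<le> 10 ^ 10 * \<eta> ^ 3 * (\<Sum>m<n. jump n m * Q 0 m) + 18700000 * \<eta> ^ 3 * 480"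
      using sum_jump_cube eta by (intro add_left_mono mult_left_mono) auto
    also have "\<dots> \<le> 10 ^ 10 * \<eta> ^ 3 * (1 + (\<Sum>m<n. jump n m * Q 0 m))"
      using eta by (simp add: algebra_simps)
    also have "\<dots> = 10 ^ 10 * \<eta> ^ 3 * Q 0 n" using Q_recurrence[OF n] by simp
    finally show ?thesis by (simp add: g_def)
  qed
qed

end

section \<open>Moments of sums over cycles\<close>

text \<open>\<open>Bfps\<close> is \<open>(1 - X)\<close> to the power \<open>- \<theta>\<close>, the generating function of the Ewens weights; marking one
  cycle multiplies it by \<open>cyc a\<close>, whose coefficient at 0 is 0 because \<open>x / 0 = 0\<close>.\<close>

definition cyc :: "(nat \<Rightarrow> real) \<Rightarrow> real fps" where
  "cyc a = Abs_fps (\<lambda>j. \<theta> * a j / real j)"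

definition Bfps :: "real fps" where "Bfps = Abs_fps B"

definition mean :: "nat \<Rightarrow> (nat \<Rightarrow> real) \<Rightarrow> real" where
  "mean n a = fps_nth (cyc a * Bfps) n / B n"

text \<open>The first term is the contribution of a cycle paired with itself; the second marks an
  ordered pair of different cycles.\<close>

definition second_moment :: "nat \<Rightarrow> (nat \<Rightarrow> real) \<Rightarrow> (nat \<Rightarrow> real) \<Rightarrow> real" where
  "second_moment n a b = mean n (\<lambda>j. a j * b j) + fps_nth (cyc a * cyc b * Bfps) n / B n"

definition covar :: "nat \<Rightarrow> (nat \<Rightarrow> real) \<Rightarrow> (nat \<Rightarrow> real) \<Rightarrow> real" where
  "covar n a b = second_moment n a b - mean n a * mean n b"

lemma mean_0 [simp]: "mean 0 a = 0"
  by (simp add: mean_def cyc_def)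

lemma second_moment_0 [simp]: "second_moment 0 a b = 0"
  by (simp add: second_moment_def cyc_def)

lemma fps_one_minus_X_nth: "fps_nth ((1 - fps_X) * F) n = fps_nth F n - (if n = 0 then 0 else fps_nth F (n - 1))"
  for F :: "real fps"
  by (simp add: left_diff_distrib)

text \<open>The differential equation of the power \<open>- \<theta>\<close> of
  \<open>1 - fps_X\<close>, in the form cleared of denominators; on coefficients it is the recursion
  of \<open>B\<close>.\<close>

lemma Bfps_ode: "(1 - fps_X) * fps_deriv Bfps = fps_const \<theta> * Bfps"
proof (rule fps_ext)
  fix n
  have "real (Suc n) * B (Suc n) = (\<theta> + real n) * B n" for n
    by (simp add: B_Suc add.commute del: of_nat_Suc) (simp add: field_simps)
  note B = this
  show "fps_nth ((1 - fps_X) * fps_deriv Bfps) n = fps_nth (fps_const \<theta> * Bfps) n"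
  proof (cases n)
    case 0
    then show ?thesis using B[of 0] by (simp add: fps_one_minus_X_nth Bfps_def)
  next
    case (Suc k)
    then show ?thesis using B[of "Suc k"]
      by (simp add: fps_one_minus_X_nth Bfps_def algebra_simps)
  qed
qed

text \<open>Dividing the equation by \<open>1 - fps_X\<close> turns \<open>\<theta> F\<close> into
  partial sums of coefficients, and multiplying by \<open>fps_X\<close> turns the derivative into a
  factor \<open>n\<close>. This is how differential equations become recursions over the size of the
  first cycle.\<close>

lemma convolution_recurrence:
  fixes F G :: "real fps"
  assumes F: "(1 - fps_X) * fps_deriv F = (1 - fps_X) * G + fps_const \<theta> * F"
  shows "real n * fps_nth F n = fps_nth (fps_X * G) n + \<theta> * (\<Sum>m<n. fps_nth F m)"
proof (induction n)
  case (Suc n)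
  have e: "fps_nth ((1 - fps_X) * fps_deriv F) n = fps_nth ((1 - fps_X) * G + fps_const \<theta> * F) n"
    using F by simp
  show ?case
  proof (cases n)
    case 0
    then show ?thesis using e Suc by (simp add: fps_one_minus_X_nth)
  next
    case (Suc k)
    then show ?thesis using e Suc.IH
      by (simp add: fps_one_minus_X_nth fps_add_nth algebra_simps)
  qed
qed simp

text \<open>The derivative cancels the division by the length, so that in the recursion a cycle is
  weighted by \<open>a j\<close> itself; the coefficient 0 stays 0.\<close>

lemma cyc_deriv: "fps_X * fps_deriv (cyc a) = Abs_fps (\<lambda>j. if j = 0 then 0 else \<theta> * a j)"
  by (rule fps_ext) (auto simp: cyc_def field_simps)

lemma cyc_deriv_nth: "fps_nth (fps_X * fps_deriv (cyc a) * H) n = \<theta> * (\<Sum>m<n. a (n - m) * fps_nth H m)"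
proof -
  have "fps_nth (fps_X * fps_deriv (cyc a) * H) n = (\<Sum>j=0..n. (if j = 0 then 0 else \<theta> * a j) * fps_nth H (n - j))"
    unfolding cyc_deriv fps_mult_nth by simp
  also have "\<dots> = (\<Sum>j=1..n. \<theta> * a j * fps_nth H (n - j))"
    by (rule sum.mono_neutral_cong_right) auto
  also have "\<dots> = (\<Sum>m<n. \<theta> * a (n - m) * fps_nth H m)"
    by (rule sum.reindex_bij_witness[of _ "\<lambda>m. n - m" "\<lambda>j. n - j"]) auto
  finally show ?thesis by (simp add: sum_distrib_left mult.assoc)
qed

lemma sum_jump_eq: "(\<Sum>m<n. jump n m * g m) = \<theta> * (\<Sum>m<n. B m * g m) / (real n * B n)"
  by (simp add: jump_def sum_distrib_left sum_divide_distrib mult.assoc)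

lemma B_nonzero [simp]: "B n \<noteq> 0"
  using B_pos[of n] by simp

lemma mean_recurrence:
  assumes n: "n \<ge> 1"
  shows "mean n a = (\<Sum>m<n. jump n m * (a (n - m) + mean m a))"
proof -
  have ode: "(1 - fps_X) * fps_deriv (cyc a * Bfps)
      = (1 - fps_X) * (fps_deriv (cyc a) * Bfps) + fps_const \<theta> * (cyc a * Bfps)"
  proof -
    have "(1 - fps_X) * fps_deriv (cyc a * Bfps)
        = (1 - fps_X) * (fps_deriv (cyc a) * Bfps) + cyc a * ((1 - fps_X) * fps_deriv Bfps)"
      by (simp add: algebra_simps)
    then show ?thesis unfolding Bfps_ode by (simp add: algebra_simps)
  qed
  have "real n * fps_nth (cyc a * Bfps) n
      = fps_nth (fps_X * fps_deriv (cyc a) * Bfps) n + \<theta> * (\<Sum>m<n. fps_nth (cyc a * Bfps) m)"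
    using convolution_recurrence[OF ode, of n] by (simp add: mult.assoc)
  also have "\<dots> = \<theta> * (\<Sum>m<n. B m * (a (n - m) + mean m a))"
    unfolding cyc_deriv_nth distrib_left sum.distrib by (simp add: mean_def Bfps_def mult.commute)
  finally show ?thesis
    unfolding sum_jump_eq mean_def[of n] using n by (simp add: field_simps)
qed

lemma second_moment_recurrence:
  assumes n: "n \<ge> 1"
  shows "second_moment n a b = (\<Sum>m<n. jump n m *
    (a (n - m) * b (n - m) + a (n - m) * mean m b + b (n - m) * mean m a + second_moment m a b))"
proof -
  define D where "D = cyc a * cyc b * Bfps"
  have ode: "(1 - fps_X) * fps_deriv D
      = (1 - fps_X) * (fps_deriv (cyc a) * (cyc b * Bfps) + fps_deriv (cyc b) * (cyc a * Bfps)) + fps_const \<theta> * D"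
  proof -
    have "(1 - fps_X) * fps_deriv D
        = (1 - fps_X) * (fps_deriv (cyc a) * (cyc b * Bfps) + fps_deriv (cyc b) * (cyc a * Bfps))
          + cyc a * cyc b * ((1 - fps_X) * fps_deriv Bfps)"
      by (simp add: D_def algebra_simps)
    then show ?thesis unfolding Bfps_ode by (simp add: D_def algebra_simps)
  qed
  have "real n * fps_nth D n
      = fps_nth (fps_X * fps_deriv (cyc a) * (cyc b * Bfps)) n
        + fps_nth (fps_X * fps_deriv (cyc b) * (cyc a * Bfps)) n + \<theta> * (\<Sum>m<n. fps_nth D m)"
    using convolution_recurrence[OF ode, of n] by (simp add: distrib_left mult.assoc)
  also have "\<dots> = \<theta> * (\<Sum>m<n. B m *
      (a (n - m) * mean m b + b (n - m) * mean m a + fps_nth D m / B m))"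
    unfolding cyc_deriv_nth distrib_left sum.distrib by (simp add: mean_def mult.commute)
  finally have "fps_nth D n / B n = (\<Sum>m<n. jump n m *
      (a (n - m) * mean m b + b (n - m) * mean m a + fps_nth D m / B m))"
    unfolding sum_jump_eq using n by (simp add: field_simps)
  then show ?thesis
    unfolding second_moment_def D_def[symmetric]
    by (subst mean_recurrence[OF n]) (simp add: algebra_simps sum.distrib)
qed

section \<open>Pair correlations of cycle lengths and their sign\<close>

definition rho :: "nat \<Rightarrow> nat \<Rightarrow> real" where "rho n j = B (n - j) / B n"

lemma rho_nonneg: "rho n j \<ge> 0"
  using B_pos by (simp add: rho_def less_imp_le)

lemma mean_eq: "mean n a = (\<Sum>j=0..n. \<theta> * a j / real j * rho n j)"
  by (simp add: mean_def fps_mult_nth cyc_def Bfps_def rho_def sum_divide_distrib)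

text \<open>For lengths up to \<open>n\<close> the mean number of cycles of length j \<ge> 1 is
  \<open>\<theta> / real j * rho n j\<close>. Multiplied by \<theta> / j and \<theta> / k,
  \<open>pair_corr n j k\<close> is the mean number of ordered pairs of different cycles of lengths
  j and k minus the product of the two mean numbers.\<close>

definition pair_corr :: "nat \<Rightarrow> nat \<Rightarrow> nat \<Rightarrow> real" where
  "pair_corr n j k = (if j + k \<le> n then rho n (j + k) else 0) - rho n j * rho n k"

lemma covar_eq:
  "covar n a b = mean n (\<lambda>j. a j * b j)
     + (\<Sum>j=0..n. \<Sum>k=0..n. (\<theta> * a j / real j) * (\<theta> * b k / real k) * pair_corr n j k)"
proof -
  have "fps_nth (cyc a * cyc b * Bfps) n / B n = (\<Sum>j=0..n. \<theta> * a j / real j * (fps_nth (cyc b * Bfps) (n - j) / B n))"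
    unfolding mult.assoc fps_mult_nth[of "cyc a"] by (simp add: cyc_def[of a] sum_divide_distrib)
  also have "\<dots> = (\<Sum>j=0..n. \<Sum>k=0..n. (\<theta> * a j / real j) * (\<theta> * b k / real k) *
      (if j + k \<le> n then rho n (j + k) else 0))"
  proof (intro sum.cong refl)
    fix j assume j: "j \<in> {0..n}"
    have "fps_nth (cyc b * Bfps) (n - j) / B n = (\<Sum>k=0..n-j. \<theta> * b k / real k * rho n (j + k))"
      by (simp add: fps_mult_nth cyc_def Bfps_def rho_def sum_divide_distrib)
    also have "\<dots> = (\<Sum>k=0..n. \<theta> * b k / real k * (if j + k \<le> n then rho n (j + k) else 0))"
      using j by (intro sum.mono_neutral_cong_left) auto
    finally show "\<theta> * a j / real j * (fps_nth (cyc b * Bfps) (n - j) / B n)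
        = (\<Sum>k=0..n. (\<theta> * a j / real j) * (\<theta> * b k / real k) * (if j + k \<le> n then rho n (j + k) else 0))"
      by (simp only: sum_distrib_left mult.assoc)
  qed
  finally show ?thesis
    unfolding covar_def second_moment_def mean_eq[of n a] mean_eq[of n b] sum_product pair_corr_def
    by (simp add: right_diff_distrib sum_subtractf mult_ac)
qed

text \<open>The quotient of consecutive values of \<open>B\<close> is 1 - (1 - \<theta>) / (x + 1)
  at x = n. Its monotonicity changes direction at \<theta> = 1, and so does the log-convexity of
  \<open>B\<close>.\<close>

lemma B_ratio_mono:
  "\<theta> \<le> 1 \<Longrightarrow> x \<le> y \<Longrightarrow> (\<theta> + x) / (x + 1) \<le> (\<theta> + y) / (y + 1)"
  "\<theta> \<ge> 1 \<Longrightarrow> x \<le> y \<Longrightarrow> (\<theta> + x) / (x + 1) \<ge> (\<theta> + y) / (y + 1)" if "x \<ge> 0" for x y :: real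
proof -
  have e: "(\<theta> + x) / (x + 1) = 1 - (1 - \<theta>) / (x + 1)" if "x \<ge> 0" for x :: real
    using that by (simp add: field_simps)
  show "(\<theta> + x) / (x + 1) \<le> (\<theta> + y) / (y + 1)" if "\<theta> \<le> 1" "x \<le> y"
    using that \<open>x \<ge> 0\<close> by (simp add: e) (intro divide_left_mono mult_pos_pos; simp)
  show "(\<theta> + x) / (x + 1) \<ge> (\<theta> + y) / (y + 1)" if "\<theta> \<ge> 1" "x \<le> y"
  proof -
    have "0 \<le> (\<theta> - 1) * (y - x)" using that by simp
    then show ?thesis using that \<open>x \<ge> 0\<close> theta_pos by (simp add: field_simps)
  qed
qed

lemma B_log_convex: "\<theta> \<le> 1 \<Longrightarrow> B (m + j) * B (m + k) \<le> B m * B (m + j + k)"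
proof (induction k)
  case (Suc k)
  have "B (m + j) * B (m + Suc k) = B (m + j) * B (m + k) * ((\<theta> + real (m + k)) / (real (m + k) + 1))"
    by (simp add: B_Suc)
  also have "\<dots> \<le> B m * B (m + j + k) * ((\<theta> + real (m + j + k)) / (real (m + j + k) + 1))"
    by (rule mult_mono[OF Suc.IH[OF Suc.prems] B_ratio_mono(1)[OF _ Suc.prems]])
       (use theta_pos B_pos in \<open>auto simp: less_imp_le\<close>)
  also have "\<dots> = B m * B (m + j + Suc k)" by (simp add: B_Suc)
  finally show ?case .
qed simp

lemma B_log_concave: "\<theta> \<ge> 1 \<Longrightarrow> B (m + j) * B (m + k) \<ge> B m * B (m + j + k)"
proof (induction k)
  case (Suc k)
  have "B m * B (m + j + Suc k) = B m * B (m + j + k) * ((\<theta> + real (m + j + k)) / (real (m + j + k) + 1))"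
    by (simp add: B_Suc)
  also have "\<dots> \<le> B (m + j) * B (m + k) * ((\<theta> + real (m + k)) / (real (m + k) + 1))"
    by (rule mult_mono[OF Suc.IH[OF Suc.prems] B_ratio_mono(2)[OF _ Suc.prems]])
       (use theta_pos B_pos in \<open>auto simp: less_imp_le\<close>)
  also have "\<dots> = B (m + j) * B (m + Suc k)" by (simp add: B_Suc)
  finally show ?case .
qed simp

text \<open>\<open>B\<close> decreases for \<theta> \<le> 1 and increases for \<theta> \<ge> 1. A
  constant sign of \<open>rho n j - 1\<close> lets a sum of absolute values be evaluated as the
  absolute value of a sum.\<close>

lemma rho_sign:
  "\<theta> \<le> 1 \<Longrightarrow> j \<le> n \<Longrightarrow> rho n j \<ge> 1"
  "\<theta> \<ge> 1 \<Longrightarrow> j \<le> n \<Longrightarrow> rho n j \<le> 1"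
proof -
  have "B m \<ge> B (m + i)" if "\<theta> \<le> 1" for m i
  proof (induction i)
    case (Suc i)
    have "B (m + Suc i) = B (m + i) * ((\<theta> + real (m + i)) / (real (m + i) + 1))" by (simp add: B_Suc)
    also have "\<dots> \<le> B (m + i) * 1"
      using that theta_pos B_pos[of "m + i"] by (intro mult_left_mono) (auto simp: field_simps)
    finally show ?case using Suc by simp
  qed simp
  from this[of "n - j" j] show "\<theta> \<le> 1 \<Longrightarrow> j \<le> n \<Longrightarrow> rho n j \<ge> 1"
    using B_pos[of n] by (simp add: rho_def)
  have "B m \<le> B (m + i)" if "\<theta> \<ge> 1" for m i
  proof (induction i)
    case (Suc i)
    have "B (m + i) * 1 \<le> B (m + i) * ((\<theta> + real (m + i)) / (real (m + i) + 1))"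
      using that theta_pos B_pos[of "m + i"] by (intro mult_left_mono) (auto simp: field_simps)
    also have "\<dots> = B (m + Suc i)" by (simp add: B_Suc)
    finally show ?case using Suc by simp
  qed simp
  from this[of "n - j" j] show "\<theta> \<ge> 1 \<Longrightarrow> j \<le> n \<Longrightarrow> rho n j \<le> 1"
    using B_pos[of n] by (simp add: rho_def)
qed

text \<open>For \<open>\<theta> \<le> 1\<close> the pairs with \<open>j + k > n\<close> have negative correlation and are treated separately in
  \<open>long_pairs_bound\<close>.\<close>

lemma pair_corr_sign:
  "j + k \<le> n \<Longrightarrow> \<theta> \<le> 1 \<Longrightarrow> pair_corr n j k \<ge> 0"
  "\<theta> \<ge> 1 \<Longrightarrow> pair_corr n j k \<le> 0"
proof -
  have e: "pair_corr n j k = (B (n - j - k) * B (n - j - k + j + k) - B (n - j - k + j) * B (n - j - k + k)) / (B n)\<^sup>2"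
    if "j + k \<le> n"
  proof -
    have "n - j - k + j + k = n" "n - j - k + j = n - k" "n - j - k + k = n - j" "n - j - k = n - (j + k)"
      using that by auto
    then show ?thesis using that by (simp add: pair_corr_def rho_def power2_eq_square divide_simps)
  qed
  show "pair_corr n j k \<ge> 0" if "j + k \<le> n" "\<theta> \<le> 1"
    unfolding e[OF that(1)] using B_log_convex[OF that(2), of "n - j - k" j k] by simp
  show "pair_corr n j k \<le> 0" if "\<theta> \<ge> 1"
  proof (cases "j + k \<le> n")
    case True
    show ?thesis
      unfolding e[OF True] using B_log_concave[OF that, of "n - j - k" j k] by (simp add: divide_nonpos_nonneg)
  qed (simp add: pair_corr_def rho_nonneg)
qed

end

section \<open>Logarithmic averages of sequences with a Cesaro mean\<close>

lemma sum_inverse_squares_le: "(\<Sum>i=1..n. 1 / (real i)\<^sup>2) \<le> 2"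
proof -
  have "n \<ge> 1 \<Longrightarrow> (\<Sum>i=1..n. 1 / (real i)\<^sup>2) \<le> 2 - 1 / real n"
  proof (induction n)
    case (Suc n)
    show ?case
    proof (cases "n = 0")
      case False
      then have n: "real n > 0" by simp
      have "1 / (real n + 1)\<^sup>2 \<le> 1 / (real n * (real n + 1))"
        using n by (intro divide_left_mono) (auto simp: power2_eq_square)
      also have "\<dots> = 1 / real n - 1 / (real n + 1)" using n by (simp add: field_simps)
      finally show ?thesis using Suc False by (simp add: add.commute)
    qed simp
  qed simp
  then show ?thesis by (cases "n = 0") (auto intro: order.trans)
qed

lemma harmonic_over_ln: "(\<lambda>N. (\<Sum>j=1..N. 1 / real j) / ln (real N)) \<longlonglongrightarrow> 1"
proof -
  have inf: "filterlim (\<lambda>N. ln (real N)) at_top sequentially"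
    by (rule filterlim_compose[OF ln_at_top filterlim_real_sequentially])
  have "(\<lambda>N. (harm N - ln (real N)) / ln (real N) + 1) \<longlonglongrightarrow> 0 + (1 :: real)"
    by (intro tendsto_add tendsto_const real_tendsto_divide_at_top[OF euler_mascheroni_LIMSEQ inf])
  moreover have "eventually (\<lambda>N. (harm N - ln (real N)) / ln (real N) + 1 = (\<Sum>j=1..N. 1 / real j) / ln (real N)) sequentially"
    using eventually_gt_at_top[of 1]
    by eventually_elim (simp add: harm_def field_simps)
  ultimately show ?thesis by (simp add: filterlim_cong)
qed

text \<open>Summation by parts expresses the logarithmic sum through the Cesaro means
  \<open>z\<close>. Finitely many of these are merely bounded and are beaten by the logarithm; the
  others are small and meet a harmonic sum, which is at most 2 ln N eventually.\<close>

lemma log_average_null: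
  fixes y :: "nat \<Rightarrow> real"
  assumes "(\<lambda>N. (\<Sum>j=1..N. y j) / real N) \<longlonglongrightarrow> 0"
  shows "(\<lambda>N. (\<Sum>j=1..N. y j / real j) / ln (real N)) \<longlonglongrightarrow> 0"
proof -
  define Y where "Y N = (\<Sum>j=1..N. y j)" for N
  define z where "z N = Y N / real N" for N
  have z: "z \<longlonglongrightarrow> 0" using assms by (simp add: z_def[abs_def] Y_def)
  have abel: "(\<Sum>j=1..N. y j / real j) = z N + (\<Sum>j=1..<N. z j / real (j + 1))" for N
  proof (induction N)
    case (Suc N)
    show ?case
    proof (cases "N = 0")
      case False
      have "z (Suc N) = Y N / real (Suc N) + y (Suc N) / real (Suc N)"
        by (simp add: z_def Y_def add_divide_distrib)
      moreover have "Y N / real (Suc N) + z N / real (N + 1) = z N"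
      proof -
        have "Y N / (real N + 1) + Y N / (real N * (real N + 1)) = Y N / real N"
          using False by (simp add: divide_simps) (simp add: algebra_simps)
        then show ?thesis by (simp add: z_def add.commute)
      qed
      moreover have "(\<Sum>j=1..<Suc N. z j / real (j + 1)) = (\<Sum>j=1..<N. z j / real (j + 1)) + z N / real (N + 1)"
        using False by simp
      ultimately show ?thesis using Suc
        by (simp del: of_nat_Suc sum.op_ivl_Suc)
    qed (simp add: z_def Y_def)
  qed (simp add: z_def)
  have inf: "filterlim (\<lambda>N. ln (real N)) at_top sequentially"
    by (rule filterlim_compose[OF ln_at_top filterlim_real_sequentially])
  show ?thesis
  proof (rule LIMSEQ_I)
    fix e :: real assume e: "e > 0"
    \<comment> \<open>In units of ln N the pieces contribute e / 4 from the initial block, 2 * e / 8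
      from the harmonic sum and e / 8 from the last mean, in total less than e.\<close>
    obtain J where J: "\<And>j. j \<ge> J \<Longrightarrow> \<bar>z j\<bar> < e / 8" using LIMSEQ_D[OF z, of "e / 8"] e by auto
    define C where "C = (\<Sum>j=1..<J. \<bar>z j\<bar>)"
    have C: "C \<ge> 0" by (simp add: C_def sum_nonneg)
    have "eventually (\<lambda>N. (\<Sum>j=1..N. 1 / real j) / ln (real N) < 2) sequentially"
      by (rule order_tendstoD[OF harmonic_over_ln]) simp
    moreover have "eventually (\<lambda>N. ln (real N) > 4 * C / e + 1) sequentially"
      using inf by (simp add: filterlim_at_top_dense)
    moreover have "eventually (\<lambda>N. N \<ge> J + 2) sequentially" by (rule eventually_ge_at_top)
    ultimately have "eventually (\<lambda>N. norm ((\<Sum>j=1..N. y j / real j) / ln (real N) - 0) < e) sequentially"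
    proof eventually_elim
      case (elim N)
      have Cl: "C < e / 4 * ln (real N)" "ln (real N) > 1"
      proof -
        have "0 \<le> 4 * C / e" using C e by simp
        then show "ln (real N) > 1" using elim by linarith
        have "4 * C / e < ln (real N)" using elim by linarith
        then show "C < e / 4 * ln (real N)" using e by (simp add: field_simps)
      qed
      have "\<bar>\<Sum>j=1..<N. z j / real (j + 1)\<bar> \<le> (\<Sum>j=1..<N. \<bar>z j\<bar> / real (j + 1))"
        by (rule order.trans[OF sum_abs]) (simp add: sum_mono)
      also have "\<dots> \<le> (\<Sum>j=1..<N. (if j < J then \<bar>z j\<bar> else 0) + e / 8 * (1 / real j))"
      proof (intro sum_mono)
        fix j assume j: "j \<in> {1..<N}"
        show "\<bar>z j\<bar> / real (j + 1) \<le> (if j < J then \<bar>z j\<bar> else 0) + e / 8 * (1 / real j)"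
        proof (cases "j < J")
          case True
          have "\<bar>z j\<bar> / real (j + 1) \<le> \<bar>z j\<bar> / 1" by (intro divide_left_mono) auto
          moreover have "0 \<le> e / 8 * (1 / real j)" using e by simp
          ultimately show ?thesis using True by simp
        next
          case False
          have "\<bar>z j\<bar> / real (j + 1) \<le> (e / 8) / real j"
            using J[of j] False j e by (intro frac_le) auto
          then show ?thesis using False by simp
        qed
      qed
      also have "\<dots> = (\<Sum>j=1..<N. if j < J then \<bar>z j\<bar> else 0) + e / 8 * (\<Sum>j=1..<N. 1 / real j)"
        by (simp add: sum.distrib sum_distrib_left)
      also have "(\<Sum>j=1..<N. if j < J then \<bar>z j\<bar> else 0) = C"
        unfolding C_def using elim by (intro sum.mono_neutral_cong_right) auto
      also have "(\<Sum>j=1..<N. 1 / real j) \<le> (\<Sum>j=1..N. 1 / real j)"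
        by (intro sum_mono2) auto
      also have "(\<Sum>j=1..N. 1 / real j) \<le> 2 * ln (real N)"
        using elim(1) Cl(2) by (simp add: field_simps)
      finally have "\<bar>\<Sum>j=1..<N. z j / real (j + 1)\<bar> \<le> C + e / 8 * (2 * ln (real N))"
        using e by simp
      moreover have "\<bar>z N\<bar> < e / 8 * ln (real N)"
      proof -
        have "e / 8 * 1 < e / 8 * ln (real N)" using Cl(2) e by (intro mult_strict_left_mono) auto
        then show ?thesis using J[of N] elim by simp
      qed
      ultimately have "\<bar>\<Sum>j=1..N. y j / real j\<bar> < e * ln (real N)"
        unfolding abel using Cl by (simp add: field_simps) 
      then show ?case using Cl by (simp add: field_simps)
    qed
    then show "\<exists>no. \<forall>n\<ge>no. norm ((\<Sum>j=1..n. y j / real j) / ln (real n) - 0) < e"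
      by (simp add: eventually_sequentially)
  qed
qed

lemma log_average:
  fixes y :: "nat \<Rightarrow> real"
  assumes "(\<lambda>N. (\<Sum>j=1..N. y j) / real N) \<longlonglongrightarrow> L"
  shows "(\<lambda>N. (\<Sum>j=1..N. y j / real j) / ln (real N)) \<longlonglongrightarrow> L"
proof -
  have "(\<lambda>N. (\<Sum>j=1..N. y j) / real N - L) \<longlonglongrightarrow> L - L"
    by (intro tendsto_diff assms tendsto_const)
  moreover have "eventually (\<lambda>N. (\<Sum>j=1..N. y j) / real N - L = (\<Sum>j=1..N. y j - L) / real N) sequentially"
    using eventually_gt_at_top[of 0] by eventually_elim (simp add: sum_subtractf field_simps)
  ultimately have "(\<lambda>N. (\<Sum>j=1..N. y j - L) / real N) \<longlonglongrightarrow> 0"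
    by (simp add: filterlim_cong)
  then have "(\<lambda>N. (\<Sum>j=1..N. (y j - L) / real j) / ln (real N) + L * ((\<Sum>j=1..N. 1 / real j) / ln (real N))) \<longlonglongrightarrow> 0 + L * 1"
    by (intro tendsto_add tendsto_mult tendsto_const harmonic_over_ln log_average_null)
  moreover have "(\<Sum>j=1..N. (y j - L) / real j) / ln (real N) + L * ((\<Sum>j=1..N. 1 / real j) / ln (real N))
      = (\<Sum>j=1..N. y j / real j) / ln (real N)" for N
    by (simp add: diff_divide_distrib sum_subtractf sum_distrib_left)
  ultimately show ?thesis by simp
qed

section \<open>Bounded corrections to the harmonic main terms\<close>

context ewens
begin

lemma mean_one: "mean n (\<lambda>_. 1) = Q 0 n"
proof (induction n rule: less_induct)
  case (less n)
  show ?case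
  proof (cases "n = 0")
    case False
    then have n: "n \<ge> 1" by simp
    have "mean n (\<lambda>_. 1) = (\<Sum>m<n. jump n m) + (\<Sum>m<n. jump n m * Q 0 m)"
      unfolding mean_recurrence[OF n] using less by (simp add: distrib_left sum.distrib)
    then show ?thesis using Q_recurrence[OF n] sum_jump[OF n] by simp
  qed (simp add: Q_def)
qed

text \<open>This is the variance of a sum of independent indicators with success probabilities
  \<open>q i\<close>, the classical description of the number of cycles; here it follows from the
  mixture identity alone. It serves to evaluate the total of the pair correlations.\<close>

lemma covar_one: "covar n (\<lambda>_. 1) (\<lambda>_. 1) = (\<Sum>i<n. q i * (1 - q i))"
proof -
  define v where "v n = second_moment n (\<lambda>_. 1) (\<lambda>_. 1)" for n
  have v: "v n = (\<Sum>m<n. jump n m * (1 + 2 * Q 0 m + v m))" for n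
    using second_moment_recurrence[of n "\<lambda>_. 1" "\<lambda>_. 1"] by (cases "n = 0") (simp_all add: v_def mean_one add_ac)
  have "v n - (Q 0 n)\<^sup>2 = (\<Sum>i<n. q i * (1 - q i))"
  proof (induction n)
    case (Suc n)
    have "v (Suc n) = q n * (1 + 2 * Q 0 n + v n) + (1 - q n) * v n"
      by (subst v, subst sum_jump_Suc) (simp flip: v)
    then show ?case using Suc by (simp add: Q_Suc power2_eq_square algebra_simps)
  qed (simp add: v_def Q_def)
  then show ?thesis by (simp add: covar_def v_def mean_one power2_eq_square)
qed

lemma sum_q_squares_le: "(\<Sum>i<n. (q i)\<^sup>2) \<le> 1 + 2 * \<theta>\<^sup>2"
proof -
  have "(\<Sum>i<n. (q i)\<^sup>2) \<le> (\<Sum>i=0..n. (q i)\<^sup>2)" by (rule sum_mono2) auto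
  also have "\<dots> = 1 + (\<Sum>i=1..n. (q i)\<^sup>2)" by (simp add: sum.atLeast_Suc_atMost)
  also have "(\<Sum>i=1..n. (q i)\<^sup>2) \<le> (\<Sum>i=1..n. \<theta>\<^sup>2 * (1 / (real i)\<^sup>2))"
  proof (intro sum_mono)
    fix i assume "i \<in> {1..n}"
    then have "q i \<le> \<theta> / real i" using theta_pos by (simp add: q_def frac_le)
    then have "(q i)\<^sup>2 \<le> (\<theta> / real i)\<^sup>2" using q_pos[of i] by (intro power_mono) auto
    then show "(q i)\<^sup>2 \<le> \<theta>\<^sup>2 * (1 / (real i)\<^sup>2)" by (simp add: power_divide)
  qed
  also have "\<dots> \<le> \<theta>\<^sup>2 * 2"
    unfolding sum_distrib_left[symmetric] by (intro mult_left_mono sum_inverse_squares_le) auto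
  finally show ?thesis by simp
qed

text \<open>A cycle among \<open>i\<close> points is no longer than \<open>i\<close>, so the source
  of the recursion vanishes for i \<le> m and is at most 1 afterwards. Only the \<open>q i\<close>
  with i > m enter the explicit solution.\<close>

lemma mean_long_cycles:
  assumes "m \<le> n"
  shows "mean n (\<lambda>j. if j > m then 1 else 0) \<le> 1 + Q m n"
proof (cases "n = 0")
  case False
  define a where "a j = (if j > m then 1 else 0 :: real)" for j
  define x where "x n = (\<Sum>l<n. jump n l * a (n - l))" for n
  have u: "mean n a = x n + (\<Sum>l<n. jump n l * mean l a)" if "n \<ge> 1" for n
    using mean_recurrence[OF that, of a] by (simp add: x_def distrib_left sum.distrib)
  have x: "x i \<le> (if i > m then 1 else 0)" for i
  proof (cases "i > m")
    case True
    have "x i \<le> (\<Sum>l<i. jump i l)" unfolding x_def a_def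
      using jump_nonneg by (intro sum_mono) auto
    then show ?thesis using sum_jump[of i] True by simp
  next
    case False
    then have "i - l \<le> m" for l by simp
    then show ?thesis using False by (simp add: x_def a_def not_less[symmetric])
  qed
  have "(\<Sum>i=1..<n. q i * x i) \<le> (\<Sum>i=1..<n. if i > m then q i else 0)"
  proof (intro sum_mono)
    fix i
    have "q i * x i \<le> q i * (if i > m then 1 else 0)" using q_pos[of i] x[of i] by (intro mult_left_mono) auto
    then show "q i * x i \<le> (if i > m then q i else 0)" by (simp split: if_splits)
  qed
  also have "\<dots> \<le> (\<Sum>i=m..<n. q i)"
    using q_pos by (subst sum.inter_filter[symmetric]) (auto intro!: sum_mono2 simp: less_imp_le)
  finally have "mean n a \<le> 1 + Q m n"
    using u[of n] jump_potential[of "\<lambda>n. mean n a" x n] u x[of n] False unfolding Q_def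
    by (auto split: if_splits)
  then show ?thesis by (simp add: a_def[abs_def])
qed (simp add: Q_def)

text \<open>If j + k > n, one of the two lengths, say j, exceeds n / 2. For it the weight is at most
  twice \<open>jump n (n - j)\<close>, while the sum over k > n - j is a mean number of long cycles,
  at most \<open>1 + Q (n - j) n\<close>. The cubic moment bounds the rest; 1920 is 2 * 2 * 480, one
  factor 2 coming from the choice of the long length.\<close>

lemma long_pairs_bound:
  "(\<Sum>j=0..n. \<Sum>k=0..n. if j + k > n then (\<theta> / real j * rho n j) * (\<theta> / real k * rho n k) else 0) \<le> 1920"
proof -
  define w where "w j = \<theta> / real j * rho n j" for j
  have w: "w j \<ge> 0" for j using theta_pos rho_nonneg by (simp add: w_def)
  define h where "h j k = (if 2 * j > n \<and> k > n - j then w j * w k else 0)" for j k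
  have "(\<Sum>j=0..n. \<Sum>k=0..n. if j + k > n then w j * w k else 0) \<le> (\<Sum>j=0..n. \<Sum>k=0..n. h j k + h k j)"
    using w by (intro sum_mono) (auto simp: h_def mult_ac)
  also have "\<dots> = (\<Sum>j=0..n. \<Sum>k=0..n. h j k) + (\<Sum>j=0..n. \<Sum>k=0..n. h k j)"
    by (simp add: sum.distrib)
  also have "(\<Sum>j=0..n. \<Sum>k=0..n. h k j) = (\<Sum>j=0..n. \<Sum>k=0..n. h j k)" by (rule sum.swap)
  also have "(\<Sum>j=0..n. \<Sum>k=0..n. h j k) \<le> (\<Sum>j=1..n. 2 * (jump n (n - j) * (1 + Q (n - j) n) ^ 3))"
  proof -
    have "(\<Sum>j=0..n. \<Sum>k=0..n. h j k) = (\<Sum>j=0..n. if 2 * j > n then w j * mean n (\<lambda>k. if k > n - j then 1 else 0) else 0)"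
    proof (intro sum.cong refl)
      fix j
      show "(\<Sum>k=0..n. h j k) = (if 2 * j > n then w j * mean n (\<lambda>k. if k > n - j then 1 else 0) else 0)"
        by (auto simp: h_def mean_eq w_def sum_distrib_left intro!: sum.cong)
    qed
    also have "\<dots> = (\<Sum>j=1..n. if 2 * j > n then w j * mean n (\<lambda>k. if k > n - j then 1 else 0) else 0)"
      by (rule sum.mono_neutral_right) auto
    also have "\<dots> \<le> (\<Sum>j=1..n. 2 * (jump n (n - j) * (1 + Q (n - j) n) ^ 3))"
    proof (intro sum_mono)
      fix j assume j: "j \<in> {1..n}"
      define L where "L = 1 + Q (n - j) n"
      have L: "L \<ge> 1" using Q_nonneg by (simp add: L_def)
      show "(if 2 * j > n then w j * mean n (\<lambda>k. if k > n - j then 1 else 0) else 0)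
          \<le> 2 * (jump n (n - j) * (1 + Q (n - j) n) ^ 3)"
      proof (cases "2 * j > n")
        case True
        have "w j = real n / real j * jump n (n - j)"
          using j by (simp add: w_def rho_def jump_def field_simps)
        also have "\<dots> \<le> 2 * jump n (n - j)"
          using True j by (intro mult_right_mono jump_nonneg) (simp add: field_simps)
        finally have "w j * mean n (\<lambda>k. if k > n - j then 1 else 0) \<le> 2 * jump n (n - j) * L"
          unfolding L_def using w jump_nonneg mean_long_cycles[of "n - j" n] Q_nonneg
          by (intro order.trans[OF mult_left_mono mult_right_mono]) auto
        also have "\<dots> \<le> 2 * jump n (n - j) * L ^ 3"
          using L jump_nonneg power_increasing[of 1 3 L] by (intro mult_left_mono) auto
        finally show ?thesis using True by (simp add: L_def)
      next
        case False
        then show ?thesis using jump_nonneg Q_nonneg by simp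
      qed
    qed
    finally show ?thesis .
  qed
  also have "(\<Sum>j=1..n. 2 * (jump n (n - j) * (1 + Q (n - j) n) ^ 3)) = 2 * (\<Sum>m<n. jump n m * (1 + Q m n) ^ 3)"
    unfolding sum_distrib_left
    by (rule sum.reindex_bij_witness[of _ "\<lambda>m. n - m" "\<lambda>j. n - j"]) auto
  finally show ?thesis using sum_jump_cube[of n] unfolding w_def by linarith
qed

text \<open>For constant summands the signed total \<open>S\<close> is known: it is minus the sum of
  the squares of the \<open>q i\<close>, the difference between variance and mean of the number of
  cycles. For \<theta> \<ge> 1 every term has the sign of \<open>S\<close>. Otherwise only the pairs
  with j + k > n are negative, and adding twice their size makes all terms nonnegative.\<close>

lemma pair_corr_abs_sum:
  "(\<Sum>j=0..n. \<Sum>k=0..n. (\<theta> / real j) * (\<theta> / real k) * \<bar>pair_corr n j k\<bar>) \<le> 3841 + 2 * \<theta>\<^sup>2"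
proof -
  define S where "S = (\<Sum>j=0..n. \<Sum>k=0..n. (\<theta> / real j) * (\<theta> / real k) * pair_corr n j k)"
  have "S = covar n (\<lambda>_. 1) (\<lambda>_. 1) - mean n (\<lambda>_. 1)"
    unfolding covar_eq S_def by simp
  also have "\<dots> = - (\<Sum>i<n. (q i)\<^sup>2)"
    unfolding covar_one mean_one Q_def
    by (simp add: atLeast0LessThan algebra_simps sum_subtractf power2_eq_square)
  finally have S: "S = - (\<Sum>i<n. (q i)\<^sup>2)" .
  show ?thesis
  proof (cases "\<theta> \<ge> 1")
    case True
    have "(\<Sum>j=0..n. \<Sum>k=0..n. (\<theta> / real j) * (\<theta> / real k) * \<bar>pair_corr n j k\<bar>) = - S"
      unfolding S_def sum_negf[symmetric] using pair_corr_sign(2)[OF True]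
      by (intro sum.cong refl) (simp add: abs_of_nonpos)
    then show ?thesis using S sum_q_squares_le[of n] by linarith
  next
    case False
    have "(\<Sum>j=0..n. \<Sum>k=0..n. (\<theta> / real j) * (\<theta> / real k) * \<bar>pair_corr n j k\<bar>)
        = (\<Sum>j=0..n. \<Sum>k=0..n. (\<theta> / real j) * (\<theta> / real k) * pair_corr n j k +
            2 * (if j + k > n then (\<theta> / real j * rho n j) * (\<theta> / real k * rho n k) else 0))"
    proof (intro sum.cong refl)
      fix j k
      show "(\<theta> / real j) * (\<theta> / real k) * \<bar>pair_corr n j k\<bar> = (\<theta> / real j) * (\<theta> / real k) * pair_corr n j k +
            2 * (if j + k > n then (\<theta> / real j * rho n j) * (\<theta> / real k * rho n k) else 0)"
      proof (cases "j + k \<le> n")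
        case True
        then show ?thesis using pair_corr_sign(1)[OF True] False by simp
      next
        case f: False
        then have "pair_corr n j k = - (rho n j * rho n k)" by (simp add: pair_corr_def)
        then show ?thesis using f rho_nonneg by (simp add: abs_mult)
      qed
    qed
    also have "\<dots> = S + 2 * (\<Sum>j=0..n. \<Sum>k=0..n. if j + k > n then (\<theta> / real j * rho n j) * (\<theta> / real k * rho n k) else 0)"
      by (simp add: S_def sum.distrib sum_distrib_left)
    also have "\<dots> \<le> S + 2 * 1920" using long_pairs_bound by simp
    also have "\<dots> \<le> 3840" using S by (simp add: sum_nonneg)
    also have "\<dots> \<le> 3841 + 2 * \<theta>\<^sup>2" by simp
    finally show ?thesis .
  qed
qed

text \<open>The error is a sum of \<open>y j\<close> against
  \<open>\<theta> / real j * (rho n j - 1)\<close>, whose sign does not depend on j. Its absolute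
  total is therefore that for y = 1, namely the distance between the mean number of cycles and
  \<theta> times the harmonic number, and that is bounded by a sum of inverse squares.\<close>

lemma mean_harmonic:
  assumes y: "\<And>j. \<bar>y j\<bar> \<le> 1"
  shows "\<bar>mean n y - \<theta> * (\<Sum>j=1..n. y j / real j)\<bar> \<le> 1 + \<theta> + 2 * \<theta>\<^sup>2"
proof (cases "n = 0")
  case True
  then show ?thesis using theta_pos by simp
next
  case False
  have h: "\<theta> * (\<Sum>j=1..n. y j / real j) = (\<Sum>j=0..n. \<theta> * y j / real j)" for y
    unfolding sum_distrib_left by (rule sum.mono_neutral_cong_left) auto
  define D where "D = (\<Sum>j=0..n. \<theta> / real j * (rho n j - 1))"
  have D: "D = Q 0 n - \<theta> * (\<Sum>j=1..n. 1 / real j)"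
    unfolding D_def h mean_one[symmetric] mean_eq by (simp add: algebra_simps sum_subtractf)
  have "\<bar>D\<bar> \<le> 1 + \<theta> + 2 * \<theta>\<^sup>2"
  proof -
    have "Q 0 n = 1 + (\<Sum>j=1..<n. q j)" using False unfolding Q_def by (simp add: sum.atLeast_Suc_lessThan)
    moreover have "(\<Sum>j=1..n. 1 / real j) = (\<Sum>j=1..<n. 1 / real j) + 1 / real n"
      using False by (simp add: sum.last_plus)
    ultimately have e: "D = 1 - \<theta> / real n - (\<Sum>j=1..<n. \<theta> / real j - q j)"
      unfolding D by (simp add: sum_subtractf sum_distrib_left algebra_simps)
    have nn: "(\<Sum>j=1..<n. \<theta> / real j - q j) \<ge> 0"
      using theta_pos by (intro sum_nonneg) (simp add: q_def frac_le)
    have "(\<Sum>j=1..<n. \<theta> / real j - q j) \<le> (\<Sum>j=1..<n. \<theta>\<^sup>2 * (1 / (real j)\<^sup>2))"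
    proof (intro sum_mono)
      fix j assume "j \<in> {1..<n}"
      then have j: "real j > 0" by simp
      have "\<theta> / real j - q j = \<theta>\<^sup>2 / (real j * (\<theta> + real j))"
        using j theta_pos by (simp add: q_def field_simps power2_eq_square)
      also have "\<dots> \<le> \<theta>\<^sup>2 / (real j * real j)"
        using j theta_pos by (intro divide_left_mono mult_left_mono) auto
      finally show "\<theta> / real j - q j \<le> \<theta>\<^sup>2 * (1 / (real j)\<^sup>2)" by (simp add: power2_eq_square)
    qed
    also have "\<dots> \<le> (\<Sum>j=1..n. \<theta>\<^sup>2 * (1 / (real j)\<^sup>2))" by (intro sum_mono2) auto
    also have "\<dots> \<le> \<theta>\<^sup>2 * 2"
      unfolding sum_distrib_left[symmetric] by (intro mult_left_mono sum_inverse_squares_le) auto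
    finally have up: "(\<Sum>j=1..<n. \<theta> / real j - q j) \<le> \<theta>\<^sup>2 * 2" .
    have "\<theta> / real n \<le> \<theta> / 1" using False theta_pos by (intro divide_left_mono) auto
    moreover have "\<theta> / real n \<ge> 0" using theta_pos by simp
    ultimately show ?thesis using e nn up theta_pos zero_le_power2[of \<theta>] unfolding abs_le_iff by (intro conjI) linarith+
  qed
  have sgn: "(\<forall>j\<le>n. rho n j - 1 \<ge> 0) \<or> (\<forall>j\<le>n. rho n j - 1 \<le> 0)"
    using rho_sign by (cases "\<theta> \<le> 1") auto
  have Dabs: "(\<Sum>j=0..n. \<theta> / real j * \<bar>rho n j - 1\<bar>) = \<bar>D\<bar>"
    using sgn
  proof
    assume a: "\<forall>j\<le>n. rho n j - 1 \<ge> 0"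
    then have "(\<Sum>j=0..n. \<theta> / real j * \<bar>rho n j - 1\<bar>) = D" unfolding D_def by (intro sum.cong) auto
    moreover have "D \<ge> 0" unfolding D_def using a theta_pos by (intro sum_nonneg) auto
    ultimately show ?thesis by simp
  next
    assume a: "\<forall>j\<le>n. rho n j - 1 \<le> 0"
    then have "(\<Sum>j=0..n. \<theta> / real j * \<bar>rho n j - 1\<bar>) = - D"
      unfolding D_def sum_negf[symmetric] by (intro sum.cong) (auto simp: abs_of_nonpos algebra_simps)
    moreover have "(\<Sum>j=0..n. \<theta> / real j * \<bar>rho n j - 1\<bar>) \<ge> 0"
      using theta_pos by (intro sum_nonneg) auto
    ultimately show ?thesis by simp
  qed
  have "mean n y - \<theta> * (\<Sum>j=1..n. y j / real j) = (\<Sum>j=0..n. y j * (\<theta> / real j * (rho n j - 1)))"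
    unfolding h mean_eq by (simp add: sum_subtractf[symmetric] algebra_simps)
  also have "\<bar>\<dots>\<bar> \<le> (\<Sum>j=0..n. \<theta> / real j * \<bar>rho n j - 1\<bar>)"
  proof (intro order.trans[OF sum_abs] sum_mono)
    fix j
    have "\<bar>y j * (\<theta> / real j * (rho n j - 1))\<bar> = \<bar>y j\<bar> * (\<theta> / real j * \<bar>rho n j - 1\<bar>)"
      using theta_pos by (simp add: abs_mult)
    also have "\<dots> \<le> 1 * (\<theta> / real j * \<bar>rho n j - 1\<bar>)"
      using y theta_pos by (intro mult_right_mono) auto
    finally show "\<bar>y j * (\<theta> / real j * (rho n j - 1))\<bar> \<le> \<theta> / real j * \<bar>rho n j - 1\<bar>" by simp
  qed
  finally show ?thesis using Dabs \<open>\<bar>D\<bar> \<le> _\<close> by linarith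
qed

lemma covar_mean_diff:
  assumes a: "\<And>j. \<bar>a j\<bar> \<le> 1" and b: "\<And>j. \<bar>b j\<bar> \<le> 1"
  shows "\<bar>covar n a b - mean n (\<lambda>j. a j * b j)\<bar> \<le> 3841 + 2 * \<theta>\<^sup>2"
proof -
  have "covar n a b - mean n (\<lambda>j. a j * b j)
      = (\<Sum>j=0..n. \<Sum>k=0..n. (\<theta> * a j / real j) * (\<theta> * b k / real k) * pair_corr n j k)"
    by (simp add: covar_eq)
  also have "\<bar>\<dots>\<bar> \<le> (\<Sum>j=0..n. \<Sum>k=0..n. (\<theta> / real j) * (\<theta> / real k) * \<bar>pair_corr n j k\<bar>)"
  proof (intro order.trans[OF sum_abs] sum_mono)
    fix j k
    have "\<bar>(\<theta> * a j / real j) * (\<theta> * b k / real k) * pair_corr n j k\<bar>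
        = (\<bar>a j\<bar> * \<bar>b k\<bar>) * ((\<theta> / real j) * (\<theta> / real k) * \<bar>pair_corr n j k\<bar>)"
      using theta_pos by (simp add: abs_mult)
    also have "\<dots> \<le> (1 * 1) * ((\<theta> / real j) * (\<theta> / real k) * \<bar>pair_corr n j k\<bar>)"
      using a b theta_pos by (intro mult_right_mono mult_mono) auto
    finally show "\<bar>(\<theta> * a j / real j) * (\<theta> * b k / real k) * pair_corr n j k\<bar>
        \<le> (\<theta> / real j) * (\<theta> / real k) * \<bar>pair_corr n j k\<bar>" by simp
  qed
  also have "\<dots> \<le> 3841 + 2 * \<theta>\<^sup>2" by (rule pair_corr_abs_sum)
  finally show ?thesis .
qed

lemma bounded_over_ln:
  fixes f :: "nat \<Rightarrow> real"
  assumes "\<And>n. \<bar>f n\<bar> \<le> K"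
  shows "(\<lambda>n. f n / ln (real n)) \<longlonglongrightarrow> 0"
proof -
  have "filterlim (\<lambda>N. ln (real N)) at_top sequentially"
    by (rule filterlim_compose[OF ln_at_top filterlim_real_sequentially])
  then have "(\<lambda>n. K / ln (real n)) \<longlonglongrightarrow> 0" by (rule tendsto_divide_0[OF tendsto_const filterlim_at_top_imp_at_infinity])
  moreover have "eventually (\<lambda>n. norm (f n / ln (real n)) \<le> K / ln (real n)) sequentially"
    using eventually_gt_at_top[of 1] by eventually_elim (use assms in \<open>simp add: divide_right_mono\<close>)
  ultimately show ?thesis by (rule Lim_null_comparison[rotated])
qed

lemma mean_asymp:
  assumes y: "\<And>j. \<bar>y j\<bar> \<le> 1" and L: "(\<lambda>N. (\<Sum>j=1..N. y j) / real N) \<longlonglongrightarrow> L"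
  shows "(\<lambda>n. mean n y / ln (real n)) \<longlonglongrightarrow> \<theta> * L"
proof -
  have "(\<lambda>n. (mean n y - \<theta> * (\<Sum>j=1..n. y j / real j)) / ln (real n)
      + \<theta> * ((\<Sum>j=1..n. y j / real j) / ln (real n))) \<longlonglongrightarrow> 0 + \<theta> * L"
    by (intro tendsto_add tendsto_mult tendsto_const log_average[OF L] bounded_over_ln[of _ "1 + \<theta> + 2 * \<theta>\<^sup>2"] mean_harmonic y)
  then show ?thesis by (simp add: diff_divide_distrib)
qed

lemma Q_over_ln: "(\<lambda>n. Q 0 n / ln (real n)) \<longlonglongrightarrow> \<theta>"
proof -
  have "eventually (\<lambda>N. 1 = (\<Sum>j=1..N. 1) / real N) sequentially"
    using eventually_gt_at_top[of 0] by eventually_elim simp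
  then have "(\<lambda>N. (\<Sum>j=1..N. 1) / real N) \<longlonglongrightarrow> 1"
    by (rule Lim_transform_eventually[OF tendsto_const])
  from mean_asymp[OF _ this] show ?thesis by (simp add: mean_one)
qed

end

section \<open>Cycles of permutations\<close>

definition cycles :: "nat \<Rightarrow> (nat \<Rightarrow> nat) \<Rightarrow> nat set set" where
  "cycles N p = orbit p ` {..<N}"

lemma num_cycles_eq: "num_cycles N p = card (cycles N p)"
  by (simp add: num_cycles_def cycles_def)

lemma permutes_self_in_orbit: "p permutes {..<N} \<Longrightarrow> x \<in> orbit p x" for p :: "nat \<Rightarrow> nat"
  by (rule permutation_self_in_orbit) (auto simp: permutation_permutes)

lemma permutes_orbit_eq:
  "p permutes {..<N} \<Longrightarrow> y \<in> orbit p x \<Longrightarrow> orbit p y = orbit p x" for p :: "nat \<Rightarrow> nat"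
proof -
  assume p: "p permutes {..<N}" and y: "y \<in> orbit p x"
  have "permutation p" using p by (auto simp: permutation_permutes)
  then have "cyclic_on p (orbit p x)" by (rule cyclic_on_orbit')
  then show ?thesis using y by (rule orbit_cyclic_eq3)
qed

lemma orbit_lessThan: "p permutes {..<N} \<Longrightarrow> x < N \<Longrightarrow> orbit p x \<subseteq> {..<N}" for p :: "nat \<Rightarrow> nat"
  by (rule permutes_orbit_subset) simp_all

lemma finite_cycles [simp]: "finite (cycles N p)"
  by (simp add: cycles_def)

lemma cycles_subset: "p permutes {..<N} \<Longrightarrow> C \<in> cycles N p \<Longrightarrow> C \<subseteq> {..<N}"
  unfolding cycles_def using orbit_lessThan[of p N] by force

lemma cycles_finite: "p permutes {..<N} \<Longrightarrow> C \<in> cycles N p \<Longrightarrow> finite C"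
  by (rule finite_subset[OF cycles_subset]) auto

lemma cycles_nonempty: "C \<in> cycles N p \<Longrightarrow> C \<noteq> {}"
  by (auto simp: cycles_def orbit_nonempty)

lemma cycles_disjoint:
  "p permutes {..<N} \<Longrightarrow> C \<in> cycles N p \<Longrightarrow> D \<in> cycles N p \<Longrightarrow> C \<noteq> D \<Longrightarrow> C \<inter> D = {}"
proof (rule ccontr)
  assume p: "p permutes {..<N}" and CD: "C \<in> cycles N p" "D \<in> cycles N p" "C \<noteq> D" "C \<inter> D \<noteq> {}"
  then obtain x where x: "x \<in> C" "x \<in> D" by blast
  have "E = orbit p x" if "E \<in> cycles N p" "x \<in> E" for E
    using that permutes_orbit_eq[OF p, of x] unfolding cycles_def by force
  then show False using x CD by blast
qed

lemma Union_cycles: "p permutes {..<N} \<Longrightarrow> \<Union> (cycles N p) = {..<N}"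
proof -
  assume p: "p permutes {..<N}"
  have "x \<in> \<Union> (cycles N p)" if "x < N" for x
    using permutes_self_in_orbit[OF p, of x] that by (auto simp: cycles_def)
  then show ?thesis using cycles_subset[OF p] by blast
qed

lemma sum_card_cycles: "p permutes {..<N} \<Longrightarrow> (\<Sum>C\<in>cycles N p. card C) = N"
proof -
  assume p: "p permutes {..<N}"
  have "card (\<Union> (cycles N p)) = (\<Sum>C\<in>cycles N p. card C)"
    using cycles_finite[OF p] cycles_disjoint[OF p]
    by (intro card_Union_disjoint) (simp_all add: pairwise_def disjnt_def)
  then show ?thesis by (simp add: Union_cycles[OF p])
qed

section \<open>Inserting a point into a permutation\<close>

lemma permutes_Suc_transpose:
  "p permutes {..<N} \<Longrightarrow> b \<le> N \<Longrightarrow> Transposition.transpose N b \<circ> p permutes {..<Suc N}"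
proof -
  assume p: "p permutes {..<N}" and b: "b \<le> N"
  have "p permutes {..<Suc N}" by (rule permutes_subset[OF p]) auto
  moreover have "Transposition.transpose N b permutes {..<Suc N}"
    using b by (intro permutes_swap_id) auto
  ultimately show ?thesis by (rule permutes_compose)
qed

lemma permutes_fixes_last: "p permutes {..<N} \<Longrightarrow> p N = N" for p :: "nat \<Rightarrow> nat"
  by (simp add: permutes_not_in)

lemma orbit_closed_subset:
  assumes "x \<in> S" "\<And>y. y \<in> S \<Longrightarrow> f y \<in> S"
  shows "orbit f x \<subseteq> S"
proof
  fix y assume "y \<in> orbit f x"
  then show "y \<in> S" by induction (use assms in auto)
qed

lemma cycles_insert_fixed:
  assumes p: "p permutes {..<N}"
  shows "cycles (Suc N) p = insert {N} (cycles N p)" "{N} \<notin> cycles N p"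
proof -
  have "orbit p N = {N}" using permutes_fixes_last[OF p] by (simp add: orbit_eq_singleton_iff)
  then show "cycles (Suc N) p = insert {N} (cycles N p)" by (simp add: cycles_def lessThan_Suc)
  show "{N} \<notin> cycles N p" using cycles_subset[OF p, of "{N}"] by auto
qed

text \<open>Composition with the transposition places the new point \<open>N\<close> immediately
  before \<open>b\<close>: the preimage of \<open>b\<close> is now sent to \<open>N\<close>, and
  \<open>N\<close> to \<open>b\<close>. Every other arrow is kept, so only the orbit through
  \<open>b\<close> changes.\<close>

lemma orbit_insert:
  fixes p :: "nat \<Rightarrow> nat"
  assumes p: "p permutes {..<N}" and b: "b < N" and x: "x < N"
  defines "r \<equiv> Transposition.transpose N b \<circ> p"
  shows "orbit r x = (if b \<in> orbit p x then insert N (orbit p x) else orbit p x)"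
proof -
  have r: "r permutes {..<Suc N}" unfolding r_def using p b by (intro permutes_Suc_transpose) auto
  have rN: "r N = b" by (simp add: r_def permutes_fixes_last[OF p])
  have lt: "p y < N" if "y < N" for y using p that permutes_in_image[OF p] by simp
  have r1: "r y = N" if "p y = b" for y using that by (simp add: r_def)
  have r2: "r y = p y" if "p y \<noteq> b" "y < N" for y
    using that lt[of y] by (simp add: r_def Transposition.transpose_def)
  have sub: "orbit p x \<subseteq> {..<N}" by (rule orbit_lessThan[OF p x])
  have stepp: "p y \<in> orbit p x" if "y \<in> orbit p x" for y using that by (rule orbit.step)
  have stepr: "r y \<in> orbit r x" if "y \<in> orbit r x" for y using that by (rule orbit.step)
  show ?thesis
  proof (cases "b \<in> orbit p x")
    case True
    have "orbit r x \<subseteq> insert N (orbit p x)"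
    proof (rule orbit_closed_subset)
      show "x \<in> insert N (orbit p x)" using permutes_self_in_orbit[OF p] by simp
      fix y assume y: "y \<in> insert N (orbit p x)"
      show "r y \<in> insert N (orbit p x)"
      proof (cases "y = N")
        case True
        then show ?thesis using rN \<open>b \<in> orbit p x\<close> by simp
      next
        case False
        then have "y \<in> orbit p x" using y by simp
        then have "p y \<in> orbit p x" "y < N" using stepp sub by auto
        then show ?thesis using r1[of y] r2[of y] by (cases "p y = b") simp_all
      qed
    qed
    moreover have "orbit p x \<subseteq> orbit r x"
    proof (rule orbit_closed_subset[of x "orbit r x \<inter> {..<N}" p, THEN order.trans])
      show "x \<in> orbit r x \<inter> {..<N}" using permutes_self_in_orbit[OF r] x by simp
      fix y assume y: "y \<in> orbit r x \<inter> {..<N}"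
      show "p y \<in> orbit r x \<inter> {..<N}"
      proof (cases "p y = b")
        case True
        then have "N \<in> orbit r x" using r1[of y] y stepr[of y] by simp
        then have "b \<in> orbit r x" using rN stepr[of N] by simp
        then show ?thesis using True b by simp
      next
        case False
        then show ?thesis using r2[of y] y lt[of y] stepr[of y] by simp
      qed
    qed simp
    moreover have "N \<in> orbit r x"
    proof -
      have "b \<in> orbit r x" using True calculation(2) by blast
      then have "orbit r b = orbit r x" by (rule permutes_orbit_eq[OF r])
      moreover have "b \<in> orbit r N" using orbit.base[of r N] rN by simp
      then have "orbit r b = orbit r N" by (rule permutes_orbit_eq[OF r])
      ultimately show ?thesis using permutes_self_in_orbit[OF r, of N] by simp
    qed
    ultimately show ?thesis using True by auto
  next
    case False
    have "orbit r x = orbit p x"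
    proof
      show "orbit r x \<subseteq> orbit p x"
      proof (rule orbit_closed_subset)
        fix y assume y: "y \<in> orbit p x"
        then have "p y \<in> orbit p x" by (rule stepp)
        then have "p y \<noteq> b" using False by auto
        then show "r y \<in> orbit p x" using r2[of y] y sub stepp[of y] by auto
      qed (use permutes_self_in_orbit[OF p] in simp)
      show "orbit p x \<subseteq> orbit r x"
      proof (rule orbit_closed_subset[of x "orbit r x \<inter> orbit p x" p, THEN order.trans])
        fix y assume y: "y \<in> orbit r x \<inter> orbit p x"
        then have "p y \<in> orbit p x" using stepp by simp
        moreover from this have "p y \<noteq> b" using False by auto
        ultimately show "p y \<in> orbit r x \<inter> orbit p x"
          using r2[of y] y sub stepr[of y] by auto
      qed (use permutes_self_in_orbit[OF p] permutes_self_in_orbit[OF r] in auto)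
    qed
    then show ?thesis using False by simp
  qed
qed

text \<open>The facts on membership accompany the equation because sums, products and cardinalities
  over the cycles are updated by removing the old cycle and inserting the enlarged one.\<close>

lemma cycles_insert:
  assumes p: "p permutes {..<N}" and b: "b < N"
  defines "r \<equiv> Transposition.transpose N b \<circ> p" and "C \<equiv> orbit p b"
  shows "cycles (Suc N) r = insert (insert N C) (cycles N p - {C})"
    and "insert N C \<notin> cycles N p - {C}" and "C \<in> cycles N p" and "N \<notin> C"
proof -
  have r: "r permutes {..<Suc N}" unfolding r_def using p b by (intro permutes_Suc_transpose) auto
  have rN: "r N = b" by (simp add: r_def permutes_fixes_last[OF p])
  show C: "C \<in> cycles N p" using b by (simp add: C_def cycles_def)
  show N: "N \<notin> C" using cycles_subset[OF p C] by auto
  show "insert N C \<notin> cycles N p - {C}" using cycles_subset[OF p] by auto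
  have o: "orbit r x = (if orbit p x = C then insert N C else orbit p x)" if "x < N" for x
  proof -
    have "b \<in> orbit p x \<longleftrightarrow> orbit p x = C"
      using permutes_orbit_eq[OF p, of b x] permutes_self_in_orbit[OF p, of b] unfolding C_def by auto
    then show ?thesis using orbit_insert[OF p b that] unfolding r_def by simp
  qed
  have "b \<in> orbit r N" using orbit.base[of r N] rN by simp
  then have oN: "orbit r N = insert N C" using permutes_orbit_eq[OF r, of b N] o[OF b] unfolding C_def by simp
  show "cycles (Suc N) r = insert (insert N C) (cycles N p - {C})"
  proof -
    have "cycles (Suc N) r = insert (insert N C) ((\<lambda>x. if orbit p x = C then insert N C else orbit p x) ` {..<N})"
      unfolding cycles_def lessThan_Suc image_insert oN using o by (intro arg_cong2[of _ _ _ _ insert] image_cong) auto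
    then show ?thesis by (auto simp: cycles_def)
  qed
qed

text \<open>Each permutation of \<open>Suc N\<close> points arises exactly once:
  \<open>b < N\<close> is the point before which \<open>N\<close> is inserted, and
  \<open>b = N\<close> makes \<open>N\<close> a fixed point.\<close>

lemma sum_permutes_Suc:
  fixes g :: "(nat \<Rightarrow> nat) \<Rightarrow> 'b::comm_monoid_add"
  shows "(\<Sum>p | p permutes {..<Suc N}. g p) = (\<Sum>p | p permutes {..<N}. \<Sum>b\<le>N. g (Transposition.transpose N b \<circ> p))"
proof -
  have "(\<Sum>p | p permutes {..<Suc N}. g p)
      = (\<Sum>b\<in>insert N {..<N}. \<Sum>p | p permutes {..<N}. g (Transposition.transpose N b \<circ> p))"
    unfolding lessThan_Suc by (rule sum_over_permutations_insert) auto
  also have "insert N {..<N} = {..N}" by auto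
  finally show ?thesis by (rule trans[OF _ sum.swap])
qed

text \<open>A multiset, as lengths repeat. The conditional expectations used later, given the
  permutation, depend on it only through these lengths.\<close>

definition cycle_type :: "nat \<Rightarrow> (nat \<Rightarrow> nat) \<Rightarrow> nat multiset" where
  "cycle_type N p = image_mset card (mset_set (cycles N p))"

lemma cycle_type_insert_fixed:
  "p permutes {..<N} \<Longrightarrow> cycle_type (Suc N) p = add_mset 1 (cycle_type N p)"
  using cycles_insert_fixed[of p N] by (simp add: cycle_type_def)

lemma cycle_type_insert:
  assumes p: "p permutes {..<N}" and b: "b < N"
  shows "cycle_type (Suc N) (Transposition.transpose N b \<circ> p)
    = add_mset (Suc (card (orbit p b))) (cycle_type N p - {#card (orbit p b)#})"
proof -
  define C where "C = orbit p b"
  have C: "C \<in> cycles N p" "N \<notin> C" "insert N C \<notin> cycles N p - {C}"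
    and e: "cycles (Suc N) (Transposition.transpose N b \<circ> p) = insert (insert N C) (cycles N p - {C})"
    unfolding C_def by (rule cycles_insert[OF p b])+
  have "mset_set (cycles N p) = add_mset C (mset_set (cycles N p - {C}))"
    by (rule mset_set.remove) (simp_all add: C)
  then have "cycle_type N p = add_mset (card C) (image_mset card (mset_set (cycles N p - {C})))"
    by (simp add: cycle_type_def)
  moreover have "cycle_type (Suc N) (Transposition.transpose N b \<circ> p)
      = add_mset (card (insert N C)) (image_mset card (mset_set (cycles N p - {C})))"
    unfolding cycle_type_def e using C(3) by (subst mset_set.insert) auto
  moreover have "card (insert N C) = Suc (card C)"
    using C(2) cycles_finite[OF p C(1)] by simp
  ultimately show ?thesis by (simp add: C_def)
qed

lemma sum_orbit_cycles:
  fixes g :: "nat set \<Rightarrow> 'b::comm_semiring_1"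
  assumes p: "p permutes {..<N}"
  shows "(\<Sum>b<N. g (orbit p b)) = (\<Sum>C\<in>cycles N p. of_nat (card C) * g C)"
proof -
  have "(\<Sum>b<N. g (orbit p b)) = (\<Sum>C\<in>cycles N p. \<Sum>b | b \<in> {..<N} \<and> orbit p b = C. g (orbit p b))"
    unfolding cycles_def by (rule sum.image_gen) simp
  also have "\<dots> = (\<Sum>C\<in>cycles N p. of_nat (card C) * g C)"
  proof (intro sum.cong refl)
    fix C assume C: "C \<in> cycles N p"
    then obtain x where x: "x < N" "C = orbit p x" by (auto simp: cycles_def)
    have "{b. b \<in> {..<N} \<and> orbit p b = C} = C"
    proof
      show "{b. b \<in> {..<N} \<and> orbit p b = C} \<subseteq> C" using permutes_self_in_orbit[OF p] by auto
      show "C \<subseteq> {b. b \<in> {..<N} \<and> orbit p b = C}"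
        using permutes_orbit_eq[OF p, of _ x] cycles_subset[OF p C] x by auto
    qed
    then have "(\<Sum>b | b \<in> {..<N} \<and> orbit p b = C. g (orbit p b)) = (\<Sum>b\<in>C. g C)"
      by (metis (mono_tags, lifting) mem_Collect_eq sum.cong)
    then show "(\<Sum>b | b \<in> {..<N} \<and> orbit p b = C. g (orbit p b)) = of_nat (card C) * g C" by simp
  qed
  finally show ?thesis .
qed

section \<open>Cycle types under the Ewens weights\<close>

context ewens
begin

text \<open>Sums over multisets of cycle lengths carry a whole distribution at once, which is what makes
  the induction in \<open>ewens_sum_first_cycle\<close> go through: inserting a new point acts on \<open>F\<close>.\<close>

definition ewens_sum :: "nat \<Rightarrow> (nat multiset \<Rightarrow> complex) \<Rightarrow> complex" where
  "ewens_sum N F = (\<Sum>p | p permutes {..<N}. of_real \<theta> ^ num_cycles N p * F (cycle_type N p))"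

text \<open>The adjoint of inserting a point: with weight \<theta> the point opens a cycle of its
  own, and it joins a cycle of length l at any of l places.\<close>

definition grow :: "(nat multiset \<Rightarrow> complex) \<Rightarrow> nat multiset \<Rightarrow> complex" where
  "grow F m = of_real \<theta> * F (add_mset 1 m) + (\<Sum>l\<in>#m. of_nat l * F (add_mset (Suc l) (m - {#l#})))"

lemma num_cycles_insert:
  assumes p: "p permutes {..<N}" and b: "b < N"
  shows "num_cycles (Suc N) (Transposition.transpose N b \<circ> p) = num_cycles N p"
proof -
  have "card (cycles N p) = Suc (card (cycles N p - {orbit p b}))"
    using cycles_insert(3)[OF p b] by (intro card.remove) simp_all
  then show ?thesis
    unfolding num_cycles_eq cycles_insert(1)[OF p b]
    by (subst card.insert) (use cycles_insert(2)[OF p b] in simp_all)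
qed

lemma num_cycles_insert_fixed:
  "p permutes {..<N} \<Longrightarrow> num_cycles (Suc N) p = Suc (num_cycles N p)"
  using cycles_insert_fixed[of p N] by (simp add: num_cycles_eq)

lemma ewens_sum_Suc: "ewens_sum (Suc N) F = ewens_sum N (grow F)"
  unfolding ewens_sum_def sum_permutes_Suc
proof (rule sum.cong[OF refl])
  fix p assume "p \<in> {p. p permutes {..<N}}"
  then have p: "p permutes {..<N}" by simp
  define h where "h b = of_real \<theta> ^ num_cycles (Suc N) (Transposition.transpose N b \<circ> p) *
         F (cycle_type (Suc N) (Transposition.transpose N b \<circ> p))" for b
  define g where "g C = F (add_mset (Suc (card C)) (cycle_type N p - {#card C#}))" for C :: "nat set"
  have "h N = of_real \<theta> ^ num_cycles N p * (of_real \<theta> * F (add_mset 1 (cycle_type N p)))"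
    using p by (simp add: h_def num_cycles_insert_fixed cycle_type_insert_fixed)
  moreover have "(\<Sum>b<N. h b) = of_real \<theta> ^ num_cycles N p * (\<Sum>b<N. g (orbit p b))"
    unfolding sum_distrib_left
    by (intro sum.cong refl) (simp add: h_def g_def num_cycles_insert[OF p] cycle_type_insert[OF p])
  moreover have "(\<Sum>b<N. g (orbit p b)) =
      (\<Sum>l\<in>#cycle_type N p. of_nat l * F (add_mset (Suc l) (cycle_type N p - {#l#})))"
    unfolding sum_orbit_cycles[OF p]
    by (simp add: cycle_type_def g_def sum_unfold_sum_mset image_mset.compositionality o_def)
  moreover have "(\<Sum>b\<le>N. h b) = (\<Sum>b<N. h b) + h N" by (simp add: lessThan_Suc_atMost[symmetric])
  ultimately show "(\<Sum>b\<le>N. h b) = of_real \<theta> ^ num_cycles N p * grow F (cycle_type N p)"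
    by (simp add: grow_def algebra_simps)
qed

lemma ewens_sum_add: "ewens_sum N (\<lambda>m. F m + G m) = ewens_sum N F + ewens_sum N G"
  by (simp add: ewens_sum_def algebra_simps sum.distrib)

lemma ewens_sum_cmult: "ewens_sum N (\<lambda>m. c * F m) = c * ewens_sum N F"
  by (simp add: ewens_sum_def sum_distrib_left mult_ac)

lemma ewens_sum_0: "ewens_sum 0 F = F {#}"
proof -
  have "{p :: nat \<Rightarrow> nat. p permutes {..<0}} = {id}" by auto
  then show ?thesis by (simp add: ewens_sum_def num_cycles_def cycle_type_def cycles_def)
qed

text \<open>The new point either enters the distinguished cycle, at one of its j places, or leaves
  it untouched and acts on the remaining cycles.\<close>

lemma grow_add_mset:
  "grow F (add_mset j m) = of_nat j * F (add_mset (Suc j) m) + grow (\<lambda>m. F (add_mset j m)) m"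
proof -
  have "(\<Sum>l\<in>#m. of_nat l * F (add_mset (Suc l) (add_mset j m - {#l#})))
      = (\<Sum>l\<in>#m. of_nat l * F (add_mset j (add_mset (Suc l) (m - {#l#}))))"
  proof (intro arg_cong[of _ _ sum_mset] image_mset_cong)
    fix l assume "l \<in># m"
    then have "add_mset j m - {#l#} = add_mset j (m - {#l#})" by simp
    then show "of_nat l * F (add_mset (Suc l) (add_mset j m - {#l#}))
        = of_nat l * F (add_mset j (add_mset (Suc l) (m - {#l#})))"
      by (simp add: add_mset_commute)
  qed
  then show ?thesis by (simp add: grow_def add_mset_commute)
qed

text \<open>A cycle of length \<open>Suc j\<close> through a given point can be filled in N! / (N -
  j)! ways. The formula is obtained by insertion rather than by a bijection: in the new sum a length
  index j collects the factor j from a growing first cycle and N + 1 - j from growth elsewhere, and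
  these add up to N + 1 for every j.\<close>

lemma ewens_sum_first_cycle:
  "ewens_sum (Suc N) F = (\<Sum>j=0..N. (fact N / fact (N - j)) * of_real \<theta> * ewens_sum (N - j) (\<lambda>m. F (add_mset (Suc j) m)))"
proof (induction N arbitrary: F)
  case 0
  then show ?case by (simp add: ewens_sum_Suc ewens_sum_0 grow_def)
next
  case (Suc N)
  define T where "T j = ewens_sum (Suc N - j) (\<lambda>m. F (add_mset (Suc j) m))" for j
  have "ewens_sum (Suc (Suc N)) F = ewens_sum (Suc N) (grow F)" by (rule ewens_sum_Suc)
  also have "\<dots> = (\<Sum>j=0..N. fact N / fact (N - j) * of_real \<theta> * (of_nat (Suc j) * T (Suc j) + T j))"
    unfolding Suc.IH
  proof (intro sum.cong refl arg_cong2[of _ _ _ _ "(*)"])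
    fix j assume "j \<in> {0..N}"
    then have e: "Suc N - j = Suc (N - j)" by auto
    have "ewens_sum (N - j) (grow (\<lambda>m. F (add_mset (Suc j) m))) = T j"
      unfolding T_def e by (rule ewens_sum_Suc[symmetric])
    moreover have "ewens_sum (N - j) (\<lambda>m. F (add_mset (Suc (Suc j)) m)) = T (Suc j)"
      by (simp add: T_def)
    ultimately show "ewens_sum (N - j) (\<lambda>m. grow F (add_mset (Suc j) m)) = of_nat (Suc j) * T (Suc j) + T j"
      unfolding grow_add_mset by (simp only: ewens_sum_add ewens_sum_cmult)
  qed
  also have "\<dots> = of_real \<theta> * ((\<Sum>j=0..N. fact N / fact (N - j) * of_nat (Suc j) * T (Suc j))
      + (\<Sum>j=0..N. fact N / fact (N - j) * T j))"
    by (simp add: algebra_simps sum.distrib sum_distrib_left sum_distrib_right)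
  also have "(\<Sum>j=0..N. fact N / fact (N - j) * of_nat (Suc j) * T (Suc j))
      = (\<Sum>j=1..Suc N. fact N / fact (Suc N - j) * of_nat j * T j)"
    by (simp add: sum.shift_bounds_cl_Suc_ivl del: sum.cl_ivl_Suc of_nat_Suc)
  also have "\<dots> = (\<Sum>j=0..Suc N. fact N / fact (Suc N - j) * of_nat j * T j)"
    by (rule sum.mono_neutral_left) auto
  also have "(\<Sum>j=0..N. fact N / fact (N - j) * T j)
      = (\<Sum>j=0..Suc N. fact N / fact (Suc N - j) * of_nat (Suc N - j) * T j)"
  proof -
    have "(\<Sum>j=0..N. fact N / fact (N - j) * T j) = (\<Sum>j=0..N. fact N / fact (Suc N - j) * of_nat (Suc N - j) * T j)"
    proof (intro sum.cong refl)
      fix j assume "j \<in> {0..N}"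
      then have "Suc N - j = Suc (N - j)" by auto
      then show "fact N / fact (N - j) * T j = fact N / fact (Suc N - j) * of_nat (Suc N - j) * T j"
        by (simp add: fact_Suc del: of_nat_Suc)
    qed
    then show ?thesis by simp
  qed
  also have "of_real \<theta> * ((\<Sum>j=0..Suc N. fact N / fact (Suc N - j) * of_nat j * T j)
      + (\<Sum>j=0..Suc N. fact N / fact (Suc N - j) * of_nat (Suc N - j) * T j))
      = (\<Sum>j=0..Suc N. fact (Suc N) / fact (Suc N - j) * of_real \<theta> * T j)"
    unfolding sum.distrib[symmetric] sum_distrib_left
  proof (intro sum.cong refl)
    fix j assume "j \<in> {0..Suc N}"
    then have "of_nat j + of_nat (Suc N - j) = (of_nat (Suc N) :: complex)"
      unfolding of_nat_add[symmetric] by simp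
    then have f: "fact N * of_nat j + fact N * of_nat (Suc N - j) = (fact (Suc N) :: complex)"
      unfolding distrib_left[symmetric] by (simp add: mult.commute)
    have "of_real \<theta> * (fact N / fact (Suc N - j) * of_nat j * T j + fact N / fact (Suc N - j) * of_nat (Suc N - j) * T j)
      = (fact N * of_nat j + fact N * of_nat (Suc N - j)) / fact (Suc N - j) * of_real \<theta> * T j"
      by (simp add: algebra_simps add_divide_distrib)
    then show "of_real \<theta> * (fact N / fact (Suc N - j) * of_nat j * T j + fact N / fact (Suc N - j) * of_nat (Suc N - j) * T j)
      = fact (Suc N) / fact (Suc N - j) * of_real \<theta> * T j"
      unfolding f .
  qed
  finally show ?case by (simp only: T_def)
qed

definition ewens_expect :: "nat \<Rightarrow> (nat multiset \<Rightarrow> complex) \<Rightarrow> complex" where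
  "ewens_expect N F = ewens_sum N F / of_real (pochhammer \<theta> N)"

lemma ewens_expect_0: "ewens_expect 0 F = F {#}"
  by (simp add: ewens_expect_def ewens_sum_0)

lemma ewens_expect_rec:
  assumes n: "n \<ge> 1"
  shows "ewens_expect n F = (\<Sum>m<n. jump n m * ewens_expect m (\<lambda>k. F (add_mset (n - m) k)))"
proof -
  obtain N where N: "n = Suc N" using n by (cases n) auto
  have "ewens_expect n F = (\<Sum>j=0..N. (fact N / fact (N - j)) * of_real \<theta> / of_real (pochhammer \<theta> n) * ewens_sum (N - j) (\<lambda>m. F (add_mset (Suc j) m)))"
    by (simp add: ewens_expect_def N ewens_sum_first_cycle sum_divide_distrib)
  also have "\<dots> = (\<Sum>j=0..N. jump n (N - j) * ewens_expect (N - j) (\<lambda>m. F (add_mset (Suc j) m)))"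
  proof (intro sum.cong refl)
    fix j
    have p: "pochhammer \<theta> k \<noteq> 0" for k using theta_pos pochhammer_pos[of \<theta> k] by simp
    have "jump n (N - j) = fact N / fact (N - j) * \<theta> / pochhammer \<theta> n * pochhammer \<theta> (N - j)"
      using p by (simp add: jump_def B_def N fact_Suc divide_simps del: of_nat_Suc)
    then have "complex_of_real (jump n (N - j)) = fact N / fact (N - j) * of_real \<theta> / of_real (pochhammer \<theta> n) * of_real (pochhammer \<theta> (N - j))"
      by (simp add: of_real_fact)
    then show "(fact N / fact (N - j)) * of_real \<theta> / of_real (pochhammer \<theta> n) * ewens_sum (N - j) (\<lambda>m. F (add_mset (Suc j) m))
       = jump n (N - j) * ewens_expect (N - j) (\<lambda>m. F (add_mset (Suc j) m))"
      using p by (simp add: ewens_expect_def)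
  qed
  also have "\<dots> = (\<Sum>m<n. jump n m * ewens_expect m (\<lambda>k. F (add_mset (n - m) k)))"
    by (rule sum.reindex_bij_witness[of _ "\<lambda>m. N - m" "\<lambda>j. N - j"]) (auto simp: N Suc_diff_le)
  finally show ?thesis .
qed

lemma ewens_expect_one: "ewens_expect n (\<lambda>_. 1) = 1"
proof (induction n rule: less_induct)
  case (less n)
  show ?case
  proof (cases "n = 0")
    case False
    then show ?thesis
      using less sum_jump[of n] by (simp add: ewens_expect_rec[of n] flip: of_real_sum)
  qed (simp add: ewens_expect_0)
qed

lemma ewens_expect_add: "ewens_expect n (\<lambda>m. F m + G m) = ewens_expect n F + ewens_expect n G"
  by (simp add: ewens_expect_def ewens_sum_add add_divide_distrib)

lemma ewens_expect_cmult: "ewens_expect n (\<lambda>m. c * F m) = c * ewens_expect n F"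
  by (simp add: ewens_expect_def ewens_sum_cmult)

text \<open>Both sides satisfy the recursion over the first cycle. This identifies the coefficient
  formula \<open>mean\<close> with an expectation under the Ewens law.\<close>

lemma ewens_expect_sum:
  fixes a :: "nat \<Rightarrow> real"
  shows "ewens_expect n (\<lambda>m. \<Sum>j\<in>#m. of_real (a j)) = of_real (mean n a)"
proof (induction n rule: less_induct)
  case (less n)
  show ?case
  proof (cases "n = 0")
    case False
    then have n: "n \<ge> 1" by simp
    have "ewens_expect m (\<lambda>k. \<Sum>j\<in>#add_mset (n - m) k. of_real (a j)) = of_real (a (n - m) + mean m a)" if "m < n" for m
    proof -
      have "ewens_expect m (\<lambda>k. of_real (a (n - m)) * 1 + (\<Sum>j\<in>#k. of_real (a j))) = of_real (a (n - m) + mean m a)"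
        unfolding ewens_expect_add ewens_expect_cmult ewens_expect_one using less[OF that] by simp
      then show ?thesis by simp
    qed
    then show ?thesis unfolding ewens_expect_rec[OF n] mean_recurrence[OF n] by simp
  qed (simp add: ewens_expect_0)
qed

lemma ewens_expect_sum_product:
  fixes a b :: "nat \<Rightarrow> real"
  shows "ewens_expect n (\<lambda>m. (\<Sum>j\<in>#m. of_real (a j)) * (\<Sum>j\<in>#m. of_real (b j))) = of_real (second_moment n a b)"
proof (induction n rule: less_induct)
  case (less n)
  show ?case
  proof (cases "n = 0")
    case False
    then have n: "n \<ge> 1" by simp
    have "ewens_expect m (\<lambda>k. (\<Sum>j\<in>#add_mset (n - m) k. of_real (a j)) * (\<Sum>j\<in>#add_mset (n - m) k. of_real (b j)))
        = of_real (a (n - m) * b (n - m) + a (n - m) * mean m b + b (n - m) * mean m a + second_moment m a b)"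
      if "m < n" for m
    proof -
      have "ewens_expect m (\<lambda>k. of_real (a (n - m) * b (n - m)) * 1 + of_real (a (n - m)) * (\<Sum>j\<in>#k. of_real (b j))
          + of_real (b (n - m)) * (\<Sum>j\<in>#k. of_real (a j)) + (\<Sum>j\<in>#k. of_real (a j)) * (\<Sum>j\<in>#k. of_real (b j)))
        = of_real (a (n - m) * b (n - m) + a (n - m) * mean m b + b (n - m) * mean m a + second_moment m a b)"
        unfolding ewens_expect_add ewens_expect_cmult ewens_expect_one ewens_expect_sum less[OF that] by simp
      moreover have "(\<lambda>k. (\<Sum>j\<in>#add_mset (n - m) k. of_real (a j)) * (\<Sum>j\<in>#add_mset (n - m) k. of_real (b j)))
        = (\<lambda>k. of_real (a (n - m) * b (n - m)) * 1 + of_real (a (n - m)) * (\<Sum>j\<in>#k. of_real (b j))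
          + of_real (b (n - m)) * (\<Sum>j\<in>#k. of_real (a j)) + (\<Sum>j\<in>#k. of_real (a j)) * (\<Sum>j\<in>#k. complex_of_real (b j)))"
        by (intro ext) (simp add: distrib_left distrib_right add_ac mult_ac)
      ultimately show ?thesis by (simp only:)
    qed
    then show ?thesis unfolding ewens_expect_rec[OF n] second_moment_recurrence[OF n] of_real_sum
      by (intro sum.cong refl) (simp only: lessThan_iff of_real_mult)
  qed (simp add: ewens_expect_0)
qed

text \<open>The summand of a cycle may itself be random, so \<open>r\<close> can exceed the square
  of \<open>a\<close>. The exponent holds the variance in two pieces: \<open>mean n r\<close> from
  each cycle with itself, and the part of \<open>covar\<close> that comes from pairs of different
  cycles and involves the means \<open>a\<close> only.\<close>

lemma ewens_char_fun_estimate: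
  fixes a r :: "nat \<Rightarrow> real" and \<phi> :: "nat \<Rightarrow> complex" and \<eta> :: real
  assumes "0 \<le> \<eta>" "\<eta> \<le> 1"
    and "\<And>j. \<bar>a j\<bar> \<le> \<eta>" and "\<And>j. (a j)\<^sup>2 \<le> r j" and "\<And>j. r j \<le> \<eta>\<^sup>2"
    and "\<And>j. cmod (\<phi> j) \<le> 1"
    and "\<And>j. cmod (\<phi> j - (1 + \<i> * a j - r j / 2)) \<le> \<eta> ^ 3"
  shows "cmod (ewens_expect n (\<lambda>m. \<Prod>j\<in>#m. \<phi> j) * cis (- mean n a)
    - exp (- ((mean n r + (covar n a a - mean n (\<lambda>j. a j * a j))) / 2))) \<le> 10 ^ 10 * \<eta> ^ 3 * Q 0 n"
proof -
  define v where "v n = mean n r + (second_moment n a a - mean n (\<lambda>j. a j * a j))" for n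
  define V where "V n = mean n r + (covar n a a - mean n (\<lambda>j. a j * a j))" for n
  have Vv: "V n = v n - (mean n a)\<^sup>2" for n by (simp add: V_def v_def covar_def power2_eq_square)
  have v_rec: "v n = (\<Sum>m<n. jump n m * (r (n - m) + 2 * a (n - m) * mean m a + v m))" if "n \<ge> 1" for n
    unfolding v_def mean_recurrence[OF that, of r] mean_recurrence[OF that, of "\<lambda>j. a j * a j"] second_moment_recurrence[OF that]
      sum_subtractf[symmetric] sum.distrib[symmetric]
    by (intro sum.cong refl) (simp add: algebra_simps)
  have V_rec: "V n = (\<Sum>m<n. jump n m *
      (r (n - m) + 2 * a (n - m) * (mean m a - mean n a) + (mean m a - mean n a)\<^sup>2 + V m))" if n: "n \<ge> 1" for n
  proof -
    have e: "jump n m * (r (n - m) + 2 * a (n - m) * (mean m a - mean n a) + (mean m a - mean n a)\<^sup>2 + V m)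
      = jump n m * (r (n - m) + 2 * a (n - m) * mean m a + v m)
        - 2 * mean n a * (jump n m * (a (n - m) + mean m a)) + (mean n a)\<^sup>2 * jump n m" for m
      unfolding Vv by (simp add: algebra_simps power2_eq_square)
    have "(\<Sum>m<n. jump n m * (r (n - m) + 2 * a (n - m) * (mean m a - mean n a) + (mean m a - mean n a)\<^sup>2 + V m))
      = v n - 2 * mean n a * mean n a + (mean n a)\<^sup>2 * 1"
      unfolding e sum.distrib sum_subtractf sum_distrib_left[symmetric] v_rec[OF n, symmetric]
        mean_recurrence[OF n, symmetric] sum_jump[OF n] ..
    then show ?thesis by (simp add: Vv power2_eq_square)
  qed
  have f_rec: "ewens_expect n (\<lambda>m. \<Prod>j\<in>#m. \<phi> j)
      = (\<Sum>m<n. jump n m * (\<phi> (n - m) * ewens_expect m (\<lambda>m. \<Prod>j\<in>#m. \<phi> j)))" if "n \<ge> 1" for n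
    using ewens_expect_rec[OF that, of "\<lambda>m. \<Prod>j\<in>#m. \<phi> j"] by (simp add: ewens_expect_cmult)
  show ?thesis
    using char_fun_estimate[OF assms, where \<mu> = "\<lambda>n. mean n a" and V = V
        and f = "\<lambda>n. ewens_expect n (\<lambda>m. \<Prod>j\<in>#m. \<phi> j)" and n = n]
      mean_recurrence[of _ a] V_rec f_rec
    by (simp add: ewens_expect_0 V_def[of 0] V_def[of n, symmetric] covar_def[of 0])
qed

end

section \<open>Eigenvalues of weighted permutation matrices\<close>

definition cycle_weight :: "(nat \<Rightarrow> complex) \<Rightarrow> nat set \<Rightarrow> complex" where
  "cycle_weight w C = (\<Prod>i\<in>C. w i)"

text \<open>The characteristic matrix evaluated at a number \<open>x\<close>, instead of a matrix of
  polynomials, so that a row operation may divide by \<open>x\<close>.\<close>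

definition shifted_mat :: "nat \<Rightarrow> complex \<Rightarrow> (nat \<Rightarrow> complex) \<Rightarrow> (nat \<Rightarrow> nat) \<Rightarrow> complex mat" where
  "shifted_mat N x w p = Matrix.mat N N (\<lambda>(i, j). (if i = j then x else 0) - (if i = p j then w i else 0))"

lemma det_last_column:
  fixes A :: "complex mat"
  assumes A: "A \<in> carrier_mat (Suc N) (Suc N)" and z: "\<And>i. i < N \<Longrightarrow> A $$ (i, N) = 0"
  shows "Determinant.det A = A $$ (N, N) * Determinant.det (mat_delete A N N)"
proof -
  have "Determinant.det A = (\<Sum>i<Suc N. A $$ (i, N) * cofactor A i N)"
    by (rule laplace_expansion_column[OF A]) simp
  also have "\<dots> = A $$ (N, N) * cofactor A N N"
    using z by simp
  also have "cofactor A N N = Determinant.det (mat_delete A N N)"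
    by (simp add: cofactor_def)
  finally show ?thesis .
qed

lemma permutes_Suc_cases:
  assumes "r permutes {..<Suc N}"
  obtains p b where "p permutes {..<N}" "b \<le> N" "r = Transposition.transpose N b \<circ> p"
proof -
  have "r \<in> {p. p permutes insert N {..<N}}" using assms by (simp add: lessThan_Suc)
  then obtain p b where "r = Transposition.transpose N b \<circ> p" "b \<in> insert N {..<N}" "p permutes {..<N}"
    unfolding permutes_insert by auto
  then show ?thesis by (intro that[of p b]) auto
qed

text \<open>Induction by removing the last point. A fixed point splits off a factor directly.
  Otherwise, adding \<open>w b / x\<close> times the last row to row \<open>b\<close> clears the
  last column above the diagonal entry \<open>x\<close>; the remaining minor belongs to the
  permutation with \<open>N\<close> taken out of its cycle and with weight
  \<open>w b * w N / x\<close> at \<open>b\<close>. The factor \<open>x\<close> in front restores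
  the missing power in that cycle.\<close>

lemma det_shifted_mat:
  assumes "p permutes {..<N}" and x: "x \<noteq> 0"
  shows "Determinant.det (shifted_mat N x w p) = (\<Prod>C\<in>cycles N p. x ^ card C - cycle_weight w C)"
  using assms(1)
proof (induction N arbitrary: p w)
  case 0
  then show ?case by (simp add: shifted_mat_def cycles_def det_dim_zero)
next
  case (Suc N r w)
  obtain p b where p: "p permutes {..<N}" and b: "b \<le> N" and r: "r = Transposition.transpose N b \<circ> p"
    using permutes_Suc_cases[OF Suc.prems] .
  have lt: "p j < N" if "j < N" for j using that permutes_in_image[OF p, of j] by simp
  show ?case
  proof (cases "b = N")
    case True
    then have r: "r = p" using r by simp
    have pN: "p N = N" by (rule permutes_fixes_last[OF p])
    have "Determinant.det (shifted_mat (Suc N) x w p)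
        = shifted_mat (Suc N) x w p $$ (N, N) * Determinant.det (mat_delete (shifted_mat (Suc N) x w p) N N)"
      by (rule det_last_column) (auto simp: shifted_mat_def pN)
    also have "mat_delete (shifted_mat (Suc N) x w p) N N = shifted_mat N x w p"
      by (rule eq_matI) (auto simp: mat_delete_def shifted_mat_def)
    also have "shifted_mat (Suc N) x w p $$ (N, N) = x - w N"
      by (simp add: shifted_mat_def pN)
    finally show ?thesis
      unfolding r Suc.IH[OF p] cycles_insert_fixed(1)[OF p]
      using cycles_insert_fixed(2)[OF p] by (simp add: cycle_weight_def)
  next
    case False
    then have b: "b < N" using b by simp
    have rN: "r N = b" by (simp add: r permutes_fixes_last[OF p])
    have rj: "r j = (if p j = b then N else p j)" if "j < N" for j
      using lt[OF that] by (simp add: r Transposition.transpose_def)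
    define A where "A = shifted_mat (Suc N) x w r"
    define A' where "A' = addrow (w b / x) b N A"
    define w' where "w' = w(b := w b * w N / x)"
    have A: "A \<in> carrier_mat (Suc N) (Suc N)" by (simp add: A_def shifted_mat_def)
    have "Determinant.det A = Determinant.det A'"
      unfolding A'_def using b by (intro det_addrow[OF _ _ A, symmetric]) auto
    also have "\<dots> = A' $$ (N, N) * Determinant.det (mat_delete A' N N)"
      using b x by (intro det_last_column) (auto simp: A'_def A_def shifted_mat_def rN)
    also have "A' $$ (N, N) = x" using b by (simp add: A'_def A_def shifted_mat_def rN)
    also have "mat_delete A' N N = shifted_mat N x w' p"
    proof (rule eq_matI)
      fix i j assume "i < dim_row (shifted_mat N x w' p)" "j < dim_col (shifted_mat N x w' p)"
      then have ij: "i < N" "j < N" by (simp_all add: shifted_mat_def)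
      have "mat_delete A' N N $$ (i, j) = A' $$ (i, j)"
        using ij by (simp add: mat_delete_def A'_def A_def shifted_mat_def)
      also have "\<dots> = shifted_mat N x w' p $$ (i, j)"
        using ij b x lt[OF ij(2)] by (simp add: A'_def A_def shifted_mat_def w'_def rj)
      finally show "mat_delete A' N N $$ (i, j) = shifted_mat N x w' p $$ (i, j)" .
    qed (simp_all add: A'_def A_def shifted_mat_def mat_delete_def)
    also have "Determinant.det (shifted_mat N x w' p) = (\<Prod>C\<in>cycles N p. x ^ card C - cycle_weight w' C)"
      by (rule Suc.IH[OF p])
    also have "\<dots> = (x ^ card (orbit p b) - cycle_weight w' (orbit p b))
        * (\<Prod>C\<in>cycles N p - {orbit p b}. x ^ card C - cycle_weight w' C)"
      using cycles_insert(3)[OF p b] by (intro prod.remove) simp_all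
    also have "(\<Prod>C\<in>cycles N p - {orbit p b}. x ^ card C - cycle_weight w' C)
        = (\<Prod>C\<in>cycles N p - {orbit p b}. x ^ card C - cycle_weight w C)"
    proof (intro prod.cong refl)
      fix C assume C: "C \<in> cycles N p - {orbit p b}"
      then have "b \<notin> C" using cycles_disjoint[OF p, of C "orbit p b"] cycles_insert(3)[OF p b]
          permutes_self_in_orbit[OF p, of b] by auto
      then have "cycle_weight w' C = cycle_weight w C"
        unfolding cycle_weight_def by (intro prod.cong refl) (auto simp: w'_def)
      then show "x ^ card C - cycle_weight w' C = x ^ card C - cycle_weight w C" by simp
    qed
    finally have 1: "Determinant.det A = x * ((x ^ card (orbit p b) - cycle_weight w' (orbit p b))
        * (\<Prod>C\<in>cycles N p - {orbit p b}. x ^ card C - cycle_weight w C))" .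
    have fin: "finite (orbit p b)" using cycles_finite[OF p cycles_insert(3)[OF p b]] .
    have bin: "b \<in> orbit p b" by (rule permutes_self_in_orbit[OF p])
    have "cycle_weight w' (orbit p b) = w' b * (\<Prod>i\<in>orbit p b - {b}. w' i)"
      unfolding cycle_weight_def by (rule prod.remove[OF fin bin])
    also have "(\<Prod>i\<in>orbit p b - {b}. w' i) = (\<Prod>i\<in>orbit p b - {b}. w i)"
      by (intro prod.cong refl) (auto simp: w'_def)
    also have "w' b * (\<Prod>i\<in>orbit p b - {b}. w i) = w N / x * cycle_weight w (orbit p b)"
      unfolding cycle_weight_def prod.remove[OF fin bin, of w] by (simp add: w'_def)
    finally have 2: "cycle_weight w' (orbit p b) = w N / x * cycle_weight w (orbit p b)" .
    have 3: "card (insert N (orbit p b)) = Suc (card (orbit p b))"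
      "cycle_weight w (insert N (orbit p b)) = w N * cycle_weight w (orbit p b)"
      using fin cycles_insert(4)[OF p b] by (simp_all add: cycle_weight_def)
    have "(\<Prod>C\<in>cycles (Suc N) r. x ^ card C - cycle_weight w C)
        = (x ^ card (insert N (orbit p b)) - cycle_weight w (insert N (orbit p b)))
          * (\<Prod>C\<in>cycles N p - {orbit p b}. x ^ card C - cycle_weight w C)"
      unfolding r cycles_insert(1)[OF p b]
      using cycles_insert(2)[OF p b] by (intro prod.insert) simp_all
    also have "\<dots> = Determinant.det A"
      unfolding 1 2 3 using x by (simp add: field_simps)
    finally show ?thesis by (simp add: A_def)
  qed
qed

text \<open>The determinant is known only for x \<noteq> 0. Multiplying both polynomials by the
  variable makes them agree at 0 as well, and this factor can be cancelled.\<close>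

lemma char_poly_twisted:
  assumes p: "p permutes {..<N}"
  shows "char_poly (twisted_perm_mat N w p) = (\<Prod>C\<in>cycles N p. Polynomial.monom 1 (card C) - [:cycle_weight w C:])"
    (is "?L = ?R")
proof -
  have eval: "poly ?L x = poly ?R x" if "x \<noteq> 0" for x
  proof -
    have "poly ?L x = Determinant.det (shifted_mat N x w p)"
      unfolding char_poly_def
      by (rule poly_det_cong[of _ N])
         (auto simp: char_poly_matrix_def twisted_perm_mat_def shifted_mat_def)
    also have "\<dots> = poly ?R x"
      unfolding det_shifted_mat[OF p that] by (simp add: poly_prod poly_monom)
    finally show ?thesis .
  qed
  have "poly ([:0, 1:] * ?L) x = poly ([:0, 1:] * ?R) x" for x
    using eval[of x] by (cases "x = 0") simp_all
  then have "poly ([:0, 1:] * ?L) = poly ([:0, 1:] * ?R)" by (rule ext)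
  then have "[:0, 1:] * ?L = [:0, 1:] * ?R" by (rule poly_eq_poly_eq_iff[THEN iffD1])
  then show ?thesis by simp
qed

text \<open>Away from 0 the derivative does not vanish, so every root is simple.\<close>

lemma order_monom_minus_const:
  fixes x W :: complex
  assumes x: "x \<noteq> 0" and l: "l \<ge> 1"
  shows "Polynomial.order x (Polynomial.monom 1 l - [:W:]) = (if x ^ l = W then 1 else 0)"
proof -
  define P where "P = Polynomial.monom 1 l - [:W:]"
  have ev: "poly P y = y ^ l - W" for y by (simp add: P_def poly_monom)
  have d: "poly (pderiv P) x \<noteq> 0" using x l by (simp add: P_def pderiv_diff pderiv_monom poly_monom pderiv_pCons)
  then have "pderiv P \<noteq> 0" by auto
  then have P0: "P \<noteq> 0" by auto
  show ?thesis
  proof (cases "x ^ l = W")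
    case True
    then have "Polynomial.order x P \<noteq> 0" using P0 ev order_root[of P x] by simp
    then have "Polynomial.order x P = Suc (Polynomial.order x (pderiv P))" using True ev by (intro order_pderiv P0) simp
    then show ?thesis using True order_0I[OF d] by (simp add: P_def)
  next
    case False
    then have "Polynomial.order x P = 0" using ev by (intro order_0I) simp
    then show ?thesis using False by (simp add: P_def)
  qed
qed

lemma order_prod:
  fixes f :: "'b \<Rightarrow> complex poly"
  assumes "finite S" "\<And>i. i \<in> S \<Longrightarrow> f i \<noteq> 0"
  shows "Polynomial.order x (\<Prod>i\<in>S. f i) = (\<Sum>i\<in>S. Polynomial.order x (f i))"
  using assms
proof (induction S rule: finite_induct)
  case (insert i S)
  then have "f i * (\<Prod>i\<in>S. f i) \<noteq> 0" by auto
  then show ?case using insert by (simp add: order_mult)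
qed (simp add: order_0I)

definition arc_roots :: "nat \<Rightarrow> complex \<Rightarrow> real \<Rightarrow> real \<Rightarrow> nat" where
  "arc_roots l W a b = card {x \<in> circle_arc a b. x ^ l = W}"

lemma circle_arc_norm: "x \<in> circle_arc a b \<Longrightarrow> cmod x = 1"
  by (auto simp: circle_arc_def)

text \<open>Points of the arc are nonzero, so the multiplicity of \<open>x\<close> is the number of
  cycles whose factor vanishes at \<open>x\<close>. Exchanging the sum over eigenvalues with the sum
  over cycles counts the roots of each factor separately.\<close>

lemma eigenvalue_count_twisted:
  assumes p: "p permutes {..<N}"
  shows "eigenvalue_count (twisted_perm_mat N w p) (circle_arc a b)
    = (\<Sum>C\<in>cycles N p. arc_roots (card C) (cycle_weight w C) a b)"
proof -
  define A where "A = twisted_perm_mat N w p"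
  define fac where "fac C = Polynomial.monom 1 (card C) - [:cycle_weight w C:]" for C
  have A: "A \<in> carrier_mat N N" by (simp add: A_def twisted_perm_mat_def)
  have cp: "char_poly A = (\<Prod>C\<in>cycles N p. fac C)"
    unfolding A_def fac_def by (rule char_poly_twisted[OF p])
  have card: "card C \<ge> 1" if "C \<in> cycles N p" for C
    using cycles_finite[OF p that] cycles_nonempty[OF that] by (simp add: Suc_le_eq card_gt_0_iff)
  have fac0: "fac C \<noteq> 0" if "C \<in> cycles N p" for C
  proof
    assume "fac C = 0"
    then have "coeff (fac C) (card C) = 0" by simp
    then show False using card[OF that] by (cases "card C") (simp_all add: fac_def)
  qed
  have cp0: "char_poly A \<noteq> 0" unfolding cp using fac0 by (simp add: prod_zero_iff)
  define R where "R = {x. x \<in> circle_arc a b \<and> eigenvalue A x}"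
  have ev: "eigenvalue A x \<longleftrightarrow> (\<exists>C\<in>cycles N p. x ^ card C = cycle_weight w C)" for x
    unfolding eigenvalue_root_char_poly[OF A] cp by (simp add: poly_prod fac_def poly_monom)
  have "finite {x. poly (char_poly A) x = 0}" by (rule poly_roots_finite[OF cp0])
  then have finR: "finite R" unfolding R_def eigenvalue_root_char_poly[OF A] by (rule rev_finite_subset) auto
  have "eigenvalue_count A (circle_arc a b) = (\<Sum>x\<in>R. Polynomial.order x (char_poly A))"
    by (simp add: eigenvalue_count_def R_def)
  also have "\<dots> = (\<Sum>x\<in>R. \<Sum>C\<in>cycles N p. if x ^ card C = cycle_weight w C then 1 else 0)"
  proof (intro sum.cong refl)
    fix x assume "x \<in> R"
    then have x: "x \<noteq> 0" using circle_arc_norm[of x a b] by (auto simp: R_def)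
    have "Polynomial.order x (char_poly A) = (\<Sum>C\<in>cycles N p. Polynomial.order x (fac C))"
      unfolding cp using fac0 by (intro order_prod) auto
    also have "\<dots> = (\<Sum>C\<in>cycles N p. if x ^ card C = cycle_weight w C then 1 else 0)"
      unfolding fac_def using card by (intro sum.cong refl order_monom_minus_const[OF x])
    finally show "Polynomial.order x (char_poly A) = \<dots>" .
  qed
  also have "\<dots> = (\<Sum>C\<in>cycles N p. \<Sum>x\<in>R. if x ^ card C = cycle_weight w C then 1 else 0)"
    by (rule sum.swap)
  also have "\<dots> = (\<Sum>C\<in>cycles N p. arc_roots (card C) (cycle_weight w C) a b)"
  proof (intro sum.cong refl)
    fix C assume C: "C \<in> cycles N p"
    have "(\<Sum>x\<in>R. if x ^ card C = cycle_weight w C then 1 else 0) = card {x \<in> R. x ^ card C = cycle_weight w C}"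
      using finR by (simp add: sum.If_cases Int_def conj_commute)
    also have "{x \<in> R. x ^ card C = cycle_weight w C} = {x \<in> circle_arc a b. x ^ card C = cycle_weight w C}"
      using C ev by (auto simp: R_def)
    finally show "(\<Sum>x\<in>R. if x ^ card C = cycle_weight w C then 1 else 0) = arc_roots (card C) (cycle_weight w C) a b"
      by (simp add: arc_roots_def)
  qed
  finally show ?thesis by (simp add: A_def)
qed

lemma perm_mat_twisted: "perm_mat N p = twisted_perm_mat N (\<lambda>_. 1) p"
  by (simp add: perm_mat_def twisted_perm_mat_def)

lemma cis_2pi_eq_iff: "cis (2 * pi * x) = cis (2 * pi * y) \<longleftrightarrow> x - y \<in> \<int>"
proof -
  have "cis (2 * pi * x) = cis (2 * pi * y) \<longleftrightarrow> cis (2 * pi * (x - y)) = 1"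
    by (simp add: right_diff_distrib cis_divide[symmetric])
  also have "\<dots> \<longleftrightarrow> (\<exists>n::int. 2 * pi * (x - y) = of_int (2 * n) * pi)"
    unfolding cis_conv_exp exp_eq_1 by simp
  also have "\<dots> \<longleftrightarrow> x - y \<in> \<int>" by (auto elim!: Ints_cases)
  finally show ?thesis .
qed

text \<open>The roots are the points with angle (k + u) / l for integers k. The arc, open at the
  left and closed at the right, selects the integers strictly above one floor and up to another; as
  its length is at most one turn, different k give different points.\<close>

lemma arc_roots_cis:
  assumes l: "l \<ge> 1" and ab: "a < b" "b \<le> a + 1"
  shows "real (arc_roots l (cis (2 * pi * u)) a b) = real l * (b - a) + frac (real l * a - u) - frac (real l * b - u)"
proof -
  define K where "K = {\<lfloor>real l * a - u\<rfloor><..\<lfloor>real l * b - u\<rfloor>}"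
  define g where "g k = cis (2 * pi * ((of_int k + u) / real l))" for k :: int
  have l0: "real l > 0" using l by simp
  have rng: "a < (of_int k + u) / real l \<and> (of_int k + u) / real l \<le> b \<longleftrightarrow> k \<in> K" for k
  proof -
    have "a < (of_int k + u) / real l \<longleftrightarrow> real l * a - u < of_int k" using l0 by (simp add: field_simps)
    moreover have "(of_int k + u) / real l \<le> b \<longleftrightarrow> of_int k \<le> real l * b - u" using l0 by (simp add: field_simps)
    ultimately show ?thesis by (simp add: K_def floor_less_iff le_floor_iff)
  qed
  have "{x \<in> circle_arc a b. x ^ l = cis (2 * pi * u)} = g ` K"
  proof
    show "{x \<in> circle_arc a b. x ^ l = cis (2 * pi * u)} \<subseteq> g ` K"
    proof
      fix x assume "x \<in> {x \<in> circle_arc a b. x ^ l = cis (2 * pi * u)}"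
      then obtain y where y: "a < y" "y \<le> b" "x = cis (2 * pi * y)" and "x ^ l = cis (2 * pi * u)"
        by (auto simp: circle_arc_def)
      then have "cis (real l * (2 * pi * y)) = cis (2 * pi * u)" by (simp only: Complex.DeMoivre[symmetric])
      then have "cis (2 * pi * (real l * y)) = cis (2 * pi * u)" by (simp only: mult_ac)
      then obtain k where k: "real l * y - u = of_int k" unfolding cis_2pi_eq_iff by (auto elim: Ints_cases)
      then have "y = (of_int k + u) / real l" using l0 by (simp add: field_simps)
      then show "x \<in> g ` K" using y rng[of k] by (auto simp: g_def)
    qed
    show "g ` K \<subseteq> {x \<in> circle_arc a b. x ^ l = cis (2 * pi * u)}"
    proof
      fix x assume "x \<in> g ` K"
      then obtain k where k: "k \<in> K" "x = g k" by auto
      have "x \<in> circle_arc a b" unfolding k(2) circle_arc_def g_def by (rule imageI) (use rng[of k] k(1) in simp)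
      moreover have "g k ^ l = cis (2 * pi * (of_int k + u))" unfolding g_def Complex.DeMoivre using l0 by simp
      moreover have "cis (2 * pi * (of_int k + u)) = cis (2 * pi * u)" unfolding cis_2pi_eq_iff by simp
      ultimately show "x \<in> {x \<in> circle_arc a b. x ^ l = cis (2 * pi * u)}" using k by simp
    qed
  qed
  moreover have "inj_on g K"
  proof (rule inj_onI)
    fix k k' assume k: "k \<in> K" "k' \<in> K" and e: "g k = g k'"
    define y where "y = (of_int k + u) / real l"
    define y' where "y' = (of_int k' + u) / real l"
    have "a < y" "y \<le> b" "a < y'" "y' \<le> b" using rng[of k] rng[of k'] k by (auto simp: y_def y'_def)
    then have "\<bar>y - y'\<bar> < 1" using ab by linarith
    moreover have "y - y' \<in> \<int>" using e unfolding g_def cis_2pi_eq_iff by (simp add: y_def y'_def)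
    ultimately have "y - y' = 0" by (metis Ints_nonzero_abs_ge1 not_less)
    then show "k = k'" using l0 by (simp add: y_def y'_def)
  qed
  ultimately have "arc_roots l (cis (2 * pi * u)) a b = card K"
    by (simp add: arc_roots_def card_image)
  moreover have "real l * a - u \<le> real l * b - u" using ab l0 by simp
  then have "\<lfloor>real l * a - u\<rfloor> \<le> \<lfloor>real l * b - u\<rfloor>" by (rule floor_mono)
  ultimately have "real (arc_roots l (cis (2 * pi * u)) a b) = of_int (\<lfloor>real l * b - u\<rfloor> - \<lfloor>real l * a - u\<rfloor>)"
    by (simp add: K_def)
  then show ?thesis by (simp add: frac_def algebra_simps)
qed

text \<open>The random weights have modulus 1 only almost surely. This value outside the circle
  makes the root count a function of all complex numbers whose measurability can be checked.\<close>

lemma arc_roots_off_circle: "cmod W \<noteq> 1 \<Longrightarrow> arc_roots l W a b = 0"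
proof -
  assume W: "cmod W \<noteq> 1"
  have "x ^ l \<noteq> W" if "x \<in> circle_arc a b" for x
  proof
    assume "x ^ l = W"
    then show False using W circle_arc_norm[OF that] by (auto simp: norm_power)
  qed
  then have "{x \<in> circle_arc a b. x ^ l = W} = {}" by auto
  then show ?thesis by (simp only: arc_roots_def card.empty)
qed

text \<open>Valid for every weight, not just on the circle, which makes the counts bounded pointwise
  and not merely almost surely.\<close>

lemma arc_roots_le: "l \<ge> 1 \<Longrightarrow> arc_roots l W a b \<le> l"
proof -
  assume l: "l \<ge> 1"
  define P where "P = Polynomial.monom 1 l - [:W:]"
  have deg: "degree P \<le> l" unfolding P_def by (intro degree_diff_le degree_monom_le) simp_all
  have "coeff P l = 1" using l by (cases l) (simp_all add: P_def)
  then have P0: "P \<noteq> 0" by auto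
  have "arc_roots l W a b \<le> card {x. poly P x = 0}"
    unfolding arc_roots_def by (intro card_mono poly_roots_finite P0) (auto simp: P_def poly_monom)
  also have "\<dots> \<le> degree P" by (rule card_poly_roots_bound[OF P0])
  finally show ?thesis using deg by simp
qed

section \<open>Almost periodic averages\<close>

text \<open>Generic in the underlying type, as it is used twice: for powers of unimodular numbers on
  the naturals, and for characters on a Euclidean space.\<close>

inductive_set char_span :: "('b \<Rightarrow> complex) set \<Rightarrow> ('b \<Rightarrow> complex) set" for X where
  char: "\<xi> \<in> X \<Longrightarrow> (\<lambda>x. c * \<xi> x) \<in> char_span X"
| add: "f \<in> char_span X \<Longrightarrow> g \<in> char_span X \<Longrightarrow> (\<lambda>x. f x + g x) \<in> char_span X"

lemma char_span_cmult: "f \<in> char_span X \<Longrightarrow> (\<lambda>x. c * f x) \<in> char_span X"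
proof (induction rule: char_span.induct)
  case (char \<xi> d)
  then show ?case using char_span.char[of \<xi> X "c * d"] by (simp add: mult.assoc)
next
  case (add f g)
  then show ?case using char_span.add[of "\<lambda>x. c * f x" X "\<lambda>x. c * g x"] by (simp add: distrib_left)
qed

lemma char_span_mult:
  assumes X: "\<And>\<xi> \<zeta>. \<xi> \<in> X \<Longrightarrow> \<zeta> \<in> X \<Longrightarrow> (\<lambda>x. \<xi> x * \<zeta> x) \<in> X"
    and "f \<in> char_span X" "g \<in> char_span X"
  shows "(\<lambda>x. f x * g x) \<in> char_span X"
  using assms(2)
proof (induction rule: char_span.induct)
  case (char \<xi> c)
  have "(\<lambda>x. \<xi> x * g x) \<in> char_span X"
    using assms(3)
  proof (induction rule: char_span.induct)
    case (char \<zeta> d)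
    then show ?case using char_span.char[OF X[OF \<open>\<xi> \<in> X\<close> char], of d] by (simp add: mult_ac)
  next
    case (add f g)
    then show ?case using char_span.add[of "\<lambda>x. \<xi> x * f x" X "\<lambda>x. \<xi> x * g x"] by (simp add: distrib_left)
  qed
  then show ?case using char_span_cmult[of "\<lambda>x. \<xi> x * g x" X c] by (simp add: mult.assoc)
next
  case (add f h)
  then show ?case using char_span.add[of "\<lambda>x. f x * g x" X "\<lambda>x. h x * g x"] by (simp add: distrib_right)
qed

lemma char_span_bounded:
  assumes "f \<in> char_span X" and X: "\<And>\<xi> x. \<xi> \<in> X \<Longrightarrow> cmod (\<xi> x) \<le> 1"
  shows "\<exists>K\<ge>0. \<forall>x. cmod (f x) \<le> K"
  using assms(1)
proof (induction rule: char_span.induct)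
  case (char \<xi> c)
  have "cmod (c * \<xi> x) \<le> cmod c" for x
    using mult_left_mono[OF X[OF char, of x], of "cmod c"] by (simp add: norm_mult)
  then show ?case by (intro exI[of _ "cmod c"]) simp
next
  case (add f g)
  then obtain K L where "K \<ge> 0" "L \<ge> 0" "\<And>x. cmod (f x) \<le> K" "\<And>x. cmod (g x) \<le> L" by blast
  then show ?case by (intro exI[of _ "K + L"]) (auto intro: norm_triangle_mono)
qed

text \<open>When the characters are closed under multiplication and contain 1, their span is an
  algebra with unit. It then contains each polynomial in functions that it contains, so a
  Stone-Weierstrass polynomial becomes a trigonometric one.\<close>

lemma char_span_real_polynomial:
  fixes s :: "'b \<Rightarrow> 'c::euclidean_space"
  assumes "real_polynomial_function g"
    and X: "\<And>\<xi> \<zeta>. \<xi> \<in> X \<Longrightarrow> \<zeta> \<in> X \<Longrightarrow> (\<lambda>x. \<xi> x * \<zeta> x) \<in> X" and one: "(\<lambda>x. 1) \<in> X"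
    and lin: "\<And>b. b \<in> Basis \<Longrightarrow> (\<lambda>x. of_real (inner (s x) b)) \<in> char_span X"
  shows "(\<lambda>x. of_real (g (s x))) \<in> char_span X"
  using assms(1)
proof (induction rule: real_polynomial_function.induct)
  case (linear f)
  have zero: "(\<lambda>x. 0) \<in> char_span X" using char_span.char[OF one, of 0] by simp
  have *: "(\<lambda>x. \<Sum>b\<in>S. of_real (inner (s x) b * f b)) \<in> char_span X" if "finite S" "S \<subseteq> Basis" for S
    using that
  proof (induction S rule: finite_induct)
    case (insert b S)
    have "(\<lambda>x. of_real (inner (s x) b * f b)) \<in> char_span X"
      using char_span_cmult[OF lin[of b], of "of_real (f b)"] insert by (simp add: mult.commute)
    then show ?case using insert char_span.add by simp
  qed (simp add: zero)
  have "f (s x) = (\<Sum>b\<in>Basis. inner (s x) b * f b)" for x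
  proof -
    have "f (s x) = f (\<Sum>b\<in>Basis. inner (s x) b *\<^sub>R b)" by (simp add: euclidean_representation)
    also have "\<dots> = (\<Sum>b\<in>Basis. inner (s x) b * f b)"
      using linear by (simp add: linear_sum linear_simps bounded_linear.linear)
    finally show ?thesis .
  qed
  then show ?case using *[of Basis] by simp
next
  case (const c)
  then show ?case using char_span.char[OF one, of "of_real c"] by simp
next
  case (add f g)
  then show ?case using char_span.add by fastforce
next
  case (mult f g)
  then show ?case using char_span_mult[OF X] by fastforce
qed

definition unit_powers :: "(nat \<Rightarrow> complex) set" where
  "unit_powers = {\<lambda>j. w ^ j | w. cmod w = 1}"

lemma unit_powers_mult: "\<xi> \<in> unit_powers \<Longrightarrow> \<zeta> \<in> unit_powers \<Longrightarrow> (\<lambda>x. \<xi> x * \<zeta> x) \<in> unit_powers"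
  unfolding unit_powers_def
proof clarify
  fix w v :: complex assume "cmod w = 1" "cmod v = 1"
  then show "\<exists>u. (\<lambda>j. w ^ j * v ^ j) = (\<lambda>j. u ^ j) \<and> cmod u = 1"
    by (intro exI[of _ "w * v"]) (simp add: power_mult_distrib norm_mult)
qed

lemma unit_powers_norm: "\<xi> \<in> unit_powers \<Longrightarrow> cmod (\<xi> j) \<le> 1"
  by (auto simp: unit_powers_def norm_power)

lemma unit_powers_one: "(\<lambda>j. 1) \<in> unit_powers"
  unfolding unit_powers_def by (rule CollectI, rule exI[of _ 1]) (simp add: fun_eq_iff)

text \<open>For w \<noteq> 1 the geometric sums stay bounded and the average tends to 0; for w = 1
  the summand is constant.\<close>

lemma char_span_mean:
  assumes "f \<in> char_span unit_powers"
  shows "\<exists>L. (\<lambda>N. (\<Sum>j=1..N. f j) / of_nat N) \<longlonglongrightarrow> L"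
  using assms
proof (induction rule: char_span.induct)
  case (char \<xi> c)
  then obtain w where w: "\<xi> = (\<lambda>j. w ^ j)" "cmod w = 1" by (auto simp: unit_powers_def)
  show ?case
  proof (cases "w = 1")
    case True
    have "eventually (\<lambda>N. c = (\<Sum>j=1..N. c * \<xi> j) / of_nat N) sequentially"
      using eventually_gt_at_top[of 0] by eventually_elim (simp add: w True)
    then show ?thesis by (intro exI[of _ c]) (rule Lim_transform_eventually[OF tendsto_const])
  next
    case False
    define K where "K = cmod c * (2 / cmod (1 - w))"
    have bnd: "cmod (\<Sum>j=1..N. c * \<xi> j) \<le> K" for N
    proof -
      have "(\<Sum>j=1..N. c * \<xi> j) = c * (\<Sum>j=1..N. w ^ j)" by (simp add: w sum_distrib_left)
      moreover
      have "(1 - w) * (\<Sum>j=1..N. w ^ j) = w - w ^ Suc N"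
      proof (induction N)
        case (Suc N)
        have "(\<Sum>j=1..Suc N. w ^ j) = (\<Sum>j=1..N. w ^ j) + w ^ Suc N" by simp
        then show ?case unfolding distrib_left by (simp only: distrib_left Suc) (simp add: left_diff_distrib)
      qed simp
      then have "(\<Sum>j=1..N. w ^ j) = (w - w ^ Suc N) / (1 - w)"
        using False by (simp add: eq_divide_eq mult.commute)
      ultimately have "cmod (\<Sum>j=1..N. c * \<xi> j) = cmod c * (cmod (w - w ^ Suc N) / cmod (1 - w))"
        by (simp add: norm_mult norm_divide)
      also have "\<dots> \<le> K"
        unfolding K_def using norm_triangle_ineq4[of w "w ^ Suc N"] w
        by (intro mult_left_mono divide_right_mono) (auto simp: norm_mult norm_power)
      finally show ?thesis .
    qed
    have "(\<lambda>N. K / real N) \<longlonglongrightarrow> 0" by (rule lim_const_over_n)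
    then have "(\<lambda>N. (\<Sum>j=1..N. c * \<xi> j) / of_nat N) \<longlonglongrightarrow> 0"
      by (rule Lim_null_comparison[rotated]) (use bnd in \<open>simp add: norm_divide divide_right_mono\<close>)
    then show ?thesis by blast
  qed
next
  case (add f g)
  then obtain L M where "(\<lambda>N. (\<Sum>j=1..N. f j) / of_nat N) \<longlonglongrightarrow> L" "(\<lambda>N. (\<Sum>j=1..N. g j) / of_nat N) \<longlonglongrightarrow> M" by blast
  from tendsto_add[OF this] show ?case by (intro exI[of _ "L + M"]) (simp add: sum.distrib add_divide_distrib)
qed

text \<open>Approximation in the mean, because the jump of the fractional part rules out uniform
  approximation in general. Boundedness is included so that products remain in the class.\<close>

definition almost_periodic :: "(nat \<Rightarrow> real) \<Rightarrow> bool" where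
  "almost_periodic f \<longleftrightarrow> (\<exists>K. \<forall>j. \<bar>f j\<bar> \<le> K) \<and> (\<forall>\<epsilon>>0. \<exists>P\<in>char_span unit_powers.
     eventually (\<lambda>N. (\<Sum>j=1..N. cmod (of_real (f j) - P j)) / real N \<le> \<epsilon>) sequentially)"

text \<open>The mean \<open>L\<close> of the approximating sum changes with the accuracy, so no
  limit is at hand; the Cauchy property follows by comparing two averages through the same
  \<open>L\<close>.\<close>

lemma almost_periodic_mean:
  assumes "almost_periodic f"
  shows "convergent (\<lambda>N. (\<Sum>j=1..N. f j) / real N)"
proof -
  have "Cauchy (\<lambda>N. (\<Sum>j=1..N. f j) / real N)"
  proof (rule CauchyI)
    fix e :: real assume e: "e > 0"
    then have "e / 4 > 0" by simp
    then obtain P where P: "P \<in> char_span unit_powers"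
      and ev: "eventually (\<lambda>N. (\<Sum>j=1..N. cmod (of_real (f j) - P j)) / real N \<le> e / 4) sequentially"
      using assms unfolding almost_periodic_def by blast
    obtain L where "(\<lambda>N. (\<Sum>j=1..N. P j) / of_nat N) \<longlonglongrightarrow> L" using char_span_mean[OF P] by blast
    then have "eventually (\<lambda>N. dist ((\<Sum>j=1..N. P j) / of_nat N) L < e / 4) sequentially"
      using e by (intro tendstoD) auto
    with ev have "eventually (\<lambda>N. dist (complex_of_real ((\<Sum>j=1..N. f j) / real N)) L < e / 2) sequentially"
    proof eventually_elim
      case (elim N)
      define A where "A = complex_of_real ((\<Sum>j=1..N. f j) / real N)"
      define B where "B = (\<Sum>j=1..N. P j) / of_nat N"
      have "A - B = (\<Sum>j=1..N. of_real (f j) - P j) / of_nat N"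
        unfolding A_def B_def sum_subtractf diff_divide_distrib by simp
      then have "dist A B = cmod (\<Sum>j=1..N. of_real (f j) - P j) / real N"
        unfolding dist_norm by (simp only: norm_divide norm_of_nat)
      also have "\<dots> \<le> (\<Sum>j=1..N. cmod (of_real (f j) - P j)) / real N"
        by (intro divide_right_mono norm_sum) simp
      also have "\<dots> \<le> e / 4" by (rule elim(1))
      finally have "dist A B \<le> e / 4" .
      moreover have "dist B L < e / 4" using elim(2) by (simp only: B_def)
      moreover have "dist A L \<le> dist A B + dist B L" by (rule dist_triangle)
      ultimately have "dist A L < e / 2" by simp
      then show ?case by (simp only: A_def)
    qed
    then obtain M where M: "\<And>N. N \<ge> M \<Longrightarrow> dist (complex_of_real ((\<Sum>j=1..N. f j) / real N)) L < e / 2"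
      unfolding eventually_sequentially by blast
    show "\<exists>M. \<forall>m\<ge>M. \<forall>n\<ge>M. norm ((\<Sum>j=1..m. f j) / real m - (\<Sum>j=1..n. f j) / real n) < e"
    proof (intro exI allI impI)
      fix m n assume mn: "m \<ge> M" "n \<ge> M"
      have "dist (complex_of_real ((\<Sum>j=1..m. f j) / real m)) (complex_of_real ((\<Sum>j=1..n. f j) / real n)) < e"
        by (rule dist_triangle_half_l[OF M[OF mn(1)] M[OF mn(2)]])
      then show "norm ((\<Sum>j=1..m. f j) / real m - (\<Sum>j=1..n. f j) / real n) < e"
        unfolding dist_norm of_real_diff[symmetric] norm_of_real real_norm_def .
    qed
  qed
  then show ?thesis by (rule Cauchy_convergent)
qed

lemma almost_periodic_approx:
  assumes K: "\<And>j. \<bar>f j\<bar> \<le> K"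
    and P: "\<And>\<epsilon>. \<epsilon> > 0 \<Longrightarrow> \<exists>P\<in>char_span unit_powers.
     eventually (\<lambda>N. (\<Sum>j=1..N. cmod (of_real (f j) - P j)) / real N \<le> \<epsilon>) sequentially"
  shows "almost_periodic f"
  unfolding almost_periodic_def using K P by (intro conjI exI[of _ K] allI impI)

lemma almost_periodic_add:
  assumes f: "almost_periodic f" and g: "almost_periodic g"
  shows "almost_periodic (\<lambda>j. f j + g j)"
proof -
  obtain K L where K: "\<And>j. \<bar>f j\<bar> \<le> K" and L: "\<And>j. \<bar>g j\<bar> \<le> L"
    using f g unfolding almost_periodic_def by blast
  show ?thesis
  proof (rule almost_periodic_approx)
    fix j show "\<bar>f j + g j\<bar> \<le> K + L" using K[of j] L[of j] by linarith
  next
    fix e :: real assume "e > 0"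
    then have e: "e / 2 > 0" by simp
    obtain P where P: "P \<in> char_span unit_powers"
      and evP: "eventually (\<lambda>N. (\<Sum>j=1..N. cmod (of_real (f j) - P j)) / real N \<le> e / 2) sequentially"
      using f e unfolding almost_periodic_def by blast
    obtain R where R: "R \<in> char_span unit_powers"
      and evR: "eventually (\<lambda>N. (\<Sum>j=1..N. cmod (of_real (g j) - R j)) / real N \<le> e / 2) sequentially"
      using g e unfolding almost_periodic_def by blast
    show "\<exists>P\<in>char_span unit_powers.
      eventually (\<lambda>N. (\<Sum>j=1..N. cmod (of_real (f j + g j) - P j)) / real N \<le> e) sequentially"
    proof (rule bexI[OF _ char_span.add[OF P R]])
      show "eventually (\<lambda>N. (\<Sum>j=1..N. cmod (of_real (f j + g j) - (P j + R j))) / real N \<le> e) sequentially"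
        using evP evR
      proof eventually_elim
        case (elim N)
        have "(\<Sum>j=1..N. cmod (of_real (f j + g j) - (P j + R j)))
            \<le> (\<Sum>j=1..N. cmod (of_real (f j) - P j) + cmod (of_real (g j) - R j))"
          by (intro sum_mono) (metis norm_diff_triangle_ineq of_real_add)
        then have "(\<Sum>j=1..N. cmod (of_real (f j + g j) - (P j + R j))) / real N
            \<le> (\<Sum>j=1..N. cmod (of_real (f j) - P j)) / real N + (\<Sum>j=1..N. cmod (of_real (g j) - R j)) / real N"
          unfolding sum.distrib add_divide_distrib[symmetric] by (intro divide_right_mono) auto
        then show ?case using elim by linarith
      qed
    qed
  qed
qed

lemma almost_periodic_mult:
  assumes f: "almost_periodic f" and g: "almost_periodic g"
  shows "almost_periodic (\<lambda>j. f j * g j)"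
proof -
  obtain K L where K: "\<And>j. \<bar>f j\<bar> \<le> K" and L: "\<And>j. \<bar>g j\<bar> \<le> L"
    using f g unfolding almost_periodic_def by blast
  have K0: "K \<ge> 0" and L0: "L \<ge> 0" using K[of 0] L[of 0] by linarith+
  show ?thesis
  proof (rule almost_periodic_approx)
    fix j show "\<bar>f j * g j\<bar> \<le> K * L" unfolding abs_mult using K[of j] L[of j] K0 by (intro mult_mono) auto
  next
    fix e :: real assume e: "e > 0"
    then have e1: "e / (2 * (L + 1)) > 0" using L0 by simp
    obtain P where P: "P \<in> char_span unit_powers"
      and evP: "eventually (\<lambda>N. (\<Sum>j=1..N. cmod (of_real (f j) - P j)) / real N \<le> e / (2 * (L + 1))) sequentially"
      using f e1 unfolding almost_periodic_def by blast
    obtain C where C: "C \<ge> 0" "\<And>j. cmod (P j) \<le> C"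
    proof -
      have "\<exists>K\<ge>0. \<forall>x. cmod (P x) \<le> K" by (rule char_span_bounded[OF P]) (rule unit_powers_norm)
      then show ?thesis using that by blast
    qed
    \<comment> \<open>The second factor is approximated after the first, since its accuracy must be
      scaled by the bound \<open>C\<close> for \<open>P\<close>. Adding 1 keeps the denominators
      positive.\<close>
    have e2: "e / (2 * (C + 1)) > 0" using C e by simp
    obtain R where R: "R \<in> char_span unit_powers"
      and evR: "eventually (\<lambda>N. (\<Sum>j=1..N. cmod (of_real (g j) - R j)) / real N \<le> e / (2 * (C + 1))) sequentially"
      using g e2 unfolding almost_periodic_def by blast
    show "\<exists>P\<in>char_span unit_powers.
      eventually (\<lambda>N. (\<Sum>j=1..N. cmod (of_real (f j * g j) - P j)) / real N \<le> e) sequentially"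
    proof (rule bexI[of _ "\<lambda>j. P j * R j"])
      show "(\<lambda>j. P j * R j) \<in> char_span unit_powers"
        by (rule char_span_mult[of unit_powers, OF _ P R]) (rule unit_powers_mult)
      show "eventually (\<lambda>N. (\<Sum>j=1..N. cmod (of_real (f j * g j) - (P j * R j))) / real N \<le> e) sequentially"
        using evP evR
      proof eventually_elim
        case (elim N)
        have "(\<Sum>j=1..N. cmod (of_real (f j * g j) - (P j * R j)))
            \<le> (\<Sum>j=1..N. L * cmod (of_real (f j) - P j) + C * cmod (of_real (g j) - R j))"
        proof (intro sum_mono)
          fix j
          have "of_real (f j * g j) - (P j * R j) = (of_real (f j) - P j) * of_real (g j) + P j * (of_real (g j) - R j)"
            by (simp add: algebra_simps)
          then have "cmod (of_real (f j * g j) - (P j * R j))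
              \<le> cmod (of_real (f j) - P j) * \<bar>g j\<bar> + cmod (P j) * cmod (of_real (g j) - R j)"
            by (metis norm_triangle_ineq norm_mult norm_of_real)
          also have "\<dots> \<le> cmod (of_real (f j) - P j) * L + C * cmod (of_real (g j) - R j)"
            using L[of j] C(2)[of j] by (intro add_mono mult_left_mono mult_right_mono) auto
          finally show "cmod (of_real (f j * g j) - (P j * R j))
              \<le> L * cmod (of_real (f j) - P j) + C * cmod (of_real (g j) - R j)" by (simp add: mult.commute)
        qed
        then have "(\<Sum>j=1..N. cmod (of_real (f j * g j) - (P j * R j))) / real N
            \<le> L * ((\<Sum>j=1..N. cmod (of_real (f j) - P j)) / real N) + C * ((\<Sum>j=1..N. cmod (of_real (g j) - R j)) / real N)"
          unfolding sum.distrib sum_distrib_left[symmetric] times_divide_eq_right add_divide_distrib[symmetric]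
          by (intro divide_right_mono) auto
        also have "\<dots> \<le> L * (e / (2 * (L + 1))) + C * (e / (2 * (C + 1)))"
          using elim L0 C(1) by (intro add_mono mult_left_mono) auto
        also have "\<dots> \<le> e / 2 + e / 2"
          using L0 C(1) e by (intro add_mono) (simp_all add: field_simps)
        finally show ?case by simp
      qed
    qed
  qed
qed

lemma almost_periodic_const: "almost_periodic (\<lambda>j. c)"
proof (rule almost_periodic_approx[of _ "\<bar>c\<bar>"])
  fix e :: real assume "e > 0"
  then show "\<exists>P\<in>char_span unit_powers.
      eventually (\<lambda>N. (\<Sum>j=1..N. cmod (of_real c - P j)) / real N \<le> e) sequentially"
  proof (intro bexI[OF _ char_span.char[OF unit_powers_one, of "of_real c"]])
    have "(\<Sum>j=1..N. cmod (of_real c - of_real c * 1)) / real N \<le> e" for N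
      using \<open>e > 0\<close> by simp
    then show "eventually (\<lambda>N. (\<Sum>j=1..N. cmod (of_real c - of_real c * 1)) / real N \<le> e) sequentially"
      by (intro always_eventually allI)
  qed
qed simp

lemma almost_periodic_diff:
  "almost_periodic f \<Longrightarrow> almost_periodic g \<Longrightarrow> almost_periodic (\<lambda>j. f j - g j)"
  using almost_periodic_add[of f "\<lambda>j. - 1 * g j"] almost_periodic_mult[OF almost_periodic_const[of "-1"], of g] by simp

text \<open>Two points further than D apart never share a block of D + 1 consecutive
  integers.\<close>

lemma spaced_card_le:
  assumes S: "S \<subseteq> {1..N}" and gap: "\<And>i j. i \<in> S \<Longrightarrow> j \<in> S \<Longrightarrow> i < j \<Longrightarrow> j - i > D"
  shows "card S \<le> N div Suc D + 1"
proof -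
  have "inj_on (\<lambda>j. j div Suc D) S"
  proof (rule inj_onI, rule ccontr)
    fix i j assume ij: "i \<in> S" "j \<in> S" "i div Suc D = j div Suc D" "i \<noteq> j"
    have "i = Suc D * (j div Suc D) + i mod Suc D" "j = Suc D * (j div Suc D) + j mod Suc D"
      using ij(3) by (metis mult_div_mod_eq)+
    moreover have "i mod Suc D < Suc D" "j mod Suc D < Suc D" by simp_all
    ultimately have "i < j + Suc D" "j < i + Suc D" by linarith+
    then show False using gap[of i j] gap[of j i] ij by (cases "i < j") auto
  qed
  moreover have "(\<lambda>j. j div Suc D) ` S \<subseteq> {0..N div Suc D}" using S by (auto intro!: div_le_mono dest: subsetD)
  ultimately have "card S \<le> card {0..N div Suc D}" by (rule card_inj_on_le) simp
  then show ?thesis by simp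
qed

text \<open>If \<open>w\<^sup>i\<close> and \<open>w\<^sup>j\<close> are both close to 1 then so is \<open>w\<close> to the power \<open>j - i\<close>; hence the times at
  which the orbit meets a small punctured neighbourhood of 1 have small density.\<close>

lemma near_one_spaced:
  assumes w: "cmod w = 1"
  obtains \<delta> where "\<delta> > 0"
    "\<And>i j. i < j \<Longrightarrow> 0 < cmod (w ^ i - 1) \<Longrightarrow> cmod (w ^ i - 1) < \<delta> \<Longrightarrow> 0 < cmod (w ^ j - 1) \<Longrightarrow> cmod (w ^ j - 1) < \<delta> \<Longrightarrow> j - i > D"
proof (cases "\<exists>q\<ge>1. w ^ q = 1")
  case True
  then obtain q where q: "q \<ge> 1" "w ^ q = 1" by blast
  \<comment> \<open>For a root of unity the powers take finitely many values, and a radius below the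
    smallest positive distance leaves no time at all to be spaced. Inserting 1 keeps the set
    nonempty.\<close>
  define V where "V = insert 1 ((\<lambda>i. cmod (w ^ i - 1)) ` {..<q} - {0})"
  have fin: "finite V" by (simp add: V_def)
  have pos: "Min V > 0" using fin by (subst Min_gr_iff) (auto simp: V_def)
  have no: "\<not> cmod (w ^ i - 1) < Min V" if "0 < cmod (w ^ i - 1)" for i
  proof -
    have "w ^ i = w ^ (q * (i div q)) * w ^ (i mod q)" by (simp flip: power_add)
    then have "w ^ i = w ^ (i mod q)" by (simp add: power_mult q)
    then have "cmod (w ^ i - 1) \<in> V" using that q by (auto simp: V_def)
    then show ?thesis using fin by (simp add: not_less)
  qed
  show ?thesis using that[OF pos] no by blast
next
  case False
  define V where "V = insert 1 ((\<lambda>i. cmod (w ^ i - 1)) ` {1..D})"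
  have fin: "finite V" by (simp add: V_def)
  have "Min V > 0" using fin False by (subst Min_gr_iff) (auto simp: V_def)
  \<comment> \<open>Half of the minimum, because the distances of the two powers to 1 are added by
    the triangle inequality.\<close>
  then have pos: "Min V / 2 > 0" by simp
  show ?thesis
  proof (rule that[OF pos], rule ccontr)
    fix i j assume ij: "i < j" "cmod (w ^ i - 1) < Min V / 2" "cmod (w ^ j - 1) < Min V / 2" "\<not> j - i > D"
    then have "cmod (w ^ (j - i) - 1) \<in> V" by (auto simp: V_def)
    then have "Min V \<le> cmod (w ^ (j - i) - 1)" using fin by simp
    also have "\<dots> = cmod (w ^ i) * cmod (w ^ (j - i) - 1)" using w by (simp add: norm_power)
    also have "\<dots> = cmod (w ^ j - w ^ i)" using ij(1) by (simp add: right_diff_distrib flip: norm_mult power_add)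
    also have "\<dots> \<le> cmod (w ^ j - 1) + cmod (w ^ i - 1)"
      using norm_triangle_ineq4[of "w ^ j - 1" "w ^ i - 1"] by simp
    finally show False using ij by linarith
  qed
qed

lemma Arg2pi_cis: "Arg2pi (cis (2 * pi * x)) = 2 * pi * frac x"
proof (rule Arg2pi_unique[of 1])
  have "cis (2 * pi * x) = cis (2 * pi * frac x + 2 * pi * of_int \<lfloor>x\<rfloor>)"
    by (simp add: frac_def algebra_simps)
  also have "\<dots> = cis (2 * pi * frac x)" by (subst cis_mult[symmetric]) simp
  finally show "of_real 1 * exp (\<i> * of_real (2 * pi * frac x)) = cis (2 * pi * x)"
    by (simp add: cis_conv_exp)
qed (use frac_ge_0[of x] frac_lt_1[of x] in auto)

text \<open>The damping factor removes the jump of the argument at 1.\<close>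

definition damped_arg :: "real \<Rightarrow> complex \<Rightarrow> real" where
  "damped_arg \<delta> z = min 1 (cmod (z - 1) / \<delta>) * (Arg2pi z / (2 * pi))"

text \<open>On the circle the argument is discontinuous at 1 only, and there the damping factor
  tends to 0 while the argument stays bounded.\<close>

lemma continuous_damped_arg:
  assumes d: "\<delta> > 0"
  shows "continuous_on (sphere 0 1) (damped_arg \<delta>)"
  unfolding continuous_on_eq_continuous_within
proof
  fix z :: complex assume z: "z \<in> sphere 0 1"
  show "continuous (at z within sphere 0 1) (damped_arg \<delta>)"
  proof (cases "z = 1")
    case False
    have "z \<notin> \<real>\<^sub>\<ge>\<^sub>0"
    proof
      assume "z \<in> \<real>\<^sub>\<ge>\<^sub>0"
      then obtain r where "z = of_real r" "r \<ge> 0" by (auto simp: nonneg_Reals_def)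
      then show False using z False by simp
    qed
    then have "continuous (at z) Arg2pi" by (rule continuous_at_Arg2pi)
    then have "continuous (at z) (damped_arg \<delta>)"
      unfolding damped_arg_def using d by (intro continuous_intros) auto
    then show ?thesis by (rule continuous_at_imp_continuous_at_within)
  next
    case True
    have "(\<lambda>y. cmod (y - 1) / \<delta>) \<midarrow>1\<rightarrow> cmod (1 - 1) / \<delta>" using d by (intro tendsto_intros) auto
    then have "(\<lambda>y. cmod (y - 1) / \<delta>) \<midarrow>1\<rightarrow> 0" by simp
    moreover have "norm (damped_arg \<delta> y) \<le> cmod (y - 1) / \<delta>" for y
    proof -
      have A: "0 \<le> Arg2pi y / (2 * pi)" "Arg2pi y / (2 * pi) \<le> 1"
        using Arg2pi_ge_0[of y] Arg2pi_lt_2pi[of y] by (simp_all add: divide_le_eq less_imp_le)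
      have m: "0 \<le> min 1 (cmod (y - 1) / \<delta>)" "min 1 (cmod (y - 1) / \<delta>) \<le> cmod (y - 1) / \<delta>" using d by auto
      have "damped_arg \<delta> y \<le> (cmod (y - 1) / \<delta>) * 1"
        unfolding damped_arg_def using A m by (intro mult_mono) auto
      moreover have "0 \<le> damped_arg \<delta> y" unfolding damped_arg_def using A m by (intro mult_nonneg_nonneg)
      ultimately show ?thesis by simp
    qed
    ultimately have "damped_arg \<delta> \<midarrow>1\<rightarrow> 0"
      by (intro Lim_null_comparison[of "damped_arg \<delta>"]) (auto intro: always_eventually)
    then have "continuous (at 1) (damped_arg \<delta>)" by (simp add: continuous_at damped_arg_def[of _ 1])
    then show ?thesis using True by (simp add: continuous_at_imp_continuous_at_within)
  qed
qed

text \<open>The fractional part is the normalized argument of \<open>w ^ j\<close>. Its damped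
  version is continuous on the circle, hence close to a polynomial in the coordinates of
  \<open>w ^ j\<close>; damping changes the value only at the rare times in \<open>bad\<close>.
  Rational and irrational \<open>s\<close> need no distinction here. The errors are e / 2 from the
  polynomial, e / 4 from the density and 1 / N, at most e / 4 for large N.\<close>

lemma almost_periodic_frac: "almost_periodic (\<lambda>j. frac (real j * s))"
proof (rule almost_periodic_approx[of _ 1])
  fix j show "\<bar>frac (real j * s)\<bar> \<le> 1" using frac_ge_0[of "real j * s"] frac_lt_1[of "real j * s"] by simp
next
  fix e :: real assume e: "e > 0"
  define w where "w = cis (2 * pi * s)"
  have w: "cmod w = 1" by (simp add: w_def)
  have wj: "w ^ j = cis (2 * pi * (real j * s))" for j
    unfolding w_def Complex.DeMoivre by (simp add: mult_ac)
  obtain D :: nat where D: "4 / e < real D" using reals_Archimedean2 by blast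
  obtain \<delta> where d: "\<delta> > 0" and gap: "\<And>i j. i < j \<Longrightarrow> 0 < cmod (w ^ i - 1) \<Longrightarrow> cmod (w ^ i - 1) < \<delta>
      \<Longrightarrow> 0 < cmod (w ^ j - 1) \<Longrightarrow> cmod (w ^ j - 1) < \<delta> \<Longrightarrow> j - i > D"
    using near_one_spaced[OF w, of D] by blast
  obtain g where g: "real_polynomial_function g" "\<And>z. z \<in> sphere 0 1 \<Longrightarrow> \<bar>damped_arg \<delta> z - g z\<bar> < e / 2"
    using Stone_Weierstrass_real_polynomial_function[OF compact_sphere continuous_damped_arg[OF d], of "e / 2"] e by auto
  define P where "P j = complex_of_real (g (w ^ j))" for j
  have P: "P \<in> char_span unit_powers"
    unfolding P_def
  proof (rule char_span_real_polynomial[OF g(1) unit_powers_mult unit_powers_one])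
    fix b :: complex assume "b \<in> Basis"
    then have b: "b = 1 \<or> b = \<i>" by (auto simp: Basis_complex_def)
    have u: "(\<lambda>j. w ^ j) \<in> unit_powers" "(\<lambda>j. cnj w ^ j) \<in> unit_powers" using w by (auto simp: unit_powers_def)
    have re: "(\<lambda>j. 1/2 * w ^ j + 1/2 * cnj w ^ j) \<in> char_span unit_powers"
      and im: "(\<lambda>j. (-\<i>/2) * w ^ j + (\<i>/2) * cnj w ^ j) \<in> char_span unit_powers"
      by (intro char_span.add char_span.char u)+
    have "of_real (inner (w ^ j) 1) = 1/2 * w ^ j + 1/2 * cnj w ^ j"
      "of_real (inner (w ^ j) \<i>) = (-\<i>/2) * w ^ j + (\<i>/2) * cnj w ^ j" for j
      by (simp_all add: complex_eq_iff inner_complex_def flip: complex_cnj_power)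
    then show "(\<lambda>j. of_real (inner (w ^ j) b)) \<in> char_span unit_powers" using b re im by auto
  qed
  \<comment> \<open>Times with \<open>w ^ j = 1\<close> are not bad: there the fractional part and
    its damped version both vanish.\<close>
  define bad where "bad N = {j \<in> {1..N}. 0 < cmod (w ^ j - 1) \<and> cmod (w ^ j - 1) < \<delta>}" for N
  have bad: "real (card (bad N)) \<le> real N * (e / 4) + 1" for N
  proof -
    have "card (bad N) \<le> N div Suc D + 1" by (rule spaced_card_le) (auto simp: bad_def intro: gap)
    then have "real (card (bad N)) \<le> real (N div Suc D) + 1" by linarith
    also have "real (N div Suc D) \<le> real N / real (Suc D)" by (rule of_nat_div_le_of_nat)
    also have "\<dots> = real N * (1 / real (Suc D))" by simp
    also have "\<dots> \<le> real N * (e / 4)"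
    proof (rule mult_left_mono)
      have "4 / e < real (Suc D)" using D by simp
      then show "1 / real (Suc D) \<le> e / 4" using e by (simp add: field_simps del: of_nat_Suc)
    qed simp
    finally show ?thesis by simp
  qed
  have close: "cmod (of_real (frac (real j * s)) - P j) \<le> e / 2 + (if 0 < cmod (w ^ j - 1) \<and> cmod (w ^ j - 1) < \<delta> then 1 else 0)" for j
  proof -
    have A: "Arg2pi (w ^ j) / (2 * pi) = frac (real j * s)" unfolding wj Arg2pi_cis by simp
    define f where "f = frac (real j * s)"
    have f: "0 \<le> f" "f < 1" unfolding f_def by (auto simp: frac_lt_1)
    define m where "m = min 1 (cmod (w ^ j - 1) / \<delta>)"
    have da: "damped_arg \<delta> (w ^ j) = m * f" unfolding damped_arg_def A m_def f_def by simp
    have "\<bar>f - m * f\<bar> \<le> (if 0 < cmod (w ^ j - 1) \<and> cmod (w ^ j - 1) < \<delta> then 1 else 0)"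
    proof (cases "0 < cmod (w ^ j - 1) \<and> cmod (w ^ j - 1) < \<delta>")
      case True
      have m: "0 \<le> m" "m \<le> 1" using d by (auto simp: m_def)
      have "m * f \<le> 1 * f" using m f by (intro mult_right_mono) auto
      moreover have "0 \<le> m * f" using m f by simp
      ultimately have "\<bar>f - m * f\<bar> \<le> 1" using f by linarith
      then show ?thesis using True by simp
    next
      case False
      then consider "cmod (w ^ j - 1) \<ge> \<delta>" | "w ^ j = 1" by fastforce
      then have "m * f = f"
      proof cases
        case 1
        then have "m = 1" using d by (simp add: m_def)
        then show ?thesis by simp
      next
        case 2
        have "Arg2pi 1 = 0" using Arg2pi_of_real[of 1] by simp
        then have "f = 0" using A 2 unfolding f_def by simp
        then show ?thesis by simp
      qed
      then show ?thesis using False by auto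
    qed
    moreover have "\<bar>m * f - g (w ^ j)\<bar> < e / 2" using g(2)[of "w ^ j"] w unfolding da by (simp add: norm_power)
    moreover have "cmod (of_real (frac (real j * s)) - P j) = \<bar>f - g (w ^ j)\<bar>"
      unfolding P_def f_def of_real_diff[symmetric] norm_of_real ..
    ultimately show ?thesis by linarith
  qed
  show "\<exists>P\<in>char_span unit_powers.
     eventually (\<lambda>N. (\<Sum>j=1..N. cmod (of_real (frac (real j * s)) - P j)) / real N \<le> e) sequentially"
  proof (rule bexI[OF _ P])
    obtain N0 :: nat where N0: "4 / e < real N0" using reals_Archimedean2 by blast
    show "eventually (\<lambda>N. (\<Sum>j=1..N. cmod (of_real (frac (real j * s)) - P j)) / real N \<le> e) sequentially"
      using eventually_ge_at_top[of N0]
    proof eventually_elim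
      case (elim N)
      have N: "4 / e < real N" "real N > 0" using elim N0 e
      proof -
        show "4 / e < real N" using N0 elim by (simp add: less_le_trans)
        moreover have "0 < 4 / e" using e by simp
        ultimately show "real N > 0" by linarith
      qed
      have "(\<Sum>j=1..N. cmod (of_real (frac (real j * s)) - P j))
          \<le> (\<Sum>j=1..N. e / 2 + (if 0 < cmod (w ^ j - 1) \<and> cmod (w ^ j - 1) < \<delta> then 1 else 0))"
        by (intro sum_mono close)
      also have "\<dots> = real N * (e / 2) + real (card (bad N))"
        by (simp add: sum.distrib bad_def sum.If_cases Int_def)
      also have "\<dots> \<le> real N * (e / 2) + (real N * (e / 4) + 1)" using bad[of N] by (intro add_left_mono)
      also have "\<dots> \<le> real N * e" using N e by (simp add: field_simps)
      finally show ?case using N by (simp add: field_simps)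
    qed
  qed
qed

section \<open>Existence and positivity of the limiting coefficients\<close>

lemma c_coeff_limit:
  "(\<lambda>N. (\<Sum>j=1..N. (frac (real j * s) - frac (real j * t)) * (frac (real j * u) - frac (real j * v))) / real N)
    \<longlonglongrightarrow> c_coeff s t u v"
proof -
  have "almost_periodic (\<lambda>j. (frac (real j * s) - frac (real j * t)) * (frac (real j * u) - frac (real j * v)))"
    by (intro almost_periodic_mult almost_periodic_diff almost_periodic_frac)
  from almost_periodic_mean[OF this] show ?thesis
    unfolding c_coeff_def convergent_LIMSEQ_iff by simp
qed

lemma almost_periodic_h: "almost_periodic (\<lambda>j. h_fun j x)"
  unfolding h_fun_def by (intro almost_periodic_mult almost_periodic_diff almost_periodic_frac almost_periodic_const)

lemma c_tilde_limit:
  "(\<lambda>N. (\<Sum>j=1..N. (h_fun j (t - u) + h_fun j (s - v) - h_fun j (s - u) - h_fun j (t - v)) / 2) / real N)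
    \<longlonglongrightarrow> c_tilde s t u v"
proof -
  have "almost_periodic (\<lambda>j. (1/2) * (h_fun j (t - u) + h_fun j (s - v) - h_fun j (s - u) - h_fun j (t - v)))"
    by (intro almost_periodic_mult almost_periodic_diff almost_periodic_add almost_periodic_h almost_periodic_const)
  from almost_periodic_mean[OF this] show ?thesis
    unfolding c_tilde_def convergent_LIMSEQ_iff by (simp add: sum_divide_distrib[symmetric] sum_distrib_left[symmetric])
qed

text \<open>Summing the lower bound over all adjacent pairs counts each interior term twice. The
  shift costs at most one extra term, which is at most 1 and disappears after division by N.\<close>

lemma mean_pos_of_adjacent_pairs:
  fixes y :: "nat \<Rightarrow> real"
  assumes L: "(\<lambda>N. (\<Sum>j=1..N. y j) / real N) \<longlonglongrightarrow> L" and K: "\<And>j. y j \<le> 1" and nn: "\<And>j. 0 \<le> y j"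
    and pair: "\<And>j. y j + y (Suc j) \<ge> \<kappa>" and \<kappa>: "\<kappa> > 0"
  shows "L > 0"
proof -
  have "(\<lambda>N. 2 * ((\<Sum>j=1..N. y j) / real N) + 1 / real N) \<longlonglongrightarrow> 2 * L + 0"
    by (intro tendsto_intros L lim_const_over_n)
  moreover have "eventually (\<lambda>N. \<kappa> \<le> 2 * ((\<Sum>j=1..N. y j) / real N) + 1 / real N) sequentially"
    using eventually_gt_at_top[of 0]
  proof eventually_elim
    case (elim N)
    have "real N * \<kappa> = (\<Sum>j=1..N. \<kappa>)" by simp
    also have "\<dots> \<le> (\<Sum>j=1..N. y j + y (Suc j))" by (intro sum_mono pair)
    also have "\<dots> = (\<Sum>j=1..N. y j) + (\<Sum>j=1..N. y (Suc j))" by (rule sum.distrib)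
    also have "(\<Sum>j=1..N. y (Suc j)) = (\<Sum>j=2..Suc N. y j)"
      by (rule sum.reindex_bij_witness[of _ "\<lambda>j. j - 1" Suc]) auto
    also have "\<dots> \<le> (\<Sum>j=1..Suc N. y j)" using nn by (intro sum_mono2) auto
    also have "\<dots> \<le> (\<Sum>j=1..N. y j) + 1" using K[of "Suc N"] by simp
    finally show ?case using elim by (simp add: field_simps)
  qed
  ultimately have "\<kappa> \<le> 2 * L + 0" by (rule tendsto_lowerbound) simp
  then show ?thesis using \<kappa> by simp
qed

text \<open>Consecutive values of \<open>y\<close> differ by an integer minus \<open>b - a\<close>,
  hence by at least the distance \<open>d\<close> of \<open>b - a\<close> from the integers, which
  is positive as 0 < b - a < 1. Two numbers that far apart have squares adding up to at least half
  the square of \<open>d\<close>.\<close>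

lemma c_coeff_pos:
  assumes "a < b" "b < a + 1"
  shows "c_coeff a b a b > 0"
proof (rule mean_pos_of_adjacent_pairs[OF c_coeff_limit])
  define y where "y j = frac (real j * a) - frac (real j * b)" for j
  define d where "d = min (b - a) (1 - (b - a))"
  have d: "d > 0" using assms by (simp add: d_def)
  then show "d\<^sup>2 / 2 > 0" by simp
  fix j
  have y1: "\<bar>y i\<bar> \<le> 1" for i unfolding y_def
    using frac_ge_0[of "real i * a"] frac_lt_1[of "real i * a"] frac_ge_0[of "real i * b"] frac_lt_1[of "real i * b"]
    by linarith
  then have "y j * y j \<le> 1" by (metis abs_mult_self_eq mult_le_one abs_ge_zero)
  then show "(frac (real j * a) - frac (real j * b)) * (frac (real j * a) - frac (real j * b)) \<le> 1"
    by (simp add: y_def)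
  show "0 \<le> (frac (real j * a) - frac (real j * b)) * (frac (real j * a) - frac (real j * b))" by simp
  define k where "k = \<lfloor>real (Suc j) * b\<rfloor> - \<lfloor>real (Suc j) * a\<rfloor> - (\<lfloor>real j * b\<rfloor> - \<lfloor>real j * a\<rfloor>)"
  have e: "y (Suc j) - y j = of_int k - (b - a)"
    by (simp add: y_def frac_def k_def algebra_simps)
  have "\<bar>y (Suc j) - y j\<bar> \<ge> d"
  proof (cases "k \<le> 0")
    case True
    then have "real_of_int k \<le> 0" by simp
    then show ?thesis using e assms by (simp add: d_def)
  next
    case False
    then have "real_of_int k \<ge> 1" by linarith
    then show ?thesis using e assms by (simp add: d_def)
  qed
  then have "d\<^sup>2 \<le> (y (Suc j) - y j)\<^sup>2" using d by (metis abs_le_square_iff abs_of_pos)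
  also have "\<dots> \<le> 2 * (y j * y j + y (Suc j) * y (Suc j))"
    using zero_le_power2[of "y j + y (Suc j)"] by (simp add: power2_eq_square algebra_simps)
  finally show "d\<^sup>2 / 2 \<le> (frac (real j * a) - frac (real j * b)) * (frac (real j * a) - frac (real j * b)) +
         (frac (real (Suc j) * a) - frac (real (Suc j) * b)) * (frac (real (Suc j) * a) - frac (real (Suc j) * b))"
    by (simp add: y_def del: of_nat_Suc)
qed

lemma h_fun_minus: "h_fun j (- x) = h_fun j x"
  by (auto simp: h_fun_def frac_neg)

lemma h_fun_0 [simp]: "h_fun j 0 = 0"
  by (simp add: h_fun_def)

lemma c_tilde_diag_limit: "(\<lambda>N. (\<Sum>j=1..N. h_fun j (b - a)) / real N) \<longlonglongrightarrow> c_tilde a b a b"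
  using c_tilde_limit[of b a a b] h_fun_minus[of _ "b - a"] by simp

text \<open>On fractional parts \<open>m\<close> is the distance to the nearest integer, and
  \<open>h_fun\<close> is at least half of it. By the triangle inequality the distances for j x and
  (j + 1) x add up to at least the distance for x.\<close>

lemma c_tilde_pos:
  assumes "a < b" "b < a + 1"
  shows "c_tilde a b a b > 0"
proof (rule mean_pos_of_adjacent_pairs[OF c_tilde_diag_limit])
  define x where "x = b - a"
  have x: "0 < x" "x < 1" using assms by (simp_all add: x_def)
  show "min x (1 - x) / 2 > 0" using x by simp
  fix j
  have fr: "0 \<le> frac y" "frac y < 1" for y :: real by (auto simp: frac_lt_1)
  show "h_fun j (b - a) \<le> 1" "0 \<le> h_fun j (b - a)"
    unfolding h_fun_def using fr[of "real j * (b - a)"] by (auto intro!: mult_le_one)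
  define m where "m y = min y (1 - y)" for y :: real
  have hm: "h_fun i (b - a) \<ge> m (frac (real i * x)) / 2" for i
  proof -
    define f where "f = frac (real i * x)"
    have f: "0 \<le> f" "f < 1" unfolding f_def using fr by auto
    have "m f / 2 \<le> f * (1 - f)"
    proof (cases "f \<le> 1/2")
      case True
      have "f * (1/2) \<le> f * (1 - f)" using True f by (intro mult_left_mono) auto
      then show ?thesis by (simp add: m_def)
    next
      case False
      have "(1/2) * (1 - f) \<le> f * (1 - f)" using False f by (intro mult_right_mono) auto
      then show ?thesis by (simp add: m_def)
    qed
    then show ?thesis by (simp add: h_fun_def f_def x_def)
  qed
  define f where "f = frac (real j * x)"
  have f: "0 \<le> f" "f < 1" unfolding f_def using fr by auto
  have "frac (real (Suc j) * x) = frac (real j * x + x)" by (simp add: algebra_simps)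
  also have "\<dots> = (if f + x < 1 then f + x else f + x - 1)"
    using x by (simp add: frac_add f_def frac_eq[of x, THEN iffD2])
  finally have "m f + m (frac (real (Suc j) * x)) \<ge> min x (1 - x)"
    using f x by (auto simp: m_def min_def)
  then show "min x (1 - x) / 2 \<le> h_fun j (b - a) + h_fun (Suc j) (b - a)"
    using hm[of j] hm[of "Suc j"] by (simp add: f_def)
qed

section \<open>Gaussian measures and convergence in distribution\<close>

text \<open>Cholesky factorization, one index at a time: \<open>D'\<close> is the Schur complement
  after eliminating \<open>a\<close>. If \<open>D a a = 0\<close> the division yields 0, so
  \<open>D'\<close> is \<open>D\<close>, and semidefiniteness forces the entries
  \<open>D k a\<close> to vanish as well.\<close>

lemma psd_gram:
  fixes D :: "'m \<Rightarrow> 'm \<Rightarrow> real"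
  assumes "finite S" and "\<And>k l. k \<in> S \<Longrightarrow> l \<in> S \<Longrightarrow> D k l = D l k"
    and "\<And>t. (\<Sum>k\<in>S. \<Sum>l\<in>S. t k * t l * D k l) \<ge> 0"
  shows "\<exists>B :: 'm \<Rightarrow> 'm \<Rightarrow> real. \<forall>k\<in>S. \<forall>l\<in>S. D k l = (\<Sum>j\<in>S. B k j * B l j)"
  using assms
proof (induction S arbitrary: D rule: finite_induct)
  case empty
  then show ?case by simp
next
  case (insert a S)
  have sym: "D k l = D l k" if "k \<in> insert a S" "l \<in> insert a S" for k l
    using insert.prems(1) that by blast
  have expand: "(\<Sum>k\<in>insert a S. \<Sum>l\<in>insert a S. t k * t l * D k l)
      = (t a)\<^sup>2 * D a a + 2 * t a * (\<Sum>k\<in>S. t k * D k a) + (\<Sum>k\<in>S. \<Sum>l\<in>S. t k * t l * D k l)" for t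
  proof -
    have "(\<Sum>l\<in>S. t a * t l * D a l) = t a * (\<Sum>k\<in>S. t k * D k a)"
      unfolding sum_distrib_left using sym by (intro sum.cong) auto
    moreover have "(\<Sum>k\<in>S. t k * t a * D k a) = t a * (\<Sum>k\<in>S. t k * D k a)"
      unfolding sum_distrib_left by (intro sum.cong) auto
    ultimately show ?thesis using insert.hyps
      by (simp add: sum.distrib power2_eq_square)
  qed
  have nn: "(t a)\<^sup>2 * D a a + 2 * t a * (\<Sum>k\<in>S. t k * D k a) + (\<Sum>k\<in>S. \<Sum>l\<in>S. t k * t l * D k l) \<ge> 0" for t
    using insert.prems(2)[of t] unfolding expand .
  have d0: "D a a \<ge> 0"
  proof -
    have "(\<Sum>k\<in>S. (if k = a then 1 else 0) * D k a) = 0"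
      using insert.hyps by (intro sum.neutral) auto
    moreover have "(\<Sum>k\<in>S. \<Sum>l\<in>S. (if k = a then 1 else 0) * (if l = a then 1 else 0) * D k l) = 0"
      using insert.hyps by (intro sum.neutral ballI) auto
    ultimately show ?thesis using nn[of "\<lambda>k. if k = a then 1 else 0"] by simp
  qed
  define D' where "D' k l = D k l - D k a * D l a / D a a" for k l
  have "\<exists>B. \<forall>k\<in>S. \<forall>l\<in>S. D' k l = (\<Sum>j\<in>S. B k j * B l j)"
  proof (rule insert.IH)
    show "D' k l = D' l k" if "k \<in> S" "l \<in> S" for k l
      using sym[of k l] that by (simp add: D'_def mult.commute)
    fix t :: "'m \<Rightarrow> real"
    define s where "s = (\<Sum>k\<in>S. t k * D k a)"
    \<comment> \<open>This value at \<open>a\<close> minimizes the form when \<open>D a a\<close> is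
      positive; the minimum is the form of the Schur complement at \<open>t\<close>.\<close>
    define u where "u = t(a := - s / D a a)"
    have u: "u a = - s / D a a" "\<And>k. k \<in> S \<Longrightarrow> u k = t k" using insert.hyps by (auto simp: u_def)
    have "0 \<le> (u a)\<^sup>2 * D a a + 2 * u a * (\<Sum>k\<in>S. u k * D k a) + (\<Sum>k\<in>S. \<Sum>l\<in>S. u k * u l * D k l)"
      by (rule nn)
    also have "(\<Sum>k\<in>S. u k * D k a) = s" unfolding s_def by (intro sum.cong) (auto simp: u)
    also have "(\<Sum>k\<in>S. \<Sum>l\<in>S. u k * u l * D k l) = (\<Sum>k\<in>S. \<Sum>l\<in>S. t k * t l * D k l)"
      by (intro sum.cong refl) (auto simp: u)
    also have "(u a)\<^sup>2 * D a a + 2 * u a * s + (\<Sum>k\<in>S. \<Sum>l\<in>S. t k * t l * D k l)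
        = (\<Sum>k\<in>S. \<Sum>l\<in>S. t k * t l * D k l) - s * s / D a a"
      by (cases "D a a = 0") (simp_all add: u power2_eq_square)
    also have "s * s / D a a = (\<Sum>k\<in>S. \<Sum>l\<in>S. t k * t l * (D k a * D l a / D a a))"
      unfolding s_def sum_product sum_divide_distrib by (intro sum.cong refl) (simp add: mult_ac)
    finally show "0 \<le> (\<Sum>k\<in>S. \<Sum>l\<in>S. t k * t l * D' k l)"
      by (simp add: D'_def right_diff_distrib sum_subtractf)
  qed
  then obtain B where B: "\<And>k l. k \<in> S \<Longrightarrow> l \<in> S \<Longrightarrow> D' k l = (\<Sum>j\<in>S. B k j * B l j)" by blast
  define C where "C k j = (if j = a then D k a / sqrt (D a a) else if k = a then 0 else B k j)" for k j
  \<comment> \<open>If the diagonal entry at \<open>a\<close> vanishes, the form is affine in the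
    coordinate \<open>a\<close>; a nonzero slope would make it negative, here equal to
    \<open>D k k - (1 + \<bar>D k k\<bar>)\<close>.\<close>
  have Da: "D k a = 0" if "k \<in> S" "D a a = 0" for k
  proof (rule ccontr)
    assume n: "D k a \<noteq> 0"
    define x where "x = - (1 + \<bar>D k k\<bar>) / (2 * D k a)"
    define t where "t = (\<lambda>l. if l = a then x else if l = k then 1 else 0)"
    have t: "\<And>l. l \<in> S \<Longrightarrow> t l = (if l = k then 1 else 0)" using insert.hyps by (auto simp: t_def)
    have "(\<Sum>l\<in>S. t l * D l a) = (\<Sum>l\<in>S. if l = k then D k a else 0)"
      by (intro sum.cong refl) (simp add: t)
    moreover have "(\<Sum>i\<in>S. \<Sum>l\<in>S. t i * t l * D i l) = (\<Sum>i\<in>S. if i = k then (\<Sum>l\<in>S. if l = k then D k k else 0) else 0)"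
      by (intro sum.cong refl) (auto simp: t intro!: sum.cong)
    ultimately have "2 * x * D k a + D k k \<ge> 0"
      using nn[of t] that insert.hyps by (simp add: t_def)
    moreover have "2 * x * D k a = - (1 + \<bar>D k k\<bar>)" using n by (simp add: x_def)
    ultimately show False by linarith
  qed
  show ?case
  proof (intro exI[of _ C] ballI)
    fix k l assume kl: "k \<in> insert a S" "l \<in> insert a S"
    have sq: "x / sqrt (D a a) * (y / sqrt (D a a)) = x * y / D a a" for x y
      using d0 by simp
    have "(\<Sum>j\<in>insert a S. C k j * C l j) = D k a * D l a / D a a + (\<Sum>j\<in>S. C k j * C l j)"
      using insert.hyps d0 by (simp add: C_def sq)
    also have "(\<Sum>j\<in>S. C k j * C l j) = (\<Sum>j\<in>S. (if k = a then 0 else B k j) * (if l = a then 0 else B l j))"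
      using insert.hyps by (intro sum.cong refl) (auto simp: C_def)
    also have "D k a * D l a / D a a + \<dots> = D k l"
    proof (cases "k = a \<or> l = a")
      case True
      then have "(\<Sum>j\<in>S. (if k = a then 0 else B k j) * (if l = a then 0 else B l j)) = 0"
        by (intro sum.neutral) auto
      moreover have "D k a * D l a / D a a = D k l"
        using True kl sym[of a k] sym[of a l] Da by (cases "D a a = 0") auto
      ultimately show ?thesis by simp
    next
      case False
      then show ?thesis using B[of k l] kl by (simp add: D'_def)
    qed
    finally show "D k l = (\<Sum>j\<in>insert a S. C k j * C l j)" by simp
  qed
qed

definition bform :: "('m::finite \<Rightarrow> 'm \<Rightarrow> real) \<Rightarrow> real ^ 'm \<Rightarrow> real" where
  "bform D t = (\<Sum>k\<in>UNIV. \<Sum>l\<in>UNIV. vec_nth t k * vec_nth t l * D k l)"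

lemma cis_eq_iexp: "cis x = exp (\<i> * complex_of_real x)"
  by (simp add: cis_conv_exp)

lemma measurable_cis [measurable]: "cis \<in> borel_measurable borel"
  by (intro borel_measurable_continuous_onI continuous_intros)

lemma integrable_cis:
  assumes "prob_space M" "f \<in> borel_measurable M"
  shows "integrable M (\<lambda>x. cis (f x))"
proof -
  interpret prob_space M by fact
  note [measurable] = assms(2)
  show ?thesis by (rule integrable_const_bound[of _ 1]) auto
qed

lemma normal_density_distr:
  assumes s: "s > 0"
  shows "density lborel (\<lambda>x. ennreal (normal_density 0 s x)) = distr std_normal_distribution borel (\<lambda>x. s * x)"
proof -
  interpret N: prob_space std_normal_distribution by (rule prob_space_normal_density) simp
  have *: "distributed std_normal_distribution lborel (\<lambda>x. x) std_normal_density"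
    unfolding distributed_def by (auto simp: distr_id2 intro!: measurable_lborel1)
  have "distributed std_normal_distribution lborel (\<lambda>x. 0 + s * x) (normal_density (0 + s * 0) (\<bar>s\<bar> * 1))"
    by (rule N.normal_density_affine[OF *]) (use s in auto)
  then have "distr std_normal_distribution lborel (\<lambda>x. s * x) = density lborel (\<lambda>x. ennreal (normal_density 0 s x))"
    using s by (simp add: distributed_def)
  moreover have "distr std_normal_distribution borel (\<lambda>x. s * x) = distr std_normal_distribution lborel (\<lambda>x. s * x)"
    by (rule distr_cong) auto
  ultimately show ?thesis by simp
qed

lemma std_normal_second_moment: "has_bochner_integral std_normal_distribution (\<lambda>x. x\<^sup>2) 1"
proof -
  have "has_bochner_integral lborel (\<lambda>x. std_normal_density x * x ^ (2 * 1)) (fact (2 * 1) / (2 ^ 1 * fact 1))"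
    by (rule std_normal_moment_even)
  then show ?thesis
    by (subst has_bochner_integral_density) (auto simp: fact_numeral)
qed

text \<open>The law is the image of independent standard normals under a Gram factor of
  \<open>D\<close>, which works for singular \<open>D\<close> too. Independence gives the
  characteristic function, and uniqueness for real distributions identifies every marginal, possibly
  as a point mass.\<close>

lemma gaussian_exists:
  fixes D :: "'m::finite \<Rightarrow> 'm \<Rightarrow> real"
  assumes sym: "\<And>k l. D k l = D l k" and psd: "\<And>t. bform D t \<ge> 0"
  shows "\<exists>\<mu>. centred_gaussian D \<mu> \<and> (\<forall>t. (LINT x|\<mu>. cis (inner t x)) = of_real (exp (- (bform D t) / 2)))
      \<and> (\<forall>k. integrable \<mu> (\<lambda>x. (vec_nth x k)\<^sup>2))"
proof -
  have "(\<Sum>k\<in>UNIV. \<Sum>l\<in>UNIV. t k * t l * D k l) \<ge> 0" for t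
    using psd[of "\<chi> k. t k"] by (simp add: bform_def)
  then have "\<exists>B :: 'm \<Rightarrow> 'm \<Rightarrow> real. \<forall>k\<in>UNIV. \<forall>l\<in>UNIV. D k l = (\<Sum>j\<in>UNIV. B k j * B l j)"
    by (intro psd_gram sym) simp
  then obtain B :: "'m \<Rightarrow> 'm \<Rightarrow> real" where B: "\<And>k l. D k l = (\<Sum>j\<in>UNIV. B k j * B l j)" by blast
  define G where "G = Pi\<^sub>M UNIV (\<lambda>_::'m. std_normal_distribution)"
  define F where "F g = (\<chi> k. \<Sum>j\<in>UNIV. B k j * g j)" for g :: "'m \<Rightarrow> real"
  define \<mu> where "\<mu> = distr G borel F"
  interpret N: prob_space std_normal_distribution by (rule prob_space_normal_density) simp
  interpret P: product_sigma_finite "\<lambda>_::'m. std_normal_distribution" ..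
  interpret P: product_prob_space "\<lambda>_::'m. std_normal_distribution" UNIV ..
  have F [measurable]: "F \<in> G \<rightarrow>\<^sub>M borel"
    unfolding F_def G_def by (subst borel_measurable_euclidean_space) (auto simp: Basis_vec_def inner_axis)
  interpret G: prob_space G unfolding G_def by (rule P.prob_space_axioms)
  interpret \<mu>: prob_space \<mu> unfolding \<mu>_def by (rule G.prob_space_distr) measurable
  have sets: "sets \<mu> = sets borel" by (simp add: \<mu>_def)
  have char: "(LINT x|\<mu>. cis (inner t x)) = of_real (exp (- (bform D t) / 2))" for t
  proof -
    define c where "c j = (\<Sum>k\<in>UNIV. vec_nth t k * B k j)" for j
    have cs: "(\<Sum>j\<in>UNIV. (c j)\<^sup>2) = bform D t"
    proof -
      have "(\<Sum>j\<in>UNIV. (c j)\<^sup>2) = (\<Sum>j\<in>UNIV. \<Sum>k\<in>UNIV. \<Sum>l\<in>UNIV. vec_nth t k * vec_nth t l * (B k j * B l j))"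
        unfolding c_def power2_eq_square sum_product by (intro sum.cong refl) (simp add: mult_ac)
      also have "\<dots> = (\<Sum>k\<in>UNIV. \<Sum>j\<in>UNIV. \<Sum>l\<in>UNIV. vec_nth t k * vec_nth t l * (B k j * B l j))"
        by (rule sum.swap)
      also have "\<dots> = (\<Sum>k\<in>UNIV. \<Sum>l\<in>UNIV. \<Sum>j\<in>UNIV. vec_nth t k * vec_nth t l * (B k j * B l j))"
        by (intro sum.cong refl sum.swap)
      finally show ?thesis by (simp add: bform_def B sum_distrib_left)
    qed
    have inn: "inner t (F g) = (\<Sum>j\<in>UNIV. c j * g j)" for g
    proof -
      have "inner t (F g) = (\<Sum>k\<in>UNIV. \<Sum>j\<in>UNIV. vec_nth t k * B k j * g j)"
        by (simp add: inner_vec_def F_def sum_distrib_left mult.assoc)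
      also have "\<dots> = (\<Sum>j\<in>UNIV. \<Sum>k\<in>UNIV. vec_nth t k * B k j * g j)" by (rule sum.swap)
      finally show ?thesis by (simp add: c_def sum_distrib_right)
    qed
    have "(LINT x|\<mu>. cis (inner t x)) = (LINT g|G. cis (inner t (F g)))"
      unfolding \<mu>_def by (subst integral_distr) auto
    also have "\<dots> = (LINT g|G. (\<Prod>j\<in>UNIV. cis (c j * g j)))"
      unfolding inn cis_eq_iexp by (simp add: exp_sum sum_distrib_left)
    also have "\<dots> = (\<Prod>j\<in>UNIV. (LINT x|std_normal_distribution. cis (c j * x)))"
      unfolding G_def
      by (rule P.product_integral_prod) (auto intro!: integrable_cis N.prob_space_axioms)
    also have "\<dots> = (\<Prod>j\<in>UNIV. complex_of_real (exp (- (c j)\<^sup>2 / 2)))"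
    proof (intro prod.cong refl)
      fix j
      show "(LINT x|std_normal_distribution. cis (c j * x)) = complex_of_real (exp (- (c j)\<^sup>2 / 2))"
        using fun_cong[OF char_std_normal_distribution, of "c j"] by (simp add: char_def cis_eq_iexp)
    qed
    also have "\<dots> = of_real (exp (- (bform D t) / 2))"
    proof -
      have "(\<Prod>j\<in>UNIV. exp (- (c j)\<^sup>2 / 2)) = exp (\<Sum>j\<in>UNIV. - (c j)\<^sup>2 / 2)"
        by (rule exp_sum[symmetric]) simp
      also have "(\<Sum>j\<in>UNIV. - (c j)\<^sup>2 / 2) = - (bform D t) / 2"
        unfolding cs[symmetric] sum_divide_distrib[symmetric] sum_negf ..
      finally show ?thesis by (simp only: of_real_prod[symmetric])
    qed
    finally show ?thesis .
  qed
  have inner_meas [measurable]: "(\<lambda>x. inner t x) \<in> borel_measurable \<mu>" for t :: "real ^ 'm"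
    unfolding measurable_cong_sets[OF sets refl] by measurable
  have marg: "(if bform D t = 0 then distr \<mu> borel (\<lambda>x. inner t x) = return borel 0
      else distr \<mu> borel (\<lambda>x. inner t x) = density lborel (\<lambda>x. ennreal (normal_density 0 (sqrt (bform D t)) x)))" for t
  proof -
    have rd: "real_distribution (distr \<mu> borel (\<lambda>x. inner t x))"
      by (rule \<mu>.real_distribution_distr) (rule inner_meas)
    have ch: "char (distr \<mu> borel (\<lambda>x. inner t x)) s = of_real (exp (- (s\<^sup>2 * bform D t) / 2))" for s
    proof -
      have "char (distr \<mu> borel (\<lambda>x. inner t x)) s = (LINT x|\<mu>. cis (inner (s *\<^sub>R t) x))"
        unfolding char_def by (subst integral_distr) (auto simp: cis_eq_iexp)
      also have "bform D (s *\<^sub>R t) = s\<^sup>2 * bform D t"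
        by (simp add: bform_def sum_distrib_left power2_eq_square mult_ac)
      ultimately show ?thesis using char[of "s *\<^sub>R t"] by simp
    qed
    show ?thesis
    proof (cases "bform D t = 0")
      case True
      have "prob_space (return borel (0::real))" by (rule prob_space_return) simp
      then have rd0: "real_distribution (return borel (0::real))"
        by (simp add: real_distribution_def real_distribution_axioms_def)
      have "char (return borel 0) s = 1" for s
      proof -
        have "(LINT x|return borel 0. iexp (s * x)) = iexp (s * 0)" by (rule integral_return) auto
        then show ?thesis by (simp add: char_def)
      qed
      then have "char (distr \<mu> borel (\<lambda>x. inner t x)) = char (return borel 0)"
        by (intro ext) (simp add: ch True)
      then have "distr \<mu> borel (\<lambda>x. inner t x) = return borel 0"
        by (rule Levy_uniqueness[OF rd rd0])
      then show ?thesis using True by simp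
    next
      case False
      define s where "s = sqrt (bform D t)"
      have s: "s > 0" "s\<^sup>2 = bform D t" using False psd[of t] by (simp_all add: s_def)
      have rds: "real_distribution (distr std_normal_distribution borel (\<lambda>x. s * x))"
        by (rule N.real_distribution_distr) simp
      have "char (distr std_normal_distribution borel (\<lambda>x. s * x)) u = of_real (exp (- (u\<^sup>2 * bform D t) / 2))" for u
      proof -
        have "char (distr std_normal_distribution borel (\<lambda>x. s * x)) u = char std_normal_distribution (u * s)"
          unfolding char_def by (subst integral_distr) (auto simp: mult_ac)
        also have "\<dots> = complex_of_real (exp (- ((u * s)\<^sup>2) / 2))"
          by (simp only: char_std_normal_distribution)
        finally show ?thesis by (simp only: power_mult_distrib s(2))
      qed
      then have "char (distr \<mu> borel (\<lambda>x. inner t x)) = char (distr std_normal_distribution borel (\<lambda>x. s * x))"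
        by (intro ext) (simp only: ch)
      then have "distr \<mu> borel (\<lambda>x. inner t x) = distr std_normal_distribution borel (\<lambda>x. s * x)"
        by (rule Levy_uniqueness[OF rd rds])
      then show ?thesis using False by (simp only: normal_density_distr[OF s(1)] s_def[symmetric] if_False)
    qed
  qed
  have sq: "has_bochner_integral \<mu> (\<lambda>x. (inner t x)\<^sup>2) (bform D t)" for t
  proof -
    have "has_bochner_integral (distr \<mu> borel (\<lambda>x. inner t x)) (\<lambda>y. y\<^sup>2) (bform D t)"
    proof (cases "bform D t = 0")
      case True
      have "AE y in return borel (0::real). y\<^sup>2 = 0" by (subst AE_return) auto
      then have "has_bochner_integral (return borel (0::real)) (\<lambda>y. y\<^sup>2) 0"
        by (subst has_bochner_integral_cong_AE[where g = "\<lambda>_. 0"]) (auto intro: has_bochner_integral_zero)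
      then show ?thesis using marg[of t] True by simp
    next
      case False
      define s where "s = sqrt (bform D t)"
      have s: "s > 0" "s\<^sup>2 = bform D t" using False psd[of t] by (simp_all add: s_def)
      have "has_bochner_integral std_normal_distribution (\<lambda>x. s\<^sup>2 * x\<^sup>2) (s\<^sup>2 * 1)"
        by (intro has_bochner_integral_mult_right std_normal_second_moment)
      then have "has_bochner_integral (distr std_normal_distribution borel (\<lambda>x. s * x)) (\<lambda>y. y\<^sup>2) (bform D t)"
        by (intro has_bochner_integral_distr) (auto simp: power_mult_distrib s)
      then show ?thesis using marg[of t] False by (simp add: normal_density_distr[OF s(1)] s_def[symmetric])
    qed
    then show ?thesis unfolding has_bochner_integral_iff
      by (auto simp: integrable_distr_eq integral_distr)
  qed
  \<comment> \<open>Covariances are recovered by polarization from second moments along one axis and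
    along the sum of two axes.\<close>
  have ax: "bform D (axis k 1) = D k k" "bform D (axis k 1 + axis l 1) = D k k + D l l + 2 * D k l" for k l
  proof -
    have d: "(\<Sum>i\<in>UNIV. \<Sum>j\<in>UNIV. vec_nth (axis k (1::real)) i * vec_nth (axis l 1) j * D i j) = D k l" for k l
    proof -
      have "(\<Sum>i\<in>UNIV. \<Sum>j\<in>UNIV. vec_nth (axis k (1::real)) i * vec_nth (axis l 1) j * D i j)
          = (\<Sum>i\<in>UNIV. if i = k then (\<Sum>j\<in>UNIV. if j = l then D k l else 0) else 0)"
        by (intro sum.cong refl) (auto simp: axis_def mult_delta_left)
      then show ?thesis by simp
    qed
    show "bform D (axis k 1) = D k k" unfolding bform_def by (rule d)
    have "bform D (axis k 1 + axis l 1) = D k k + D k l + (D l k + D l l)"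
      unfolding bform_def vector_add_component distrib_left distrib_right sum.distrib d by simp
    then show "bform D (axis k 1 + axis l 1) = D k k + D l l + 2 * D k l" using sym[of l k] by simp
  qed
  have ik: "integrable \<mu> (\<lambda>x. (vec_nth x k)\<^sup>2)" "(LINT x|\<mu>. (vec_nth x k)\<^sup>2) = D k k" for k
    using sq[of "axis k 1"] by (auto simp: inner_axis' ax has_bochner_integral_iff)
  have cov: "(LINT x|\<mu>. vec_nth x k * vec_nth x l) = D k l" for k l
  proof -
    have s: "integrable \<mu> (\<lambda>x. (vec_nth x k + vec_nth x l)\<^sup>2)"
      "(LINT x|\<mu>. (vec_nth x k + vec_nth x l)\<^sup>2) = D k k + D l l + 2 * D k l"
      using sq[of "axis k 1 + axis l 1"] by (auto simp: inner_axis' inner_add_left ax has_bochner_integral_iff)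
    have "(LINT x|\<mu>. vec_nth x k * vec_nth x l)
        = (LINT x|\<mu>. ((vec_nth x k + vec_nth x l)\<^sup>2 - (vec_nth x k)\<^sup>2 - (vec_nth x l)\<^sup>2) / 2)"
      by (intro Bochner_Integration.integral_cong refl) (simp add: power2_eq_square field_simps)
    also have "\<dots> = D k l" using s ik by simp
    finally show ?thesis .
  qed
  have "centred_gaussian D \<mu>"
    unfolding centred_gaussian_def
  proof (intro conjI allI)
    show "prob_space \<mu>" by (rule \<mu>.prob_space_axioms)
    show "sets \<mu> = sets borel" by (rule sets)
    fix t :: "real ^ 'm"
    show "distr \<mu> borel (inner t) = return borel 0 \<or>
       (\<exists>s>0. distr \<mu> borel (inner t) = density lborel (\<lambda>x. ennreal (normal_density 0 s x)))"
    proof (cases "bform D t = 0")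
      case False
      then have "sqrt (bform D t) > 0" using psd[of t] by simp
      then show ?thesis using marg[of t] False by (intro disjI2 exI[of _ "sqrt (bform D t)"] conjI) simp_all
    qed (use marg[of t] in simp)
  next
    fix k l show "(LINT x|\<mu>. vec_nth x k * vec_nth x l) = D k l" by (rule cov)
  qed
  then show ?thesis using char ik by blast
qed

section \<open>Weak convergence from characteristic functions\<close>

definition cis_chars :: "(real ^ 'm::finite \<Rightarrow> complex) set" where
  "cis_chars = {\<lambda>x. cis (inner t x) | t. True}"

lemma cis_chars_mult: "\<xi> \<in> cis_chars \<Longrightarrow> \<zeta> \<in> cis_chars \<Longrightarrow> (\<lambda>x. \<xi> x * \<zeta> x) \<in> cis_chars"
proof -
  assume "\<xi> \<in> cis_chars" "\<zeta> \<in> cis_chars"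
  then obtain t u where "\<xi> = (\<lambda>x. cis (inner t x))" "\<zeta> = (\<lambda>x. cis (inner u x))" by (auto simp: cis_chars_def)
  then have "(\<lambda>x. \<xi> x * \<zeta> x) = (\<lambda>x. cis (inner (t + u) x))" by (simp add: cis_mult inner_add_left)
  then show ?thesis unfolding cis_chars_def by blast
qed

lemma cis_chars_one: "(\<lambda>x. 1) \<in> cis_chars"
  unfolding cis_chars_def by (rule CollectI, rule exI[of _ 0]) simp

lemma cis_span_integrable:
  fixes Z :: "'a \<Rightarrow> real ^ 'm::finite"
  assumes M: "prob_space M" and Z: "Z \<in> borel_measurable M" and h: "h \<in> char_span cis_chars"
  shows "integrable M (\<lambda>\<omega>. h (Z \<omega>))"
  using h
proof (induction rule: char_span.induct)
  case (char \<xi> c)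
  then obtain t where t: "\<xi> = (\<lambda>x. cis (inner t x))" by (auto simp: cis_chars_def)
  have "integrable M (\<lambda>\<omega>. cis (inner t (Z \<omega>)))" using Z by (intro integrable_cis[OF M]) simp
  then show ?case unfolding t by simp
qed simp

lemma cis_span_converges:
  fixes Y :: "nat \<Rightarrow> 'a \<Rightarrow> real ^ 'm::finite"
  assumes M: "prob_space M" and Y: "\<And>N. Y N \<in> borel_measurable M"
    and \<mu>: "prob_space \<mu>" "sets \<mu> = sets borel"
    and lim: "\<And>t. (\<lambda>N. LINT \<omega>|M. cis (inner t (Y N \<omega>))) \<longlonglongrightarrow> (LINT x|\<mu>. cis (inner t x))"
    and h: "h \<in> char_span cis_chars"
  shows "(\<lambda>N. LINT \<omega>|M. h (Y N \<omega>)) \<longlonglongrightarrow> (LINT x|\<mu>. h x)"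
  using h
proof (induction rule: char_span.induct)
  case (char \<xi> c)
  then obtain t where t: "\<xi> = (\<lambda>x. cis (inner t x))" by (auto simp: cis_chars_def)
  show ?case unfolding t integral_mult_right_zero by (rule tendsto_mult[OF tendsto_const lim])
next
  case (add f g)
  have id: "(\<lambda>x. x) \<in> borel_measurable \<mu>" unfolding measurable_cong_sets[OF \<mu>(2) refl] by simp
  have "(LINT \<omega>|M. f (Y N \<omega>) + g (Y N \<omega>)) = (LINT \<omega>|M. f (Y N \<omega>)) + (LINT \<omega>|M. g (Y N \<omega>))" for N
    by (rule Bochner_Integration.integral_add[OF cis_span_integrable[OF M Y add(1)] cis_span_integrable[OF M Y add(2)]])
  moreover have "(LINT x|\<mu>. f x + g x) = (LINT x|\<mu>. f x) + (LINT x|\<mu>. g x)"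
    by (rule Bochner_Integration.integral_add[OF cis_span_integrable[OF \<mu>(1) id add(1)] cis_span_integrable[OF \<mu>(1) id add(2)]])
  ultimately show ?case using tendsto_add[OF add.IH] by (simp only:)
qed

text \<open>On \<open>[- T, T]\<close> a coordinate is \<open>T arcsin (sin (x / T))\<close>, so polynomial approximation in the variables
  \<open>sin (x / T)\<close> yields trigonometric polynomials; outside the box the error is paid by the quadratic term.\<close>

lemma trig_approx:
  fixes f :: "real ^ 'm::finite \<Rightarrow> real"
  assumes f: "continuous_on UNIV f" "\<And>x. \<bar>f x\<bar> \<le> K" and \<epsilon>: "\<epsilon> > 0" and T: "T > 0"
  shows "\<exists>h. (\<lambda>x. of_real (h x)) \<in> char_span cis_chars \<and>
    (\<forall>x. \<bar>f x - h x\<bar> \<le> \<epsilon> + (2 * K + \<epsilon>) * (\<Sum>k\<in>UNIV. (vec_nth x k)\<^sup>2) / T\<^sup>2)"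
proof -
  define S :: "(real ^ 'm) set" where "S = cbox (- 1) 1"
  have S: "y \<in> S \<longleftrightarrow> (\<forall>k. - 1 \<le> vec_nth y k \<and> vec_nth y k \<le> 1)" for y
    unfolding S_def mem_box_cart by simp
  define r where "r y = (\<chi> k. T * arcsin (vec_nth y k))" for y :: "real ^ 'm"
  define s where "s x = (\<chi> k. sin (vec_nth x k / T))" for x :: "real ^ 'm"
  have "continuous_on S r"
    unfolding r_def by (intro continuous_intros) (auto simp: S)
  then have "continuous_on S (\<lambda>y. f (r y))"
    by (rule continuous_on_compose2[OF f(1)]) auto
  then obtain P where P: "real_polynomial_function P" "\<And>y. y \<in> S \<Longrightarrow> \<bar>f (r y) - P y\<bar> < \<epsilon>"
    using Stone_Weierstrass_real_polynomial_function[of S "\<lambda>y. f (r y)" \<epsilon>] \<epsilon> by (auto simp: S_def compact_cbox)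
  have sS: "s x \<in> S" for x by (simp add: S s_def)
  define h where "h x = P (s x)" for x
  have "(\<lambda>x. of_real (P (s x))) \<in> char_span cis_chars"
  proof (rule char_span_real_polynomial[OF P(1) cis_chars_mult cis_chars_one])
    fix b :: "real ^ 'm" assume "b \<in> Basis"
    then obtain k where b: "b = axis k 1" by (auto simp: Basis_vec_def)
    have m: "(\<lambda>x. cis (inner (axis k (c / T)) x)) \<in> cis_chars" for c by (auto simp: cis_chars_def)
    have "(\<lambda>x. (- \<i> / 2) * cis (inner (axis k (1 / T)) x) + (\<i> / 2) * cis (inner (axis k (- 1 / T)) x)) \<in> char_span cis_chars"
      by (intro char_span.add char_span.char m)
    moreover have "of_real (inner (s x) b) = (- \<i> / 2) * cis (inner (axis k (1 / T)) x) + (\<i> / 2) * cis (inner (axis k (- 1 / T)) x)" for x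
      by (simp add: b inner_axis inner_axis' s_def complex_eq_iff)
    ultimately show "(\<lambda>x. of_real (inner (s x) b)) \<in> char_span cis_chars" by simp
  qed
  moreover have "\<bar>f x - h x\<bar> \<le> \<epsilon> + (2 * K + \<epsilon>) * (\<Sum>k\<in>UNIV. (vec_nth x k)\<^sup>2) / T\<^sup>2" for x
  proof (cases "\<forall>k. \<bar>vec_nth x k\<bar> \<le> T")
    case True
    have "T * arcsin (sin (vec_nth x k / T)) = vec_nth x k" for k
    proof -
      have "\<bar>vec_nth x k / T\<bar> \<le> 1" using True T by (simp add: abs_divide)
      then have "\<bar>vec_nth x k / T\<bar> \<le> pi / 2" using pi_ge_two by linarith
      then have "arcsin (sin (vec_nth x k / T)) = vec_nth x k / T" by (intro arcsin_sin) linarith+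
      then show ?thesis using T by simp
    qed
    then have "r (s x) = x" by (simp add: r_def s_def vec_eq_iff)
    then have "\<bar>f x - h x\<bar> < \<epsilon>" using P(2)[OF sS[of x]] by (simp add: h_def)
    moreover have "0 \<le> (2 * K + \<epsilon>) * (\<Sum>k\<in>UNIV. (vec_nth x k)\<^sup>2) / T\<^sup>2"
      using f(2)[of 0] \<epsilon> by (intro divide_nonneg_nonneg mult_nonneg_nonneg sum_nonneg) auto
    ultimately show ?thesis by linarith
  next
    case False
    then obtain k where k: "\<bar>vec_nth x k\<bar> > T" by (auto simp: not_le)
    have "T\<^sup>2 \<le> (vec_nth x k)\<^sup>2" using k T by (intro abs_le_square_iff[THEN iffD1]) simp
    also have "\<dots> \<le> (\<Sum>k\<in>UNIV. (vec_nth x k)\<^sup>2)" by (rule member_le_sum) auto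
    finally have "1 \<le> (\<Sum>k\<in>UNIV. (vec_nth x k)\<^sup>2) / T\<^sup>2" using T by simp
    then have "(2 * K + \<epsilon>) * 1 \<le> (2 * K + \<epsilon>) * ((\<Sum>k\<in>UNIV. (vec_nth x k)\<^sup>2) / T\<^sup>2)"
      using f(2)[of 0] \<epsilon> by (intro mult_left_mono) auto
    moreover have "\<bar>f x - h x\<bar> \<le> 2 * K + \<epsilon>"
      using P(2)[OF sS[of x]] f(2)[of x] f(2)[of "r (s x)"] unfolding h_def by linarith
    ultimately show ?thesis using \<epsilon> by simp
  qed
  ultimately show ?thesis by (intro exI[of _ h] conjI allI) (simp_all only: h_def)
qed

text \<open>Integrating the pointwise error, each coordinate pays a second moment of at most 1 for
  the region outside the box. The real part appears because membership in \<open>char_span\<close>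
  speaks of complex functions.\<close>

lemma trig_approx_expectation:
  fixes Z :: "'a \<Rightarrow> real ^ 'm::finite"
  assumes M: "prob_space M" and Z: "Z \<in> borel_measurable M"
    and f: "f \<in> borel_measurable borel" "\<And>x. \<bar>f x\<bar> \<le> K"
    and h: "(\<lambda>x. of_real (h x)) \<in> char_span cis_chars"
    and fh: "\<And>x. \<bar>f x - h x\<bar> \<le> \<epsilon> + C * (\<Sum>k\<in>UNIV. (vec_nth x k)\<^sup>2) / T\<^sup>2" and C: "C \<ge> 0"
    and sq: "\<And>k. integrable M (\<lambda>\<omega>. (vec_nth (Z \<omega>) k)\<^sup>2)" "\<And>k. (LINT \<omega>|M. (vec_nth (Z \<omega>) k)\<^sup>2) \<le> 1"
  shows "\<bar>(LINT \<omega>|M. f (Z \<omega>)) - Re (LINT \<omega>|M. of_real (h (Z \<omega>)))\<bar> \<le> \<epsilon> + C * real CARD('m) / T\<^sup>2"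
proof -
  interpret prob_space M by fact
  note [measurable] = Z f(1)
  have ih: "integrable M (\<lambda>\<omega>. complex_of_real (h (Z \<omega>)))" by (rule cis_span_integrable[OF M Z h])
  from integrable_Re[OF this] have ihr: "integrable M (\<lambda>\<omega>. h (Z \<omega>))" by simp
  have if': "integrable M (\<lambda>\<omega>. f (Z \<omega>))" by (rule integrable_const_bound[of _ K]) (use f(2) in auto)
  have "(LINT \<omega>|M. f (Z \<omega>)) - Re (LINT \<omega>|M. of_real (h (Z \<omega>))) = (LINT \<omega>|M. f (Z \<omega>) - h (Z \<omega>))"
    using ihr if' by (simp add: integral_complex_of_real)
  also have "\<bar>\<dots>\<bar> \<le> (LINT \<omega>|M. \<bar>f (Z \<omega>) - h (Z \<omega>)\<bar>)" by (rule integral_abs_bound)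
  also have "\<dots> \<le> (LINT \<omega>|M. \<epsilon> + C * (\<Sum>k\<in>UNIV. (vec_nth (Z \<omega>) k)\<^sup>2) / T\<^sup>2)"
    using ihr if' sq fh by (intro integral_mono) auto
  also have "\<dots> = \<epsilon> + C * (\<Sum>k\<in>UNIV. (LINT \<omega>|M. (vec_nth (Z \<omega>) k)\<^sup>2)) / T\<^sup>2"
    using sq by (simp add: prob_space Bochner_Integration.integral_sum)
  also have "\<dots> \<le> \<epsilon> + C * (\<Sum>k\<in>(UNIV::'m set). 1) / T\<^sup>2"
    using sq C by (intro add_left_mono divide_right_mono mult_left_mono sum_mono) auto
  finally show ?thesis by simp
qed

theorem converges_of_char_funs:
  fixes Y :: "nat \<Rightarrow> 'a \<Rightarrow> real ^ 'm::finite"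
  assumes M: "prob_space M" and Y: "\<And>N. Y N \<in> borel_measurable M"
    and \<mu>: "prob_space \<mu>" "sets \<mu> = sets borel"
    and lim: "\<And>t. (\<lambda>N. LINT \<omega>|M. cis (inner t (Y N \<omega>))) \<longlonglongrightarrow> (LINT x|\<mu>. cis (inner t x))"
    and sqY: "\<And>N k. integrable M (\<lambda>\<omega>. (vec_nth (Y N \<omega>) k)\<^sup>2)" "\<And>N k. (LINT \<omega>|M. (vec_nth (Y N \<omega>) k)\<^sup>2) \<le> 1"
    and sq\<mu>: "\<And>k. integrable \<mu> (\<lambda>x. (vec_nth x k)\<^sup>2)" "\<And>k. (LINT x|\<mu>. (vec_nth x k)\<^sup>2) \<le> 1"
  shows "converges_in_distribution M Y \<mu>"
  unfolding converges_in_distribution_def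
proof (intro conjI allI impI)
  fix N show "Y N \<in> borel_measurable M" by (rule Y)
next
  fix f :: "real ^ 'm \<Rightarrow> real" assume "continuous_on UNIV f \<and> bounded (range f)"
  then have f: "continuous_on UNIV f" and "bounded (range f)" by auto
  then obtain K where K: "\<And>x. \<bar>f x\<bar> \<le> K" by (auto simp: bounded_iff)
  have K0: "K \<ge> 0" using K[of 0] by linarith
  have fm: "f \<in> borel_measurable borel" by (rule borel_measurable_continuous_onI[OF f])
  have id: "(\<lambda>x. x) \<in> borel_measurable \<mu>" unfolding measurable_cong_sets[OF \<mu>(2) refl] by simp
  show "(\<lambda>N. LINT \<omega>|M. f (Y N \<omega>)) \<longlonglongrightarrow> (LINT x|\<mu>. f x)"
  proof (rule LIMSEQ_I)
    fix e :: real assume e: "e > 0"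
    \<comment> \<open>Replacing \<open>f\<close> by \<open>h\<close> costs twice this amount on
      either side and the convergence for \<open>h\<close> once, in total 5 e / 8.\<close>
    define \<epsilon> where "\<epsilon> = e / 8"
    define m where "m = real CARD('m)"
    have \<epsilon>: "\<epsilon> > 0" using e by (simp add: \<epsilon>_def)
    define C where "C = 2 * K + \<epsilon>"
    have C: "C \<ge> 0" using K0 \<epsilon> by (simp add: C_def)
    \<comment> \<open>Large enough to make the quadratic remainder at most
      \<open>\<epsilon>\<close>; the added 1 keeps \<open>T\<close> positive.\<close>
    define T where "T = sqrt (C * m / \<epsilon>) + 1"
    have T: "T > 0" "C * m / T\<^sup>2 \<le> \<epsilon>"
    proof -
      have nn: "C * m / \<epsilon> \<ge> 0" using C \<epsilon> by (simp add: m_def)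
      then show "T > 0" by (simp add: T_def add_nonneg_pos)
      have "(sqrt (C * m / \<epsilon>))\<^sup>2 \<le> T\<^sup>2" using nn by (intro power_mono) (auto simp: T_def)
      then have "C * m / \<epsilon> \<le> T\<^sup>2" using nn by simp
      then show "C * m / T\<^sup>2 \<le> \<epsilon>" using \<epsilon> \<open>T > 0\<close> by (simp add: field_simps)
    qed
    obtain h where h: "(\<lambda>x. of_real (h x)) \<in> char_span cis_chars"
      and fh: "\<And>x. \<bar>f x - h x\<bar> \<le> \<epsilon> + C * (\<Sum>k\<in>UNIV. (vec_nth x k)\<^sup>2) / T\<^sup>2"
      using trig_approx[OF f K \<epsilon> T(1)] unfolding C_def by blast
    have 1: "\<bar>(LINT \<omega>|M. f (Y N \<omega>)) - Re (LINT \<omega>|M. of_real (h (Y N \<omega>)))\<bar> \<le> 2 * \<epsilon>" for N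
      using trig_approx_expectation[OF M Y fm K h fh C sqY, of N] T(2) unfolding m_def by linarith
    have 2: "\<bar>(LINT x|\<mu>. f x) - Re (LINT x|\<mu>. of_real (h x))\<bar> \<le> 2 * \<epsilon>"
      using trig_approx_expectation[OF \<mu>(1) id fm K h fh C sq\<mu>] T(2) unfolding m_def by linarith
    have "(\<lambda>N. Re (LINT \<omega>|M. of_real (h (Y N \<omega>)))) \<longlonglongrightarrow> Re (LINT x|\<mu>. of_real (h x))"
  by (rule tendsto_Re[OF cis_span_converges[OF M Y \<mu> lim h]])
    from LIMSEQ_D[OF this \<epsilon>] obtain N0
      where 3: "\<And>N. N \<ge> N0 \<Longrightarrow> \<bar>Re (LINT \<omega>|M. of_real (h (Y N \<omega>))) - Re (LINT x|\<mu>. of_real (h x))\<bar> < \<epsilon>"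
      by auto
    show "\<exists>no. \<forall>n\<ge>no. norm ((LINT \<omega>|M. f (Y n \<omega>)) - (LINT x|\<mu>. f x)) < e"
    proof (intro exI allI impI)
      fix N assume "N \<ge> N0"
      from 1[of N] 2 3[OF this] show "norm ((LINT \<omega>|M. f (Y N \<omega>)) - (LINT x|\<mu>. f x)) < e"
        unfolding \<epsilon>_def real_norm_def by linarith
    qed
  qed
qed

section \<open>Uniform variables on the circle\<close>

abbreviation unit_uniform :: "real measure" where
  "unit_uniform \<equiv> uniform_measure lborel {0..1}"

lemma prob_space_unit_uniform: "prob_space unit_uniform"
  by (rule prob_space_uniform_measure) auto

lemma prob_space_uniform_circle: "prob_space uniform_circle"
proof -
  interpret prob_space unit_uniform by (rule prob_space_unit_uniform)
  show ?thesis unfolding uniform_circle_def by (rule prob_space_distr) simp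
qed

lemma sets_uniform_circle [simp]: "sets uniform_circle = sets borel" "space uniform_circle = UNIV"
  by (simp_all add: uniform_circle_def)

lemma measurable_uniform_circle: "borel_measurable uniform_circle = borel_measurable borel"
  by (rule measurable_cong_sets) simp_all

lemma frac_add_of_int: "frac (x + of_int k) = frac x" for x :: real
  by (simp add: frac_def)

lemma nn_integral_circle:
  assumes [measurable]: "f \<in> borel_measurable borel"
  shows "(\<integral>\<^sup>+W. f W \<partial>uniform_circle) = (\<integral>\<^sup>+x. f (cis (2 * pi * x)) * indicator {0..1} x \<partial>lborel)"
  unfolding uniform_circle_def
  by (subst nn_integral_distr) (simp_all add: nn_integral_uniform_measure divide_ennreal_def)

text \<open>A rotation translates the angle; after reducing the shift modulo 1, the part of the
  interval beyond 1 is moved back by periodicity.\<close>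

lemma nn_integral_circle_shift:
  fixes g :: "complex \<Rightarrow> ennreal"
  assumes [measurable]: "g \<in> borel_measurable borel"
  shows "(\<integral>\<^sup>+W. g (W * cis (2 * pi * a)) \<partial>uniform_circle) = (\<integral>\<^sup>+W. g W \<partial>uniform_circle)"
proof -
  define b where "b = frac a"
  have b: "0 \<le> b" "b < 1" by (simp_all add: b_def frac_lt_1)
  have ab: "cis (2 * pi * a) = cis (2 * pi * b)" unfolding cis_2pi_eq_iff by (simp add: b_def frac_def)
  define f where "f x = g (cis (2 * pi * x))" for x
  have [measurable]: "f \<in> borel_measurable borel" unfolding f_def by measurable
  have per: "f (y + 1) = f y" for y
  proof -
    have "cis (2 * pi * (y + 1)) = cis (2 * pi * y)" unfolding cis_2pi_eq_iff by simp
    then show ?thesis by (simp only: f_def)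
  qed
  have "(\<integral>\<^sup>+W. g (W * cis (2 * pi * a)) \<partial>uniform_circle) = (\<integral>\<^sup>+x. f (x + b) * indicator {0..1} x \<partial>lborel)"
    unfolding ab by (subst nn_integral_circle) (simp_all add: f_def cis_mult distrib_left)
  also have "\<dots> = (\<integral>\<^sup>+y. f y * indicator {b..1 + b} y \<partial>lborel)"
  proof -
    have "(\<integral>\<^sup>+y. f y * indicator {b..1 + b} y \<partial>lborel) = ennreal \<bar>1\<bar> * (\<integral>\<^sup>+x. f (b + 1 * x) * indicator {b..1 + b} (b + 1 * x) \<partial>lborel)"
      by (rule nn_integral_real_affine) auto
    also have "\<dots> = (\<integral>\<^sup>+x. f (x + b) * indicator {0..1} x \<partial>lborel)"
      by (simp add: add.commute) (intro nn_integral_cong, simp add: indicator_def)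
    finally show ?thesis by simp
  qed
  also have "\<dots> = (\<integral>\<^sup>+y. f y * indicator {b..1} y + f y * indicator {1<..1 + b} y \<partial>lborel)"
    using b by (intro nn_integral_cong) (auto simp: indicator_def)
  also have "\<dots> = (\<integral>\<^sup>+y. f y * indicator {b..1} y \<partial>lborel) + (\<integral>\<^sup>+y. f y * indicator {1<..1 + b} y \<partial>lborel)"
    by (rule nn_integral_add) auto
  also have "(\<integral>\<^sup>+y. f y * indicator {1<..1 + b} y \<partial>lborel) = (\<integral>\<^sup>+y. f y * indicator {0<..b} y \<partial>lborel)"
  proof -
    have "(\<integral>\<^sup>+y. f y * indicator {1<..1 + b} y \<partial>lborel) = ennreal \<bar>1\<bar> * (\<integral>\<^sup>+x. f (1 + 1 * x) * indicator {1<..1 + b} (1 + 1 * x) \<partial>lborel)"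
      by (rule nn_integral_real_affine) auto
    also have "\<dots> = (\<integral>\<^sup>+y. f y * indicator {0<..b} y \<partial>lborel)"
      by (simp add: add.commute[of 1] per) (intro nn_integral_cong, simp add: indicator_def)
    finally show ?thesis .
  qed
  also have "(\<integral>\<^sup>+y. f y * indicator {b..1} y \<partial>lborel) + (\<integral>\<^sup>+y. f y * indicator {0<..b} y \<partial>lborel)
      = (\<integral>\<^sup>+y. f y * indicator {b..1} y + f y * indicator {0<..b} y \<partial>lborel)"
    by (rule nn_integral_add[symmetric]) auto
  also have "\<dots> = (\<integral>\<^sup>+y. f y * indicator {0..1} y \<partial>lborel)"
  proof (rule nn_integral_cong_AE)
    \<comment> \<open>The pieces from b to 1 and from 0 to b overlap at \<open>b\<close> and miss 0,
      a null set.\<close>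
    have "AE y in lborel. y \<noteq> 0 \<and> y \<noteq> b" by (intro AE_conjI AE_lborel_singleton)
    then show "AE y in lborel. f y * indicator {b..1} y + f y * indicator {0<..b} y = f y * indicator {0..1} y"
      by eventually_elim (use b in \<open>auto simp: indicator_def\<close>)
  qed
  also have "\<dots> = (\<integral>\<^sup>+W. g W \<partial>uniform_circle)" by (simp add: nn_integral_circle f_def)
  finally show ?thesis .
qed

lemma uniform_circle_rotate: "distr uniform_circle borel (\<lambda>W. W * cis (2 * pi * a)) = uniform_circle"
proof (rule measure_eqI)
  fix A assume A: "A \<in> sets (distr uniform_circle borel (\<lambda>W. W * cis (2 * pi * a)))"
  then have [measurable]: "A \<in> sets borel" by simp
  have "emeasure (distr uniform_circle borel (\<lambda>W. W * cis (2 * pi * a))) A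
      = (\<integral>\<^sup>+W. indicator A (W * cis (2 * pi * a)) \<partial>uniform_circle)"
  proof -
    have "emeasure (distr uniform_circle borel (\<lambda>W. W * cis (2 * pi * a))) A
        = (\<integral>\<^sup>+W. indicator A W \<partial>distr uniform_circle borel (\<lambda>W. W * cis (2 * pi * a)))" by simp
    also have "\<dots> = (\<integral>\<^sup>+W. indicator A (W * cis (2 * pi * a)) \<partial>uniform_circle)"
      by (rule nn_integral_distr) (simp_all add: measurable_uniform_circle)
    finally show ?thesis .
  qed
  also have "\<dots> = (\<integral>\<^sup>+W. indicator A W \<partial>uniform_circle)" by (rule nn_integral_circle_shift) simp
  finally show "emeasure (distr uniform_circle borel (\<lambda>W. W * cis (2 * pi * a))) A = emeasure uniform_circle A"
    by simp
qed simp

lemma unit_circle_cases: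
  assumes "cmod W = 1" obtains a where "W = cis (2 * pi * a)"
proof -
  have "W \<noteq> 0" using assms by auto
  then have "W = cis (2 * pi * (Arg W / (2 * pi)))"
    using assms cis_Arg[of W] by (simp add: sgn_eq)
  then show ?thesis by (rule that)
qed

lemma AE_uniform_circle_norm: "AE W in uniform_circle. cmod W = 1"
  unfolding uniform_circle_def by (subst AE_distr_iff) auto

context prob_space
begin

text \<open>By independence the second factor may be fixed first. It lies on the circle almost
  surely, so it merely rotates the first, whose law is invariant.\<close>

lemma uniform_circle_mult:
  assumes ind: "indep_var borel X borel Y"
    and X: "distr M borel X = uniform_circle" and Y: "distr M borel Y = uniform_circle"
  shows "distr M borel (\<lambda>\<omega>. X \<omega> * Y \<omega>) = uniform_circle"
proof -
  interpret C: prob_space uniform_circle by (rule prob_space_uniform_circle)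
  interpret CC: pair_prob_space uniform_circle uniform_circle ..
  have [measurable]: "X \<in> borel_measurable M" "Y \<in> borel_measurable M"
    using indep_var_rv1[OF ind] indep_var_rv2[OF ind] by auto
  have joint: "uniform_circle \<Otimes>\<^sub>M uniform_circle = distr M (borel \<Otimes>\<^sub>M borel) (\<lambda>\<omega>. (X \<omega>, Y \<omega>))"
    using ind unfolding indep_var_distribution_eq X Y by simp
  show ?thesis
  proof (rule measure_eqI)
    fix A assume "A \<in> sets (distr M borel (\<lambda>\<omega>. X \<omega> * Y \<omega>))"
    then have [measurable]: "A \<in> sets borel" by simp
    have "emeasure (distr M borel (\<lambda>\<omega>. X \<omega> * Y \<omega>)) A = (\<integral>\<^sup>+\<omega>. indicator A (X \<omega> * Y \<omega>) \<partial>M)"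
    proof -
      have "emeasure (distr M borel (\<lambda>\<omega>. X \<omega> * Y \<omega>)) A = (\<integral>\<^sup>+W. indicator A W \<partial>distr M borel (\<lambda>\<omega>. X \<omega> * Y \<omega>))" by simp
      also have "\<dots> = (\<integral>\<^sup>+\<omega>. indicator A (X \<omega> * Y \<omega>) \<partial>M)" by (rule nn_integral_distr) auto
      finally show ?thesis .
    qed
    also have "\<dots> = (\<integral>\<^sup>+p. indicator A (fst p * snd p) \<partial>(uniform_circle \<Otimes>\<^sub>M uniform_circle))"
      unfolding joint by (subst nn_integral_distr) simp_all
    also have "\<dots> = (\<integral>\<^sup>+y. (\<integral>\<^sup>+x. indicator A (x * y) \<partial>uniform_circle) \<partial>uniform_circle)"
    proof -
      have m: "(\<lambda>p. indicator A (fst p * snd p) :: ennreal) \<in> borel_measurable (uniform_circle \<Otimes>\<^sub>M uniform_circle)"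
        unfolding joint by simp
      show ?thesis using CC.nn_integral_snd[OF m] by simp
    qed
    also have "\<dots> = (\<integral>\<^sup>+y. emeasure uniform_circle A \<partial>uniform_circle)"
    proof (rule nn_integral_cong_AE)
      show "AE y in uniform_circle. (\<integral>\<^sup>+x. indicator A (x * y) \<partial>uniform_circle) = emeasure uniform_circle A"
        using AE_uniform_circle_norm
      proof eventually_elim
        case (elim y)
        then obtain a where "y = cis (2 * pi * a)" by (rule unit_circle_cases)
        then have "(\<integral>\<^sup>+x. indicator A (x * y) \<partial>uniform_circle) = (\<integral>\<^sup>+x. indicator A x \<partial>uniform_circle)"
          by (simp only: nn_integral_circle_shift borel_measurable_indicator \<open>A \<in> sets borel\<close>)
        then show ?case by simp
      qed
    qed
    also have "\<dots> = emeasure uniform_circle A" using C.emeasure_space_1 by simp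
    finally show "emeasure (distr M borel (\<lambda>\<omega>. X \<omega> * Y \<omega>)) A = emeasure uniform_circle A" .
  qed simp
qed

lemma indep_var_prod_rest:
  fixes X :: "'i \<Rightarrow> 'a \<Rightarrow> complex"
  assumes I: "finite I" "i \<notin> I" and indep: "indep_vars (\<lambda>_. borel) X (insert i I)"
  shows "indep_var borel (X i) borel (\<lambda>\<omega>. \<Prod>i\<in>I. X i \<omega>)"
proof -
  have "indep_var
    borel ((\<lambda>f. f i) \<circ> (\<lambda>\<omega>. restrict (\<lambda>i. X i \<omega>) {i}))
    borel ((\<lambda>f. \<Prod>i\<in>I. f i) \<circ> (\<lambda>\<omega>. restrict (\<lambda>i. X i \<omega>) I))"
    using I by (intro indep_var_compose[OF indep_var_restrict[OF indep]]) auto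
  also have "((\<lambda>f. f i) \<circ> (\<lambda>\<omega>. restrict (\<lambda>i. X i \<omega>) {i})) = X i"
    by auto
  also have "((\<lambda>f. \<Prod>i\<in>I. f i) \<circ> (\<lambda>\<omega>. restrict (\<lambda>i. X i \<omega>) I)) = (\<lambda>\<omega>. \<Prod>i\<in>I. X i \<omega>)"
    by (rule ext) simp
  finally show ?thesis .
qed

lemma uniform_circle_prod:
  fixes Z :: "'i \<Rightarrow> 'a \<Rightarrow> complex"
  assumes "finite I" "I \<noteq> {}" and "indep_vars (\<lambda>_. borel) Z I"
    and "\<And>i. i \<in> I \<Longrightarrow> distr M borel (Z i) = uniform_circle"
  shows "distr M borel (\<lambda>\<omega>. \<Prod>i\<in>I. Z i \<omega>) = uniform_circle"
  using assms
proof (induction I rule: finite_ne_induct)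
  case (singleton i)
  then show ?case by simp
next
  case (insert i I)
  have "indep_var borel (Z i) borel (\<lambda>\<omega>. \<Prod>i\<in>I. Z i \<omega>)"
    by (rule indep_var_prod_rest) (use insert in auto)
  moreover have "distr M borel (\<lambda>\<omega>. \<Prod>i\<in>I. Z i \<omega>) = uniform_circle"
    by (rule insert.IH) (use insert.prems indep_vars_subset[OF insert.prems(1)] in auto)
  ultimately show ?case using insert by (simp add: uniform_circle_mult)
qed

end

text \<open>For \<open>|W| = 1\<close> this is the number of \<open>l\<close>-th roots of \<open>W\<close> on the arc minus its mean \<open>l (b - a)\<close>.\<close>

definition arc_dev :: "nat \<Rightarrow> real \<Rightarrow> real \<Rightarrow> complex \<Rightarrow> real" where
  "arc_dev l a b W = frac (real l * a - Arg W / (2 * pi)) - frac (real l * b - Arg W / (2 * pi))"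

text \<open>\<open>Arg\<close> is continuous off the nonpositive reals, constantly \<open>pi\<close>
  on the negative ones and 0 at 0, so it is pasted together from measurable pieces.\<close>

lemma measurable_Arg [measurable]: "Arg \<in> borel_measurable borel"
proof -
  define S where "S = - (\<real>\<^sub>\<le>\<^sub>0 :: complex set)"
  have S: "S \<in> sets borel" unfolding S_def by (intro borel_open open_Compl) simp
  have "continuous_on S Arg"
    by (intro continuous_at_imp_continuous_on ballI continuous_at_Arg) (simp add: S_def)
  then have "(\<lambda>z. indicator S z *\<^sub>R Arg z) \<in> borel_measurable borel"
    by (rule borel_measurable_continuous_on_indicator[OF S])
  then have m: "(\<lambda>z. indicator S z *\<^sub>R Arg z + indicator (- S - {0}) z *\<^sub>R pi) \<in> borel_measurable borel"
    using S by simp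
  have "Arg z = indicator S z *\<^sub>R Arg z + indicator (- S - {0}) z *\<^sub>R pi" for z
  proof (cases "z \<in> S \<or> z = 0")
    case False
    then obtain r where r: "z = complex_of_real r" "r < 0"
      by (auto simp: S_def nonpos_Reals_def) (metis less_eq_real_def of_real_0)
    then have "Arg z = pi" by simp
    then show ?thesis using False by simp
  qed (auto simp: Arg_zero)
  then have "Arg = (\<lambda>z. indicator S z *\<^sub>R Arg z + indicator (- S - {0}) z *\<^sub>R pi)" by (rule ext)
  then show ?thesis using m by (simp only:)
qed

lemma measurable_frac [measurable]: "(frac :: real \<Rightarrow> real) \<in> borel_measurable borel"
  unfolding frac_def by measurable

lemma measurable_arc_dev [measurable]: "arc_dev l a b \<in> borel_measurable borel"
  unfolding arc_dev_def by measurable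

lemma arc_dev_bound: "\<bar>arc_dev l a b W\<bar> \<le> 1"
  unfolding arc_dev_def
  using frac_ge_0[of "real l * a - Arg W / (2 * pi)"] frac_lt_1[of "real l * a - Arg W / (2 * pi)"]
    frac_ge_0[of "real l * b - Arg W / (2 * pi)"] frac_lt_1[of "real l * b - Arg W / (2 * pi)"]
  by linarith

lemma frac_diff_Ints: "x - y \<in> \<int> \<Longrightarrow> frac (c - x) = frac (c - y)" for x y c :: real
proof -
  assume "x - y \<in> \<int>"
  then obtain k where "x = y + of_int k" by (metis Ints_cases add.commute diff_eq_eq)
  then have "frac (c - x) = frac (c - y + of_int (- k))" by (simp add: algebra_simps)
  then show ?thesis by (simp only: frac_add_of_int)
qed

lemma arc_dev_cis: "arc_dev l a b (cis (2 * pi * x)) = frac (real l * a - x) - frac (real l * b - x)"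
proof -
  define u where "u = Arg (cis (2 * pi * x)) / (2 * pi)"
  have "cis (2 * pi * u) = cis (2 * pi * x)" unfolding u_def using cis_Arg[of "cis (2 * pi * x)"] by (simp add: sgn_eq)
  then have "u - x \<in> \<int>" by (simp only: cis_2pi_eq_iff)
  then show ?thesis unfolding arc_dev_def u_def[symmetric] by (simp only: frac_diff_Ints)
qed

lemma arc_roots_unit:
  assumes "l \<ge> 1" "a < b" "b \<le> a + 1" "cmod W = 1"
  shows "real (arc_roots l W a b) = real l * (b - a) + arc_dev l a b W"
proof -
  obtain x where "W = cis (2 * pi * x)" using assms(4) by (rule unit_circle_cases)
  then show ?thesis using arc_roots_cis[OF assms(1-3), of x] by (simp add: arc_dev_cis)
qed

lemma measurable_arc_roots:
  assumes "l \<ge> 1" "a < b" "b \<le> a + 1"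
  shows "(\<lambda>W. real (arc_roots l W a b)) \<in> borel_measurable borel"
proof -
  have "(\<lambda>W. real (arc_roots l W a b)) = (\<lambda>W. if cmod W = 1 then real l * (b - a) + arc_dev l a b W else 0)"
    by (rule ext) (simp add: arc_roots_unit[OF assms] arc_roots_off_circle)
  also have "\<dots> \<in> borel_measurable borel" by measurable
  finally show ?thesis .
qed

lemma circle_integral_shift:
  fixes g :: "complex \<Rightarrow> real"
  assumes [measurable]: "g \<in> borel_measurable borel"
  shows "(LINT W|uniform_circle. g W) = (LINT x|unit_uniform. g (cis (2 * pi * (x + a))))"
proof -
  have "(LINT W|uniform_circle. g W) = (LINT W|distr uniform_circle borel (\<lambda>W. W * cis (2 * pi * a)). g W)"
    unfolding uniform_circle_rotate ..
  also have "\<dots> = (LINT W|uniform_circle. g (W * cis (2 * pi * a)))"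
    by (rule integral_distr) (simp_all add: measurable_uniform_circle)
  also have "\<dots> = (LINT x|unit_uniform. g (cis (2 * pi * x) * cis (2 * pi * a)))"
    unfolding uniform_circle_def by (rule integral_distr) auto
  finally show ?thesis by (simp add: cis_mult distrib_left)
qed

text \<open>After a rotation that turns the second fractional part into 1 - x, the deviation takes
  just two values: f - 1 on an interval of length f, and f on the rest. All moments of this
  two-point law follow at once.\<close>

lemma arc_dev_integral_power:
  fixes l :: nat and a b :: real
  defines "f \<equiv> frac (real l * (a - b))"
  shows "(LINT W|uniform_circle. (arc_dev l a b W) ^ n) = (f - 1) ^ n * f + f ^ n * (1 - f)"
proof -
  interpret U: prob_space unit_uniform by (rule prob_space_unit_uniform)
  have f: "0 \<le> f" "f < 1" by (auto simp: f_def frac_lt_1)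
  have "(LINT W|uniform_circle. (arc_dev l a b W) ^ n)
      = (LINT x|unit_uniform. (arc_dev l a b (cis (2 * pi * (x + real l * b)))) ^ n)"
    by (rule circle_integral_shift) measurable
  also have "\<dots> = (LINT x|unit_uniform. (f - 1) ^ n * indicator {0..f} x + f ^ n * indicator {f<..1} x)"
  proof (rule integral_cong_AE)
    have "AE x in lborel. x \<noteq> (0 :: real) \<and> x \<noteq> 1" by (intro AE_conjI AE_lborel_singleton)
    then have "AE x in lborel. x \<in> {0..1 :: real} \<longrightarrow> 0 < x \<and> x < 1"
    proof eventually_elim
      case (elim x)
      then show ?case unfolding atLeastAtMost_iff by linarith
    qed
    then have "AE x in unit_uniform. 0 < x \<and> x < 1" by (rule AE_uniform_measureI[rotated]) simp
    then show "AE x in unit_uniform. (arc_dev l a b (cis (2 * pi * (x + real l * b)))) ^ n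
        = (f - 1) ^ n * indicator {0..f} x + f ^ n * indicator {f<..1} x"
    proof eventually_elim
      case (elim x)
      have 1: "frac (real l * b - (x + real l * b)) = 1 - x"
        using elim by (subst frac_unique_iff) auto
      have e: "real l * a - (x + real l * b) = f - x + of_int \<lfloor>real l * (a - b)\<rfloor>"
        by (simp add: f_def frac_def algebra_simps)
      have "frac (real l * a - (x + real l * b)) = frac (f - x)" unfolding e by (rule frac_add_of_int)
      also have "\<dots> = (if x \<le> f then f - x else f - x + 1)"
        using elim f by (subst frac_unique_iff) auto
      finally have "arc_dev l a b (cis (2 * pi * (x + real l * b))) = (if x \<le> f then f - 1 else f)"
        unfolding arc_dev_cis 1 by simp
      then show ?case using elim f by (simp add: indicator_def)
    qed
  qed auto
  also have "\<dots> = (f - 1) ^ n * measure unit_uniform {0..f} + f ^ n * measure unit_uniform {f<..1}"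
    by (simp add: less_top[symmetric] U.emeasure_eq_measure)
  also have "measure unit_uniform {0..f} = f"
    using f by (subst measure_uniform_measure) (auto simp: Int_absorb1)
  also have "measure unit_uniform {f<..1} = 1 - f"
  proof -
    have "{0..1} \<inter> {f<..1} = {f<..1}" using f by auto
    then show ?thesis using f by (subst measure_uniform_measure) auto
  qed
  finally show ?thesis .
qed

lemma arc_dev_integral: "(LINT W|uniform_circle. arc_dev l a b W) = 0"
  using arc_dev_integral_power[of l a b 1] by (simp add: algebra_simps)

lemma arc_dev_integral_square: "(LINT W|uniform_circle. (arc_dev l a b W)\<^sup>2) = h_fun l (a - b)"
  using arc_dev_integral_power[of l a b 2] by (simp add: h_fun_def power2_eq_square algebra_simps)

lemma integrable_circle_bounded:
  fixes f :: "complex \<Rightarrow> 'b::{banach,second_countable_topology}"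
  assumes "f \<in> borel_measurable borel" "\<And>W. norm (f W) \<le> K"
  shows "integrable uniform_circle f"
proof -
  interpret prob_space uniform_circle by (rule prob_space_uniform_circle)
  show ?thesis
    by (rule integrable_const_bound[of _ K]) (use assms in \<open>auto simp: measurable_cong_sets[OF sets_uniform_circle(1) refl]\<close>)
qed

text \<open>A product of two differences of four numbers is half a signed sum of four squares of
  differences. Each square is itself a deviation, whose mean is a value of \<open>h_fun\<close>;
  this explains the four terms in \<open>c_tilde\<close>.\<close>

lemma arc_dev_integral_product:
  "(LINT W|uniform_circle. arc_dev l s t W * arc_dev l u v W)
    = (h_fun l (t - u) + h_fun l (s - v) - h_fun l (s - u) - h_fun l (t - v)) / 2"
proof -
  have sq: "integrable uniform_circle (\<lambda>W. (arc_dev l x y W)\<^sup>2)" for x y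
  proof (rule integrable_circle_bounded[of _ 1])
    fix W show "norm ((arc_dev l x y W)\<^sup>2) \<le> 1"
      using arc_dev_bound[of l x y W] by (simp add: abs_square_le_1)
  qed measurable
  have e: "arc_dev l s t W * arc_dev l u v W
      = ((arc_dev l t u W)\<^sup>2 + (arc_dev l s v W)\<^sup>2 - (arc_dev l s u W)\<^sup>2 - (arc_dev l t v W)\<^sup>2) / 2" for W
    by (simp add: arc_dev_def power2_eq_square algebra_simps)
  have "(LINT W|uniform_circle. arc_dev l s t W * arc_dev l u v W)
      = ((LINT W|uniform_circle. (arc_dev l t u W)\<^sup>2) + (LINT W|uniform_circle. (arc_dev l s v W)\<^sup>2)
        - (LINT W|uniform_circle. (arc_dev l s u W)\<^sup>2) - (LINT W|uniform_circle. (arc_dev l t v W)\<^sup>2)) / 2"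
    unfolding e using sq by simp
  then show ?thesis by (simp only: arc_dev_integral_square)
qed

section \<open>Eigenvalue counts as sums over cycles\<close>

lemma sum_cycles_type: "(\<Sum>C\<in>cycles N p. g (card C)) = (\<Sum>j\<in>#cycle_type N p. g j)"
  by (simp add: cycle_type_def sum_unfold_sum_mset image_mset.compositionality o_def)

lemma prod_cycles_type: "(\<Prod>C\<in>cycles N p. g (card C)) = (\<Prod>j\<in>#cycle_type N p. g j)"
  by (simp add: cycle_type_def prod_unfold_prod_mset image_mset.compositionality o_def)

lemma card_cycle_pos: "p permutes {..<N} \<Longrightarrow> C \<in> cycles N p \<Longrightarrow> card C \<ge> 1"
  using cycles_finite[of p N C] cycles_nonempty[of C N p] by (simp add: Suc_le_eq card_gt_0_iff)

lemma sum_real_card_cycles: "p permutes {..<N} \<Longrightarrow> (\<Sum>C\<in>cycles N p. real (card C)) = real N"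
  unfolding of_nat_sum[symmetric] by (simp only: sum_card_cycles)

lemma eigenvalue_count_perm:
  assumes p: "p permutes {..<N}" and ab: "a < b" "b \<le> a + 1"
  shows "real (eigenvalue_count (perm_mat N p) (circle_arc a b))
    = real N * (b - a) + (\<Sum>j\<in>#cycle_type N p. frac (real j * a) - frac (real j * b))"
proof -
  have "real (eigenvalue_count (perm_mat N p) (circle_arc a b))
      = (\<Sum>C\<in>cycles N p. real (arc_roots (card C) (cycle_weight (\<lambda>_. 1) C) a b))"
    unfolding perm_mat_twisted eigenvalue_count_twisted[OF p] by simp
  also have "\<dots> = (\<Sum>C\<in>cycles N p. real (card C) * (b - a) + (frac (real (card C) * a) - frac (real (card C) * b)))"
  proof (intro sum.cong refl)
    fix C assume "C \<in> cycles N p"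
    then have "card C \<ge> 1" by (rule card_cycle_pos[OF p])
    from arc_roots_cis[OF this ab, of 0]
    show "real (arc_roots (card C) (cycle_weight (\<lambda>_. 1) C) a b)
        = real (card C) * (b - a) + (frac (real (card C) * a) - frac (real (card C) * b))"
      by (simp add: cycle_weight_def)
  qed
  also have "\<dots> = real N * (b - a) + (\<Sum>C\<in>cycles N p. frac (real (card C) * a) - frac (real (card C) * b))"
    unfolding sum.distrib sum_distrib_right[symmetric] sum_real_card_cycles[OF p] ..
  finally show ?thesis
    by (simp only: sum_cycles_type[of "\<lambda>j. frac (real j * a) - frac (real j * b)"])
qed

text \<open>A function of a fixed permutation and a fixed weight sequence, which allows the
  randomness of \<sigma> and of z to be treated separately.\<close>

definition twisted_count :: "nat \<Rightarrow> real \<Rightarrow> real \<Rightarrow> (nat \<Rightarrow> nat) \<Rightarrow> (nat \<Rightarrow> complex) \<Rightarrow> real" where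
  "twisted_count N a b p w = (\<Sum>C\<in>cycles N p. real (arc_roots (card C) (cycle_weight w C) a b))"

lemma eigenvalue_count_twisted_real:
  "p permutes {..<N} \<Longrightarrow> real (eigenvalue_count (twisted_perm_mat N w p) (circle_arc a b)) = twisted_count N a b p w"
  by (simp add: eigenvalue_count_twisted twisted_count_def)

lemma twisted_count_bounds:
  assumes p: "p permutes {..<N}"
  shows "0 \<le> twisted_count N a b p w" "twisted_count N a b p w \<le> real N"
proof -
  show "0 \<le> twisted_count N a b p w" unfolding twisted_count_def by (intro sum_nonneg) simp
  have "twisted_count N a b p w \<le> (\<Sum>C\<in>cycles N p. real (card C))"
    unfolding twisted_count_def using card_cycle_pos[OF p] by (intro sum_mono) (simp add: arc_roots_le)
  then show "twisted_count N a b p w \<le> real N" by (simp only: sum_real_card_cycles[OF p])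
qed

lemma measurable_cycle_weight:
  "(\<lambda>w. cycle_weight w C) \<in> borel_measurable (Pi\<^sub>M UNIV (\<lambda>_::nat. borel))"
  unfolding cycle_weight_def by measurable

lemma measurable_twisted_count:
  assumes p: "p permutes {..<N}" and ab: "a < b" "b \<le> a + 1"
  shows "twisted_count N a b p \<in> borel_measurable (Pi\<^sub>M UNIV (\<lambda>_::nat. borel))"
  unfolding twisted_count_def
  by (intro borel_measurable_sum measurable_compose[OF measurable_cycle_weight measurable_arc_roots] card_cycle_pos[OF p] ab)

lemma twisted_count_unit:
  assumes p: "p permutes {..<N}" and ab: "a < b" "b \<le> a + 1"
    and w: "\<And>C. C \<in> cycles N p \<Longrightarrow> cmod (cycle_weight w C) = 1"
  shows "twisted_count N a b p w = real N * (b - a) + (\<Sum>C\<in>cycles N p. arc_dev (card C) a b (cycle_weight w C))"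
proof -
  have "twisted_count N a b p w = (\<Sum>C\<in>cycles N p. real (card C) * (b - a) + arc_dev (card C) a b (cycle_weight w C))"
    unfolding twisted_count_def by (intro sum.cong refl arc_roots_unit card_cycle_pos[OF p] ab w)
  then show ?thesis unfolding sum.distrib sum_distrib_right[symmetric] sum_real_card_cycles[OF p] .
qed

section \<open>The random matrix model\<close>

locale twisted_model = prob_space M + ewens \<theta> for M :: "'a measure" and \<theta> :: real +
  fixes \<sigma> :: "nat \<Rightarrow> 'a \<Rightarrow> nat \<Rightarrow> nat" and z :: "nat \<Rightarrow> 'a \<Rightarrow> complex"
  assumes sigma_measurable: "\<And>N. N \<ge> 1 \<Longrightarrow> \<sigma> N \<in> measurable M (count_space (sym_group N))"
    and sigma_ewens: "\<And>N. N \<ge> 1 \<Longrightarrow> distr M (count_space (sym_group N)) (\<sigma> N) = ewens_measure \<theta> N"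
    and z_indep: "indep_vars (\<lambda>_. borel) z UNIV"
    and z_uniform: "\<And>j. distr M borel (z j) = uniform_circle"
    and z_sigma_indep: "indep_set
      (sets (vimage_algebra (space M) (\<lambda>\<omega>. \<lambda>j\<in>UNIV. z j \<omega>) (\<Pi>\<^sub>M j\<in>UNIV. borel)))
      (sets (vimage_algebra (space M) (\<lambda>\<omega>. \<lambda>N\<in>{1..}. \<sigma> N \<omega>)
        (\<Pi>\<^sub>M N\<in>{1..}. count_space (sym_group N))))"
begin

lemma z_measurable [measurable]: "z i \<in> borel_measurable M"
  using z_indep by (auto simp: indep_vars_def)

lemma z_tuple_measurable: "(\<lambda>\<omega> i. z i \<omega>) \<in> M \<rightarrow>\<^sub>M Pi\<^sub>M UNIV (\<lambda>_. borel)"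
  by (rule measurable_PiM_single') auto

lemma sigma_permutes: "N \<ge> 1 \<Longrightarrow> \<omega> \<in> space M \<Longrightarrow> \<sigma> N \<omega> permutes {..<N}"
  using measurable_space[OF sigma_measurable, of N \<omega>] by (simp add: sym_group_def)

lemma finite_sym_group: "finite (sym_group N)"
  unfolding sym_group_def by (rule finite_permutations) simp

lemma prob_sigma:
  assumes N: "N \<ge> 1" and p: "p permutes {..<N}"
  shows "prob (\<sigma> N -` {p} \<inter> space M) = \<theta> ^ num_cycles N p / pochhammer \<theta> N"
proof -
  have pS: "p \<in> sym_group N" using p by (simp add: sym_group_def)
  have "prob (\<sigma> N -` {p} \<inter> space M) = measure (distr M (count_space (sym_group N)) (\<sigma> N)) {p}"
    using pS by (intro measure_distr[symmetric] sigma_measurable[OF N]) simp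
  also have "\<dots> = measure (ewens_measure \<theta> N) {p}" by (simp only: sigma_ewens[OF N])
  also have "emeasure (ewens_measure \<theta> N) {p} = ennreal (\<theta> ^ num_cycles N p / pochhammer \<theta> N)"
    unfolding ewens_measure_def using pS
    by (subst emeasure_point_measure_finite[OF finite_sym_group]) auto
  then have "measure (ewens_measure \<theta> N) {p} = \<theta> ^ num_cycles N p / pochhammer \<theta> N"
    using theta_pos pochhammer_pos[of \<theta> N] by (simp add: measure_def)
  finally show ?thesis .
qed

text \<open>Independence is given for the two generated \<sigma>-algebras. A measurable function of
  all z, and any function of one \<sigma>_N, are measurable with respect to these, so the
  \<sigma>-algebras that they generate are smaller and still independent.\<close>

lemma indep_sigma_z:
  fixes g :: "(nat \<Rightarrow> nat) \<Rightarrow> 'b::topological_space" and H :: "(nat \<Rightarrow> complex) \<Rightarrow> 'b"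
  assumes N: "N \<ge> 1" and H: "H \<in> borel_measurable (Pi\<^sub>M UNIV (\<lambda>_. borel))"
  shows "indep_var borel (\<lambda>\<omega>. H (\<lambda>i. z i \<omega>)) borel (\<lambda>\<omega>. g (\<sigma> N \<omega>))"
proof -
  define V1 where "V1 = vimage_algebra (space M) (\<lambda>\<omega>. \<lambda>j\<in>UNIV. z j \<omega>) (\<Pi>\<^sub>M j\<in>UNIV. borel :: complex measure)"
  define V2 where "V2 = vimage_algebra (space M) (\<lambda>\<omega>. \<lambda>N\<in>{1..}. \<sigma> N \<omega>) (\<Pi>\<^sub>M N\<in>{1..}. count_space (sym_group N))"
  have 1: "(\<lambda>\<omega>. \<lambda>j\<in>UNIV. z j \<omega>) \<in> V1 \<rightarrow>\<^sub>M (\<Pi>\<^sub>M j\<in>UNIV. borel)"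
    unfolding V1_def by (rule measurable_vimage_algebra1) (auto simp: space_PiM)
  have m1: "(\<lambda>\<omega>. H (\<lambda>i. z i \<omega>)) \<in> borel_measurable V1"
    using measurable_compose[OF 1 H] by (simp add: restrict_def)
  have 2: "(\<lambda>\<omega>. \<lambda>N\<in>{1..}. \<sigma> N \<omega>) \<in> V2 \<rightarrow>\<^sub>M (\<Pi>\<^sub>M N\<in>{1..}. count_space (sym_group N))"
    unfolding V2_def
    by (rule measurable_vimage_algebra1) (auto simp: space_PiM sym_group_def sigma_permutes)
  have "(\<lambda>f. f N) \<in> (\<Pi>\<^sub>M N\<in>{1..}. count_space (sym_group N)) \<rightarrow>\<^sub>M count_space (sym_group N)"
    using N by (intro measurable_component_singleton) simp
  from measurable_compose[OF measurable_compose[OF 2 this], of g borel]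
  have m2: "(\<lambda>\<omega>. g (\<sigma> N \<omega>)) \<in> borel_measurable V2" using N by simp
  have sp: "space V1 = space M" "space V2 = space M" by (simp_all add: V1_def V2_def)
  have sub1: "{(\<lambda>\<omega>. H (\<lambda>i. z i \<omega>)) -` A \<inter> space M |A. A \<in> sets borel} \<subseteq> sets V1"
    using measurable_sets[OF m1] by (auto simp: sp)
  have sub2: "{(\<lambda>\<omega>. g (\<sigma> N \<omega>)) -` A \<inter> space M |A. A \<in> sets borel} \<subseteq> sets V2"
    using measurable_sets[OF m2] by (auto simp: sp)
  have s1: "sigma_sets (space M) {(\<lambda>\<omega>. H (\<lambda>i. z i \<omega>)) -` A \<inter> space M |A. A \<in> sets borel} \<subseteq> sets V1"
    using sets.sigma_sets_subset[OF sub1] by (simp only: sp)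
  have s2: "sigma_sets (space M) {(\<lambda>\<omega>. g (\<sigma> N \<omega>)) -` A \<inter> space M |A. A \<in> sets borel} \<subseteq> sets V2"
    using sets.sigma_sets_subset[OF sub2] by (simp only: sp)
  have "indep_set (sigma_sets (space M) {(\<lambda>\<omega>. H (\<lambda>i. z i \<omega>)) -` A \<inter> space M |A. A \<in> sets borel})
      (sigma_sets (space M) {(\<lambda>\<omega>. g (\<sigma> N \<omega>)) -` A \<inter> space M |A. A \<in> sets borel})"
    using z_sigma_indep unfolding indep_set_def V1_def[symmetric] V2_def[symmetric]
    by (rule indep_sets_mono_sets) (use s1 s2 in \<open>auto split: bool.splits\<close>)
  moreover have "(\<lambda>\<omega>. H (\<lambda>i. z i \<omega>)) \<in> borel_measurable M"
    using measurable_compose[OF z_tuple_measurable H] by simp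
  moreover have "(\<lambda>\<omega>. g (\<sigma> N \<omega>)) \<in> borel_measurable M"
    using measurable_compose[OF sigma_measurable[OF N], of g borel] by simp
  ultimately show ?thesis unfolding indep_var_eq by simp
qed

text \<open>As \<sigma>_N takes finitely many values, the integrand is a finite sum of a function of
  z times the indicator of a value of \<sigma>_N. Independence factors each product, which amounts
  to conditioning on the permutation.\<close>

lemma expectation_mixture:
  fixes H :: "(nat \<Rightarrow> nat) \<Rightarrow> (nat \<Rightarrow> complex) \<Rightarrow> 'b::{real_normed_field,banach,second_countable_topology}"
  assumes N: "N \<ge> 1" and H: "\<And>p. p permutes {..<N} \<Longrightarrow> H p \<in> borel_measurable (Pi\<^sub>M UNIV (\<lambda>_. borel))"
    and K: "\<And>p w. p permutes {..<N} \<Longrightarrow> norm (H p w) \<le> K"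
  shows "integrable M (\<lambda>\<omega>. H (\<sigma> N \<omega>) (\<lambda>i. z i \<omega>))"
    and "expectation (\<lambda>\<omega>. H (\<sigma> N \<omega>) (\<lambda>i. z i \<omega>))
      = (\<Sum>p | p permutes {..<N}. of_real (\<theta> ^ num_cycles N p / pochhammer \<theta> N) * expectation (\<lambda>\<omega>. H p (\<lambda>i. z i \<omega>)))"
proof -
  define g where "g p p' = (if p' = p then 1 else 0 :: 'b)" for p p' :: "nat \<Rightarrow> nat"
  have fin: "finite {p. p permutes {..<N}}" by (rule finite_permutations) simp
  have eq: "H (\<sigma> N \<omega>) (\<lambda>i. z i \<omega>) = (\<Sum>p | p permutes {..<N}. H p (\<lambda>i. z i \<omega>) * g p (\<sigma> N \<omega>))"
    if "\<omega> \<in> space M" for \<omega>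
  proof -
    have "(\<Sum>p | p permutes {..<N}. H p (\<lambda>i. z i \<omega>) * g p (\<sigma> N \<omega>))
        = (\<Sum>p | p permutes {..<N}. if p = \<sigma> N \<omega> then H p (\<lambda>i. z i \<omega>) else 0)"
      by (intro sum.cong refl) (simp add: g_def)
    also have "\<dots> = H (\<sigma> N \<omega>) (\<lambda>i. z i \<omega>)"
      using sigma_permutes[OF N that] fin by (simp add: sum.delta)
    finally show ?thesis ..
  qed
  have Hi: "integrable M (\<lambda>\<omega>. H p (\<lambda>i. z i \<omega>))" if "p permutes {..<N}" for p
  proof (rule integrable_const_bound[of _ K])
    show "(\<lambda>\<omega>. H p (\<lambda>i. z i \<omega>)) \<in> borel_measurable M"
      using measurable_compose[OF z_tuple_measurable H[OF that]] by simp
  qed (use K[OF that] in simp)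
  have gm: "(\<lambda>\<omega>. g p (\<sigma> N \<omega>)) \<in> borel_measurable M" for p
    using measurable_compose[OF sigma_measurable[OF N], of "g p" borel] by simp
  have gi: "integrable M (\<lambda>\<omega>. g p (\<sigma> N \<omega>))" for p
    by (rule integrable_const_bound[of _ 1]) (use gm in \<open>auto simp: g_def\<close>)
  have prodi: "integrable M (\<lambda>\<omega>. H p (\<lambda>i. z i \<omega>) * g p (\<sigma> N \<omega>))" if "p permutes {..<N}" for p
    by (rule indep_var_integrable[OF indep_sigma_z[OF N H[OF that]] Hi[OF that] gi])
  have ge: "expectation (\<lambda>\<omega>. g p (\<sigma> N \<omega>)) = of_real (\<theta> ^ num_cycles N p / pochhammer \<theta> N)"
    if p: "p permutes {..<N}" for p
  proof -
    have "expectation (\<lambda>\<omega>. g p (\<sigma> N \<omega>)) = expectation (\<lambda>\<omega>. indicator (\<sigma> N -` {p} \<inter> space M) \<omega> *\<^sub>R 1)"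
      by (intro Bochner_Integration.integral_cong refl) (simp add: g_def indicator_def)
    also have "\<dots> = prob (\<sigma> N -` {p} \<inter> space M) *\<^sub>R 1"
    proof (rule has_bochner_integral_integral_eq, rule has_bochner_integral_indicator)
      show "\<sigma> N -` {p} \<inter> space M \<in> events"
        using p by (intro measurable_sets[OF sigma_measurable[OF N]]) (simp add: sym_group_def)
    qed (simp add: less_top[symmetric])
    finally show ?thesis unfolding prob_sigma[OF N p] by (simp add: of_real_def)
  qed
  have "integrable M (\<lambda>\<omega>. \<Sum>p | p permutes {..<N}. H p (\<lambda>i. z i \<omega>) * g p (\<sigma> N \<omega>))"
    by (rule Bochner_Integration.integrable_sum) (use prodi in simp)
  then show "integrable M (\<lambda>\<omega>. H (\<sigma> N \<omega>) (\<lambda>i. z i \<omega>))"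
    using eq by (subst Bochner_Integration.integrable_cong[OF refl]) auto
  have "expectation (\<lambda>\<omega>. H (\<sigma> N \<omega>) (\<lambda>i. z i \<omega>))
      = expectation (\<lambda>\<omega>. \<Sum>p | p permutes {..<N}. H p (\<lambda>i. z i \<omega>) * g p (\<sigma> N \<omega>))"
    using eq by (intro Bochner_Integration.integral_cong refl)
  also have "\<dots> = (\<Sum>p | p permutes {..<N}. expectation (\<lambda>\<omega>. H p (\<lambda>i. z i \<omega>) * g p (\<sigma> N \<omega>)))"
    by (rule Bochner_Integration.integral_sum) (use prodi in simp)
  also have "\<dots> = (\<Sum>p | p permutes {..<N}. of_real (\<theta> ^ num_cycles N p / pochhammer \<theta> N) * expectation (\<lambda>\<omega>. H p (\<lambda>i. z i \<omega>)))"
  proof (intro sum.cong refl)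
    fix p assume "p \<in> {p. p permutes {..<N}}"
    then have p: "p permutes {..<N}" by simp
    have "expectation (\<lambda>\<omega>. H p (\<lambda>i. z i \<omega>) * g p (\<sigma> N \<omega>))
        = expectation (\<lambda>\<omega>. H p (\<lambda>i. z i \<omega>)) * expectation (\<lambda>\<omega>. g p (\<sigma> N \<omega>))"
      by (rule indep_var_lebesgue_integral[OF indep_sigma_z[OF N H[OF p]] Hi[OF p] gi])
    then show "expectation (\<lambda>\<omega>. H p (\<lambda>i. z i \<omega>) * g p (\<sigma> N \<omega>))
        = of_real (\<theta> ^ num_cycles N p / pochhammer \<theta> N) * expectation (\<lambda>\<omega>. H p (\<lambda>i. z i \<omega>))"
      unfolding ge[OF p] by (simp only: mult.commute)
  qed
  finally show "expectation (\<lambda>\<omega>. H (\<sigma> N \<omega>) (\<lambda>i. z i \<omega>))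
      = (\<Sum>p | p permutes {..<N}. of_real (\<theta> ^ num_cycles N p / pochhammer \<theta> N) * expectation (\<lambda>\<omega>. H p (\<lambda>i. z i \<omega>)))" .
qed

lemma expectation_cycle_type:
  fixes H :: "(nat \<Rightarrow> nat) \<Rightarrow> (nat \<Rightarrow> complex) \<Rightarrow> complex"
  assumes N: "N \<ge> 1" and H: "\<And>p. p permutes {..<N} \<Longrightarrow> H p \<in> borel_measurable (Pi\<^sub>M UNIV (\<lambda>_. borel))"
    and K: "\<And>p w. p permutes {..<N} \<Longrightarrow> norm (H p w) \<le> K"
    and F: "\<And>p. p permutes {..<N} \<Longrightarrow> expectation (\<lambda>\<omega>. H p (\<lambda>i. z i \<omega>)) = F (cycle_type N p)"
  shows "expectation (\<lambda>\<omega>. H (\<sigma> N \<omega>) (\<lambda>i. z i \<omega>)) = ewens_expect N F"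
proof -
  have "expectation (\<lambda>\<omega>. H (\<sigma> N \<omega>) (\<lambda>i. z i \<omega>))
      = (\<Sum>p | p permutes {..<N}. of_real (\<theta> ^ num_cycles N p / pochhammer \<theta> N) * F (cycle_type N p))"
  proof -
    have "expectation (\<lambda>\<omega>. H (\<sigma> N \<omega>) (\<lambda>i. z i \<omega>))
      = (\<Sum>p | p permutes {..<N}. of_real (\<theta> ^ num_cycles N p / pochhammer \<theta> N) * expectation (\<lambda>\<omega>. H p (\<lambda>i. z i \<omega>)))"
      by (rule expectation_mixture(2)[OF N H K])
    also have "\<dots> = (\<Sum>p | p permutes {..<N}. of_real (\<theta> ^ num_cycles N p / pochhammer \<theta> N) * F (cycle_type N p))"
      by (intro sum.cong refl arg_cong2[of _ _ _ _ "(*)"] F) simp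
    finally show ?thesis .
  qed
  then show ?thesis
    by (simp add: ewens_expect_def ewens_sum_def sum_divide_distrib)
qed

lemma expectation_cycle_type_real:
  fixes H :: "(nat \<Rightarrow> nat) \<Rightarrow> (nat \<Rightarrow> complex) \<Rightarrow> real"
  assumes N: "N \<ge> 1" and H: "\<And>p. p permutes {..<N} \<Longrightarrow> H p \<in> borel_measurable (Pi\<^sub>M UNIV (\<lambda>_. borel))"
    and K: "\<And>p w. p permutes {..<N} \<Longrightarrow> \<bar>H p w\<bar> \<le> K"
    and F: "\<And>p. p permutes {..<N} \<Longrightarrow> expectation (\<lambda>\<omega>. H p (\<lambda>i. z i \<omega>)) = F (cycle_type N p)"
    and L: "ewens_expect N (\<lambda>m. of_real (F m)) = of_real L"
  shows "integrable M (\<lambda>\<omega>. H (\<sigma> N \<omega>) (\<lambda>i. z i \<omega>))"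
    and "expectation (\<lambda>\<omega>. H (\<sigma> N \<omega>) (\<lambda>i. z i \<omega>)) = L"
proof -
  show "integrable M (\<lambda>\<omega>. H (\<sigma> N \<omega>) (\<lambda>i. z i \<omega>))"
    by (rule expectation_mixture(1)[where H = H and K = K, OF N H]) (use K in auto)
  have "expectation (\<lambda>\<omega>. complex_of_real (H (\<sigma> N \<omega>) (\<lambda>i. z i \<omega>))) = ewens_expect N (\<lambda>m. of_real (F m))"
  proof (rule expectation_cycle_type[where H = "\<lambda>p w. complex_of_real (H p w)" and K = K, OF N])
    fix p assume p: "p permutes {..<N}"
    show "(\<lambda>w. complex_of_real (H p w)) \<in> borel_measurable (Pi\<^sub>M UNIV (\<lambda>_. borel))"
      using H[OF p] by simp
    show "expectation (\<lambda>\<omega>. complex_of_real (H p (\<lambda>i. z i \<omega>))) = of_real (F (cycle_type N p))"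
      unfolding integral_complex_of_real F[OF p] ..
  qed (use K in simp)
  then show "expectation (\<lambda>\<omega>. H (\<sigma> N \<omega>) (\<lambda>i. z i \<omega>)) = L"
    unfolding integral_complex_of_real L by simp
qed

abbreviation cycW :: "nat set \<Rightarrow> 'a \<Rightarrow> complex" where
  "cycW C \<omega> \<equiv> cycle_weight (\<lambda>i. z i \<omega>) C"

lemma W_measurable [measurable]: "cycW C \<in> borel_measurable M"
  unfolding cycle_weight_def by measurable

lemma indep_W:
  assumes p: "p permutes {..<N}"
  shows "indep_vars (\<lambda>_. borel) cycW (cycles N p)"
proof -
  have "disjoint_family_on (\<lambda>C. C) (cycles N p)"
    using cycles_disjoint[OF p] by (auto simp: disjoint_family_on_def)
  then have "indep_vars (\<lambda>C. Pi\<^sub>M C (\<lambda>_. borel)) (\<lambda>C \<omega>. restrict (\<lambda>i. z i \<omega>) C) (cycles N p)"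
    by (intro indep_vars_restrict[OF z_indep]) auto
  then have "indep_vars (\<lambda>_. borel) (\<lambda>C \<omega>. \<Prod>i\<in>C. (restrict (\<lambda>i. z i \<omega>) C) i) (cycles N p)"
    by (rule indep_vars_compose2) measurable
  moreover have "(\<Prod>i\<in>C. (restrict (\<lambda>i. z i \<omega>) C) i) = cycW C \<omega>" for C \<omega>
    unfolding cycle_weight_def by (intro prod.cong refl) simp
  ultimately show ?thesis by simp
qed

lemma W_uniform:
  assumes p: "p permutes {..<N}" and C: "C \<in> cycles N p"
  shows "distr M borel (cycW C) = uniform_circle"
  unfolding cycle_weight_def
  by (rule uniform_circle_prod[OF cycles_finite[OF p C] cycles_nonempty[OF C] indep_vars_subset[OF z_indep] z_uniform]) auto

lemma AE_W_norm:
  assumes p: "p permutes {..<N}"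
  shows "AE \<omega> in M. \<forall>C\<in>cycles N p. cmod (cycW C \<omega>) = 1"
proof (rule AE_finite_allI)
  fix C assume C: "C \<in> cycles N p"
  have "AE w in distr M borel (cycW C). cmod w = 1" unfolding W_uniform[OF p C] by (rule AE_uniform_circle_norm)
  then show "AE \<omega> in M. cmod (cycW C \<omega>) = 1" by (subst (asm) AE_distr_iff) auto
qed simp

lemma expectation_W:
  fixes f :: "complex \<Rightarrow> 'b::{banach,second_countable_topology}"
  assumes p: "p permutes {..<N}" and C: "C \<in> cycles N p" and f: "f \<in> borel_measurable borel"
  shows "expectation (\<lambda>\<omega>. f (cycW C \<omega>)) = (LINT w|uniform_circle. f w)"
  unfolding W_uniform[OF p C, symmetric] by (rule integral_distr[symmetric]) (use f in auto)

lemma expectation_prod_W: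
  fixes \<psi> :: "nat \<Rightarrow> complex \<Rightarrow> complex"
  assumes p: "p permutes {..<N}" and \<psi>: "\<And>j. \<psi> j \<in> borel_measurable borel" "\<And>j w. cmod (\<psi> j w) \<le> 1"
  shows "expectation (\<lambda>\<omega>. \<Prod>C\<in>cycles N p. \<psi> (card C) (cycW C \<omega>))
    = (\<Prod>j\<in>#cycle_type N p. (LINT w|uniform_circle. \<psi> j w))"
proof -
  have "indep_vars (\<lambda>_. borel) (\<lambda>C \<omega>. \<psi> (card C) (cycW C \<omega>)) (cycles N p)"
    by (rule indep_vars_compose2[OF indep_W[OF p]]) (rule \<psi>(1))
  moreover have "integrable M (\<lambda>\<omega>. \<psi> (card C) (cycW C \<omega>))" for C
    using measurable_compose[OF W_measurable \<psi>(1)] \<psi>(2) by (intro integrable_const_bound[of _ 1]) auto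
  ultimately have "expectation (\<lambda>\<omega>. \<Prod>C\<in>cycles N p. \<psi> (card C) (cycW C \<omega>))
      = (\<Prod>C\<in>cycles N p. expectation (\<lambda>\<omega>. \<psi> (card C) (cycW C \<omega>)))"
    by (intro indep_vars_lebesgue_integral) auto
  also have "\<dots> = (\<Prod>C\<in>cycles N p. (LINT w|uniform_circle. \<psi> (card C) w))"
    by (intro prod.cong refl expectation_W[OF p _ \<psi>(1)])
  finally show ?thesis by (simp only: prod_cycles_type[of "\<lambda>j. LINT w|uniform_circle. \<psi> j w"])
qed

text \<open>Different cycles have independent weights and centred deviations, so the mixed terms
  vanish.\<close>

lemma expectation_dev_square:
  assumes p: "p permutes {..<N}"
  shows "expectation (\<lambda>\<omega>. (\<Sum>C\<in>cycles N p. arc_dev (card C) a b (cycW C \<omega>))\<^sup>2)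
    = (\<Sum>j\<in>#cycle_type N p. h_fun j (a - b))"
proof -
  define D where "D C \<omega> = arc_dev (card C) a b (cycW C \<omega>)" for C \<omega>
  have Dm [measurable]: "D C \<in> borel_measurable M" for C unfolding D_def by measurable
  have Db: "\<bar>D C \<omega>\<bar> \<le> 1" for C \<omega> by (simp add: D_def arc_dev_bound)
  have Di: "integrable M (D C)" for C
    using Db by (intro integrable_const_bound[of _ 1]) auto
  have DDi: "integrable M (\<lambda>\<omega>. D C \<omega> * D C' \<omega>)" for C C'
    using Db by (intro integrable_const_bound[of _ 1]) (auto simp: abs_mult mult_le_one)
  have "expectation (\<lambda>\<omega>. (\<Sum>C\<in>cycles N p. D C \<omega>)\<^sup>2)
      = (\<Sum>C\<in>cycles N p. \<Sum>C'\<in>cycles N p. expectation (\<lambda>\<omega>. D C \<omega> * D C' \<omega>))"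
    unfolding power2_eq_square sum_product using DDi by (simp add: Bochner_Integration.integral_sum)
  also have "\<dots> = (\<Sum>C\<in>cycles N p. \<Sum>C'\<in>cycles N p. if C' = C then h_fun (card C) (a - b) else 0)"
  proof (intro sum.cong refl)
    fix C C' assume C: "C \<in> cycles N p" "C' \<in> cycles N p"
    show "expectation (\<lambda>\<omega>. D C \<omega> * D C' \<omega>) = (if C' = C then h_fun (card C) (a - b) else 0)"
    proof (cases "C' = C")
      case True
      have "expectation (\<lambda>\<omega>. (arc_dev (card C) a b (cycW C \<omega>))\<^sup>2) = h_fun (card C) (a - b)"
        unfolding arc_dev_integral_square[of "card C" a b, symmetric]
        by (rule expectation_W[OF p C(1)]) measurable
      then show ?thesis using True by (simp add: D_def power2_eq_square)
    next
      case False
      have "indep_vars (\<lambda>_. borel) D (cycles N p)"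
        unfolding D_def by (rule indep_vars_compose2[OF indep_W[OF p]]) measurable
      then have "indep_vars (\<lambda>_. borel) D {C, C'}" by (rule indep_vars_subset) (use C in auto)
      then have "expectation (\<lambda>\<omega>. \<Prod>i\<in>{C, C'}. D i \<omega>) = (\<Prod>i\<in>{C, C'}. expectation (D i))"
        by (intro indep_vars_lebesgue_integral Di) auto
      moreover have "expectation (D C) = 0"
        unfolding D_def arc_dev_integral[of "card C" a b, symmetric]
        by (rule expectation_W[OF p C(1)]) measurable
      ultimately show ?thesis using False by simp
    qed
  qed
  also have "\<dots> = (\<Sum>C\<in>cycles N p. h_fun (card C) (a - b))" by simp
  finally show ?thesis unfolding D_def by (simp only: sum_cycles_type[of "\<lambda>j. h_fun j (a - b)"])
qed

end

section \<open>Central limit theorem\<close>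

context ewens
begin

text \<open>The contribution of pairs of different cycles to the covariance, with the product of the
  means already subtracted. It is bilinear, and bounded when \<open>a\<close> and \<open>b\<close>
  are bounded by 1.\<close>

definition pair_part :: "nat \<Rightarrow> (nat \<Rightarrow> real) \<Rightarrow> (nat \<Rightarrow> real) \<Rightarrow> real" where
  "pair_part n a b = covar n a b - mean n (\<lambda>j. a j * b j)"

lemma pair_part_eq:
  "pair_part n a b = (\<Sum>j=0..n. \<Sum>i=0..n. (\<theta> * a j / real j) * (\<theta> * b i / real i) * pair_corr n j i)"
  by (simp add: pair_part_def covar_eq)

lemma mean_sum: "mean n (\<lambda>j. \<Sum>k\<in>S. s k * f k j) = (\<Sum>k\<in>S. s k * mean n (f k))"
proof -
  have "mean n (\<lambda>j. \<Sum>k\<in>S. s k * f k j) = (\<Sum>j=0..n. \<Sum>k\<in>S. s k * (\<theta> * f k j / real j * rho n j))"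
    unfolding mean_eq by (intro sum.cong refl) (simp add: sum_distrib_left sum_distrib_right sum_divide_distrib mult_ac)
  also have "\<dots> = (\<Sum>k\<in>S. \<Sum>j=0..n. s k * (\<theta> * f k j / real j * rho n j))" by (rule sum.swap)
  finally show ?thesis by (simp only: mean_eq sum_distrib_left)
qed

lemma pair_part_sum_left: "pair_part n (\<lambda>j. \<Sum>k\<in>S. s k * f k j) b = (\<Sum>k\<in>S. s k * pair_part n (f k) b)"
proof -
  have "pair_part n (\<lambda>j. \<Sum>k\<in>S. s k * f k j) b
      = (\<Sum>j=0..n. \<Sum>i=0..n. \<Sum>k\<in>S. s k * ((\<theta> * f k j / real j) * (\<theta> * b i / real i) * pair_corr n j i))"
    unfolding pair_part_eq
    by (intro sum.cong refl) (simp add: sum_distrib_left sum_distrib_right sum_divide_distrib mult_ac)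
  also have "\<dots> = (\<Sum>j=0..n. \<Sum>k\<in>S. \<Sum>i=0..n. s k * ((\<theta> * f k j / real j) * (\<theta> * b i / real i) * pair_corr n j i))"
    by (intro sum.cong refl sum.swap)
  also have "\<dots> = (\<Sum>k\<in>S. \<Sum>j=0..n. \<Sum>i=0..n. s k * ((\<theta> * f k j / real j) * (\<theta> * b i / real i) * pair_corr n j i))"
    by (rule sum.swap)
  finally show ?thesis by (simp only: pair_part_eq sum_distrib_left)
qed

lemma pair_part_sum_right: "pair_part n b (\<lambda>j. \<Sum>k\<in>S. s k * f k j) = (\<Sum>k\<in>S. s k * pair_part n b (f k))"
proof -
  have "pair_part n b (\<lambda>j. \<Sum>k\<in>S. s k * f k j)
      = (\<Sum>j=0..n. \<Sum>i=0..n. \<Sum>k\<in>S. s k * ((\<theta> * b j / real j) * (\<theta> * f k i / real i) * pair_corr n j i))"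
    unfolding pair_part_eq
    by (intro sum.cong refl) (simp add: sum_distrib_left sum_distrib_right sum_divide_distrib mult_ac)
  also have "\<dots> = (\<Sum>j=0..n. \<Sum>k\<in>S. \<Sum>i=0..n. s k * ((\<theta> * b j / real j) * (\<theta> * f k i / real i) * pair_corr n j i))"
    by (intro sum.cong refl sum.swap)
  also have "\<dots> = (\<Sum>k\<in>S. \<Sum>j=0..n. \<Sum>i=0..n. s k * ((\<theta> * b j / real j) * (\<theta> * f k i / real i) * pair_corr n j i))"
    by (rule sum.swap)
  finally show ?thesis by (simp only: pair_part_eq sum_distrib_left)
qed

lemma mean_zero [simp]: "mean n (\<lambda>j. 0) = 0"
  by (simp add: mean_eq)

lemma pair_part_zero: "pair_part n (\<lambda>j. 0) b = 0"
  by (simp add: pair_part_eq)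

text \<open>The common limit theorem for both models. For a cycle of length j, \<open>a\<close>
  lists the means of its contributions to the counts, \<open>r\<close> their joint second moments,
  and \<open>\<phi> s j\<close> is the characteristic function of the combination with coefficients
  \<open>s\<close>. The assumption \<open>zero\<close> covers full circles, for which
  standardization divides by 0 and the limit is degenerate.\<close>

lemma gaussian_limit:
  fixes M :: "'a measure" and X :: "nat \<Rightarrow> 'm::finite \<Rightarrow> 'a \<Rightarrow> real"
    and a :: "'m \<Rightarrow> nat \<Rightarrow> real" and r :: "'m \<Rightarrow> 'm \<Rightarrow> nat \<Rightarrow> real" and c :: "'m \<Rightarrow> 'm \<Rightarrow> real"
    and \<phi> :: "('m \<Rightarrow> real) \<Rightarrow> nat \<Rightarrow> complex"
  assumes M: "prob_space M"
    and Xm: "\<And>N k. X N k \<in> borel_measurable M"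
    and Xb: "\<And>N k \<omega>. \<omega> \<in> space M \<Longrightarrow> \<bar>X N k \<omega>\<bar> \<le> real N"
    and a1: "\<And>k j. \<bar>a k j\<bar> \<le> 1" and r1: "\<And>k l j. \<bar>r k l j\<bar> \<le> 1"
    and r_sym: "\<And>k l j. r k l j = r l k j"
    and r_pos: "\<And>s j. (\<Sum>k\<in>UNIV. s k * a k j)\<^sup>2 \<le> (\<Sum>k\<in>UNIV. s k * (\<Sum>l\<in>UNIV. s l * r k l j))"
    and r_le: "\<And>s j. (\<Sum>k\<in>UNIV. s k * (\<Sum>l\<in>UNIV. s l * r k l j)) \<le> (\<Sum>k\<in>UNIV. \<bar>s k\<bar>)\<^sup>2"
    and phi1: "\<And>s j. cmod (\<phi> s j) \<le> 1"
    and phi2: "\<And>s j. cmod (\<phi> s j - (1 + \<i> * of_real (\<Sum>k\<in>UNIV. s k * a k j)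
        - of_real (\<Sum>k\<in>UNIV. s k * (\<Sum>l\<in>UNIV. s l * r k l j)) / 2)) \<le> (\<Sum>k\<in>UNIV. \<bar>s k\<bar>) ^ 3"
    and var: "\<And>N k. N \<ge> 1 \<Longrightarrow> prob_space.variance M (X N k) = mean N (r k k) + pair_part N (a k) (a k)"
    and char: "\<And>N s. N \<ge> 1 \<Longrightarrow> (LINT \<omega>|M. cis (\<Sum>k\<in>UNIV. s k * (X N k \<omega> - prob_space.expectation M (X N k))))
        = ewens_expect N (\<lambda>m. \<Prod>j\<in>#m. \<phi> s j) * cis (- mean N (\<lambda>j. \<Sum>k\<in>UNIV. s k * a k j))"
    and ces: "\<And>k l. (\<lambda>N. (\<Sum>j=1..N. r k l j) / real N) \<longlonglongrightarrow> c k l"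
    and zero: "\<And>k j. c k k = 0 \<Longrightarrow> a k j = 0 \<and> r k k j = 0"
  shows "(\<forall>k. (\<lambda>N. prob_space.variance M (X N k)) \<sim>[at_top] (\<lambda>N. c k k * \<theta> * ln (real N)))
    \<and> (\<exists>\<mu>. centred_gaussian (correlation c) \<mu> \<and> converges_in_distribution M (\<lambda>N. standardize M (X N)) \<mu>)"
proof -
  interpret prob_space M by (rule M)
  note [measurable] = Xm
  define V where "V N k l = mean N (r k l) + pair_part N (a k) (a l)" for N k l
  define v where "v N k = variance (X N k)" for N k
  have ln_ev: "eventually (\<lambda>N. ln (real N) > 0 \<and> N \<ge> 1) sequentially"
    using eventually_gt_at_top[of 1] by eventually_elim simp
  have ln_inf: "filterlim (\<lambda>N. ln (real N)) at_top sequentially"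
    by (rule filterlim_compose[OF ln_at_top filterlim_real_sequentially])
  have V_lim: "(\<lambda>N. V N k l / ln (real N)) \<longlonglongrightarrow> \<theta> * c k l" for k l
  proof -
    have "(\<lambda>N. mean N (r k l) / ln (real N) + pair_part N (a k) (a l) / ln (real N)) \<longlonglongrightarrow> \<theta> * c k l + 0"
      unfolding pair_part_def
      by (intro tendsto_add mean_asymp r1 ces bounded_over_ln[of _ "3841 + 2 * \<theta>\<^sup>2"] covar_mean_diff a1)
    then show ?thesis by (simp add: V_def add_divide_distrib)
  qed
  have vV: "v N k = V N k k" if "N \<ge> 1" for N k by (simp add: v_def V_def var[OF that])
  have v_lim: "(\<lambda>N. v N k / ln (real N)) \<longlonglongrightarrow> \<theta> * c k k" for k
    by (rule Lim_transform_eventually[OF V_lim]) (use ln_ev in \<open>eventually_elim, simp add: vV\<close>)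
  have v_nonneg: "v N k \<ge> 0" for N k unfolding v_def by (rule variance_positive)
  have v_zero: "v N k = 0" if "c k k = 0" "N \<ge> 1" for N k
  proof -
    have "a k = (\<lambda>j. 0)" "r k k = (\<lambda>j. 0)" using zero[OF that(1)] by (auto simp: fun_eq_iff)
    then show ?thesis using vV[OF that(2), of k] by (simp add: V_def pair_part_zero)
  qed
  have c_nonneg: "c k k \<ge> 0" for k
  proof (rule LIMSEQ_le_const[OF ces], intro exI[of _ 0] allI impI divide_nonneg_nonneg sum_nonneg)
    fix j
    define s where "s l = (if l = k then 1 else 0 :: real)" for l
    have "0 \<le> (\<Sum>k\<in>UNIV. s k * (\<Sum>l\<in>UNIV. s l * r k l j))"
      using r_pos[of s j] zero_le_power2[of "\<Sum>k\<in>UNIV. s k * a k j"] by linarith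
    then show "0 \<le> r k k j" by (simp add: s_def if_distrib[of "\<lambda>x. x * _"] cong: if_cong)
  qed simp
  have asymp: "(\<lambda>N. v N k) \<sim>[at_top] (\<lambda>N. c k k * \<theta> * ln (real N))" for k
  proof (cases "c k k = 0")
    case True
    have "eventually (\<lambda>N. (if v N k = 0 \<and> c k k * \<theta> * ln (real N) = 0 then 1 else v N k / (c k k * \<theta> * ln (real N))) = 1) sequentially"
      using eventually_ge_at_top[of 1] by eventually_elim (simp add: True v_zero)
    then show ?thesis unfolding asymp_equiv_def by (rule tendsto_eventually)
  next
    case False
    have "(\<lambda>N. v N k / ln (real N) / (\<theta> * c k k)) \<longlonglongrightarrow> \<theta> * c k k / (\<theta> * c k k)"
      using False theta_pos by (intro tendsto_divide v_lim tendsto_const) auto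
    then have "(\<lambda>N. v N k / (c k k * \<theta> * ln (real N))) \<longlonglongrightarrow> 1"
      using False theta_pos by (simp add: mult_ac)
    then show ?thesis by (rule asymp_equivI')
  qed
  define D where "D = correlation c"
  have c_sym: "c k l = c l k" for k l
    using ces[of k l] ces[of l k] unfolding r_sym[of k l] by (rule LIMSEQ_unique)
  have D_sym: "D k l = D l k" for k l
    by (simp add: D_def correlation_def c_sym[of k l] mult.commute)
  define Y where "Y N = standardize M (X N)" for N
  have Yk: "vec_nth (Y N \<omega>) k = (X N k \<omega> - expectation (X N k)) / sqrt (v N k)" for N \<omega> k
    by (simp add: Y_def standardize_def v_def)
  have Ym: "Y N \<in> borel_measurable M" for N
  proof (subst borel_measurable_euclidean_space, rule ballI)
    fix b :: "real ^ 'm" assume "b \<in> Basis"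
    then obtain k where "b = axis k 1" by (auto simp: Basis_vec_def)
    then have "(\<lambda>\<omega>. inner (Y N \<omega>) b) = (\<lambda>\<omega>. (X N k \<omega> - expectation (X N k)) / sqrt (v N k))"
      by (simp add: inner_axis Yk)
    then show "(\<lambda>\<omega>. inner (Y N \<omega>) b) \<in> borel_measurable M" by simp
  qed
  define s where "s t N k = vec_nth t k / sqrt (v N k)" for t :: "real ^ 'm" and N k
  have inner_Y: "inner t (Y N \<omega>) = (\<Sum>k\<in>UNIV. s t N k * (X N k \<omega> - expectation (X N k)))" for t N \<omega>
    by (simp add: inner_vec_def Yk s_def)
  \<comment> \<open>The coefficients have size 1 / sqrt (ln N). In the degenerate case both sides
    are 0 through division by 0.\<close>
  have s_lim: "(\<lambda>N. s t N k * sqrt (ln (real N))) \<longlonglongrightarrow> vec_nth t k / sqrt (\<theta> * c k k)" for t k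
  proof (cases "c k k = 0")
    case True
    have "eventually (\<lambda>N. s t N k * sqrt (ln (real N)) = 0) sequentially"
      using eventually_ge_at_top[of 1] by eventually_elim (simp add: s_def v_zero[OF True])
    then show ?thesis using True by (simp add: tendsto_eventually)
  next
    case False
    have "(\<lambda>N. vec_nth t k / sqrt (v N k / ln (real N))) \<longlonglongrightarrow> vec_nth t k / sqrt (\<theta> * c k k)"
      using False theta_pos by (intro tendsto_divide tendsto_const tendsto_real_sqrt v_lim) simp
    moreover have "eventually (\<lambda>N. vec_nth t k / sqrt (v N k / ln (real N)) = s t N k * sqrt (ln (real N))) sequentially"
      using ln_ev by eventually_elim (simp add: s_def real_sqrt_divide)
    ultimately show ?thesis by (rule Lim_transform_eventually)
  qed
  define \<eta> where "\<eta> t N = (\<Sum>k\<in>UNIV. \<bar>s t N k\<bar>)" for t N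
  define \<Lambda> where "\<Lambda> t = (\<Sum>k\<in>UNIV. \<bar>vec_nth t k / sqrt (\<theta> * c k k)\<bar>)" for t
  have \<eta>_lim: "(\<lambda>N. \<eta> t N * sqrt (ln (real N))) \<longlonglongrightarrow> \<Lambda> t" for t
  proof -
    have "(\<lambda>N. \<Sum>k\<in>UNIV. \<bar>s t N k * sqrt (ln (real N))\<bar>) \<longlonglongrightarrow> \<Lambda> t"
      unfolding \<Lambda>_def by (intro tendsto_sum tendsto_rabs s_lim)
    moreover have "eventually (\<lambda>N. (\<Sum>k\<in>UNIV. \<bar>s t N k * sqrt (ln (real N))\<bar>) = \<eta> t N * sqrt (ln (real N))) sequentially"
      using ln_ev by eventually_elim (simp add: \<eta>_def sum_distrib_right abs_mult)
    ultimately show ?thesis by (rule Lim_transform_eventually)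
  qed
  have inv_lim: "(\<lambda>N. 1 / sqrt (ln (real N))) \<longlonglongrightarrow> 0"
  proof -
    have "filterlim (\<lambda>N. sqrt (ln (real N))) at_top sequentially"
      by (rule filterlim_compose[OF sqrt_at_top ln_inf])
    then show ?thesis by (intro tendsto_divide_0[OF tendsto_const] filterlim_at_top_imp_at_infinity)
  qed
  have \<eta>0: "(\<lambda>N. \<eta> t N) \<longlonglongrightarrow> 0" for t
  proof -
    have "(\<lambda>N. (\<eta> t N * sqrt (ln (real N))) * (1 / sqrt (ln (real N)))) \<longlonglongrightarrow> \<Lambda> t * 0"
      by (intro tendsto_mult \<eta>_lim inv_lim)
    moreover have "eventually (\<lambda>N. (\<eta> t N * sqrt (ln (real N))) * (1 / sqrt (ln (real N))) = \<eta> t N) sequentially"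
      using ln_ev
    proof eventually_elim
      case (elim N)
      define x where "x = sqrt (ln (real N))"
      have "x \<noteq> 0" using elim by (auto simp: x_def)
      then show ?case unfolding x_def[symmetric] by simp
    qed
    ultimately show ?thesis by (simp add: Lim_transform_eventually)
  qed
  \<comment> \<open>Three factors of size 1 / sqrt (ln N) meet \<open>Q 0 N\<close>, of size ln N,
    which leaves one factor that tends to 0.\<close>
  have err0: "(\<lambda>N. 10 ^ 10 * \<eta> t N ^ 3 * Q 0 N) \<longlonglongrightarrow> 0" for t
  proof -
    have "(\<lambda>N. 10 ^ 10 * (\<eta> t N * sqrt (ln (real N))) ^ 3 * (Q 0 N / ln (real N)) * (1 / sqrt (ln (real N)))) \<longlonglongrightarrow> 10 ^ 10 * \<Lambda> t ^ 3 * \<theta> * 0"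
      by (intro tendsto_mult tendsto_power tendsto_const \<eta>_lim Q_over_ln inv_lim)
    moreover have "eventually (\<lambda>N. 10 ^ 10 * (\<eta> t N * sqrt (ln (real N))) ^ 3 * (Q 0 N / ln (real N)) * (1 / sqrt (ln (real N)))
        = 10 ^ 10 * \<eta> t N ^ 3 * Q 0 N) sequentially"
      using ln_ev
    proof eventually_elim
      case (elim N)
      define x where "x = sqrt (ln (real N))"
      have x: "x > 0" "ln (real N) = x * x" using elim by (auto simp: x_def)
      show ?case unfolding x_def[symmetric] unfolding x(2) using x(1) by (simp add: power3_eq_cube)
    qed
    ultimately show ?thesis by (simp add: Lim_transform_eventually)
  qed
  define VV where "VV t N = (\<Sum>k\<in>UNIV. s t N k * (\<Sum>l\<in>UNIV. s t N l * V N k l))" for t N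
  have VV_lim: "(\<lambda>N. VV t N) \<longlonglongrightarrow> bform D t" for t
  proof -
    have "(\<lambda>N. \<Sum>k\<in>UNIV. (s t N k * sqrt (ln (real N))) * (\<Sum>l\<in>UNIV. (s t N l * sqrt (ln (real N))) * (V N k l / ln (real N))))
        \<longlonglongrightarrow> (\<Sum>k\<in>UNIV. vec_nth t k / sqrt (\<theta> * c k k) * (\<Sum>l\<in>UNIV. vec_nth t l / sqrt (\<theta> * c l l) * (\<theta> * c k l)))"
      by (intro tendsto_sum tendsto_mult s_lim V_lim)
    moreover have "(\<Sum>k\<in>UNIV. vec_nth t k / sqrt (\<theta> * c k k) * (\<Sum>l\<in>UNIV. vec_nth t l / sqrt (\<theta> * c l l) * (\<theta> * c k l))) = bform D t"
    proof -
      have "vec_nth t k / sqrt (\<theta> * c k k) * (vec_nth t l / sqrt (\<theta> * c l l) * (\<theta> * c k l)) = vec_nth t k * vec_nth t l * D k l" for k l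
      proof -
        define x where "x = sqrt \<theta>"
        have x: "x \<noteq> 0" "\<theta> = x * x" using theta_pos by (auto simp: x_def)
        have "vec_nth t k / sqrt (\<theta> * c k k) * (vec_nth t l / sqrt (\<theta> * c l l) * (\<theta> * c k l))
            = vec_nth t k / (x * sqrt (c k k)) * (vec_nth t l / (x * sqrt (c l l)) * (x * x * c k l))"
          unfolding real_sqrt_mult x_def[symmetric] x(2)[symmetric] ..
        also have "\<dots> = vec_nth t k * vec_nth t l * (c k l / (sqrt (c k k) * sqrt (c l l)))"
          using x(1) by simp
        finally show ?thesis by (simp only: D_def correlation_def real_sqrt_mult)
      qed
      then show ?thesis by (simp only: bform_def sum_distrib_left)
    qed
    moreover have "eventually (\<lambda>N. (\<Sum>k\<in>UNIV. (s t N k * sqrt (ln (real N))) * (\<Sum>l\<in>UNIV. (s t N l * sqrt (ln (real N))) * (V N k l / ln (real N)))) = VV t N) sequentially"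
      using ln_ev
    proof eventually_elim
      case (elim N)
      define x where "x = sqrt (ln (real N))"
      have x: "x \<noteq> 0" "ln (real N) = x * x" using elim by (auto simp: x_def)
      have "(s t N k * x) * (s t N l * x * (V N k l / (x * x))) = s t N k * (s t N l * V N k l)" for k l
        using x(1) by simp
      then show ?case unfolding VV_def x_def[symmetric] unfolding x(2) sum_distrib_left by (simp only: mult.assoc)
    qed
    ultimately show ?thesis by (simp only: Lim_transform_eventually)
  qed
  have est: "eventually (\<lambda>N. cmod ((LINT \<omega>|M. cis (inner t (Y N \<omega>))) - of_real (exp (- (VV t N / 2)))) \<le> 10 ^ 10 * \<eta> t N ^ 3 * Q 0 N) sequentially" for t
  proof -
    have "eventually (\<lambda>N. \<eta> t N < 1) sequentially" by (rule order_tendstoD(2)[OF \<eta>0]) simp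
    with ln_ev show ?thesis
    proof eventually_elim
      case (elim N)
      define A where "A j = (\<Sum>k\<in>UNIV. s t N k * a k j)" for j
      define R where "R j = (\<Sum>k\<in>UNIV. s t N k * (\<Sum>l\<in>UNIV. s t N l * r k l j))" for j
      have "cmod (ewens_expect N (\<lambda>m. \<Prod>j\<in>#m. \<phi> (s t N) j) * cis (- mean N A)
          - exp (- ((mean N R + (covar N A A - mean N (\<lambda>j. A j * A j))) / 2))) \<le> 10 ^ 10 * \<eta> t N ^ 3 * Q 0 N"
      proof (rule ewens_char_fun_estimate)
        show "0 \<le> \<eta> t N" unfolding \<eta>_def by (intro sum_nonneg) simp
        show "\<eta> t N \<le> 1" using elim by simp
        show "\<bar>A j\<bar> \<le> \<eta> t N" for j
          unfolding A_def \<eta>_def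
        proof (rule order.trans[OF sum_abs], rule sum_mono)
          fix k show "\<bar>s t N k * a k j\<bar> \<le> \<bar>s t N k\<bar>"
            unfolding abs_mult using mult_left_mono[OF a1[of k j], of "\<bar>s t N k\<bar>"] by simp
        qed
        show "(A j)\<^sup>2 \<le> R j" for j unfolding A_def R_def by (rule r_pos)
        show "R j \<le> (\<eta> t N)\<^sup>2" for j unfolding R_def \<eta>_def by (rule r_le)
        show "cmod (\<phi> (s t N) j) \<le> 1" for j by (rule phi1)
        show "cmod (\<phi> (s t N) j - (1 + \<i> * A j - R j / 2)) \<le> \<eta> t N ^ 3" for j
          using phi2[of "s t N" j] by (simp add: A_def R_def \<eta>_def)
      qed
      moreover have "mean N R + (covar N A A - mean N (\<lambda>j. A j * A j)) = VV t N"
      proof -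
        have "mean N R = (\<Sum>k\<in>UNIV. s t N k * (\<Sum>l\<in>UNIV. s t N l * mean N (r k l)))"
          unfolding R_def mean_sum ..
        moreover have "pair_part N A A = (\<Sum>k\<in>UNIV. s t N k * (\<Sum>l\<in>UNIV. s t N l * pair_part N (a k) (a l)))"
          unfolding A_def pair_part_sum_left pair_part_sum_right ..
        ultimately show ?thesis
          unfolding pair_part_def[symmetric] VV_def V_def by (simp only: distrib_left sum.distrib)
      qed
      moreover have "(LINT \<omega>|M. cis (inner t (Y N \<omega>))) = ewens_expect N (\<lambda>m. \<Prod>j\<in>#m. \<phi> (s t N) j) * cis (- mean N A)"
        unfolding inner_Y A_def using elim by (intro char) simp
      ultimately show ?case by (simp only:)
    qed
  qed
  have char_lim: "(\<lambda>N. LINT \<omega>|M. cis (inner t (Y N \<omega>))) \<longlonglongrightarrow> of_real (exp (- (bform D t) / 2))" for t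
  proof -
    have "(\<lambda>N. (LINT \<omega>|M. cis (inner t (Y N \<omega>))) - of_real (exp (- (VV t N / 2)))) \<longlonglongrightarrow> 0"
      by (rule Lim_null_comparison[OF est err0])
    moreover have "(\<lambda>N. complex_of_real (exp (- (VV t N / 2)))) \<longlonglongrightarrow> of_real (exp (- (bform D t / 2)))"
      by (intro tendsto_intros VV_lim) simp
    ultimately have "(\<lambda>N. (LINT \<omega>|M. cis (inner t (Y N \<omega>))) - of_real (exp (- (VV t N / 2))) + of_real (exp (- (VV t N / 2))))
        \<longlonglongrightarrow> 0 + of_real (exp (- (bform D t / 2)))" by (rule tendsto_add)
    then show ?thesis by simp
  qed
  \<comment> \<open>Characteristic functions are bounded by 1, and so is their limit; a negative
    value of the form would contradict this.\<close>
  have psd: "bform D t \<ge> 0" for t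
  proof -
    have "cmod (LINT \<omega>|M. cis (inner t (Y N \<omega>))) \<le> 1" for N
    proof -
      have "cmod (LINT \<omega>|M. cis (inner t (Y N \<omega>))) \<le> (LINT \<omega>|M. cmod (cis (inner t (Y N \<omega>))))"
        by (rule integral_norm_bound)
      then show ?thesis by (simp add: prob_space)
    qed
    moreover have "(\<lambda>N. cmod (LINT \<omega>|M. cis (inner t (Y N \<omega>)))) \<longlonglongrightarrow> cmod (of_real (exp (- (bform D t) / 2)))"
      by (rule tendsto_norm[OF char_lim])
    ultimately have "cmod (of_real (exp (- (bform D t) / 2))) \<le> 1"
      by (intro LIMSEQ_le_const2) auto
    then show ?thesis by simp
  qed
  obtain \<mu> where \<mu>: "centred_gaussian D \<mu>"
    and \<mu>_char: "\<And>t. (LINT x|\<mu>. cis (inner t x)) = of_real (exp (- (bform D t) / 2))"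
    and \<mu>_sq: "\<And>k. integrable \<mu> (\<lambda>x. (vec_nth x k)\<^sup>2)"
    using gaussian_exists[OF D_sym psd] by blast
  have Yb: "\<bar>X N k \<omega> - expectation (X N k)\<bar> \<le> real N + \<bar>expectation (X N k)\<bar>" if "\<omega> \<in> space M" for N k \<omega>
    using Xb[OF that, of N k] by linarith
  have Y_sq_int: "integrable M (\<lambda>\<omega>. (X N k \<omega> - expectation (X N k))\<^sup>2)" for N k
  proof (rule integrable_const_bound[of _ "(real N + \<bar>expectation (X N k)\<bar>)\<^sup>2"])
    show "AE \<omega> in M. norm ((X N k \<omega> - expectation (X N k))\<^sup>2) \<le> (real N + \<bar>expectation (X N k)\<bar>)\<^sup>2"
    proof (rule AE_I2)
      fix \<omega> assume "\<omega> \<in> space M"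
      from power_mono[OF Yb[OF this, of N k], of 2]
      show "norm ((X N k \<omega> - expectation (X N k))\<^sup>2) \<le> (real N + \<bar>expectation (X N k)\<bar>)\<^sup>2" by simp
    qed
  qed simp
  have Yk2: "(vec_nth (Y N \<omega>) k)\<^sup>2 = (X N k \<omega> - expectation (X N k))\<^sup>2 / v N k" for N k \<omega>
    using v_nonneg[of N k] by (simp add: Yk power_divide)
  have conv: "converges_in_distribution M Y \<mu>"
  proof (rule converges_of_char_funs[OF M Ym])
    show "prob_space \<mu>" "sets \<mu> = sets borel" using \<mu> by (simp_all add: centred_gaussian_def)
    show "(\<lambda>N. LINT \<omega>|M. cis (inner t (Y N \<omega>))) \<longlonglongrightarrow> (LINT x|\<mu>. cis (inner t x))" for t
      unfolding \<mu>_char by (rule char_lim)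
    show "integrable M (\<lambda>\<omega>. (vec_nth (Y N \<omega>) k)\<^sup>2)" for N k
      unfolding Yk2 using Y_sq_int by simp
    \<comment> \<open>A standardized component has second moment 1, or 0 when its variance
      vanishes.\<close>
    show "(LINT \<omega>|M. (vec_nth (Y N \<omega>) k)\<^sup>2) \<le> 1" for N k
    proof -
      have "(LINT \<omega>|M. (vec_nth (Y N \<omega>) k)\<^sup>2) = v N k / v N k"
        unfolding Yk2 v_def by simp
      then show ?thesis by simp
    qed
    show "integrable \<mu> (\<lambda>x. (vec_nth x k)\<^sup>2)" for k by (rule \<mu>_sq)
    show "(LINT x|\<mu>. (vec_nth x k)\<^sup>2) \<le> 1" for k
    proof -
      have "(LINT x|\<mu>. (vec_nth x k)\<^sup>2) = D k k" using \<mu> by (simp add: centred_gaussian_def power2_eq_square)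
      also have "\<dots> \<le> 1" using c_nonneg[of k] by (simp add: D_def correlation_def)
      finally show ?thesis .
    qed
  qed
  have Yeq: "Y = (\<lambda>N. standardize M (X N))" by (simp add: Y_def fun_eq_iff)
  show ?thesis
    using asymp \<mu> conv unfolding v_def D_def Yeq by blast
qed

end

section \<open>Application to the two matrix models\<close>

lemma of_real_sum_mset: "of_real (\<Sum>j\<in>#m. f j) = (\<Sum>j\<in>#m. (of_real (f j) :: 'b::real_algebra_1))"
  by (induction m) simp_all

lemma cis_sum: "finite S \<Longrightarrow> cis (\<Sum>i\<in>S. f i) = (\<Prod>i\<in>S. cis (f i))"
  by (induction S rule: finite_induct) (simp_all add: cis_mult[symmetric])

lemma cis_sum_mset: "cis (\<Sum>j\<in>#m. f j) = (\<Prod>j\<in>#m. cis (f j))"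
  by (induction m) (simp_all add: cis_mult[symmetric])

lemma sum_mset_sum_swap: "(\<Sum>k\<in>S. s k * (\<Sum>j\<in>#m. f k j)) = (\<Sum>j\<in>#m. \<Sum>k\<in>S. s k * f k j)" for s :: "'k \<Rightarrow> real"
  by (induction m) (simp_all add: distrib_left sum.distrib)

lemma cis_taylor_bound:
  assumes "\<bar>x\<bar> \<le> \<eta>"
  shows "cmod (cis x - (1 + \<i> * x - x\<^sup>2 / 2)) \<le> \<eta> ^ 3"
proof -
  have "cmod (cis x - (1 + \<i> * x - x\<^sup>2 / 2)) \<le> \<bar>x\<bar> ^ 3 / 6" by (rule cis_third_order)
  also have "\<dots> \<le> \<bar>x\<bar> ^ 3" by simp
  also have "\<dots> \<le> \<eta> ^ 3" using assms by (intro power_mono) auto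
  finally show ?thesis .
qed

lemma quadratic_form_square: "(\<Sum>k\<in>S. s k * (\<Sum>l\<in>S. s l * (f k * f l))) = (\<Sum>k\<in>S. s k * f k)\<^sup>2" for s :: "'k \<Rightarrow> real"
  by (simp add: power2_eq_square sum_product sum_distrib_left mult_ac)

lemma weighted_sum_bound:
  fixes s f :: "'k \<Rightarrow> real"
  assumes "\<And>k. \<bar>f k\<bar> \<le> 1"
  shows "\<bar>\<Sum>k\<in>S. s k * f k\<bar> \<le> (\<Sum>k\<in>S. \<bar>s k\<bar>)"
proof (rule order.trans[OF sum_abs], rule sum_mono)
  fix k show "\<bar>s k * f k\<bar> \<le> \<bar>s k\<bar>"
    unfolding abs_mult using mult_left_mono[OF assms[of k], of "\<bar>s k\<bar>"] by simp
qed

lemma abs_le_imp_square_le: "\<bar>x\<bar> \<le> y \<Longrightarrow> x\<^sup>2 \<le> y\<^sup>2" for x y :: real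
  by (metis abs_ge_zero power2_abs power_mono)

definition frac_diff :: "real \<Rightarrow> real \<Rightarrow> nat \<Rightarrow> real" where
  "frac_diff a b j = frac (real j * a) - frac (real j * b)"

lemma frac_diff_bound: "\<bar>frac_diff a b j\<bar> \<le> 1"
  unfolding frac_diff_def
  using frac_ge_0[of "real j * a"] frac_lt_1[of "real j * a"] frac_ge_0[of "real j * b"] frac_lt_1[of "real j * b"]
  by linarith

lemma frac_diff_full: "frac_diff a (a + 1) j = 0"
proof -
  have "frac (real j * (a + 1)) = frac (real j * a + of_int (int j))" by (simp add: distrib_left)
  then show ?thesis unfolding frac_diff_def frac_add_of_int by simp
qed

lemma h_fun_one [simp]: "h_fun j 1 = 0" "h_fun j (- 1) = 0"
  by (simp_all add: h_fun_minus h_fun_def)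

lemma h_fun_bounds: "0 \<le> h_fun j x" "h_fun j x \<le> 1"
  unfolding h_fun_def using frac_ge_0[of "real j * x"] frac_lt_1[of "real j * x"]
  by (auto intro!: mult_le_one mult_nonneg_nonneg)

context twisted_model
begin

text \<open>For statistics of the permutation alone. There are finitely many permutations, so the
  sum of all absolute values serves as the uniform bound in the mixture formula.\<close>

lemma expectation_sigma:
  assumes N: "N \<ge> 1" and G: "\<And>p. p permutes {..<N} \<Longrightarrow> G p = F (cycle_type N p)"
  shows "expectation (\<lambda>\<omega>. G (\<sigma> N \<omega>)) = ewens_expect N F"
proof (rule expectation_cycle_type[where H = "\<lambda>p w. G p" and K = "\<Sum>p | p permutes {..<N}. cmod (G p)", OF N])
  fix p assume p: "p permutes {..<N}"
  show "cmod (G p) \<le> (\<Sum>p | p permutes {..<N}. cmod (G p))"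
    using p finite_permutations[of "{..<N}"] by (intro member_le_sum) auto
  show "expectation (\<lambda>\<omega>. G p) = F (cycle_type N p)" by (simp add: G[OF p] prob_space)
qed simp

lemma expectation_sigma_real:
  assumes N: "N \<ge> 1" and G: "\<And>p. p permutes {..<N} \<Longrightarrow> G p = F (cycle_type N p)"
    and L: "ewens_expect N (\<lambda>m. of_real (F m)) = of_real L"
  shows "expectation (\<lambda>\<omega>. G (\<sigma> N \<omega>)) = L"
proof -
  have "expectation (\<lambda>\<omega>. complex_of_real (G (\<sigma> N \<omega>))) = ewens_expect N (\<lambda>m. of_real (F m))"
    by (rule expectation_sigma[OF N, of "\<lambda>p. complex_of_real (G p)"]) (simp add: G)
  then show ?thesis unfolding integral_complex_of_real L by simp
qed

definition perm_count :: "real \<Rightarrow> real \<Rightarrow> nat \<Rightarrow> 'a \<Rightarrow> real" where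
  "perm_count a b N \<omega> = real (eigenvalue_count (perm_mat N (\<sigma> N \<omega>)) (circle_arc a b))"

definition twist_count :: "real \<Rightarrow> real \<Rightarrow> nat \<Rightarrow> 'a \<Rightarrow> real" where
  "twist_count a b N \<omega> = real (eigenvalue_count (twisted_perm_mat N (\<lambda>i. z i \<omega>) (\<sigma> N \<omega>)) (circle_arc a b))"

text \<open>Convergence in distribution asks for measurability at every index, while nothing is
  known about \<open>\<sigma> 0\<close>. In dimension 0 the matrix is empty and does not depend on
  the permutation.\<close>

lemma eigenvalue_count_dim0:
  "eigenvalue_count (perm_mat 0 p) (circle_arc a b) = 0"
  "eigenvalue_count (twisted_perm_mat 0 w p) (circle_arc a b) = 0"
proof -
  show twist: "eigenvalue_count (twisted_perm_mat 0 w p) (circle_arc a b) = 0" for w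
  proof -
    have "twisted_perm_mat 0 w p = twisted_perm_mat 0 w id" by (rule eq_matI) (simp_all add: twisted_perm_mat_def)
    moreover have "eigenvalue_count (twisted_perm_mat 0 w id) (circle_arc a b) = 0"
      using eigenvalue_count_twisted[of id 0 w a b] permutes_id[of "{..<0::nat}"] by (simp add: cycles_def)
    ultimately show ?thesis by (simp only:)
  qed
  show "eigenvalue_count (perm_mat 0 p) (circle_arc a b) = 0" unfolding perm_mat_twisted by (rule twist)
qed

lemma perm_count_measurable: "perm_count a b N \<in> borel_measurable M"
proof (cases "N = 0")
  case True
  then show ?thesis by (simp add: perm_count_def[abs_def] eigenvalue_count_dim0)
next
  case False
  then show ?thesis unfolding perm_count_def
    by (intro measurable_compose[OF sigma_measurable]) simp_all
qed

lemma perm_count_bound: "\<omega> \<in> space M \<Longrightarrow> \<bar>perm_count a b N \<omega>\<bar> \<le> real N"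
proof (cases "N = 0")
  case False
  assume "\<omega> \<in> space M"
  then have p: "\<sigma> N \<omega> permutes {..<N}" using False by (intro sigma_permutes) auto
  show ?thesis
    unfolding perm_count_def perm_mat_twisted eigenvalue_count_twisted_real[OF p]
    using twisted_count_bounds[OF p, of a b "\<lambda>_. 1"] by simp
qed (simp add: perm_count_def eigenvalue_count_dim0)

lemma twist_count_eq:
  "N \<ge> 1 \<Longrightarrow> \<omega> \<in> space M \<Longrightarrow> twist_count a b N \<omega> = twisted_count N a b (\<sigma> N \<omega>) (\<lambda>i. z i \<omega>)"
  unfolding twist_count_def by (rule eigenvalue_count_twisted_real[OF sigma_permutes])

lemma twist_count_bound: "\<omega> \<in> space M \<Longrightarrow> \<bar>twist_count a b N \<omega>\<bar> \<le> real N"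
proof (cases "N = 0")
  case False
  assume w: "\<omega> \<in> space M"
  then have p: "\<sigma> N \<omega> permutes {..<N}" using False by (intro sigma_permutes) auto
  show ?thesis
    using twist_count_eq[of N \<omega> a b] False w twisted_count_bounds[OF p, of a b "\<lambda>i. z i \<omega>"] by simp
qed (simp add: twist_count_def eigenvalue_count_dim0)

lemma twist_count_measurable:
  assumes ab: "a < b" "b \<le> a + 1"
  shows "twist_count a b N \<in> borel_measurable M"
proof (cases "N = 0")
  case True
  then show ?thesis by (simp add: twist_count_def[abs_def] eigenvalue_count_dim0)
next
  case False
  then have N: "N \<ge> 1" by simp
  have "integrable M (\<lambda>\<omega>. twisted_count N a b (\<sigma> N \<omega>) (\<lambda>i. z i \<omega>))"
    by (rule expectation_mixture(1)[where H = "twisted_count N a b" and K = "real N", OF N])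
       (use measurable_twisted_count[OF _ ab] twisted_count_bounds in auto)
  then have "(\<lambda>\<omega>. twisted_count N a b (\<sigma> N \<omega>) (\<lambda>i. z i \<omega>)) \<in> borel_measurable M" by (rule borel_measurable_integrable)
  then show ?thesis by (subst measurable_cong[OF twist_count_eq[OF N]])
qed

context
  fixes a b :: real
  assumes ab: "a < b" "b \<le> a + 1"
begin

lemma perm_count_mean:
  assumes N: "N \<ge> 1"
  shows "expectation (perm_count a b N) = real N * (b - a) + mean N (frac_diff a b)"
  unfolding perm_count_def
proof (rule expectation_sigma_real[OF N])
  fix p assume p: "p permutes {..<N}"
  show "real (eigenvalue_count (perm_mat N p) (circle_arc a b))
      = real N * (b - a) + (\<Sum>j\<in>#cycle_type N p. frac_diff a b j)"
    unfolding frac_diff_def by (rule eigenvalue_count_perm[OF p ab])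
next
  have "ewens_expect N (\<lambda>m. of_real (real N * (b - a)) * 1 + (\<Sum>j\<in>#m. of_real (frac_diff a b j)))
      = of_real (real N * (b - a)) * 1 + of_real (mean N (frac_diff a b))"
    unfolding ewens_expect_add ewens_expect_cmult ewens_expect_one ewens_expect_sum ..
  then show "ewens_expect N (\<lambda>m. of_real (real N * (b - a) + (\<Sum>j\<in>#m. frac_diff a b j)))
      = of_real (real N * (b - a) + mean N (frac_diff a b))"
    by (simp only: of_real_sum_mset of_real_add mult_1_right)
qed

lemma perm_count_centred:
  assumes N: "N \<ge> 1" and \<omega>: "\<omega> \<in> space M"
  shows "perm_count a b N \<omega> - expectation (perm_count a b N)
    = (\<Sum>j\<in>#cycle_type N (\<sigma> N \<omega>). frac_diff a b j) - mean N (frac_diff a b)"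
  unfolding perm_count_mean[OF N] unfolding perm_count_def eigenvalue_count_perm[OF sigma_permutes[OF N \<omega>] ab]
  by (simp add: frac_diff_def)

lemma perm_count_variance:
  assumes N: "N \<ge> 1"
  shows "variance (perm_count a b N) = covar N (frac_diff a b) (frac_diff a b)"
proof -
  define d where "d = frac_diff a b"
  have "variance (perm_count a b N) = expectation (\<lambda>\<omega>. ((\<Sum>j\<in>#cycle_type N (\<sigma> N \<omega>). d j) - mean N d)\<^sup>2)"
    by (intro Bochner_Integration.integral_cong refl) (simp add: perm_count_centred[OF N] d_def)
  also have "\<dots> = covar N d d"
  proof (rule expectation_sigma_real[OF N])
    show "((\<Sum>j\<in>#cycle_type N p. d j) - mean N d)\<^sup>2 = (\<lambda>m. ((\<Sum>j\<in>#m. d j) - mean N d)\<^sup>2) (cycle_type N p)" for p by simp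
    have square: "complex_of_real ((S - u)\<^sup>2) = of_real S * of_real S + (of_real (- 2 * u) * of_real S + of_real (u\<^sup>2) * 1)" for S u
      by (simp add: power2_eq_square algebra_simps)
    have "ewens_expect N (\<lambda>m. (\<Sum>j\<in>#m. of_real (d j)) * (\<Sum>j\<in>#m. of_real (d j))
        + (of_real (- 2 * mean N d) * (\<Sum>j\<in>#m. of_real (d j)) + of_real ((mean N d)\<^sup>2) * 1))
        = of_real (second_moment N d d) + (of_real (- 2 * mean N d) * of_real (mean N d) + of_real ((mean N d)\<^sup>2) * 1)"
      unfolding ewens_expect_add ewens_expect_cmult ewens_expect_one ewens_expect_sum ewens_expect_sum_product ..
    moreover have "(\<lambda>m. complex_of_real (((\<Sum>j\<in>#m. d j) - mean N d)\<^sup>2)) = (\<lambda>m. (\<Sum>j\<in>#m. of_real (d j)) * (\<Sum>j\<in>#m. of_real (d j))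
        + (of_real (- 2 * mean N d) * (\<Sum>j\<in>#m. of_real (d j)) + of_real ((mean N d)\<^sup>2) * 1))"
      unfolding of_real_sum_mset[symmetric] by (rule ext, rule square)
    moreover have "of_real (second_moment N d d) + (of_real (- 2 * mean N d) * of_real (mean N d) + of_real ((mean N d)\<^sup>2) * 1)
        = complex_of_real (covar N d d)"
      by (simp add: covar_def power2_eq_square)
    ultimately show "ewens_expect N (\<lambda>m. of_real (((\<Sum>j\<in>#m. d j) - mean N d)\<^sup>2)) = of_real (covar N d d)"
      by (simp only:)
  qed
  finally show ?thesis by (simp only: d_def)
qed

lemma AE_twisted_count:
  assumes p: "p permutes {..<N}"
  shows "AE \<omega> in M. twisted_count N a b p (\<lambda>i. z i \<omega>)
    = real N * (b - a) + (\<Sum>C\<in>cycles N p. arc_dev (card C) a b (cycW C \<omega>))"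
  using AE_W_norm[OF p] by eventually_elim (rule twisted_count_unit[OF p ab], simp)

lemma twist_count_mean:
  assumes N: "N \<ge> 1"
  shows "expectation (twist_count a b N) = real N * (b - a)"
proof -
  have "expectation (twist_count a b N) = expectation (\<lambda>\<omega>. twisted_count N a b (\<sigma> N \<omega>) (\<lambda>i. z i \<omega>))"
    by (intro Bochner_Integration.integral_cong refl twist_count_eq[OF N])
  also have "\<dots> = real N * (b - a)"
  proof (rule expectation_cycle_type_real(2)[where H = "twisted_count N a b" and K = "real N" and F = "\<lambda>_. real N * (b - a)", OF N])
    fix p assume p: "p permutes {..<N}"
    show "twisted_count N a b p \<in> borel_measurable (Pi\<^sub>M UNIV (\<lambda>_. borel))" by (rule measurable_twisted_count[OF p ab])
    show "\<bar>twisted_count N a b p w\<bar> \<le> real N" for w using twisted_count_bounds[OF p, of a b w] by simp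
    have di: "integrable M (\<lambda>\<omega>. arc_dev (card C) a b (cycW C \<omega>))" for C
      by (rule integrable_const_bound[of _ 1]) (simp_all add: arc_dev_bound)
    have "expectation (\<lambda>\<omega>. twisted_count N a b p (\<lambda>i. z i \<omega>))
        = expectation (\<lambda>\<omega>. real N * (b - a) + (\<Sum>C\<in>cycles N p. arc_dev (card C) a b (cycW C \<omega>)))"
    proof (rule integral_cong_AE)
      show "(\<lambda>\<omega>. twisted_count N a b p (\<lambda>i. z i \<omega>)) \<in> borel_measurable M"
        using measurable_compose[OF z_tuple_measurable measurable_twisted_count[OF p ab]] by simp
    qed (simp_all add: AE_twisted_count[OF p])
    also have "\<dots> = real N * (b - a) + (\<Sum>C\<in>cycles N p. expectation (\<lambda>\<omega>. arc_dev (card C) a b (cycW C \<omega>)))"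
      using di by (simp add: prob_space Bochner_Integration.integral_sum)
    also have "(\<Sum>C\<in>cycles N p. expectation (\<lambda>\<omega>. arc_dev (card C) a b (cycW C \<omega>))) = 0"
    proof (rule sum.neutral, rule ballI)
      fix C assume "C \<in> cycles N p"
      from expectation_W[OF p this measurable_arc_dev, of "card C" a b]
      show "expectation (\<lambda>\<omega>. arc_dev (card C) a b (cycW C \<omega>)) = 0" by (simp only: arc_dev_integral)
    qed
    finally show "expectation (\<lambda>\<omega>. twisted_count N a b p (\<lambda>i. z i \<omega>)) = real N * (b - a)" by simp
  next
    show "ewens_expect N (\<lambda>m. of_real (real N * (b - a))) = of_real (real N * (b - a))"
      using ewens_expect_cmult[of N "of_real (real N * (b - a))" "\<lambda>_. 1"] by (simp add: ewens_expect_one)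
  qed
  finally show ?thesis .
qed

text \<open>Given the permutation the mean count is already N (b - a), so the randomness of the
  permutation adds nothing to the variance: it is the mean of the conditional variances, a sum of
  \<open>h_fun\<close> over the cycle lengths.\<close>

lemma twist_count_variance:
  assumes N: "N \<ge> 1"
  shows "variance (twist_count a b N) = mean N (\<lambda>j. h_fun j (a - b))"
proof -
  define H where "H p w = (twisted_count N a b p w - real N * (b - a))\<^sup>2" for p w
  have "variance (twist_count a b N) = expectation (\<lambda>\<omega>. H (\<sigma> N \<omega>) (\<lambda>i. z i \<omega>))"
    by (intro Bochner_Integration.integral_cong refl) (simp add: H_def twist_count_mean[OF N] twist_count_eq[OF N])
  also have "\<dots> = mean N (\<lambda>j. h_fun j (a - b))"
  proof (rule expectation_cycle_type_real(2)[where H = H and K = "(real N)\<^sup>2" and F = "\<lambda>m. \<Sum>j\<in>#m. h_fun j (a - b)", OF N])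
    fix p assume p: "p permutes {..<N}"
    have m: "twisted_count N a b p \<in> borel_measurable (Pi\<^sub>M UNIV (\<lambda>_. borel))" by (rule measurable_twisted_count[OF p ab])
    then show Hm: "H p \<in> borel_measurable (Pi\<^sub>M UNIV (\<lambda>_. borel))" unfolding H_def by measurable
    show "\<bar>H p w\<bar> \<le> (real N)\<^sup>2" for w
    proof -
      have "0 \<le> real N * (b - a)" "real N * (b - a) \<le> real N * 1"
        using ab by (simp, intro mult_left_mono) auto
      then have "\<bar>twisted_count N a b p w - real N * (b - a)\<bar> \<le> real N"
        using twisted_count_bounds[OF p, of a b w] by linarith
      then show ?thesis unfolding H_def by (simp add: abs_le_imp_square_le)
    qed
    have "expectation (\<lambda>\<omega>. H p (\<lambda>i. z i \<omega>)) = expectation (\<lambda>\<omega>. (\<Sum>C\<in>cycles N p. arc_dev (card C) a b (cycW C \<omega>))\<^sup>2)"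
    proof (rule integral_cong_AE)
      show "(\<lambda>\<omega>. H p (\<lambda>i. z i \<omega>)) \<in> borel_measurable M"
        using measurable_compose[OF z_tuple_measurable Hm] by simp
      show "AE \<omega> in M. H p (\<lambda>i. z i \<omega>) = (\<Sum>C\<in>cycles N p. arc_dev (card C) a b (cycW C \<omega>))\<^sup>2"
        using AE_twisted_count[OF p] by eventually_elim (simp add: H_def)
    qed simp
    then show "expectation (\<lambda>\<omega>. H p (\<lambda>i. z i \<omega>)) = (\<Sum>j\<in>#cycle_type N p. h_fun j (a - b))"
      by (simp only: expectation_dev_square[OF p])
  next
    show "ewens_expect N (\<lambda>m. of_real (\<Sum>j\<in>#m. h_fun j (a - b))) = of_real (mean N (\<lambda>j. h_fun j (a - b)))"
      unfolding of_real_sum_mset by (rule ewens_expect_sum)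
  qed
  finally show ?thesis .
qed

end

context
  fixes \<alpha> \<beta> :: "'m::finite \<Rightarrow> real"
  assumes arcs: "\<And>k. \<alpha> k < \<beta> k \<and> \<beta> k \<le> \<alpha> k + 1"
begin

lemma perm_count_char_fun:
  assumes N: "N \<ge> 1"
  shows "(LINT \<omega>|M. cis (\<Sum>k\<in>UNIV. s k * (perm_count (\<alpha> k) (\<beta> k) N \<omega> - expectation (perm_count (\<alpha> k) (\<beta> k) N))))
    = ewens_expect N (\<lambda>m. \<Prod>j\<in>#m. cis (\<Sum>k\<in>UNIV. s k * frac_diff (\<alpha> k) (\<beta> k) j))
      * cis (- mean N (\<lambda>j. \<Sum>k\<in>UNIV. s k * frac_diff (\<alpha> k) (\<beta> k) j))"
proof -
  have ab: "\<alpha> k < \<beta> k" "\<beta> k \<le> \<alpha> k + 1" for k using arcs[of k] by auto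
  define d where "d k = frac_diff (\<alpha> k) (\<beta> k)" for k
  have "(LINT \<omega>|M. cis (\<Sum>k\<in>UNIV. s k * (perm_count (\<alpha> k) (\<beta> k) N \<omega> - expectation (perm_count (\<alpha> k) (\<beta> k) N))))
      = (LINT \<omega>|M. cis (\<Sum>k\<in>UNIV. s k * ((\<Sum>j\<in>#cycle_type N (\<sigma> N \<omega>). d k j) - mean N (d k))))"
    by (intro Bochner_Integration.integral_cong refl) (simp add: perm_count_centred[OF ab N] d_def)
  also have "\<dots> = ewens_expect N (\<lambda>m. cis (\<Sum>k\<in>UNIV. s k * ((\<Sum>j\<in>#m. d k j) - mean N (d k))))"
    by (rule expectation_sigma[OF N]) simp
  also have "(\<lambda>m. cis (\<Sum>k\<in>UNIV. s k * ((\<Sum>j\<in>#m. d k j) - mean N (d k))))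
      = (\<lambda>m. cis (- mean N (\<lambda>j. \<Sum>k\<in>UNIV. s k * d k j)) * (\<Prod>j\<in>#m. cis (\<Sum>k\<in>UNIV. s k * d k j)))"
  proof (rule ext)
    fix m
    have "(\<Sum>k\<in>UNIV. s k * ((\<Sum>j\<in>#m. d k j) - mean N (d k)))
        = - mean N (\<lambda>j. \<Sum>k\<in>UNIV. s k * d k j) + (\<Sum>j\<in>#m. \<Sum>k\<in>UNIV. s k * d k j)"
      unfolding mean_sum right_diff_distrib sum_subtractf sum_mset_sum_swap by simp
    then show "cis (\<Sum>k\<in>UNIV. s k * ((\<Sum>j\<in>#m. d k j) - mean N (d k)))
      = cis (- mean N (\<lambda>j. \<Sum>k\<in>UNIV. s k * d k j)) * (\<Prod>j\<in>#m. cis (\<Sum>k\<in>UNIV. s k * d k j))"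
      by (simp only: cis_mult[symmetric] cis_sum_mset)
  qed
  finally show ?thesis unfolding ewens_expect_cmult d_def by (simp only: mult.commute)
qed

text \<open>Given the permutation the cycle weights are independent and uniform, so the
  characteristic function is a product over the cycles of factors depending only on the
  length.\<close>

lemma twist_count_char_fun:
  assumes N: "N \<ge> 1"
  shows "(LINT \<omega>|M. cis (\<Sum>k\<in>UNIV. s k * (twist_count (\<alpha> k) (\<beta> k) N \<omega> - expectation (twist_count (\<alpha> k) (\<beta> k) N))))
    = ewens_expect N (\<lambda>m. \<Prod>j\<in>#m. (LINT w|uniform_circle. cis (\<Sum>k\<in>UNIV. s k * arc_dev j (\<alpha> k) (\<beta> k) w)))"
proof -
  have ab: "\<alpha> k < \<beta> k" "\<beta> k \<le> \<alpha> k + 1" for k using arcs[of k] by auto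
  define H where "H p w = cis (\<Sum>k\<in>UNIV. s k * (twisted_count N (\<alpha> k) (\<beta> k) p w - real N * (\<beta> k - \<alpha> k)))" for p w
  define \<psi> where "\<psi> j w = cis (\<Sum>k\<in>UNIV. s k * arc_dev j (\<alpha> k) (\<beta> k) w)" for j w
  have "(LINT \<omega>|M. cis (\<Sum>k\<in>UNIV. s k * (twist_count (\<alpha> k) (\<beta> k) N \<omega> - expectation (twist_count (\<alpha> k) (\<beta> k) N))))
      = (LINT \<omega>|M. H (\<sigma> N \<omega>) (\<lambda>i. z i \<omega>))"
    by (intro Bochner_Integration.integral_cong refl)
       (simp add: H_def twist_count_mean[OF ab N] twist_count_eq[OF N])
  also have "\<dots> = ewens_expect N (\<lambda>m. \<Prod>j\<in>#m. (LINT w|uniform_circle. \<psi> j w))"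
  proof (rule expectation_cycle_type[where H = H and K = 1, OF N])
    fix p assume p: "p permutes {..<N}"
    have m: "twisted_count N (\<alpha> k) (\<beta> k) p \<in> borel_measurable (Pi\<^sub>M UNIV (\<lambda>_. borel))" for k
      by (rule measurable_twisted_count[OF p ab])
    then show Hm: "H p \<in> borel_measurable (Pi\<^sub>M UNIV (\<lambda>_. borel))"
      unfolding H_def by (intro measurable_compose[OF _ measurable_cis] borel_measurable_sum borel_measurable_times borel_measurable_diff borel_measurable_const m)
    show "cmod (H p w) \<le> 1" for w by (simp add: H_def)
    have \<psi>m: "\<psi> j \<in> borel_measurable borel" for j unfolding \<psi>_def by measurable
    have "expectation (\<lambda>\<omega>. H p (\<lambda>i. z i \<omega>)) = expectation (\<lambda>\<omega>. \<Prod>C\<in>cycles N p. \<psi> (card C) (cycW C \<omega>))"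
    proof (rule integral_cong_AE)
      show "(\<lambda>\<omega>. H p (\<lambda>i. z i \<omega>)) \<in> borel_measurable M"
        using measurable_compose[OF z_tuple_measurable Hm] by simp
      show "(\<lambda>\<omega>. \<Prod>C\<in>cycles N p. \<psi> (card C) (cycW C \<omega>)) \<in> borel_measurable M"
        by (intro borel_measurable_prod measurable_compose[OF W_measurable \<psi>m])
      show "AE \<omega> in M. H p (\<lambda>i. z i \<omega>) = (\<Prod>C\<in>cycles N p. \<psi> (card C) (cycW C \<omega>))"
        using AE_W_norm[OF p]
      proof eventually_elim
        case (elim \<omega>)
        have "twisted_count N (\<alpha> k) (\<beta> k) p (\<lambda>i. z i \<omega>) - real N * (\<beta> k - \<alpha> k)
            = (\<Sum>C\<in>cycles N p. arc_dev (card C) (\<alpha> k) (\<beta> k) (cycW C \<omega>))" for k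
          using twisted_count_unit[OF p ab, of "\<lambda>i. z i \<omega>" k] elim by simp
        then have "H p (\<lambda>i. z i \<omega>) = cis (\<Sum>k\<in>UNIV. \<Sum>C\<in>cycles N p. s k * arc_dev (card C) (\<alpha> k) (\<beta> k) (cycW C \<omega>))"
          by (simp only: H_def sum_distrib_left)
        also have "\<dots> = cis (\<Sum>C\<in>cycles N p. \<Sum>k\<in>UNIV. s k * arc_dev (card C) (\<alpha> k) (\<beta> k) (cycW C \<omega>))"
          by (subst sum.swap) (rule refl)
        finally show ?case by (simp only: cis_sum[OF finite_cycles] \<psi>_def)
      qed
    qed
    then show "expectation (\<lambda>\<omega>. H p (\<lambda>i. z i \<omega>)) = (\<Prod>j\<in>#cycle_type N p. (LINT w|uniform_circle. \<psi> j w))"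
      using expectation_prod_W[OF p \<psi>m] by (simp add: \<psi>_def)
  qed
  finally show ?thesis by (simp only: \<psi>_def)
qed

text \<open>Here the contribution of a cycle is determined by its length, so the second moments are
  products of the means and the quadratic form in \<open>s\<close> is a perfect square.\<close>

lemma perm_count_limit:
  defines "c \<equiv> \<lambda>k l. c_coeff (\<alpha> k) (\<beta> k) (\<alpha> l) (\<beta> l)"
  shows "(\<forall>k. (\<lambda>N. variance (perm_count (\<alpha> k) (\<beta> k) N)) \<sim>[at_top] (\<lambda>N. c k k * \<theta> * ln (real N)))
    \<and> (\<exists>\<mu>. centred_gaussian (correlation c) \<mu> \<and>
        converges_in_distribution M (\<lambda>N. standardize M (\<lambda>k. perm_count (\<alpha> k) (\<beta> k) N)) \<mu>)"
proof -
  define d where "d k = frac_diff (\<alpha> k) (\<beta> k)" for k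
  have d1: "\<bar>d k j\<bar> \<le> 1" for k j by (simp add: d_def frac_diff_bound)
  have ab: "\<alpha> k < \<beta> k" "\<beta> k \<le> \<alpha> k + 1" for k using arcs[of k] by auto
  have q: "(\<Sum>k\<in>UNIV. s k * (\<Sum>l\<in>UNIV. s l * (d k j * d l j))) = (\<Sum>k\<in>UNIV. s k * d k j)\<^sup>2" for s j
    by (rule quadratic_form_square)
  show ?thesis
  proof (rule gaussian_limit[where X = "\<lambda>N k. perm_count (\<alpha> k) (\<beta> k) N" and a = d and r = "\<lambda>k l j. d k j * d l j"
        and c = c and \<phi> = "\<lambda>s j. cis (\<Sum>k\<in>UNIV. s k * d k j)"])
    show "prob_space M" by (rule prob_space_axioms)
    show "perm_count (\<alpha> k) (\<beta> k) N \<in> borel_measurable M" for N k by (rule perm_count_measurable)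
    show "\<bar>perm_count (\<alpha> k) (\<beta> k) N \<omega>\<bar> \<le> real N" if "\<omega> \<in> space M" for N k \<omega> by (rule perm_count_bound[OF that])
    show "\<bar>d k j\<bar> \<le> 1" for k j by (rule d1)
    show "\<bar>d k j * d l j\<bar> \<le> 1" for k l j using d1[of k j] d1[of l j] by (simp add: abs_mult mult_le_one)
    show "d k j * d l j = d l j * d k j" for k l j by (rule mult.commute)
    show "(\<Sum>k\<in>UNIV. s k * d k j)\<^sup>2 \<le> (\<Sum>k\<in>UNIV. s k * (\<Sum>l\<in>UNIV. s l * (d k j * d l j)))" for s j by (simp only: q)
    show "(\<Sum>k\<in>UNIV. s k * (\<Sum>l\<in>UNIV. s l * (d k j * d l j))) \<le> (\<Sum>k\<in>UNIV. \<bar>s k\<bar>)\<^sup>2" for s j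
      unfolding q by (rule abs_le_imp_square_le, rule weighted_sum_bound, rule d1)
    show "cmod (cis (\<Sum>k\<in>UNIV. s k * d k j)) \<le> 1" for s j by simp
    show "cmod (cis (\<Sum>k\<in>UNIV. s k * d k j) - (1 + \<i> * of_real (\<Sum>k\<in>UNIV. s k * d k j)
        - of_real (\<Sum>k\<in>UNIV. s k * (\<Sum>l\<in>UNIV. s l * (d k j * d l j))) / 2)) \<le> (\<Sum>k\<in>UNIV. \<bar>s k\<bar>) ^ 3" for s j
      unfolding q
      using cis_taylor_bound[OF weighted_sum_bound[where s = s and f = "\<lambda>k. d k j" and S = UNIV, OF d1]] by simp
    show "variance (perm_count (\<alpha> k) (\<beta> k) N) = mean N (\<lambda>j. d k j * d k j) + pair_part N (d k) (d k)" if "N \<ge> 1" for N k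
      unfolding perm_count_variance[OF ab that] pair_part_def d_def by simp
    show "(LINT \<omega>|M. cis (\<Sum>k\<in>UNIV. s k * (perm_count (\<alpha> k) (\<beta> k) N \<omega> - expectation (perm_count (\<alpha> k) (\<beta> k) N))))
        = ewens_expect N (\<lambda>m. \<Prod>j\<in>#m. cis (\<Sum>k\<in>UNIV. s k * d k j)) * cis (- mean N (\<lambda>j. \<Sum>k\<in>UNIV. s k * d k j))"
      if "N \<ge> 1" for N s unfolding d_def by (rule perm_count_char_fun[OF that])
    show "(\<lambda>N. (\<Sum>j=1..N. d k j * d l j) / real N) \<longlonglongrightarrow> c k l" for k l
      unfolding d_def frac_diff_def c_def by (rule c_coeff_limit)
    \<comment> \<open>By positivity of the coefficient for proper arcs, only a full circle can have
      coefficient 0.\<close>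
    show "d k j = 0 \<and> d k j * d k j = 0" if "c k k = 0" for k j
    proof -
      have "\<not> \<beta> k < \<alpha> k + 1" using c_coeff_pos[of "\<alpha> k" "\<beta> k"] ab(1)[of k] that by (auto simp: c_def)
      then have "\<beta> k = \<alpha> k + 1" using ab(2)[of k] by simp
      then show ?thesis by (simp add: d_def frac_diff_full)
    qed
  qed
qed

text \<open>The deviation on a cycle is centred, so the means \<open>a\<close> vanish and so does
  the pair part. The Gaussian limit is driven by the second moments \<open>r\<close> alone, which
  average to \<open>c_tilde\<close>.\<close>

lemma twist_count_limit:
  defines "c \<equiv> \<lambda>k l. c_tilde (\<alpha> k) (\<beta> k) (\<alpha> l) (\<beta> l)"
  shows "(\<forall>k. (\<lambda>N. variance (twist_count (\<alpha> k) (\<beta> k) N)) \<sim>[at_top] (\<lambda>N. c k k * \<theta> * ln (real N)))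
    \<and> (\<exists>\<mu>. centred_gaussian (correlation c) \<mu> \<and>
        converges_in_distribution M (\<lambda>N. standardize M (\<lambda>k. twist_count (\<alpha> k) (\<beta> k) N)) \<mu>)"
proof -
  interpret U: prob_space uniform_circle by (rule prob_space_uniform_circle)
  have ab: "\<alpha> k < \<beta> k" "\<beta> k \<le> \<alpha> k + 1" for k using arcs[of k] by auto
  define D where "D k j w = arc_dev j (\<alpha> k) (\<beta> k) w" for k j w
  have D1: "\<bar>D k j w\<bar> \<le> 1" for k j w by (simp add: D_def arc_dev_bound)
  have Dm [measurable]: "D k j \<in> borel_measurable borel" for k j unfolding D_def by measurable
  have DDi: "integrable uniform_circle (\<lambda>w. D k j w * D l j w)" for k l j
    by (rule integrable_circle_bounded[of _ 1]) (use D1 in \<open>auto simp: abs_mult mult_le_one\<close>)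
  have Di: "integrable uniform_circle (\<lambda>w. D k j w)" for k j
    by (rule integrable_circle_bounded[of _ 1]) (use D1 in auto)
  define r where "r k l j = (LINT w|uniform_circle. D k j w * D l j w)" for k l j
  have r_eq: "r k l j = (h_fun j (\<beta> k - \<alpha> l) + h_fun j (\<alpha> k - \<beta> l) - h_fun j (\<alpha> k - \<alpha> l) - h_fun j (\<beta> k - \<beta> l)) / 2" for k l j
    unfolding r_def D_def by (rule arc_dev_integral_product)
  have r_diag: "r k k j = h_fun j (\<alpha> k - \<beta> k)" for k j
    unfolding r_eq using h_fun_minus[of j "\<alpha> k - \<beta> k"] by simp
  define S where "S s j w = (\<Sum>k\<in>UNIV. s k * D k j w)" for s j w
  have Sm [measurable]: "S s j \<in> borel_measurable borel" for s j unfolding S_def by measurable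
  have S1: "\<bar>S s j w\<bar> \<le> (\<Sum>k\<in>UNIV. \<bar>s k\<bar>)" for s j w
    unfolding S_def by (rule weighted_sum_bound) (rule D1)
  have S2: "(S s j w)\<^sup>2 \<le> (\<Sum>k\<in>UNIV. \<bar>s k\<bar>)\<^sup>2" for s j w by (rule abs_le_imp_square_le[OF S1])
  have S2i: "integrable uniform_circle (\<lambda>w. (S s j w)\<^sup>2)" for s j
    by (rule integrable_circle_bounded[of _ "(\<Sum>k\<in>UNIV. \<bar>s k\<bar>)\<^sup>2"]) (use S2 in auto)
  have Si: "integrable uniform_circle (\<lambda>w. S s j w)" for s j
    by (rule integrable_circle_bounded[of _ "\<Sum>k\<in>UNIV. \<bar>s k\<bar>"]) (use S1 in auto)
  have S_int: "(LINT w|uniform_circle. S s j w) = 0" for s j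
    unfolding S_def using Di by (simp add: Bochner_Integration.integral_sum D_def arc_dev_integral)
  have q: "(\<Sum>k\<in>UNIV. s k * (\<Sum>l\<in>UNIV. s l * r k l j)) = (LINT w|uniform_circle. (S s j w)\<^sup>2)" for s j
  proof -
    have "(LINT w|uniform_circle. (S s j w)\<^sup>2) = (LINT w|uniform_circle. (\<Sum>k\<in>UNIV. s k * (\<Sum>l\<in>UNIV. s l * (D k j w * D l j w))))"
      unfolding S_def quadratic_form_square ..
    also have "\<dots> = (\<Sum>k\<in>UNIV. s k * (\<Sum>l\<in>UNIV. s l * r k l j))"
      unfolding r_def using DDi by (simp add: Bochner_Integration.integral_sum)
    finally show ?thesis ..
  qed
  have q_nonneg: "(LINT w|uniform_circle. (S s j w)\<^sup>2) \<ge> 0" for s j by (rule integral_nonneg_AE) simp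
  have q_le: "(LINT w|uniform_circle. (S s j w)\<^sup>2) \<le> (\<Sum>k\<in>UNIV. \<bar>s k\<bar>)\<^sup>2" for s j
  proof -
    have "(LINT w|uniform_circle. (S s j w)\<^sup>2) \<le> (LINT w|uniform_circle. (\<Sum>k\<in>UNIV. \<bar>s k\<bar>)\<^sup>2)"
      by (rule integral_mono[OF S2i]) (simp_all add: S2)
    then show ?thesis using U.prob_space by simp
  qed
  define \<phi> where "\<phi> s j = (LINT w|uniform_circle. cis (S s j w))" for s j
  have cisi: "integrable uniform_circle (\<lambda>w. cis (S s j w))" for s j
    by (rule integrable_circle_bounded[of _ 1]) auto
  show ?thesis
  proof (rule gaussian_limit[where X = "\<lambda>N k. twist_count (\<alpha> k) (\<beta> k) N" and a = "\<lambda>k j. 0" and r = r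
        and c = c and \<phi> = \<phi>])
    show "prob_space M" by (rule prob_space_axioms)
    show "twist_count (\<alpha> k) (\<beta> k) N \<in> borel_measurable M" for N k by (rule twist_count_measurable[OF ab])
    show "\<bar>twist_count (\<alpha> k) (\<beta> k) N \<omega>\<bar> \<le> real N" if "\<omega> \<in> space M" for N k \<omega> by (rule twist_count_bound[OF that])
    show "\<bar>0 :: real\<bar> \<le> 1" by simp
    show "\<bar>r k l j\<bar> \<le> 1" for k l j
      unfolding r_eq using h_fun_bounds[of j "\<beta> k - \<alpha> l"] h_fun_bounds[of j "\<alpha> k - \<beta> l"]
        h_fun_bounds[of j "\<alpha> k - \<alpha> l"] h_fun_bounds[of j "\<beta> k - \<beta> l"] by (simp add: abs_le_iff)
    show "r k l j = r l k j" for k l j unfolding r_def by (simp only: mult.commute)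
    show "(\<Sum>k\<in>UNIV. s k * 0)\<^sup>2 \<le> (\<Sum>k\<in>UNIV. s k * (\<Sum>l\<in>UNIV. s l * r k l j))" for s j
      unfolding q using q_nonneg[of s j] by simp
    show "(\<Sum>k\<in>UNIV. s k * (\<Sum>l\<in>UNIV. s l * r k l j)) \<le> (\<Sum>k\<in>UNIV. \<bar>s k\<bar>)\<^sup>2" for s j
      unfolding q by (rule q_le)
    show "cmod (\<phi> s j) \<le> 1" for s j
    proof -
      have "cmod (\<phi> s j) \<le> (LINT w|uniform_circle. cmod (cis (S s j w)))" unfolding \<phi>_def by (rule integral_norm_bound)
      then show ?thesis using U.prob_space by simp
    qed
    \<comment> \<open>The Taylor bound for \<open>cis\<close> holds pointwise with the same
      constant, so it survives integration; the linear term integrates to 0.\<close>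
    show "cmod (\<phi> s j - (1 + \<i> * of_real (\<Sum>k\<in>UNIV. s k * 0)
        - of_real (\<Sum>k\<in>UNIV. s k * (\<Sum>l\<in>UNIV. s l * r k l j)) / 2)) \<le> (\<Sum>k\<in>UNIV. \<bar>s k\<bar>) ^ 3" for s j
    proof -
      define T where "T w = 1 + \<i> * complex_of_real (S s j w) - complex_of_real ((S s j w)\<^sup>2) / 2" for w
      have i1: "integrable uniform_circle (\<lambda>w. complex_of_real (S s j w))" using Si by simp
      have i2: "integrable uniform_circle (\<lambda>w. complex_of_real ((S s j w)\<^sup>2))" using S2i by (rule integrable_of_real)
      have i0: "integrable uniform_circle (\<lambda>w. 1 :: complex)" by simp
      have i3: "integrable uniform_circle (\<lambda>w. \<i> * complex_of_real (S s j w))" using i1 by simp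
      have i4: "integrable uniform_circle (\<lambda>w. complex_of_real ((S s j w)\<^sup>2) / 2)" using i2 by simp
      have i5: "integrable uniform_circle (\<lambda>w. 1 + \<i> * complex_of_real (S s j w))" using i0 i3 by (rule Bochner_Integration.integrable_add)
      have Ti: "integrable uniform_circle T" unfolding T_def using i5 i4 by (rule Bochner_Integration.integrable_diff)
      have "(LINT w|uniform_circle. T w) = (LINT w|uniform_circle. 1 + \<i> * complex_of_real (S s j w)) - (LINT w|uniform_circle. complex_of_real ((S s j w)\<^sup>2) / 2)"
        unfolding T_def by (rule Bochner_Integration.integral_diff[OF i5 i4])
      also have "(LINT w|uniform_circle. 1 + \<i> * complex_of_real (S s j w)) = (LINT w|uniform_circle. 1) + (LINT w|uniform_circle. \<i> * complex_of_real (S s j w))"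
        by (rule Bochner_Integration.integral_add[OF i0 i3])
      also have "(LINT w|uniform_circle. 1 :: complex) = 1" using U.prob_space by simp
      also have "(LINT w|uniform_circle. \<i> * complex_of_real (S s j w)) = 0"
        unfolding integral_mult_right_zero integral_complex_of_real S_int by simp
      also have "(LINT w|uniform_circle. complex_of_real ((S s j w)\<^sup>2) / 2) = of_real (LINT w|uniform_circle. (S s j w)\<^sup>2) / 2"
        unfolding integral_divide_zero integral_complex_of_real ..
      finally have T: "(LINT w|uniform_circle. T w) = 1 + \<i> * of_real (\<Sum>k\<in>UNIV. s k * 0)
          - of_real (\<Sum>k\<in>UNIV. s k * (\<Sum>l\<in>UNIV. s l * r k l j)) / 2" unfolding q by simp
      have "\<phi> s j - (LINT w|uniform_circle. T w) = (LINT w|uniform_circle. cis (S s j w) - T w)"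
        unfolding \<phi>_def by (rule Bochner_Integration.integral_diff[OF cisi Ti, symmetric])
      also have "cmod \<dots> \<le> (LINT w|uniform_circle. cmod (cis (S s j w) - T w))" by (rule integral_norm_bound)
      also have "\<dots> \<le> (LINT w|uniform_circle. (\<Sum>k\<in>UNIV. \<bar>s k\<bar>) ^ 3)"
      proof (rule integral_mono)
        show "integrable uniform_circle (\<lambda>w. cmod (cis (S s j w) - T w))"
          by (rule integrable_norm[OF Bochner_Integration.integrable_diff[OF cisi Ti]])
        show "cmod (cis (S s j w) - T w) \<le> (\<Sum>k\<in>UNIV. \<bar>s k\<bar>) ^ 3" for w
          using cis_taylor_bound[OF S1[of s j w]] unfolding T_def by simp
      qed simp
      finally show ?thesis unfolding T using U.prob_space by simp
    qed
    show "variance (twist_count (\<alpha> k) (\<beta> k) N) = mean N (r k k) + pair_part N (\<lambda>j. 0) (\<lambda>j. 0)" if "N \<ge> 1" for N k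
    proof -
      have "r k k = (\<lambda>j. h_fun j (\<alpha> k - \<beta> k))" by (rule ext) (rule r_diag)
      then show ?thesis unfolding twist_count_variance[OF ab that] pair_part_zero by simp
    qed
    show "(LINT \<omega>|M. cis (\<Sum>k\<in>UNIV. s k * (twist_count (\<alpha> k) (\<beta> k) N \<omega> - expectation (twist_count (\<alpha> k) (\<beta> k) N))))
        = ewens_expect N (\<lambda>m. \<Prod>j\<in>#m. \<phi> s j) * cis (- mean N (\<lambda>j. \<Sum>k\<in>UNIV. s k * 0))"
      if "N \<ge> 1" for N s
      unfolding twist_count_char_fun[OF that] \<phi>_def S_def D_def by simp
    show "(\<lambda>N. (\<Sum>j=1..N. r k l j) / real N) \<longlonglongrightarrow> c k l" for k l
      unfolding r_eq c_def by (rule c_tilde_limit)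
    show "(0::real) = 0 \<and> r k k j = 0" if "c k k = 0" for k j
    proof -
      have "\<not> \<beta> k < \<alpha> k + 1" using c_tilde_pos[of "\<alpha> k" "\<beta> k"] ab(1)[of k] that by (auto simp: c_def)
      then have "\<beta> k = \<alpha> k + 1" using ab(2)[of k] by simp
      then have "\<alpha> k - \<beta> k = - 1" by simp
      then show ?thesis unfolding r_diag by simp
    qed
  qed
qed

end
end

theorem theorem2:
  fixes M :: "'a measure"
    and \<sigma> :: "nat \<Rightarrow> 'a \<Rightarrow> nat \<Rightarrow> nat"
    and z :: "nat \<Rightarrow> 'a \<Rightarrow> complex"
    and \<theta> :: real
    and \<alpha> \<beta> :: "'m::finite \<Rightarrow> real"
    and X X' :: "nat \<Rightarrow> 'm \<Rightarrow> 'a \<Rightarrow> real"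
    and c c' :: "'m \<Rightarrow> 'm \<Rightarrow> real"
  assumes "prob_space M"
    and "\<theta> > 0"
    and sigma_measurable: "\<And>N. N \<ge> 1 \<Longrightarrow> \<sigma> N \<in> measurable M (count_space (sym_group N))"
    and sigma_ewens: "\<And>N. N \<ge> 1 \<Longrightarrow> distr M (count_space (sym_group N)) (\<sigma> N) = ewens_measure \<theta> N"
    and z_indep: "prob_space.indep_vars M (\<lambda>_. borel) z UNIV"
    and z_uniform: "\<And>j. distr M borel (z j) = uniform_circle"
    and z_sigma_indep: "prob_space.indep_set M
      (sets (vimage_algebra (space M) (\<lambda>\<omega>. \<lambda>j\<in>UNIV. z j \<omega>) (\<Pi>\<^sub>M j\<in>UNIV. borel)))
      (sets (vimage_algebra (space M) (\<lambda>\<omega>. \<lambda>N\<in>{1..}. \<sigma> N \<omega>)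
        (\<Pi>\<^sub>M N\<in>{1..}. count_space (sym_group N))))"
    and arcs: "\<And>k. 0 \<le> \<alpha> k \<and> \<alpha> k < 1 \<and> \<alpha> k < \<beta> k \<and> \<beta> k \<le> \<alpha> k + 1"
  defines "X \<equiv> \<lambda>N k \<omega>. real (eigenvalue_count (perm_mat N (\<sigma> N \<omega>)) (circle_arc (\<alpha> k) (\<beta> k)))"
    and "X' \<equiv> \<lambda>N k \<omega>. real (eigenvalue_count (twisted_perm_mat N (\<lambda>i. z i \<omega>) (\<sigma> N \<omega>))
                              (circle_arc (\<alpha> k) (\<beta> k)))"
    and "c \<equiv> \<lambda>k l. c_coeff (\<alpha> k) (\<beta> k) (\<alpha> l) (\<beta> l)"
    and "c' \<equiv> \<lambda>k l. c_tilde (\<alpha> k) (\<beta> k) (\<alpha> l) (\<beta> l)"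
  shows "(\<forall>k. (\<lambda>N. prob_space.variance M (X N k)) \<sim>[at_top] (\<lambda>N. c k k * \<theta> * ln (real N)) \<and>
              (\<lambda>N. prob_space.variance M (X' N k)) \<sim>[at_top] (\<lambda>N. c' k k * \<theta> * ln (real N)))
       \<and> (\<exists>\<mu>. centred_gaussian (correlation c) \<mu> \<and>
              converges_in_distribution M (\<lambda>N. standardize M (X N)) \<mu>)
       \<and> (\<exists>\<mu>. centred_gaussian (correlation c') \<mu> \<and>
              converges_in_distribution M (\<lambda>N. standardize M (X' N)) \<mu>)"
proof -
  interpret prob_space M by fact
  interpret twisted_model M \<theta> \<sigma> z
    by unfold_locales (fact \<open>\<theta> > 0\<close> sigma_measurable sigma_ewens z_indep z_uniform z_sigma_indep)+
  have arcs': "\<alpha> k < \<beta> k \<and> \<beta> k \<le> \<alpha> k + 1" for k using arcs[of k] by simp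
  have X: "X = (\<lambda>N k. perm_count (\<alpha> k) (\<beta> k) N)" by (simp add: X_def perm_count_def fun_eq_iff)
  have X': "X' = (\<lambda>N k. twist_count (\<alpha> k) (\<beta> k) N)" by (simp add: X'_def twist_count_def fun_eq_iff)
  show ?thesis
    using perm_count_limit[of \<alpha> \<beta>, OF arcs'] twist_count_limit[of \<alpha> \<beta>, OF arcs']
    unfolding X X' c_def c'_def by blast
qed

end
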